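(* Let $(\Gamma,I)$ be a finite quiver. Let $a(q)=\sum_{\alpha\in\mathbb{N}^I}a_\alpha(q)x^\alpha$ be the generating function of the polynomials $a_\alpha(q)$ counting isomorphism classes of absolutely irreducible representations of dimension $\alpha$ over $\mathbb{F}_q$ (with $a_0=0$), let $r=\sum_{\alpha\in\mathbb{N}^I}r_\alpha(q)x^\alpha$ with $r_\alpha(q)=\#\mathcal{R}_\alpha(\mathbb{F}_q)/\#\mathrm{GL}_\alpha(\mathbb{F}_q)$, and let $p=\sum_{\alpha\in\mathbb{N}^I}[\infty,\alpha]x^\alpha=\operatorname{Exp}\left(\frac{\sum_{i\in I}x_i}{1-q}\right)$, all in $\mathbb{Q}(q)[[x_i\mid i\in I]]$. Then $$r=\overline{Tp}.$$ In particular, $$\overline{Tp}\circ\operatorname{Exp}\left(\frac{a(q)}{1-q}\right)=1$$ in the twisted algebra $\mathbb{Q}(q)^{\mathrm{tw}}[[x_i\mid i\in I]]$.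
   Context: Quivers: $I$ is the finite set of vertices, $\Gamma$ the finite set of arrows. All representations are finite dimensional; a representation $M=\oplus_{i\in I}M_i$ has dimension $(\dim M_i)_{i\in I}\in\mathbb{N}^I$ ($\mathbb{N}$ includes $0$). A representation over a field $k$ is absolutely irreducible if it is irreducible (nonzero without nonzero proper subrepresentations) and remains so after every finite field extension of $k$. It is known that the number of isomorphism classes of absolutely irreducible representations of dimension $\alpha$ over $\mathbb{F}_q$ is given by a polynomial $a_\alpha(q)\in\mathbb{Z}[q]$, valid for all finite fields. Here $\mathcal{R}_\alpha(k)=\bigoplus_{h:i\to j}\operatorname{Hom}_k(k^{\alpha^i},k^{\alpha^j})$ (sum over arrows) and $\mathrm{GL}_\alpha(k)=\prod_i\mathrm{GL}_{\alpha^i}(k)$; $r_\alpha(q)$ is regarded as a rational function in $q$. (This is the case of the zero stability map $\theta=0$, for which stable means irreducible and all representations are semistable.) Forms: the Ringel form on $\mathbb{Z}^I$ is $\langle\alpha,\beta\rangle=\sum_{i\in I}\alpha^i\beta^i-\sum_{h:i\to j}\alpha^i\beta^j$, and the Tits form is $T(\alpha)=\langle\alpha,\alpha\rangle$. Put $x^\alpha=\prod_i x_i^{\alpha^i}$. Operators on $\mathbb{Q}(q)[[x_i\mid i\in I]]$: $T$ is the continuous $\mathbb{Q}(q)$-linear operator with $T(x^\alpha)=q^{T(\alpha)}x^\alpha$; the conjugation $f\mapsto\overline{f}$ substitutes $q\mapsto q^{-1}$ in all coefficients and fixes the $x_i$, so $\overline{Tp}$ is the conjugate of $T(p)$. Also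 $[\infty,\alpha]=\prod_{i\in I}[\infty,\alpha^i]$ with $[\infty,m]=\frac{1}{\prod_{i=1}^m(1-q^i)}$. Exp: with $\psi_n(f(q,(x_i)_i))=f(q^n,(x_i^n)_i)$, for $f$ with zero constant term $\operatorname{Exp}(f)=\exp\left(\sum_{k\ge1}\frac1k\psi_k(f)\right)$, computed with the usual commutative product. Twisted algebra: $\mathbb{Q}(q)^{\mathrm{tw}}[[x_i\mid i\in I]]$ is the vector space $\mathbb{Q}(q)[[x_i\mid i\in I]]$ with the continuous $\mathbb{Q}(q)$-bilinear product determined by $x^\alpha\circ x^\beta=q^{-\langle\alpha,\beta\rangle}x^{\alpha+\beta}$. *)

theory Defs
  imports
    "HOL-Library.Poly_Mapping"
    "HOL-Library.FuncSet"
    "HOL-Computational_Algebra.Computational_Algebra"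
    "HOL-Computational_Algebra.Field_as_Ring"
    "HOL-Algebra.Embedded_Algebras"
    "Jordan_Normal_Form.Matrix"
    "Graph_Theory.Digraph"
begin

section \<open>Matrices over a field given as a HOL-Algebra record\<close>

text \<open>
  Statements about all finite fields have to quantify over fields of different characteristics
  inside a formula, so fields are HOL-Algebra records here, on the type of naturals where the
  quantifier occurs; every finite field has an isomorphic copy there. The types of matrices and
  vectors are those of Jordan Normal Form, whose arithmetic is tied to type classes; the
  operations below use the operations of the record instead.
\<close>

definition mats :: "('a, 'b) ring_scheme \<Rightarrow> nat \<Rightarrow> nat \<Rightarrow> 'a mat set" where
  "mats K m n = {A \<in> carrier_mat m n. elements_mat A \<subseteq> carrier K}"

definition mat_prod :: "('a, 'b) ring_scheme \<Rightarrow> 'a mat \<Rightarrow> 'a mat \<Rightarrow> 'a mat" where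
  "mat_prod K A B = mat (dim_row A) (dim_col B)
     (\<lambda>(i, j). \<Oplus>\<^bsub>K\<^esub>k\<in>{..<dim_col A}. A $$ (i, k) \<otimes>\<^bsub>K\<^esub> B $$ (k, j))"

definition mat_app :: "('a, 'b) ring_scheme \<Rightarrow> 'a mat \<Rightarrow> 'a vec \<Rightarrow> 'a vec" where
  "mat_app K A v = vec (dim_row A)
     (\<lambda>i. \<Oplus>\<^bsub>K\<^esub>j\<in>{..<dim_col A}. A $$ (i, j) \<otimes>\<^bsub>K\<^esub> v $ j)"

definition mat_monoid :: "('a, 'b) ring_scheme \<Rightarrow> nat \<Rightarrow> 'a mat monoid" where
  "mat_monoid K n = \<lparr>
     carrier = mats K n n,
     mult = mat_prod K,
     one = mat n n (\<lambda>(i, j). if i = j then \<one>\<^bsub>K\<^esub> else \<zero>\<^bsub>K\<^esub>)\<rparr>"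

definition GL :: "('a, 'b) ring_scheme \<Rightarrow> nat \<Rightarrow> 'a mat set" where
  "GL K n = Units (mat_monoid K n)"

text \<open>The vector space \<open>K\<^sup>n\<close>; the multiplicative part of the record plays no role.\<close>

definition vec_space :: "('a, 'b) ring_scheme \<Rightarrow> nat \<Rightarrow> ('a, 'a vec) module" where
  "vec_space K n = \<lparr>
     carrier = {v \<in> carrier_vec n. \<forall>i<n. v $ i \<in> carrier K},
     mult = undefined,
     one = undefined,
     zero = vec n (\<lambda>_. \<zero>\<^bsub>K\<^esub>),
     add = (\<lambda>v w. vec n (\<lambda>i. v $ i \<oplus>\<^bsub>K\<^esub> w $ i)),
     smult = (\<lambda>c v. vec n (\<lambda>i. c \<otimes>\<^bsub>K\<^esub> v $ i))\<rparr>"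


section \<open>Quiver representations\<close>

text \<open>
  A finite quiver is a \<^locale>\<open>fin_digraph\<close>: loops and multiple arrows are allowed.
  An arrow \<open>h\<close> goes from \<open>tail Q h\<close> to \<open>head Q h\<close>.
\<close>

type_synonym 'i dimvec = "'i \<Rightarrow>\<^sub>0 nat"

definition dimvecs :: "('i, 'h) pre_digraph \<Rightarrow> 'i dimvec set" where
  "dimvecs Q = {\<alpha>. Poly_Mapping.keys \<alpha> \<subseteq> verts Q}"

text \<open>\<open>R\<^sub>\<alpha>(K)\<close> and \<open>GL\<^sub>\<alpha>(K)\<close>, with linear maps \<open>K\<^sup>m \<rightarrow> K\<^sup>n\<close> given by \<open>n \<times> m\<close> matrices.\<close>

definition rep_space ::
  "('i, 'h) pre_digraph \<Rightarrow> ('a, 'b) ring_scheme \<Rightarrow> 'i dimvec \<Rightarrow> ('h \<Rightarrow> 'a mat) set" where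
  "rep_space Q K \<alpha> =
     (\<Pi>\<^sub>E h\<in>arcs Q. mats K (Poly_Mapping.lookup \<alpha> (head Q h)) (Poly_Mapping.lookup \<alpha> (tail Q h)))"

definition GL_dim ::
  "('i, 'h) pre_digraph \<Rightarrow> ('a, 'b) ring_scheme \<Rightarrow> 'i dimvec \<Rightarrow> ('i \<Rightarrow> 'a mat) set" where
  "GL_dim Q K \<alpha> = (\<Pi>\<^sub>E i\<in>verts Q. GL K (Poly_Mapping.lookup \<alpha> i))"

definition rep_iso ::
  "('i, 'h) pre_digraph \<Rightarrow> ('a, 'b) ring_scheme \<Rightarrow> 'i dimvec
     \<Rightarrow> (('h \<Rightarrow> 'a mat) \<times> ('h \<Rightarrow> 'a mat)) set" where
  "rep_iso Q K \<alpha> = {(M, N). M \<in> rep_space Q K \<alpha> \<and> N \<in> rep_space Q K \<alpha> \<and>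
     (\<exists>g\<in>GL_dim Q K \<alpha>. \<forall>h\<in>arcs Q.
        mat_prod K (g (head Q h)) (M h) = mat_prod K (N h) (g (tail Q h)))}"

definition subrep ::
  "('i, 'h) pre_digraph \<Rightarrow> ('a, 'b) ring_scheme \<Rightarrow> 'i dimvec \<Rightarrow> ('h \<Rightarrow> 'a mat)
     \<Rightarrow> ('i \<Rightarrow> 'a vec set) \<Rightarrow> bool" where
  "subrep Q K \<alpha> M U \<longleftrightarrow>
     (\<forall>i\<in>verts Q. submodule (U i) K (vec_space K (Poly_Mapping.lookup \<alpha> i))) \<and>
     (\<forall>h\<in>arcs Q. \<forall>v\<in>U (tail Q h). mat_app K (M h) v \<in> U (head Q h))"

definition irreducible_rep ::
  "('i, 'h) pre_digraph \<Rightarrow> ('a, 'b) ring_scheme \<Rightarrow> 'i dimvec \<Rightarrow> ('h \<Rightarrow> 'a mat) \<Rightarrow> bool" where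
  "irreducible_rep Q K \<alpha> M \<longleftrightarrow>
     (\<exists>i\<in>verts Q. Poly_Mapping.lookup \<alpha> i \<noteq> 0) \<and>
     (\<forall>U. subrep Q K \<alpha> M U \<longrightarrow>
        (\<forall>i\<in>verts Q. U i = {\<zero>\<^bsub>vec_space K (Poly_Mapping.lookup \<alpha> i)\<^esub>}) \<or>
        (\<forall>i\<in>verts Q. U i = carrier (vec_space K (Poly_Mapping.lookup \<alpha> i))))"

text \<open>Extension of scalars along a field homomorphism acts on the entries of the matrices.\<close>

definition extend_scalars ::
  "('i, 'h) pre_digraph \<Rightarrow> ('a \<Rightarrow> 'c) \<Rightarrow> ('h \<Rightarrow> 'a mat) \<Rightarrow> ('h \<Rightarrow> 'c mat)" where
  "extend_scalars Q \<phi> M = (\<lambda>h\<in>arcs Q. map_mat \<phi> (M h))"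

text \<open>
  The finite extensions of \<open>K\<close> are given by a field \<open>L\<close>, again on the naturals, and an
  embedding of \<open>K\<close> into \<open>L\<close>; up to isomorphism this is no restriction.
\<close>

definition abs_irreducible_rep ::
  "('i, 'h) pre_digraph \<Rightarrow> nat ring \<Rightarrow> 'i dimvec \<Rightarrow> ('h \<Rightarrow> nat mat) \<Rightarrow> bool" where
  "abs_irreducible_rep Q K \<alpha> M \<longleftrightarrow>
     irreducible_rep Q K \<alpha> M \<and>
     (\<forall>(L :: nat ring) \<phi>.
        Ring.field L \<and> \<phi> \<in> Ring.ring_hom K L \<and>
        ring.finite_dimension L (\<phi> ` carrier K) (carrier L) \<longrightarrow>
        irreducible_rep Q L \<alpha> (extend_scalars Q \<phi> M))"

definition num_abs_irreducible ::
  "('i, 'h) pre_digraph \<Rightarrow> nat ring \<Rightarrow> 'i dimvec \<Rightarrow> nat" where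
  "num_abs_irreducible Q K \<alpha> =
     card ({M \<in> rep_space Q K \<alpha>. abs_irreducible_rep Q K \<alpha> M} // rep_iso Q K \<alpha>)"

definition finite_field :: "nat ring \<Rightarrow> bool" where
  "finite_field K \<longleftrightarrow> Ring.field K \<and> finite (carrier K)"

definition is_abs_irreducible_poly ::
  "('i, 'h) pre_digraph \<Rightarrow> 'i dimvec \<Rightarrow> int poly \<Rightarrow> bool" where
  "is_abs_irreducible_poly Q \<alpha> P \<longleftrightarrow>
     (\<forall>K. finite_field K \<longrightarrow>
        poly P (int (order K)) = int (num_abs_irreducible Q K \<alpha>))"


section \<open>The field of rational functions\<close>

type_synonym ratfun = "rat poly fract"

definition qvar :: ratfun where
  "qvar = to_fract [:0, 1:]"

definition ratfun_of_int_poly :: "int poly \<Rightarrow> ratfun" where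
  "ratfun_of_int_poly P = to_fract (map_poly rat_of_int P)"

text \<open>
  \<^const>\<open>quot_of_fract\<close> is the reduced fraction. At a pole the value is 0 by the convention on
  division.
\<close>

definition ratfun_eval :: "ratfun \<Rightarrow> rat \<Rightarrow> rat" where
  "ratfun_eval f x = poly (fst (quot_of_fract f)) x / poly (snd (quot_of_fract f)) x"

text \<open>Substitution of \<open>s\<close> for \<open>q\<close>, meant for non-constant \<open>s\<close>.\<close>

definition ratfun_subst :: "ratfun \<Rightarrow> ratfun \<Rightarrow> ratfun" where
  "ratfun_subst s f =
     poly (map_poly (\<lambda>c. to_fract [:c:]) (fst (quot_of_fract f))) s /
     poly (map_poly (\<lambda>c. to_fract [:c:]) (snd (quot_of_fract f))) s"

text \<open>The rational function \<open>r\<^sub>\<alpha>\<close>; it is determined by its values at the prime powers.\<close>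

definition rep_ratfun :: "('i, 'h) pre_digraph \<Rightarrow> 'i dimvec \<Rightarrow> ratfun" where
  "rep_ratfun Q \<alpha> = (THE f. \<forall>K. finite_field K \<longrightarrow>
     ratfun_eval f (of_nat (order K)) =
       of_nat (card (rep_space Q K \<alpha>)) / of_nat (card (GL_dim Q K \<alpha>)))"

definition q_infty :: "nat \<Rightarrow> ratfun" where
  "q_infty m = 1 / (\<Prod>i=1..m. 1 - qvar ^ i)"

definition q_infty_dim :: "('i, 'h) pre_digraph \<Rightarrow> 'i dimvec \<Rightarrow> ratfun" where
  "q_infty_dim Q \<alpha> = (\<Prod>i\<in>verts Q. q_infty (Poly_Mapping.lookup \<alpha> i))"


section \<open>Power series\<close>

text \<open>
  A power series is the function giving its coefficients. The exponents range over all
  finitely supported functions on the type of vertices; the series of \<open>x\<^sub>i\<close>, \<open>i \<in> verts Q\<close>,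
  are those vanishing outside \<^term>\<open>dimvecs Q\<close>.
\<close>

type_synonym 'i series = "'i dimvec \<Rightarrow> ratfun"

definition gen_series :: "('i, 'h) pre_digraph \<Rightarrow> ('i dimvec \<Rightarrow> ratfun) \<Rightarrow> 'i series" where
  "gen_series Q c = (\<lambda>\<alpha>. if \<alpha> \<in> dimvecs Q then c \<alpha> else 0)"

definition series_monom :: "'i dimvec \<Rightarrow> 'i series" where
  "series_monom \<beta> = (\<lambda>\<alpha>. if \<alpha> = \<beta> then 1 else 0)"

definition series_one :: "'i series" where
  "series_one = series_monom 0"

definition series_scale :: "ratfun \<Rightarrow> 'i series \<Rightarrow> 'i series" where
  "series_scale c f = (\<lambda>\<alpha>. c * f \<alpha>)"

definition series_mult :: "'i series \<Rightarrow> 'i series \<Rightarrow> 'i series" where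
  "series_mult f g = (\<lambda>\<gamma>. \<Sum>(\<alpha>, \<beta>)\<in>{(\<alpha>, \<beta>). \<alpha> + \<beta> = \<gamma>}. f \<alpha> * g \<beta>)"

definition sum_vars :: "('i, 'h) pre_digraph \<Rightarrow> 'i series" where
  "sum_vars Q = (\<lambda>\<alpha>. \<Sum>i\<in>verts Q. series_monom (Poly_Mapping.single i 1) \<alpha>)"

definition series_conj :: "'i series \<Rightarrow> 'i series" where
  "series_conj f = (\<lambda>\<alpha>. ratfun_subst (inverse qvar) (f \<alpha>))"

text \<open>
  For \<open>n \<ge> 1\<close>, the coefficient of \<open>\<psi>\<^sub>n f\<close> at \<open>n \<beta>\<close> comes from the coefficient of \<open>f\<close> at \<open>\<beta>\<close>.
\<close>

definition adams :: "nat \<Rightarrow> 'i series \<Rightarrow> 'i series" where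
  "adams n f = (\<lambda>\<alpha>. if \<forall>i. n dvd Poly_Mapping.lookup \<alpha> i
     then ratfun_subst (qvar ^ n) (f (Poly_Mapping.map (\<lambda>m. m div n) \<alpha>)) else 0)"

text \<open>
  The infinite sums of series in \<open>exp\<close> and \<open>Exp\<close> are formed coefficientwise: for series
  without constant term only finitely many summands contribute to each coefficient, and
  \<^const>\<open>Sum_any\<close> is the sum of a family with finitely many non-zero members.
\<close>

definition series_exp :: "'i series \<Rightarrow> 'i series" where
  "series_exp f = (\<lambda>\<alpha>. Sum_any (\<lambda>n. (series_mult f ^^ n) series_one \<alpha> / fact n))"

definition plethystic_Exp :: "'i series \<Rightarrow> 'i series" where
  "plethystic_Exp f =
     series_exp (\<lambda>\<alpha>. Sum_any (\<lambda>k. if k \<ge> 1 then adams k f \<alpha> / of_nat k else 0))"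


section \<open>Ringel form and twisted product\<close>

definition ringel_form :: "('i, 'h) pre_digraph \<Rightarrow> ('i \<Rightarrow> int) \<Rightarrow> ('i \<Rightarrow> int) \<Rightarrow> int" where
  "ringel_form Q \<alpha> \<beta> =
     (\<Sum>i\<in>verts Q. \<alpha> i * \<beta> i) - (\<Sum>h\<in>arcs Q. \<alpha> (tail Q h) * \<beta> (head Q h))"

definition tits_form :: "('i, 'h) pre_digraph \<Rightarrow> ('i \<Rightarrow> int) \<Rightarrow> int" where
  "tits_form Q \<alpha> = ringel_form Q \<alpha> \<alpha>"

definition int_dim :: "'i dimvec \<Rightarrow> 'i \<Rightarrow> int" where
  "int_dim \<alpha> = (\<lambda>i. int (Poly_Mapping.lookup \<alpha> i))"

definition tits_op :: "('i, 'h) pre_digraph \<Rightarrow> 'i series \<Rightarrow> 'i series" where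
  "tits_op Q f = (\<lambda>\<alpha>. qvar powi tits_form Q (int_dim \<alpha>) * f \<alpha>)"

definition twisted_mult :: "('i, 'h) pre_digraph \<Rightarrow> 'i series \<Rightarrow> 'i series \<Rightarrow> 'i series" where
  "twisted_mult Q f g = (\<lambda>\<gamma>. \<Sum>(\<alpha>, \<beta>)\<in>{(\<alpha>, \<beta>). \<alpha> + \<beta> = \<gamma>}.
     qvar powi (- ringel_form Q (int_dim \<alpha>) (int_dim \<beta>)) * f \<alpha> * g \<beta>)"

end

theory Submission
  imports
    Defs
    "HOL-Algebra.Algebraic_Closure_Type"
    "HOL-Algebra.Multiplicative_Group"
    "HOL-Library.Z2"
    "HOL-Algebra.Group_Action"
    "HOL-Library.Function_Algebras"
begin

text \<open>
Both identities hold between rational functions, and these are compared by their values at \<open>q = 2^n\<close>: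
infinitely many values determine a rational function (\<open>ratfun_eqI\<close>). All fields are finite
subfields FF q of one algebraic closure, so that extending scalars just means using more vectors
with the same matrices.

The equation for r compares two explicit formulas: counting matrices and tuples of independent
columns gives r, and \<open>(1-x)...(1-x^m)\<close> at \<open>x = 1/q\<close> is the order of the general linear group
up to a power of q that the Tits form accounts for. That
p is a plethystic exponential is the case of one class per vertex of \<open>qmass_log\<close>, below.

For the twisted product let S run over the simple representations over a field with q
elements, put \<open>q_S = #End(S)\<close> and
\<open>mass(be) = \<Sum>_m \<Prod>_S 1/((1-q_S)...(1-q_S^m_S))\<close> over the semisimple
\<open>N_m = \<Oplus> S^m_S\<close> of dimension be. A fixed representation \<open>M \<noteq> 0\<close> satisfies
\<open>\<Sum>_m (\<Prod>_S 1/((1-q_S)...(1-q_S^m_S))) * #{embeddings of N_m into M} = 0\<close>: the sum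
factors over S, and each simple S contained in M contributes a telescoping sum with value 0
(\<open>alternating_sum_embeddings\<close>, \<open>qe_sum_eq_0\<close>). Summing over all M, after
counting those for which a given graded injection is a homomorphism, shows that \<open>mass\<close> is
inverse to r (\<open>simple_mass_inverse\<close>, \<open>twisted_term\<close>).

It remains to see that \<open>mass\<close> is \<open>Exp(a/(1-q))\<close> at this q. The logarithm of \<open>mass\<close>
is the sum of \<open>x^(n dim S)/(n(1-q_S^n))\<close> over S and \<open>n > 0\<close> (\<open>qmass_log\<close>).
By Schur and Wedderburn End(S) is a field with \<open>q^d\<close> elements. Over the extension of degree k
with d dividing k, S splits into d Galois-conjugate absolutely simple representations of dimension
\<open>dim S/d\<close>, and all absolutely simple ones arise in this way from exactly one S (\<open>count_abs_simple\<close>).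
With \<open>k = dn\<close> the logarithm becomes the sum of \<open>a_al(q^k) x^(k al)/(k(1-q^k))\<close> over k and al
(\<open>simple_mass_log\<close>), which defines \<open>Exp\<close>. Logarithms are used as recursions: \<open>f = exp g\<close> is
determined by \<open>f_0 = 1\<close> and \<open>E f = (E g) f\<close>, where E multiplies \<open>x^ga\<close> by \<open>|ga|\<close>.
\<close>

abbreviation "lk \<equiv> Poly_Mapping.lookup"
abbreviation "pcoeff \<equiv> Polynomial.coeff"
abbreviation "pmonom \<equiv> Polynomial.monom"
abbreviation "pdeg \<equiv> Polynomial.degree"
abbreviation "psmult \<equiv> Polynomial.smult"
abbreviation "plead p \<equiv> Polynomial.lead_coeff p"

section \<open>Groups with operators\<close>

text \<open>Only additivity in the vector is asked of the operators: scalars and arrows then act on the same footing, and changing the field of scalars only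
changes the set P of operators.\<close>

definition additive_action::"('o => 'a::ab_group_add => 'a) => bool" where
 "additive_action A \<longleftrightarrow> (ALL c x y. A c (x + y) = A c x + A c y)"

definition submod::"'o set => ('o => 'a::ab_group_add => 'a) => 'a set => bool" where
 "submod P A U \<longleftrightarrow> 0:U & (ALL x:U. ALL y:U. x - y:U) & (ALL c:P. ALL x:U. A c x:U)"

text \<open>Maps are 0 outside the source, so that equal homomorphisms are equal functions and can be counted.\<close>

definition ophom::"'o set => ('o => 'a::ab_group_add => 'a) => 'a set
 => ('o => 'b::ab_group_add => 'b) => 'b set => ('a => 'b) set" where
 "ophom P A V B W = {f. (ALL x. x ~: V --> f x = 0) & (ALL x:V. f x:W) &
 (ALL x:V. ALL y:V. f (x + y) = f x + f y) & (ALL c:P. ALL x:V. f (A c x) = B c (f x))}"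

definition simple_mod::"'o set => ('o => 'a::ab_group_add => 'a) => 'a set => bool" where
 "simple_mod P A V \<longleftrightarrow> submod P A V & V ~= {0} &
 (ALL U. submod P A U --> U <= V --> U = {0} | U = V)"

lemma additive_actionD: "additive_action A ==> A c (x + y) = A c x + A c y"
 by (simp add: additive_action_def)

lemma additive_action_zero: "additive_action A ==> A c 0 = 0"
 using additive_actionD[of A c 0 0] by simp

lemma additive_action_diff: "additive_action A ==> A c (x - y) = A c x - A c y"
 using additive_actionD[of A c "x - y" y] by (simp add: algebra_simps)

lemma submodD:
 assumes "submod P A U"
 shows "0:U" "x:U ==> y:U ==> x - y:U" "x:U ==> y:U ==> x + y:U"
 "x:U ==> - x:U" "c:P ==> x:U ==> A c x:U"
proof -
 show z: "0:U" and d: "x:U ==> y:U ==> x - y:U" for x y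
 using assms by (auto simp: submod_def)
 show n: "- x:U" if "x:U" for x using d[OF z that] by simp
 show "x + y:U" if "x:U" "y:U" using d[OF that(1) n[OF that(2)]] by simp
 show "c:P ==> x:U ==> A c x:U" using assms by (auto simp: submod_def)
qed

lemma submod_zero: "additive_action A ==> submod P A {0}"
 by (auto simp: submod_def additive_action_zero)

lemma simple_submod: "simple_mod P A V ==> submod P A V"
 by (simp add: simple_mod_def)

lemma ophomD:
 assumes "f:ophom P A V B W"
 shows "x ~: V ==> f x = 0" "x:V ==> f x:W"
 "x:V ==> y:V ==> f (x + y) = f x + f y"
 "c:P ==> x:V ==> f (A c x) = B c (f x)"
 using assms by (auto simp: ophom_def)

lemma ophomI:
 assumes "!!x. x ~: V ==> f x = 0" "!!x. x:V ==> f x:W"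
 "!!x y. x:V ==> y:V ==> f (x + y) = f x + f y"
 "!!c x. c:P ==> x:V ==> f (A c x) = B c (f x)"
 shows "f:ophom P A V B W"
 using assms by (auto simp: ophom_def)

lemma ophom_zero_at:
 assumes "f:ophom P A V B W"
 shows "f 0 = 0"
proof (cases "0:V")
 case True
 with ophomD(3)[OF assms, of 0 0] show ?thesis by simp
qed (use ophomD(1)[OF assms] in auto)

lemma ophom_diff_at:
 assumes "f:ophom P A V B W" "submod P A V" "x:V" "y:V"
 shows "f (x - y) = f x - f y"
 using ophomD(3)[OF assms(1), of "x - y" y] submodD(2)[OF assms(2-4)] assms(4)
 by (simp add: algebra_simps)

lemma ophom_uminus_at:
 assumes "f:ophom P A V B W" "submod P A V" "y:V"
 shows "f (- y) = - f y"
 using ophom_diff_at[OF assms(1,2), of 0 y] submodD(1)[OF assms(2)] assms(3)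
 ophom_zero_at[OF assms(1)] by simp

lemma ophom_eqI:
 assumes "f:ophom P A V B W" "g:ophom P A V B' W'" "!!x. x:V ==> f x = g x"
 shows "f = g"
 using assms ophomD(1)[OF assms(1)] ophomD(1)[OF assms(2)] by (metis ext)

lemma ophom_comp:
 assumes "g:ophom P A U B V" "f:ophom P B V C W"
 shows "f o g:ophom P A U C W"
proof (rule ophomI)
 show "(f o g) x = 0" if "x ~: U" for x
 using ophomD(1)[OF assms(1) that] ophom_zero_at[OF assms(2)] by simp
qed (use ophomD[OF assms(1)] ophomD[OF assms(2)] in auto)

lemma ophom_mono_codomain:
 "f:ophom P A V B W ==> (!!x. x:V ==> f x:W') ==> f:ophom P A V B W'"
 by (auto simp: ophom_def)

lemma ophom_mono_ops: "f:ophom P A V B W ==> P' <= P ==> f:ophom P' A V B W"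
 by (auto simp: ophom_def)

lemma submod_mono_ops: "submod P A V ==> P' <= P ==> submod P' A V"
 by (auto simp: submod_def)

lemma ophom_add:
 assumes "f:ophom P A V B W" "g:ophom P A V B W" "submod P B W" "additive_action B"
 shows "f + g:ophom P A V B W"
 by (rule ophomI) (use ophomD[OF assms(1)] ophomD[OF assms(2)] submodD(3)[OF assms(3)]
 additive_actionD[OF assms(4)] in "auto simp: plus_fun_def algebra_simps")

lemma ophom_diff:
 assumes "f:ophom P A V B W" "g:ophom P A V B W" "submod P B W" "additive_action B"
 shows "f - g:ophom P A V B W"
 by (rule ophomI) (use ophomD[OF assms(1)] ophomD[OF assms(2)] submodD(2)[OF assms(3)]
 additive_action_diff[OF assms(4)] in "auto simp: fun_diff_def algebra_simps")

lemma ophom_zero: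
 assumes "submod P B W" "additive_action B"
 shows "0:ophom P A V B W"
 by (rule ophomI) (use submodD(1)[OF assms(1)] additive_action_zero[OF assms(2)] in "auto simp: zero_fun_def")

definition idon::"'a::ab_group_add set => 'a => 'a" where
 "idon V x = (if x:V then x else 0)"

lemma idon_ophom: "submod P A U ==> U <= V ==> idon U:ophom P A U A V"
 by (rule ophomI) (auto simp: idon_def submodD)

lemma ophom_kernel:
 assumes "f:ophom P A V B W" "submod P A V" "additive_action B"
 shows "submod P A {x:V. f x = 0}"
 using ophomD[OF assms(1)] submodD[OF assms(2)] ophom_diff_at[OF assms(1,2)]
 ophom_zero_at[OF assms(1)] additive_action_zero[OF assms(3)]
 by (auto simp: submod_def)

lemma ophom_image:
 assumes "f:ophom P A V B W" "submod P A V"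
 shows "submod P B (f ` V)"
proof -
 have "f x - f y:f ` V" if "x:V" "y:V" for x y
 using ophom_diff_at[OF assms that] submodD(2)[OF assms(2) that] by (metis imageI)
 moreover have "B c (f x):f ` V" if "c:P" "x:V" for c x
 using ophomD(4)[OF assms(1) that] submodD(5)[OF assms(2) that] by (metis imageI)
 moreover have "0:f ` V"
 using ophom_zero_at[OF assms(1)] submodD(1)[OF assms(2)] by (metis imageI)
 ultimately show ?thesis by (auto simp: submod_def)
qed

lemma ophom_inj_iff:
 assumes "f:ophom P A V B W" "submod P A V"
 shows "inj_on f V \<longleftrightarrow> (ALL x:V. f x = 0 --> x = 0)"
proof
 assume "inj_on f V"
 thus "ALL x:V. f x = 0 --> x = 0"
 using ophom_zero_at[OF assms(1)] submodD(1)[OF assms(2)] by (metis inj_onD)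
next
 assume *: "ALL x:V. f x = 0 --> x = 0"
 show "inj_on f V"
 proof (rule inj_onI)
 fix x y assume xy: "x:V" "y:V" "f x = f y"
 hence "f (x - y) = 0" using ophom_diff_at[OF assms xy(1,2)] by simp
 with * submodD(2)[OF assms(2) xy(1,2)] show "x = y" by force
 qed
qed

lemma simple_ophom_inj:
 assumes "simple_mod P A S" "f:ophom P A S B W" "additive_action B" "f ~= 0"
 shows "inj_on f S"
proof -
 have "{x:S. f x = 0} ~= S"
 using ophomD(1)[OF assms(2)] assms(4) by (auto simp: fun_eq_iff zero_fun_def)
 hence "{x:S. f x = 0} = {0}"
 using assms(1) ophom_kernel[OF assms(2) simple_submod[OF assms(1)] assms(3)]
 by (auto simp: simple_mod_def)
 thus ?thesis using ophom_inj_iff[OF assms(2) simple_submod[OF assms(1)]] by auto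
qed

lemma simple_ophom_bij:
 assumes "simple_mod P A S" "simple_mod P B T" "f:ophom P A S B T" "additive_action B" "f ~= 0"
 shows "bij_betw f S T"
proof -
 have "f ` S ~= {0}"
 proof
 assume "f ` S = {0}"
 hence "f = 0" using ophomD(1)[OF assms(3)] by (intro ext) (metis image_eqI singletonD zero_fun_def)
 with assms(5) show False by simp
 qed
 hence "f ` S = T"
 using assms(2) ophom_image[OF assms(3) simple_submod[OF assms(1)]] ophomD(2)[OF assms(3)]
 unfolding simple_mod_def by blast
 thus ?thesis using simple_ophom_inj[OF assms(1,3,4,5)] by (simp add: bij_betw_def)
qed

definition hinv::"'a::ab_group_add set => ('a => 'b) => 'b set => 'b => 'a" where
 "hinv V f W y = (if y:W then inv_into V f y else 0)"

lemma hinv_ophom: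
 assumes "f:ophom P A V B W" "bij_betw f V W" "submod P A V"
 shows "hinv V f W:ophom P B W A V" "!!x. x:V ==> hinv V f W (f x) = x"
 "!!y. y:W ==> f (hinv V f W y) = y"
proof -
 show 1: "hinv V f W (f x) = x" if "x:V" for x
 using assms(2) ophomD(2)[OF assms(1)] that by (auto simp: hinv_def bij_betw_def inv_into_f_f)
 have W: "EX x:V. y = f x" if "y:W" for y using assms(2) that by (auto simp: bij_betw_def)
 show "f (hinv V f W y) = y" if "y:W" for y using W[OF that] 1 by force
 show "hinv V f W:ophom P B W A V"
 proof (rule ophomI)
 fix y z assume "y:W" "z:W"
 then obtain a b where ab: "a:V" "b:V" "y = f a" "z = f b" using W by metis
 thus "hinv V f W (y + z) = hinv V f W y + hinv V f W z"
 using ophomD(3)[OF assms(1) ab(1,2)] 1 submodD(3)[OF assms(3)] by (metis ab)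
 next
 fix c y assume "c:P" "y:W"
 then obtain a where a: "a:V" "y = f a" using W by metis
 thus "hinv V f W (B c y) = A c (hinv V f W y)"
 using ophomD(4)[OF assms(1) \<open>c:P\<close> a(1)] 1 submodD(5)[OF assms(3) \<open>c:P\<close>] by metis
 qed (use W 1 in "force simp: hinv_def")+
qed

lemma bij_hinv:
 assumes "f:ophom P A V B W" "bij_betw f V W" "submod P A V"
 shows "bij_betw (hinv V f W) W V"
 by (rule bij_betwI[where g = f])
 (use hinv_ophom[OF assms] ophomD(2)[OF assms(1)] ophomD(2)[OF hinv_ophom(1)[OF assms]] in auto)

lemma exists_simple_submod:
 assumes "finite V" "submod P A V" "V ~= {0}"
 shows "EX U. U <= V & simple_mod P A U"
 using assms
proof (induction "card V" arbitrary: V rule: less_induct)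
 case less
 show ?case
 proof (cases "simple_mod P A V")
 case False
 then obtain U where U: "submod P A U" "U <= V" "U ~= {0}" "U ~= V"
 using less.prems by (auto simp: simple_mod_def)
 hence "card U < card V" using less.prems(1) by (simp add: psubset_card_mono psubsetI)
 from less.hyps[OF this _ U(1,3)] U(2) less.prems(1) show ?thesis
 by (meson finite_subset order_trans)
 qed auto
qed

lemma simple_mod_image:
 assumes "f:ophom P A V B W" "bij_betw f V W" "submod P A V" "simple_mod P B W"
 shows "simple_mod P A V"
proof -
 note h = hinv_ophom[OF assms(1-3)]
 have "V ~= {0}" using assms(4) assms(2) ophom_zero_at[OF assms(1)] by (auto simp: simple_mod_def bij_betw_def)
 moreover have "U = {0} | U = V" if "submod P A U" "U <= V" for U
 proof -
 have "submod P B (f ` U)"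
 proof -
 have "f x - f y:f ` U" if "x:U" "y:U" for x y
 using ophom_diff_at[OF assms(1,3), of x y] submodD(2)[OF \<open>submod P A U\<close> that] that \<open>U <= V\<close>
 by (metis imageI subsetD)
 moreover have "B c (f x):f ` U" if "c:P" "x:U" for c x
 using ophomD(4)[OF assms(1) that(1), of x] submodD(5)[OF \<open>submod P A U\<close> that] that \<open>U <= V\<close>
 by (metis imageI subsetD)
 moreover have "0:f ` U"
 using ophom_zero_at[OF assms(1)] submodD(1)[OF \<open>submod P A U\<close>] by (metis imageI)
 ultimately show ?thesis by (auto simp: submod_def)
 qed
 moreover have "f ` U <= W" using that(2) ophomD(2)[OF assms(1)] by auto
 ultimately have "f ` U = {0} | f ` U = W" using assms(4) by (auto simp: simple_mod_def)
 thus ?thesis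
 proof
 assume "f ` U = {0}"
 hence "ALL x:U. x = 0"
 using assms(2) that(2) ophom_zero_at[OF assms(1)] submodD(1)[OF assms(3)]
 by (metis bij_betw_def image_eqI inj_onD singletonD subsetD)
 thus ?thesis using submodD(1)[OF that(1)] by auto
 next
 assume "f ` U = W"
 hence "f ` U = f ` V" using assms(2) by (simp add: bij_betw_def)
 thus ?thesis using assms(2) that(2) by (metis bij_betw_def inj_on_image_eq_iff order_refl)
 qed
 qed
 ultimately show ?thesis using assms(3) by (auto simp: simple_mod_def)
qed

lemma finite_ophom: "finite V ==> finite W ==> finite (ophom P A V B W)"
 by (rule finite_subset[OF _ finite_set_of_finite_funs[of V W 0]]) (auto simp: ophom_def)

subsection \<open>Adjoining the image of a homomorphism\<close>

definition adjoin::"'a::ab_group_add set => ('b => 'a) => 'b set => 'a set" where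
 "adjoin U g E = {u + g s | u s. u:U & s:E}"

definition indep_of::"'a set => ('b::zero => 'a) => 'b set => bool" where
 "indep_of U g E \<longleftrightarrow> (ALL s:E. g s:U --> s = 0)"

lemma adjoin_submod:
 assumes "submod P B U" "submod P A E" "g:ophom P A E B V" "additive_action B"
 shows "submod P B (adjoin U g E)" "U <= adjoin U g E" "g ` E <= adjoin U g E"
proof -
 show 1: "U <= adjoin U g E"
 using submodD(1)[OF assms(2)] ophom_zero_at[OF assms(3)] by (force simp: adjoin_def)
 show "g ` E <= adjoin U g E"
 using submodD(1)[OF assms(1)] by (force simp: adjoin_def)
 have "x - y:adjoin U g E" if "x:adjoin U g E" "y:adjoin U g E" for x y
 proof -
 from that obtain u s v t where "u:U" "s:E" "v:U" "t:E" "x = u + g s" "y = v + g t"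
 by (auto simp: adjoin_def)
 hence "x - y = (u - v) + g (s - t)" "u - v:U" "s - t:E"
 using ophom_diff_at[OF assms(3,2)] submodD(2)[OF assms(1)] submodD(2)[OF assms(2)] by auto
 thus ?thesis by (auto simp: adjoin_def)
 qed
 moreover have "B c x:adjoin U g E" if "c:P" "x:adjoin U g E" for c x
 proof -
 from that obtain u s where "u:U" "s:E" "x = u + g s" by (auto simp: adjoin_def)
 hence "B c x = B c u + g (A c s)" "B c u:U" "A c s:E"
 using ophomD(4)[OF assms(3) that(1)] additive_actionD[OF assms(4)]
 submodD(5)[OF assms(1) that(1)] submodD(5)[OF assms(2) that(1)] by auto
 thus ?thesis by (auto simp: adjoin_def)
 qed
 ultimately show "submod P B (adjoin U g E)"
 using 1 submodD(1)[OF assms(1)] by (auto simp: submod_def)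
qed

lemma adjoin_subset:
 assumes "submod P B V" "U <= V" "g:ophom P A E B V"
 shows "adjoin U g E <= V"
 using assms(2) ophomD(2)[OF assms(3)] submodD(3)[OF assms(1)] by (auto simp: adjoin_def)

lemma adjoin_coordinate:
 assumes "submod P B U" "submod P A E" "g:ophom P A E B V" "additive_action B" "indep_of U g E"
 obtains pr where "pr:ophom P B (adjoin U g E) A E"
 "!!u s. u:U ==> s:E ==> pr (u + g s) = s"
 "!!y. y:adjoin U g E ==> y - g (pr y):U"
proof -
 define pr where "pr y = (if y:adjoin U g E then SOME s. s:E & y - g s:U else 0)" for y
 have uniq: "pr (u + g s) = s" if "u:U" "s:E" for u s
 proof -
 have mem: "u + g s:adjoin U g E" using that by (auto simp: adjoin_def)
 have "EX t. t:E & (u + g s) - g t:U" using that by (intro exI[of _ s]) auto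
 hence t: "pr (u + g s):E" "(u + g s) - g (pr (u + g s)):U"
 using mem someI_ex[of "%t. t:E & (u + g s) - g t:U"] by (auto simp: pr_def)
 have "g (s - pr (u + g s)) = ((u + g s) - g (pr (u + g s))) - u"
 using ophom_diff_at[OF assms(3,2) that(2) t(1)] by simp
 also have "...:U" using t(2) that(1) submodD(2)[OF assms(1)] by blast
 finally have "s - pr (u + g s) = 0"
 using assms(5) submodD(2)[OF assms(2) that(2) t(1)] by (auto simp: indep_of_def)
 thus ?thesis by simp
 qed
 have "pr:ophom P B (adjoin U g E) A E"
 proof (rule ophomI)
 fix x y assume "x:adjoin U g E" "y:adjoin U g E"
 then obtain u s v t where *: "u:U" "s:E" "v:U" "t:E" "x = u + g s" "y = v + g t"
 by (auto simp: adjoin_def)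
 hence "x + y = (u + v) + g (s + t)" "u + v:U" "s + t:E"
 using ophomD(3)[OF assms(3)] submodD(3)[OF assms(1)] submodD(3)[OF assms(2)] by auto
 hence "pr (x + y) = s + t" using uniq by metis
 thus "pr (x + y) = pr x + pr y" using uniq * by simp
 next
 fix c x assume c: "c:P" and "x:adjoin U g E"
 then obtain u s where *: "u:U" "s:E" "x = u + g s" by (auto simp: adjoin_def)
 hence "B c x = B c u + g (A c s)" "B c u:U" "A c s:E"
 using ophomD(4)[OF assms(3) c] additive_actionD[OF assms(4)]
 submodD(5)[OF assms(1) c] submodD(5)[OF assms(2) c] by auto
 thus "pr (B c x) = A c (pr x)" using uniq * by simp
 next
 fix x assume "x:adjoin U g E"
 thus "pr x:E" using uniq by (auto simp: adjoin_def)
 qed (simp add: pr_def)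
 moreover have "y - g (pr y):U" if "y:adjoin U g E" for y
 using that uniq by (auto simp: adjoin_def)
 ultimately show thesis using that uniq by blast
qed

lemma ophom_into_adjoin:
 assumes "submod P B U" "submod P A E" "g:ophom P A E B V" "additive_action B" "indep_of U g E"
 and A: "additive_action A"
 shows "bij_betw (%(u, th). u + (g o th)) (ophom P C R B U \<times> ophom P C R A E)
 (ophom P C R B (adjoin U g E))"
proof -
 obtain pr where pr: "pr:ophom P B (adjoin U g E) A E"
 "!!u s. u:U ==> s:E ==> pr (u + g s) = s"
 "!!y. y:adjoin U g E ==> y - g (pr y):U"
 using adjoin_coordinate[OF assms(1-5)] by blast
 note adj = adjoin_submod[OF assms(1-4)]
 have gU: "g:ophom P A E B (adjoin U g E)"
 by (rule ophom_mono_codomain[OF assms(3)]) (use adj(3) in auto)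
 have fwd: "u + (g o th):ophom P C R B (adjoin U g E)" "pr o (u + (g o th)) = th"
 if "u:ophom P C R B U" "th:ophom P C R A E" for u th
 proof -
 show *: "u + (g o th):ophom P C R B (adjoin U g E)"
 by (rule ophom_add[OF ophom_mono_codomain[OF that(1)] ophom_comp[OF that(2) gU] adj(1) assms(4)])
 (use adj(2) ophomD(2)[OF that(1)] in auto)
 show "pr o (u + (g o th)) = th"
 by (rule ophom_eqI[OF ophom_comp[OF * pr(1)] that(2)])
 (simp add: pr(2) ophomD(2)[OF that(1)] ophomD(2)[OF that(2)])
 qed
 show ?thesis
 proof (rule bij_betwI[where g = "%ph. (ph - (g o (pr o ph)), pr o ph)"])
 show "(%ph. (ph - (g o (pr o ph)), pr o ph)):ophom P C R B (adjoin U g E) \<rightarrow> ophom P C R B U \<times> ophom P C R A E"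
 proof
 fix ph assume ph: "ph:ophom P C R B (adjoin U g E)"
 have t: "pr o ph:ophom P C R A E" by (rule ophom_comp[OF ph pr(1)])
 have "ph - (g o (pr o ph)):ophom P C R B (adjoin U g E)"
 by (rule ophom_diff[OF ph ophom_comp[OF t gU] adj(1) assms(4)])
 hence "ph - (g o (pr o ph)):ophom P C R B U"
 by (rule ophom_mono_codomain) (use pr(3) ophomD(2)[OF ph] in "auto simp: fun_diff_def")
 with t show "(ph - (g o (pr o ph)), pr o ph):ophom P C R B U \<times> ophom P C R A E" by simp
 qed
 qed (use fwd in "auto simp: fun_eq_iff")
qed

lemma card_ophom_adjoin:
 assumes "submod P B U" "submod P A E" "g:ophom P A E B V" "additive_action B" "indep_of U g E"
 "additive_action A"
 shows "card (ophom P C R B (adjoin U g E)) = card (ophom P C R B U) * card (ophom P C R A E)"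
proof -
 have "card (ophom P C R B U \<times> ophom P C R A E) = card (ophom P C R B (adjoin U g E))"
 by (rule bij_betw_same_card[OF ophom_into_adjoin[OF assms]])
 thus ?thesis by (simp add: card_cartesian_product)
qed

lemma card_adjoin:
 assumes "submod P B U" "submod P A E" "g:ophom P A E B V" "additive_action B" "indep_of U g E"
 shows "card (adjoin U g E) = card U * card E"
proof -
 obtain pr where pr: "pr:ophom P B (adjoin U g E) A E"
 "!!u s. u:U ==> s:E ==> pr (u + g s) = s"
 "!!y. y:adjoin U g E ==> y - g (pr y):U"
 using adjoin_coordinate[OF assms(1-5)] by blast
 have "bij_betw (%(u, s). u + g s) (U \<times> E) (adjoin U g E)"
 by (rule bij_betwI[where g = "%y. (y - g (pr y), pr y)"])
 (use pr ophomD(2)[OF pr(1)] in "auto simp: adjoin_def")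
 thus ?thesis using bij_betw_same_card by (fastforce simp: card_cartesian_product)
qed

lemma ophom_from_adjoin:
 assumes "submod P B U" "submod P A E" "g:ophom P A E B V" "additive_action B" "indep_of U g E"
 and C: "additive_action C" "submod P C W" and uw: "u:ophom P B U C W" "w:ophom P A E C W"
 obtains ph where "ph:ophom P B (adjoin U g E) C W" "!!x. x:U ==> ph x = u x"
 "!!s. s:E ==> ph (g s) = w s"
proof -
 obtain pr where pr: "pr:ophom P B (adjoin U g E) A E"
 "!!u s. u:U ==> s:E ==> pr (u + g s) = s"
 "!!y. y:adjoin U g E ==> y - g (pr y):U"
 using adjoin_coordinate[OF assms(1-5)] by blast
 note adj = adjoin_submod[OF assms(1-4)]
 have gU: "g:ophom P A E B (adjoin U g E)"
 by (rule ophom_mono_codomain[OF assms(3)]) (use adj(3) in auto)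
 have p: "idon (adjoin U g E) - (g o pr):ophom P B (adjoin U g E) B U"
 by (rule ophom_mono_codomain[OF ophom_diff[OF idon_ophom[OF adj(1) order_refl]
 ophom_comp[OF pr(1) gU] adj(1) assms(4)]])
 (use pr(3) in "auto simp: idon_def fun_diff_def")
 define ph where "ph = (u o (idon (adjoin U g E) - (g o pr))) + (w o pr)"
 have "ph:ophom P B (adjoin U g E) C W"
 unfolding ph_def by (intro ophom_add ophom_comp[OF p uw(1)] ophom_comp[OF pr(1) uw(2)] C)
 moreover have "ph x = u x" if "x:U" for x
 proof -
 have "pr x = 0"
 using pr(2)[OF that submodD(1)[OF assms(2)]] ophom_zero_at[OF assms(3)] by simp
 thus ?thesis
 using that adj(2) ophom_zero_at[OF assms(3)] ophom_zero_at[OF uw(2)]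
 by (auto simp: ph_def idon_def fun_diff_def)
 qed
 moreover have "ph (g s) = w s" if "s:E" for s
 proof -
 have "pr (g s) = s" using pr(2)[OF submodD(1)[OF assms(1)] that] by simp
 thus ?thesis
 using that adj(3) ophom_zero_at[OF uw(1)] by (auto simp: ph_def idon_def fun_diff_def)
 qed
 ultimately show thesis by (rule that)
qed

lemma ophom_adjoin_eqI:
 assumes "f:ophom P B (adjoin U g E) C W" "h:ophom P B (adjoin U g E) C W'"
 "!!x. x:U ==> f x = h x" "!!s. s:E ==> f (g s) = h (g s)"
 "U <= adjoin U g E" "g ` E <= adjoin U g E"
 shows "f = h"
proof (rule ophom_eqI[OF assms(1,2)])
 fix x assume "x:adjoin U g E"
 then obtain u s where "u:U" "s:E" "x = u + g s" by (auto simp: adjoin_def)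
 thus "f x = h x"
 using ophomD(3)[OF assms(1), of u "g s"] ophomD(3)[OF assms(2), of u "g s"]
 assms(3,4) subsetD[OF assms(5)] subsetD[OF assms(6) imageI] by simp
qed

lemma simple_indep_iff:
 assumes "simple_mod P A E" "submod P B U" "g:ophom P A E B V" "additive_action B"
 shows "indep_of U g E \<longleftrightarrow> g ~: ophom P A E B U"
proof -
 have "submod P A {s:E. g s:U}"
 using submodD[OF simple_submod[OF assms(1)]] submodD[OF assms(2)] ophomD[OF assms(3)]
 ophom_zero_at[OF assms(3)] ophom_diff_at[OF assms(3) simple_submod[OF assms(1)]]
 by (auto simp: submod_def)
 hence "{s:E. g s:U} = {0} | {s:E. g s:U} = E"
 using assms(1) by (auto simp: simple_mod_def)
 moreover have "{s:E. g s:U} = E \<longleftrightarrow> g:ophom P A E B U"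
 using assms(3) by (auto simp: ophom_def)
 moreover have "{s:E. g s:U} = {0} \<longleftrightarrow> indep_of U g E"
 using ophom_zero_at[OF assms(3)] submodD(1)[OF simple_submod[OF assms(1)]] submodD(1)[OF assms(2)]
 by (auto simp: indep_of_def)
 moreover have "E ~= {0}" using assms(1) by (simp add: simple_mod_def)
 ultimately show ?thesis by auto
qed

definition injhom where "injhom P A V B W = {f:ophom P A V B W. inj_on f V}"

lemma card_ophom_iso_codomain:
 assumes "f:ophom P A V B W" "bij_betw f V W" "submod P A V"
 shows "card (ophom P C R A V) = card (ophom P C R B W)"
proof (rule bij_betw_same_card[of "%th. f o th"])
 note h = hinv_ophom[OF assms]
 show "bij_betw (%th. f o th) (ophom P C R A V) (ophom P C R B W)"
 proof (rule bij_betwI[where g = "%th. hinv V f W o th"])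
 show "hinv V f W o (f o th) = th" if "th:ophom P C R A V" for th
 by (rule ophom_eqI[OF ophom_comp[OF ophom_comp[OF that assms(1)] h(1)] that])
 (simp add: h(2) ophomD(2)[OF that])
 show "f o (hinv V f W o th) = th" if "th:ophom P C R B W" for th
 by (rule ophom_eqI[OF ophom_comp[OF ophom_comp[OF that h(1)] assms(1)] that])
 (simp add: h(3) ophomD(2)[OF that])
 qed (use ophom_comp[OF _ assms(1)] ophom_comp[OF _ h(1)] in auto)
qed

lemma inj_on_adjoin_iff:
 assumes "submod P B U" "submod P A E" "g:ophom P A E B V" "additive_action B" "indep_of U g E"
 and ph: "ph:ophom P B (adjoin U g E) C W" and u: "u:ophom P B U C W"
 and w: "w:ophom P A E C W" and e: "!!x. x:U ==> ph x = u x" "!!s. s:E ==> ph (g s) = w s"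
 shows "inj_on ph (adjoin U g E) \<longleftrightarrow> inj_on u U & indep_of (u ` U) w E"
proof -
 note E = assms(2)
 note adj = adjoin_submod[OF assms(1-4)]
 have sum: "ph (x + g s) = u x + w s" if "x:U" "s:E" for x s
 using ophomD(3)[OF ph subsetD[OF adj(2) that(1)] subsetD[OF adj(3) imageI[OF that(2)]]] e that by simp
 have "inj_on ph (adjoin U g E) \<longleftrightarrow> (ALL x:U. ALL s:E. u x + w s = 0 --> x + g s = 0)"
 proof
 assume "inj_on ph (adjoin U g E)"
 thus "ALL x:U. ALL s:E. u x + w s = 0 --> x + g s = 0"
 proof (intro ballI impI)
 fix x s assume xs: "x:U" "s:E" "u x + w s = 0"
 hence "x + g s:adjoin U g E" by (auto simp: adjoin_def)
 with \<open>inj_on ph (adjoin U g E)\<close> xs sum show "x + g s = 0"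
 unfolding ophom_inj_iff[OF ph adj(1)] by metis
 qed
 next
 assume *: "ALL x:U. ALL s:E. u x + w s = 0 --> x + g s = 0"
 show "inj_on ph (adjoin U g E)"
 unfolding ophom_inj_iff[OF ph adj(1)]
 proof (intro ballI impI)
 fix y assume y: "y:adjoin U g E" "ph y = 0"
 then obtain x s where "x:U" "s:E" "y = x + g s" by (auto simp: adjoin_def)
 with * y(2) sum show "y = 0" by simp
 qed
 qed
 also have "... \<longleftrightarrow> inj_on u U & indep_of (u ` U) w E"
 proof
 assume L: "ALL x:U. ALL s:E. u x + w s = 0 --> x + g s = 0"
 have "inj_on u U"
 unfolding ophom_inj_iff[OF u assms(1)]
 proof (intro ballI impI)
 fix x assume "x:U" "u x = 0"
 with L submodD(1)[OF E] ophom_zero_at[OF w] have "x + g 0 = 0" by simp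
 thus "x = 0" using ophom_zero_at[OF assms(3)] by simp
 qed
 moreover have "indep_of (u ` U) w E"
 unfolding indep_of_def
 proof (intro ballI impI)
 fix s assume s: "s:E" "w s:u ` U"
 then obtain x where x: "x:U" "w s = u x" by auto
 hence "u (- x) + w s = 0" using ophom_uminus_at[OF u assms(1)] by simp
 hence "- x + g s = 0" using L s x submodD(4)[OF assms(1)] by blast
 hence "g s = x" by simp
 hence "g s:U" using x by simp
 thus "s = 0" using assms(5) s by (simp add: indep_of_def)
 qed
 ultimately show "inj_on u U & indep_of (u ` U) w E" by simp
 next
 assume R: "inj_on u U & indep_of (u ` U) w E"
 show "ALL x:U. ALL s:E. u x + w s = 0 --> x + g s = 0"
 proof (intro ballI impI)
 fix x s assume xs: "x:U" "s:E" "u x + w s = 0"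
 hence "w s = u (- x)" using ophom_uminus_at[OF u assms(1)]
 by (metis add.commute eq_neg_iff_add_eq_0)
 hence "s = 0" using R xs submodD(4)[OF assms(1)] by (auto simp: indep_of_def)
 with xs have "u x = 0" using ophom_zero_at[OF w] by simp
 hence "x = 0" using R xs ophom_inj_iff[OF u assms(1)] by auto
 with \<open>s = 0\<close> show "x + g s = 0" using ophom_zero_at[OF assms(3)] by simp
 qed
 qed
 finally show ?thesis .
qed

text \<open>A homomorphism on \<open>U \<oplus> g(E)\<close> extending an injective f on U is injective iff the image of the simple E is not contained in
\<open>f(U)\<close>; the homomorphisms that fail are those of E into \<open>f(U)\<close>, as many as those into U.\<close>

lemma card_injhom_adjoin:
 assumes "submod P B U" "simple_mod P A E" "g:ophom P A E B V" "additive_action B" "indep_of U g E"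
 and C: "additive_action C" "submod P C W" "finite W" and fin: "finite U" "finite E"
 shows "card (injhom P B (adjoin U g E) C W) =
 card (injhom P B U C W) * (card (ophom P A E C W) - card (ophom P A E B U))"
proof -
 note E = simple_submod[OF assms(2)]
 note adj = adjoin_submod[OF assms(1) E assms(3,4)]
 define Y where "Y = Sigma (injhom P B U C W) (%u. ophom P A E C W - ophom P A E C (u ` U))"
 define F::"('b => 'd) => ('b => 'd) \<times> ('c => 'd)"
 where "F = (%ph. ((%x. if x:U then ph x else 0), ph o g))"
 have gU: "g:ophom P A E B (adjoin U g E)"
 by (rule ophom_mono_codomain[OF assms(3)]) (use adj(3) in auto)
 have restr: "(%x. if x:U then ph x else 0):ophom P B U C W"
 if "ph:ophom P B (adjoin U g E) C W" for ph
 proof (rule ophomI)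
 fix x y assume "x:U" "y:U"
 thus "(if x + y:U then ph (x + y) else 0) = (if x:U then ph x else 0) + (if y:U then ph y else 0)"
 using ophomD(3)[OF that subsetD[OF adj(2)] subsetD[OF adj(2)]] submodD(3)[OF assms(1)] by simp
 next
 fix c x assume "c:P" "x:U"
 thus "(if B c x:U then ph (B c x) else 0) = C c (if x:U then ph x else 0)"
 using ophomD(4)[OF that _ subsetD[OF adj(2)]] submodD(5)[OF assms(1)] by simp
 qed (use ophomD(2)[OF that subsetD[OF adj(2)]] in auto)
 have indep: "inj_on ph (adjoin U g E) \<longleftrightarrow> inj_on u U & w ~: ophom P A E C (u ` U)"
 if ph: "ph:ophom P B (adjoin U g E) C W" and u: "u:ophom P B U C W"
 and w: "w:ophom P A E C W" and e: "!!x. x:U ==> ph x = u x" "!!s. s:E ==> ph (g s) = w s"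
 for ph u w
 using inj_on_adjoin_iff[OF assms(1) E assms(3-5) ph u w e]
 simple_indep_iff[OF assms(2) ophom_image[OF u assms(1)] w C(1)] by simp
 have "bij_betw F (injhom P B (adjoin U g E) C W) Y"
 unfolding bij_betw_def
 proof
 show "inj_on F (injhom P B (adjoin U g E) C W)"
 proof (rule inj_onI)
 fix ph ps assume *: "ph:injhom P B (adjoin U g E) C W" "ps:injhom P B (adjoin U g E) C W" "F ph = F ps"
 have "ph x = ps x" if "x:U" for x
 using fun_cong[OF arg_cong[OF *(3), of fst], of x] that by (simp add: F_def)
 moreover have "ph (g s) = ps (g s)" for s
 using fun_cong[OF arg_cong[OF *(3), of snd], of s] by (simp add: F_def)
 ultimately show "ph = ps"
 using * adj(2,3) by (intro ophom_adjoin_eqI[of ph P B U g E C W ps W]) (auto simp: injhom_def)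
 qed
 show "F ` injhom P B (adjoin U g E) C W = Y"
 proof (intro equalityI subsetI)
 fix p assume "p:F ` injhom P B (adjoin U g E) C W"
 then obtain ph where ph: "ph:ophom P B (adjoin U g E) C W" "inj_on ph (adjoin U g E)" "p = F ph"
 by (auto simp: injhom_def)
 note w = ophom_comp[OF gU ph(1)]
 from indep[OF ph(1) restr[OF ph(1)] w] ph(2) show "p:Y"
 unfolding ph(3) F_def Y_def using restr[OF ph(1)] w by (auto simp: injhom_def)
 next
 fix p assume "p:Y"
 then obtain u w where p: "p = (u, w)" "u:ophom P B U C W" "inj_on u U" "w:ophom P A E C W"
 "w ~: ophom P A E C (u ` U)" by (auto simp: Y_def injhom_def)
 obtain ph where ph: "ph:ophom P B (adjoin U g E) C W" "!!x. x:U ==> ph x = u x"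
 "!!s. s:E ==> ph (g s) = w s"
 using ophom_from_adjoin[OF assms(1) E assms(3-5) C(1,2) p(2,4)] by blast
 have "ph:injhom P B (adjoin U g E) C W"
 using indep[OF ph(1) p(2,4) ph(2,3)] p ph(1) by (auto simp: injhom_def)
 moreover have "F ph = p"
 proof -
 have "ph (g s) = w s" for s
 by (cases "s:E")
 (simp_all add: ph(3) ophomD(1)[OF p(4)] ophomD(1)[OF assms(3)] ophom_zero_at[OF ph(1)])
 moreover have "(if x:U then ph x else 0) = u x" for x
 by (simp add: ph(2) ophomD(1)[OF p(2)])
 ultimately show ?thesis unfolding F_def p(1) by (simp add: fun_eq_iff)
 qed
 ultimately show "p:F ` injhom P B (adjoin U g E) C W" by (metis imageI)
 qed
 qed
 hence "card (injhom P B (adjoin U g E) C W) = card Y" by (rule bij_betw_same_card)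
 also have "... = (SUM u:injhom P B U C W. card (ophom P A E C W - ophom P A E C (u ` U)))"
 unfolding Y_def using C(3) fin
 by (intro card_SigmaI) (auto simp: injhom_def finite_ophom)
 also have "... = (SUM u:injhom P B U C W. card (ophom P A E C W) - card (ophom P A E B U))"
 proof (rule sum.cong[OF refl])
 fix u assume "u:injhom P B U C W"
 hence u: "u:ophom P B U C W" "inj_on u U" by (auto simp: injhom_def)
 have "u:ophom P B U C (u ` U)" by (rule ophom_mono_codomain[OF u(1)]) auto
 hence "card (ophom P A E B U) = card (ophom P A E C (u ` U))"
 by (rule card_ophom_iso_codomain) (use u assms(1) in "auto simp: bij_betw_def")
 moreover have "ophom P A E C (u ` U) <= ophom P A E C W"
 using ophomD(2)[OF u(1)] by (auto simp: ophom_def)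
 ultimately show "card (ophom P A E C W - ophom P A E C (u ` U)) = card (ophom P A E C W) - card (ophom P A E B U)"
 using fin by (subst card_Diff_subset) (auto intro!: finite_ophom)
 qed
 finally show ?thesis by simp
qed

subsection \<open>Isotypic submodules\<close>

text \<open>Sums of n independent copies of E, built one copy at a time: each new g is one that does not already map into U, so by simplicity its image is
independent of U.\<close>

inductive isotypic for P A E B V where
 isotypic_zero: "isotypic P A E B V {0} 0"
| isotypic_adjoin: "isotypic P A E B V U n ==> g:ophom P A E B V ==> g ~: ophom P A E B U ==>
 isotypic P A E B V (adjoin U g E) (Suc n)"

context
 fixes P A E B V
 assumes E: "simple_mod P A E" and V: "submod P B V" and A: "additive_action A" and B: "additive_action B"
begin

lemma isotypic_submod: "isotypic P A E B V U n ==> submod P B U & U <= V"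
proof (induction rule: isotypic.induct)
 case isotypic_zero
 thus ?case using submod_zero[OF B] submodD(1)[OF V] by auto
next
 case (isotypic_adjoin U n g)
 thus ?case
 using adjoin_submod[OF _ simple_submod[OF E] _ B, of U g V] adjoin_subset[OF V, of U g A E] by auto
qed

lemma isotypic_indep:
 "isotypic P A E B V U n ==> g:ophom P A E B V ==> g ~: ophom P A E B U ==> indep_of U g E"
 using simple_indep_iff[OF E _ _ B] isotypic_submod by blast

lemma isotypic_card: "isotypic P A E B V U n ==> card U = card E ^ n"
proof (induction rule: isotypic.induct)
 case (isotypic_adjoin U n g)
 thus ?case
 using card_adjoin[OF _ simple_submod[OF E] isotypic_adjoin(2) B isotypic_indep[OF isotypic_adjoin(1-3)]]
 isotypic_submod[OF isotypic_adjoin(1)] by simp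
qed auto

lemma isotypic_card_ophom:
 assumes "isotypic P A E B V U n" "P' <= P"
 shows "card (ophom P' C R B U) = card (ophom P' C R A E) ^ n"
 using assms(1)
proof (induction rule: isotypic.induct)
 case isotypic_zero
 have "f = 0" if "f:ophom P' C R B {0}" for f
 using ophomD(1,2)[OF that] by (intro ext) (metis singletonD zero_fun_def)
 hence "ophom P' C R B {0} = {0}"
 using ophom_zero[OF submod_zero[OF B] B, of P' C R] by blast
 thus ?case by simp
next
 case (isotypic_adjoin U n g)
 thus ?case
 using card_ophom_adjoin[where C = C and R = R,
 OF _ submod_mono_ops[OF simple_submod[OF E] assms(2)] ophom_mono_ops[OF isotypic_adjoin(2) assms(2)]
 B isotypic_indep[OF isotypic_adjoin(1-3)] A]
 submod_mono_ops[OF conjunct1[OF isotypic_submod[OF isotypic_adjoin(1)]] assms(2)] by simp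
qed

lemma isotypic_maximal:
 assumes "finite V"
 obtains U n where "isotypic P A E B V U n" "ophom P A E B U = ophom P A E B V"
proof -
 let ?Z = "{U. EX n. isotypic P A E B V U n}"
 have "finite ?Z" by (rule finite_subset[of _ "Pow V"]) (use isotypic_submod assms in auto)
 moreover have "{0}:?Z" using isotypic.isotypic_zero[of P A E B V] by blast
 ultimately have "Max (card ` ?Z):card ` ?Z" and le: "!!U'. U':?Z ==> card U' <= Max (card ` ?Z)"
 by (intro Max_in, auto)
 then obtain U where "U:?Z" "card U = Max (card ` ?Z)" by fastforce
 with le have U: "U:?Z" "!!U'. U':?Z ==> card U' <= card U" by simp_all
 then obtain n where n: "isotypic P A E B V U n" by auto
 have sub: "submod P B U" "U <= V" using isotypic_submod[OF n] by auto
 have "g:ophom P A E B U" if g: "g:ophom P A E B V" for g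
 proof (rule ccontr)
 assume ng: "g ~: ophom P A E B U"
 have adj: "adjoin U g E:?Z" using isotypic_adjoin[OF n g ng] by blast
 hence "finite (adjoin U g E)" using isotypic_submod assms finite_subset by blast
 moreover have "U <= adjoin U g E" "g ` E <= adjoin U g E"
 using adjoin_submod[OF sub(1) simple_submod[OF E] g B] by auto
 moreover have "~  g ` E <= U" using ng g by (auto simp: ophom_def)
 ultimately have "card U < card (adjoin U g E)" by (metis psubsetI psubset_card_mono)
 with U(2)[OF adj] show False by simp
 qed
 moreover have "ophom P A E B U <= ophom P A E B V" using sub(2) by (auto simp: ophom_def)
 ultimately show thesis using n that by blast
qed

lemma card_ophom_simple_power:
 assumes "finite V"
 obtains n where "card (ophom P A E B V) = card (ophom P A E A E) ^ n"
 using isotypic_maximal[OF assms] isotypic_card_ophom[OF _ order_refl] by metis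

lemma isotypic_total:
 assumes "finite V" "!!v. v:V ==> EX g:ophom P A E B V. v:g ` E"
 obtains n where "isotypic P A E B V V n"
proof -
 obtain U n where U: "isotypic P A E B V U n" "ophom P A E B U = ophom P A E B V"
 using isotypic_maximal[OF assms(1)] .
 have "V <= U" using assms(2) U(2) by (metis image_iff ophomD(2) subsetI)
 hence "U = V" using isotypic_submod[OF U(1)] by auto
 with U that show thesis by blast
qed

text \<open>A maximal U of this kind that uses only maps from G absorbs G. Closure under End(E) makes all homomorphisms into U lie in G.\<close>

lemma isotypic_of_homs:
 assumes "finite V" and G: "G <= ophom P A E B V" "0:G" "!!f g. f:G ==> g:G ==> f + g:G"
 "!!f th. f:G ==> th:ophom P A E A E ==> f o th:G"
 obtains U n where "isotypic P A E B V U n" "ophom P A E B U = G"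
proof -
 let ?Z = "{U. (EX n. isotypic P A E B V U n) & ophom P A E B U <= G}"
 have fin: "finite ?Z" by (rule finite_subset[of _ "Pow V"]) (use isotypic_submod assms in auto)
 have "ophom P A E B {0} <= G"
 proof
 fix f assume f: "f:ophom P A E B {0}"
 have "f = 0" using ophomD(1,2)[OF f] by (intro ext) (metis singletonD zero_fun_def)
 with G(2) show "f:G" by simp
 qed
 hence "{0}:?Z" using isotypic.isotypic_zero[of P A E B V] by blast
 with fin have "Max (card ` ?Z):card ` ?Z" and le: "!!U'. U':?Z ==> card U' <= Max (card ` ?Z)"
 by (intro Max_in, auto)
 then obtain U where "U:?Z" "card U = Max (card ` ?Z)" by fastforce
 with le have U: "U:?Z" "!!U'. U':?Z ==> card U' <= card U" by simp_all
 then obtain n where n: "isotypic P A E B V U n" by auto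
 have sub: "submod P B U" "U <= V" using isotypic_submod[OF n] by auto
 have "g:ophom P A E B U" if gG: "g:G" for g
 proof (rule ccontr)
 assume ng: "g ~: ophom P A E B U"
 have g: "g:ophom P A E B V" using gG G(1) by auto
 note ig = isotypic_indep[OF n g ng]
 have "ophom P A E B (adjoin U g E) <= G"
 proof
 fix f assume "f:ophom P A E B (adjoin U g E)"
 hence "f:(%(u, th). u + (g o th)) ` (ophom P A E B U \<times> ophom P A E A E)"
 using ophom_into_adjoin[OF sub(1) simple_submod[OF E] g B ig A, of A E] by (simp add: bij_betw_def)
 then obtain u th where f: "f = u + (g o th)" "u:ophom P A E B U" "th:ophom P A E A E" by auto
 have "u:G" using U(1) f(2) by blast
 thus "f:G" unfolding f(1) by (rule G(3)[OF _ G(4)[OF gG f(3)]])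
 qed
 hence adj: "adjoin U g E:?Z" using isotypic_adjoin[OF n g ng] by blast
 have "finite (adjoin U g E)"
 using finite_subset[OF conjunct2[OF isotypic_submod[OF isotypic_adjoin[OF n g ng]]] assms(1)] .
 moreover have "U <= adjoin U g E" "g ` E <= adjoin U g E"
 using adjoin_submod[OF sub(1) simple_submod[OF E] g B] by auto
 moreover have "~  g ` E <= U" using ng g by (auto simp: ophom_def)
 ultimately have "card U < card (adjoin U g E)" by (metis psubsetI psubset_card_mono)
 with U(2)[OF adj] show False by simp
 qed
 with U(1) n that show thesis by blast
qed

lemma isotypic_span:
 assumes "isotypic P A E B V U n" "0:Y" "!!x y. x:Y ==> y:Y ==> x + y:Y"
 "!!f s. f:ophom P A E B U ==> s:E ==> f s:Y"
 shows "U <= Y"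
 using assms(1,4)
proof (induction rule: isotypic.induct)
 case (isotypic_adjoin U n g)
 have sU: "submod P B U" using isotypic_submod[OF isotypic_adjoin(1)] by simp
 note adj = adjoin_submod[OF sU simple_submod[OF E] isotypic_adjoin(2) B]
 have "f s:Y" if "f:ophom P A E B U" "s:E" for f s
 by (rule isotypic_adjoin.prems[OF ophom_mono_codomain[OF that(1)] that(2)])
 (use ophomD(2)[OF that(1)] adj(2) in auto)
 hence "U <= Y" by (rule isotypic_adjoin.IH)
 moreover have "g s:Y" if "s:E" for s
 by (rule isotypic_adjoin.prems[OF ophom_mono_codomain[OF isotypic_adjoin(2)] that]) (use adj(3) in auto)
 ultimately show ?case using assms(3) by (auto simp: adjoin_def)
qed (use assms(2) in auto)

end

section \<open>Matrix representations over finite subfields of a field\<close>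

definition fsubfield::"'f::field set => bool" where
 "fsubfield k \<longleftrightarrow> finite k & 0:k & 1:k & (ALL x:k. ALL y:k. x - y:k & x * y:k) &
 (ALL x:k. inverse x:k)"

lemma fsubfieldD:
 assumes "fsubfield k"
 shows "finite k" "0:k" "1:k" "x:k ==> y:k ==> x - y:k" "x:k ==> y:k ==> x * y:k"
 "x:k ==> inverse x:k" "x:k ==> y:k ==> x + y:k" "x:k ==> - x:k"
proof -
 show "finite k" "0:k" "1:k" "x:k ==> y:k ==> x * y:k" "x:k ==> inverse x:k"
 and d: "!!x y. x:k ==> y:k ==> x - y:k"
 using assms by (auto simp: fsubfield_def)
 show n: "!!x. x:k ==> - x:k" using d[of 0] assms by (auto simp: fsubfield_def)
 show "x:k ==> y:k ==> x + y:k" using d[OF _ n, of x y] by simp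
qed

lemma fsubfield_sum: "fsubfield k ==> (!!x. x:A ==> f x:k) ==> sum f A:k"
 by (induction A rule: infinite_finite_induct) (auto simp: fsubfieldD)

lemma fsubfield_card_gt_1: assumes "fsubfield k" shows "card k > 1"
proof -
 have "{0, 1} <= k" using assms by (auto simp: fsubfield_def)
 hence "card {0, 1::'a} <= card k" using fsubfieldD(1)[OF assms] by (rule card_mono[rotated])
 thus ?thesis by simp
qed

datatype ('i, 'h, 'f) rep_op = Scal 'f | Proj 'i | Arr 'h

type_synonym ('i, 'f) gvec = "'i => nat => 'f"
type_synonym ('h, 'f) mats_fam = "'h => nat => nat => 'f"

definition rep_act::"('i, 'h) pre_digraph => 'i dimvec => ('h, 'f::field) mats_fam
 => ('i, 'h, 'f) rep_op => ('i, 'f) gvec => ('i, 'f) gvec" where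
 "rep_act Q al M c v = (case c of
 Scal t => (%i a. t * v i a)
 | Proj j => (%i a. if i = j then v i a else 0)
 | Arr h => (%i a. if i = head Q h
 then SUM b<lk al (tail Q h). M h a b * v (tail Q h) b else 0))"

definition ops::"'f set => ('i, 'h, 'f) rep_op set" where
 "ops k = Scal ` k \<union> range Proj \<union> range Arr"

text \<open>The operators of graded vector spaces, forgetting the arrows.\<close>

definition lops::"'f set => ('i, 'h, 'f) rep_op set" where
 "lops k = Scal ` k \<union> range Proj"

definition vspace::"'f::zero set => 'i dimvec => ('i, 'f) gvec set" where
 "vspace k al = {v. ALL i a. v i a:k & (lk al i <= a --> v i a = 0)}"

text \<open>Families of \<open>be (head h) \<times> al (tail h)\<close> matrices; for \<open>al = be\<close> these are the representations.\<close>

definition mat_fams::"('i, 'h) pre_digraph => 'f::zero set => 'i dimvec => 'i dimvec => ('h, 'f) mats_fam set" where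
 "mat_fams Q k al be = {M. ALL h a b. M h a b:k & (M h a b ~= 0 -->
 h:arcs Q & a < lk be (head Q h) & b < lk al (tail Q h))}"

abbreviation reps where "reps Q k al \<equiv> mat_fams Q k al al"

lemma add_rep [simp]: "additive_action (rep_act Q al M)"
 by (auto simp: additive_action_def rep_act_def fun_eq_iff sum.distrib algebra_simps split: rep_op.split)

lemma rep_act_simps:
 "rep_act Q al M (Scal t) v = (%i a. t * v i a)"
 "rep_act Q al M (Proj j) v = (%i a. if i = j then v i a else 0)"
 "rep_act Q al M (Arr h) v = (%i a. if i = head Q h
 then SUM b<lk al (tail Q h). M h a b * v (tail Q h) b else 0)"
 by (simp_all add: rep_act_def)

abbreviation lact::"('i, 'h) pre_digraph => ('i, 'h, 'f::field) rep_op => ('i, 'f) gvec => ('i, 'f) gvec" where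
 "lact Q \<equiv> rep_act Q 0 (%_ _ _. 0)"

lemma rep_act_lops: "c:lops k ==> rep_act Q al M c = rep_act Q be N c"
 by (auto simp: lops_def rep_act_simps fun_eq_iff)

lemma lops_subset_ops: "lops k <= ops k"
 by (auto simp: lops_def ops_def)

lemma ops_mono: "k <= k' ==> ops k <= ops k'" "k <= k' ==> lops k <= lops k'"
 by (auto simp: ops_def lops_def)

lemma ophom_cong:
 assumes "!!c v. c:P ==> v:V ==> A c v = A' c v" "!!c w. c:P ==> w:W ==> B c w = B' c w"
 shows "ophom P A V B W = ophom P A' V B' W"
 using assms by (auto simp: ophom_def)

lemma submod_cong: "(!!c v. c:P ==> v:V ==> A c v = A' c v) ==> submod P A V \<longleftrightarrow> submod P A' V"
 by (auto simp: submod_def)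

lemma ophom_lops: "ophom (lops k) (rep_act Q al M) V (rep_act Q be N) W = ophom (lops k) (lact Q) V (lact Q) W"
 by (rule ophom_cong) (use rep_act_lops in metis)+

lemma submod_lops: "submod (lops k) (rep_act Q al M) V \<longleftrightarrow> submod (lops k) (lact Q) V"
 by (rule submod_cong) (use rep_act_lops in metis)+

lemma finite_vspace [simp]:
 assumes "finite k"
 shows "finite (vspace k al)"
proof -
 let ?D = "Sigma (Poly_Mapping.keys al) (%i. {..<lk al i})"
 have "finite {f. ALL x. (x:?D --> f x:k) & (x ~: ?D --> f x = 0)}"
 by (rule finite_set_of_finite_funs) (use assms in auto)
 moreover have "(%v (i, a). v i a) ` vspace k al <= {f. ALL x. (x:?D --> f x:k) & (x ~: ?D --> f x = 0)}"
 by (auto simp: vspace_def not_less in_keys_iff)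
 moreover have "inj (%v (i, a). v i a::'a)"
 by (rule injI) (simp add: fun_eq_iff)
 ultimately show ?thesis by (meson finite_imageD finite_subset inj_on_subset subset_UNIV)
qed

lemma vspace_submod:
 assumes "fsubfield K" "k <= K" "M:reps Q K al"
 shows "submod (ops k) (rep_act Q al M) (vspace K al)"
proof -
 note K = fsubfieldD[OF assms(1)]
 have M: "M h a b:K" "M h a b ~= 0 ==> a < lk al (head Q h)" for h a b
 using assms(3) by (auto simp: mat_fams_def)
 have "rep_act Q al M (Arr h) v:vspace K al" if "v:vspace K al" for h v
 unfolding rep_act_simps vspace_def
 proof (intro CollectI allI conjI impI)
 fix i a
 show "(if i = head Q h then SUM b<lk al (tail Q h). M h a b * v (tail Q h) b else 0):K"
 using that M K by (auto simp: vspace_def intro!: fsubfield_sum[OF assms(1)])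
 assume "lk al i <= a"
 hence "M h a b = 0" if "i = head Q h" for b using M(2)[of h a b] that by fastforce
 thus "(if i = head Q h then SUM b<lk al (tail Q h). M h a b * v (tail Q h) b else 0) = 0"
 by simp
 qed
 moreover have "rep_act Q al M (Scal t) v:vspace K al" if "v:vspace K al" "t:k" for t v
 using that K assms(2) by (auto simp: rep_act_simps vspace_def)
 moreover have "rep_act Q al M (Proj t) v:vspace K al" if "v:vspace K al" for t v
 using that K assms(2) by (auto simp: rep_act_simps vspace_def)
 ultimately show ?thesis using K by (auto simp: submod_def ops_def vspace_def fun_diff_def zero_fun_def)
qed

lemma zero_reps: "fsubfield k ==> (%_ _ _. 0):mat_fams Q k al be"
 by (auto simp: mat_fams_def fsubfieldD)

lemma reps_mono: "k <= K ==> M:reps Q k al ==> M:reps Q K al"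
 by (auto simp: mat_fams_def)

lemma vspace_lsubmod:
 assumes "fsubfield K" "k <= K"
 shows "submod (lops k) (lact Q) (vspace K al)"
 by (rule submod_lops[THEN iffD1, OF submod_mono_ops[OF vspace_submod[OF assms zero_reps[OF assms(1), of Q al al]] lops_subset_ops]])

lemma vspace_zero: "vspace k 0 = {0}" if "0:k"
 using that by (auto simp: vspace_def fun_eq_iff)

abbreviation unit_dim::"'i => 'i dimvec" where
 "unit_dim i \<equiv> Poly_Mapping.single i (Suc 0)"

lemma dimvec_induct [case_names zero add]:
 fixes be::"'i dimvec"
 assumes "P 0" "!!be i. P be ==> P (be + Poly_Mapping.single i (Suc 0))"
 shows "P be"
proof (induction "SUM i:Poly_Mapping.keys be. lk be i" arbitrary: be rule: less_induct)
 case less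
 show ?case
 proof (cases "be = 0")
 case False
 then obtain i where i: "i:Poly_Mapping.keys be" by fastforce
 define be' where "be' = be - Poly_Mapping.single i (Suc 0)"
 have l: "lk be' j = lk be j - (if i = j then 1 else 0)" for j
 by (simp add: be'_def lookup_minus lookup_single when_def)
 have eq: "be = be' + Poly_Mapping.single i (Suc 0)"
 by (rule poly_mapping_eqI) (use i in "auto simp: l lookup_add lookup_single when_def in_keys_iff")
 have "(SUM j:Poly_Mapping.keys be'. lk be' j) = (SUM j:Poly_Mapping.keys be. lk be' j)"
 by (rule sum.mono_neutral_left) (auto simp: l in_keys_iff)
 also have "... < (SUM j:Poly_Mapping.keys be. lk be j)"
 by (rule sum_strict_mono_ex1) (use i in "auto simp: l in_keys_iff")
 finally show ?thesis using less assms(2) eq by metis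
 qed (use assms in auto)
qed

subsection \<open>Block sums\<close>

definition shift_emb::"'i dimvec => 'f::zero set => 'i dimvec => ('i, 'f) gvec => ('i, 'f) gvec" where
 "shift_emb be k si v = (if v:vspace k si then
 (%i a. if lk be i <= a then v i (a - lk be i) else 0) else (%_ _. 0))"

definition block_sum::"('i, 'h) pre_digraph => 'i dimvec => ('h, 'f::zero) mats_fam => ('h, 'f) mats_fam => ('h, 'f) mats_fam" where
 "block_sum Q be N S h a b = (if b < lk be (tail Q h) then N h a b
 else if lk be (head Q h) <= a
 then S h (a - lk be (head Q h)) (b - lk be (tail Q h)) else 0)"

lemma sum_lessThan_add_split: "(SUM b<m + n. f b) = (SUM b<m. f b) + (SUM b<n. f (m + b))" for f::"nat => 'a::comm_monoid_add"
 by (induction n) (auto simp: add_ac)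

lemma block_sum_reps:
 assumes "fsubfield k" "N:reps Q k be" "S:reps Q k si"
 shows "block_sum Q be N S:reps Q k (be + si)"
proof -
 have *: "N h a b:k" "S h a b:k" for h a b using assms(2,3) by (auto simp: mat_fams_def)
 have **: "N h a b ~= 0 ==> h:arcs Q & a < lk be (head Q h) & b < lk be (tail Q h)"
 "S h a b ~= 0 ==> h:arcs Q & a < lk si (head Q h) & b < lk si (tail Q h)" for h a b
 using assms(2,3) by (auto simp: mat_fams_def)
 show ?thesis
 unfolding mat_fams_def block_sum_def lookup_add using * fsubfieldD(2)[OF assms(1)]
 by (auto dest!: ** split: if_splits)
qed

lemma shift_emb_ophom:
 fixes Q::"('i, 'h) pre_digraph" and k::"'f::field set"
 assumes "fsubfield k" "N:reps Q k be" "S:reps Q k si"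
 shows "shift_emb be k si:ophom (ops k) (rep_act Q si S) (vspace k si)
 (rep_act Q (be + si) (block_sum Q be N S)) (vspace k (be + si))"
proof -
 note k = fsubfieldD[OF assms(1)]
 have sm: "submod (ops k) (rep_act Q si S) (vspace k si)" by (rule vspace_submod[OF assms(1) order_refl assms(3)])
 have S: "S h a b ~= 0 ==> a < lk si (head Q h) & b < lk si (tail Q h)" for h a b
 using assms(3) by (auto simp: mat_fams_def)
 have N: "N h a b ~= 0 ==> a < lk be (head Q h)" for h a b
 using assms(2) by (auto simp: mat_fams_def)
 show ?thesis
 proof (rule ophomI)
 fix v assume v: "v:vspace k si"
 thus "shift_emb be k si v:vspace k (be + si)"
 using k by (auto simp: shift_emb_def vspace_def lookup_add)
 fix w assume w: "w:vspace k si"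
 from v w submodD(3)[OF sm v w] show "shift_emb be k si (v + w) = shift_emb be k si v + shift_emb be k si w"
 by (auto simp: shift_emb_def fun_eq_iff)
 next
 fix c::"('i, 'h, 'f) rep_op" and v assume c: "c:ops k" and v: "v:vspace k si"
 note cv = submodD(5)[OF sm c v]
 show "shift_emb be k si (rep_act Q si S c v) = rep_act Q (be + si) (block_sum Q be N S) c (shift_emb be k si v)"
 proof (cases c)
 case (Arr h)
 have "rep_act Q (be + si) (block_sum Q be N S) (Arr h) (shift_emb be k si v) i a
 = shift_emb be k si (rep_act Q si S (Arr h) v) i a" for i a
 using v cv unfolding Arr
 by (auto simp: shift_emb_def rep_act_simps lookup_add sum_lessThan_add_split block_sum_def)
 thus ?thesis unfolding Arr by (simp add: fun_eq_iff)
 qed (use v cv in "auto simp: shift_emb_def rep_act_simps fun_eq_iff")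
 qed (simp add: shift_emb_def zero_fun_def)
qed

lemma vspace_add:
 assumes "fsubfield k"
 shows "adjoin (vspace k be) (shift_emb be k si) (vspace k si) = vspace k (be + si)"
proof (intro equalityI subsetI)
 note k = fsubfieldD[OF assms]
 fix x assume "x:adjoin (vspace k be) (shift_emb be k si) (vspace k si)"
 thus "x:vspace k (be + si)"
 using k by (auto simp: adjoin_def vspace_def shift_emb_def lookup_add)
next
 note k = fsubfieldD[OF assms]
 fix x assume x: "x:vspace k (be + si)"
 define u where "u = (%i a. if a < lk be i then x i a else 0)"
 define s where "s = (%i a. x i (a + lk be i))"
 have "u:vspace k be" "s:vspace k si" using x k by (auto simp: u_def s_def vspace_def lookup_add)
 moreover from this have "x = u + shift_emb be k si s"
 by (auto simp: shift_emb_def u_def s_def fun_eq_iff)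
 ultimately show "x:adjoin (vspace k be) (shift_emb be k si) (vspace k si)" by (auto simp: adjoin_def)
qed

lemma shift_emb_indep:
 "indep_of (vspace k be) (shift_emb be k si) (vspace k si)"
 unfolding indep_of_def
proof (intro ballI impI)
 fix s assume s: "s:vspace k si" "shift_emb be k si s:vspace k be"
 have "s i a = 0" for i a
 proof -
 have "shift_emb be k si s i (a + lk be i) = 0" using s(2) by (auto simp: vspace_def)
 thus ?thesis using s(1) by (simp add: shift_emb_def)
 qed
 thus "s = 0" by (simp add: fun_eq_iff)
qed

lemma rep_act_block_sum:
 assumes "N:reps Q k be" "S:reps Q k si" "v:vspace k be"
 shows "rep_act Q (be + si) (block_sum Q be N S) c v = rep_act Q be N c v"
 using assms(3)
 by (cases c) (auto simp: rep_act_simps fun_eq_iff lookup_add sum_lessThan_add_split block_sum_def vspace_def)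

lemma block_sum_facts:
 assumes k: "fsubfield k" and N: "N:reps Q k be" and S: "S:reps Q k si"
 defines "B \<equiv> rep_act Q (be + si) (block_sum Q be N S)"
 shows "submod (ops k) B (vspace k be)"
 and "card (ophom (ops k) A R B (vspace k (be + si))) =
 card (ophom (ops k) A R (rep_act Q be N) (vspace k be)) * card (ophom (ops k) A R (rep_act Q si S) (vspace k si))"
 and "simple_mod (ops k) (rep_act Q si S) (vspace k si) ==> additive_action C ==> submod (ops k) C W ==> finite W ==>
 card (injhom (ops k) B (vspace k (be + si)) C W) = card (injhom (ops k) (rep_act Q be N) (vspace k be) C W) *
 (card (ophom (ops k) (rep_act Q si S) (vspace k si) C W)
 - card (ophom (ops k) (rep_act Q si S) (vspace k si) (rep_act Q be N) (vspace k be)))"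
proof -
 have B: "B c v = rep_act Q be N c v" if "v:vspace k be" for c v
 unfolding B_def by (rule rep_act_block_sum[OF N S that])
 have add: "additive_action B" by (simp add: B_def)
 show sub: "submod (ops k) B (vspace k be)"
 using vspace_submod[OF k order_refl N] submod_cong[of "ops k" "vspace k be" B "rep_act Q be N"] B by blast
 have h: "shift_emb be k si:ophom (ops k) (rep_act Q si S) (vspace k si) B (vspace k (be + si))"
 unfolding B_def by (rule shift_emb_ophom[OF k N S])
 have c1: "ophom (ops k) A R B (vspace k be) = ophom (ops k) A R (rep_act Q be N) (vspace k be)"
 "ophom (ops k) (rep_act Q si S) R' B (vspace k be) = ophom (ops k) (rep_act Q si S) R' (rep_act Q be N) (vspace k be)" for R'
 by (rule ophom_cong; use B in auto)+
 have c2: "injhom (ops k) B (vspace k be) C W = injhom (ops k) (rep_act Q be N) (vspace k be) C W"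
 unfolding injhom_def using ophom_cong[of "ops k" "vspace k be" B "rep_act Q be N" W C C] B by auto
 show "card (ophom (ops k) A R B (vspace k (be + si))) =
 card (ophom (ops k) A R (rep_act Q be N) (vspace k be)) * card (ophom (ops k) A R (rep_act Q si S) (vspace k si))"
 using card_ophom_adjoin[OF sub vspace_submod[OF k order_refl S] h add shift_emb_indep add_rep, of A R]
 by (simp add: vspace_add[OF k] c1)
 show "card (injhom (ops k) B (vspace k (be + si)) C W) = card (injhom (ops k) (rep_act Q be N) (vspace k be) C W) *
 (card (ophom (ops k) (rep_act Q si S) (vspace k si) C W)
 - card (ophom (ops k) (rep_act Q si S) (vspace k si) (rep_act Q be N) (vspace k be)))"
 if "simple_mod (ops k) (rep_act Q si S) (vspace k si)" "additive_action C" "submod (ops k) C W" "finite W"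
 using card_injhom_adjoin[OF sub that(1) h add shift_emb_indep that(2-4)] fsubfieldD(1)[OF k]
 by (simp add: vspace_add[OF k] c1 c2)
qed

lemma vspaceD:
 assumes "v:vspace k al"
 shows "v i a:k" "v i a ~= 0 ==> a < lk al i" "~  a < lk al i ==> v i a = 0"
 using assms by (auto simp: vspace_def) (metis not_less)

lemma mat_famsD:
 assumes "M:mat_fams Q k al be"
 shows "M h a b:k" "M h a b ~= 0 ==> h:arcs Q & a < lk be (head Q h) & b < lk al (tail Q h)"
 "h ~: arcs Q ==> M h a b = 0" "~  b < lk al (tail Q h) ==> M h a b = 0"
 using assms by (auto simp: mat_fams_def)

lemma vspace_finite_support: "w:vspace k ga ==> finite {i. w i ~= 0}"
 by (rule finite_subset[of _ "Poly_Mapping.keys ga"])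
 (auto simp: fun_eq_iff in_keys_iff dest: vspaceD(2))

subsection \<open>Graded linear maps\<close>

definition basis_vec::"'i => nat => ('i, 'f::{zero,one}) gvec" where
 "basis_vec i b = (%j a. if j = i & a = b then 1 else 0)"

lemma basis_vec_in: "fsubfield k ==> b < lk al i ==> basis_vec i b:vspace k al"
 by (auto simp: basis_vec_def vspace_def fsubfieldD)

lemma ophom_sum:
 assumes "f:ophom P A V B W" "submod P A V" "!!x. x:I ==> g x:V"
 shows "f (SUM x:I. g x) = (SUM x:I. f (g x)) & (SUM x:I. g x):V"
 using assms(3)
 by (induction I rule: infinite_finite_induct)
 (auto simp: ophom_zero_at[OF assms(1)] submodD(1)[OF assms(2)] ophomD(3)[OF assms(1)] submodD(3)[OF assms(2)])

lemma sum_gvec_apply: "(SUM x:I. g x) i a = (SUM x:I. g x i a)" for g::"_ => ('i, 'f::comm_monoid_add) gvec"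
 by (induction I rule: infinite_finite_induct) auto

lemma proj_expand:
 assumes "v:vspace k al"
 shows "rep_act Q al M (Proj i) v = (SUM b<lk al i. rep_act Q al M (Scal (v i b)) (basis_vec i b))"
proof -
 have "(SUM b<lk al i. v i b * (if j = i & a = b then 1 else 0)) = (if j = i then v i a else 0)" for j a
 proof (cases "a < lk al i & j = i")
 case True
 thus ?thesis by (simp add: sum.delta' mult_delta_right if_distrib cong: if_cong)
 next
 case False
 have "v i a = 0" if "~  a < lk al i" using that assms by (auto simp: vspace_def not_less)
 with False show ?thesis by (auto intro!: sum.neutral)
 qed
 thus ?thesis by (simp add: fun_eq_iff sum_gvec_apply rep_act_simps basis_vec_def)
qed

lemma lhom_apply:
 fixes f::"('i, 'f::field) gvec => ('i, 'f) gvec" and Q::"('i, 'h) pre_digraph"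
 assumes k: "fsubfield k" and f: "f:ophom (lops k) (lact Q) (vspace k be) (lact Q) W" and v: "v:vspace k be"
 shows "f v i a = (SUM b<lk be i. v i b * f (basis_vec i b) i a)"
 and "j ~= i ==> b < lk be i ==> f (basis_vec i b) j a = 0"
proof -
 let ?A = "lact Q::('i, 'h, 'f) rep_op => _"
 have sm: "submod (lops k) ?A (vspace k be)" by (rule vspace_lsubmod[OF k order_refl])
 have P: "Proj j:lops k" for j by (simp add: lops_def)
 have in_k: "v i b:k" for b using v by (auto simp: vspace_def)
 have "f v i a = ?A (Proj i) (f v) i a" by (simp add: rep_act_simps)
 also have "... = f (?A (Proj i) v) i a" by (simp add: ophomD(4)[OF f P v])
 also have "?A (Proj i) v = (SUM b<lk be i. ?A (Scal (v i b)) (basis_vec i b))"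
 using proj_expand[OF v, of Q "%_ _ _. 0" i] by (simp add: rep_act_simps)
 also have "f ... = (SUM b<lk be i. f (?A (Scal (v i b)) (basis_vec i b)))"
 by (rule conjunct1[OF ophom_sum[OF f sm]], rule submodD(5)[OF sm])
 (use basis_vec_in[OF k] in_k in "auto simp: lops_def")
 also have "... i a = (SUM b<lk be i. v i b * f (basis_vec i b) i a)"
 unfolding sum_gvec_apply
 by (rule sum.cong[OF refl], subst ophomD(4)[OF f])
 (use basis_vec_in[OF k] in_k in "auto simp: lops_def rep_act_simps")
 finally show "f v i a = (SUM b<lk be i. v i b * f (basis_vec i b) i a)" .
 assume ji: "j ~= i" and b: "b < lk be i"
 have "?A (Proj i) (basis_vec i b) = basis_vec i b" by (auto simp: rep_act_simps basis_vec_def fun_eq_iff)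
 hence "f (basis_vec i b) j a = ?A (Proj i) (f (basis_vec i b)) j a"
 using ophomD(4)[OF f P basis_vec_in[OF k b]] by metis
 thus "f (basis_vec i b) j a = 0" using ji by (simp add: rep_act_simps)
qed

definition mat_map::"'f::field set => 'i dimvec => ('i => nat => nat => 'f) => ('i, 'f) gvec => ('i, 'f) gvec" where
 "mat_map k be F v = (if v:vspace k be then %i a. SUM b<lk be i. v i b * F i a b else 0)"

lemma mat_map_lhom:
 fixes Q::"('i, 'h) pre_digraph"
 assumes k: "fsubfield k" and F: "!!i a b. F i a b:k" "!!i a b. lk ga i <= a ==> F i a b = 0"
 shows "mat_map k be F:ophom (lops k) (lact Q) (vspace k be) (lact Q) (vspace k ga)"
proof (rule ophomI)
 have sm: "submod (lops k) (lact Q) (vspace k be)" by (rule vspace_lsubmod[OF k order_refl])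
 fix v assume v: "v:vspace k be"
 thus "mat_map k be F v:vspace k ga"
 using F fsubfieldD[OF k] by (auto simp: mat_map_def vspace_def intro!: fsubfield_sum[OF k])
 fix w assume w: "w:vspace k be"
 from submodD(3)[OF sm v w] v w show "mat_map k be F (v + w) = mat_map k be F v + mat_map k be F w"
 by (simp add: mat_map_def fun_eq_iff sum.distrib algebra_simps)
next
 have sm: "submod (lops k) (lact Q) (vspace k be)" by (rule vspace_lsubmod[OF k order_refl])
 fix c::"('i, 'h, 'a) rep_op" and v assume c: "c:lops k" and v: "v:vspace k be"
 from submodD(5)[OF sm c v] c v show "mat_map k be F (lact Q c v) = lact Q c (mat_map k be F v)"
 by (auto simp: lops_def mat_map_def rep_act_simps fun_eq_iff sum_distrib_left mult.assoc)
qed (simp add: mat_map_def)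

text \<open>The one-dimensional space at the vertex \<open>i\<close> is \<^term>\<open>vspace k (unit_dim i)\<close>.\<close>

lemma card_coords:
 assumes "finite k" "(0::'f::field):k"
 shows "card {w. ALL a. w a:k & (n <= a --> w a = 0)} = card k ^ n"
proof -
 have "bij_betw (%w. restrict w {..<n}) {w. ALL a. w a:k & (n <= a --> w a = 0)} ({..<n} \<rightarrow>\<^sub>E k)"
 by (rule bij_betwI[where g = "%w a. if a < n then w a else 0"])
 (use assms in "auto simp: fun_eq_iff PiE_iff extensional_def restrict_def")
 thus ?thesis by (simp add: bij_betw_same_card card_PiE)
qed

definition line_map::"'f::field set => 'i => ('i, 'f) gvec => ('i, 'f) gvec => ('i, 'f) gvec" where
 "line_map k i w s = (if s:vspace k (unit_dim i) then %j a. s i 0 * w j a else 0)"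

lemma line_vec:
 fixes s::"('i, 'f::field) gvec"
 assumes "s:vspace k (unit_dim i)" 
 shows "s = (%j a. s i 0 * basis_vec i 0 j a)"
 using assms by (auto simp: vspace_def basis_vec_def fun_eq_iff lookup_single when_def not_less Suc_le_eq)

lemma line_map_hom:
 fixes Q::"('i, 'h) pre_digraph"
 assumes k: "fsubfield k" and W: "submod (lops k) (lact Q) W" and w: "w:W" "lact Q (Proj i::('i,'h,'f) rep_op) w = (w::('i, 'f::field) gvec)"
 shows "line_map k i w:ophom (lops k) (lact Q) (vspace k (unit_dim i)) (lact Q) W"
 "line_map k i w (basis_vec i 0) = w"
proof -
 let ?V = "vspace k (unit_dim i)"
 have sm: "submod (lops k) (lact Q) ?V" by (rule vspace_lsubmod[OF k order_refl])
 have w0: "w j a = 0" if "j ~= i" for j a using w(2) that by (metis rep_act_simps(2))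
 show "line_map k i w:ophom (lops k) (lact Q) ?V (lact Q) W"
 proof (rule ophomI)
 fix s assume s: "s:?V"
 hence "s i 0:k" by (auto simp: vspace_def)
 hence "lact Q (Scal (s i 0)) w:W" using submodD(5)[OF W _ w(1)] by (simp add: lops_def)
 thus "line_map k i w s:W" using s by (simp add: line_map_def rep_act_simps)
 fix t assume t: "t:?V"
 from submodD(3)[OF sm s t] s t show "line_map k i w (s + t) = line_map k i w s + line_map k i w t"
 by (simp add: line_map_def fun_eq_iff algebra_simps)
 next
 fix c::"('i, 'h, 'f) rep_op" and s assume c: "c:lops k" and s: "s:?V"
 from submodD(5)[OF sm c s] c s w0 show "line_map k i w (lact Q c s) = lact Q c (line_map k i w s)"
 by (auto simp: lops_def line_map_def rep_act_simps fun_eq_iff)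
 qed (simp add: line_map_def)
 show "line_map k i w (basis_vec i 0) = w"
 using basis_vec_in[OF k, of 0 "unit_dim i" i] by (simp add: line_map_def) (simp add: basis_vec_def)
qed

lemma lhom_line_eqI:
 fixes Q::"('i, 'h) pre_digraph"
 assumes k: "fsubfield k" and f: "f:ophom (lops k) (lact Q) (vspace k (unit_dim i)) (lact Q) W"
 and g: "g:ophom (lops k) (lact Q) (vspace k (unit_dim i)) (lact Q) W'"
 and e: "f (basis_vec i 0) = g (basis_vec i 0)"
 shows "f = (g::('i, 'f::field) gvec => ('i, 'f) gvec)"
proof (rule ophom_eqI[OF f g])
 fix s::"('i, 'f) gvec" assume s: "s:vspace k (unit_dim i)"
 hence c: "(Scal (s i 0)::('i, 'h, 'f) rep_op):lops k" by (auto simp: vspace_def lops_def)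
 have u: "basis_vec i 0:vspace k (unit_dim i)" by (rule basis_vec_in[OF k]) simp
 have "s = lact Q (Scal (s i 0)::('i, 'h, 'f) rep_op) (basis_vec i 0)" 
 using line_vec[OF s] by (simp add: rep_act_simps)
 thus "f s = g s" using ophomD(4)[OF f c u] ophomD(4)[OF g c u] e by metis
qed

lemma card_lhom_line:
 fixes Q::"('i, 'h) pre_digraph" and K::"'f::field set"
 assumes k: "fsubfield k" and K: "fsubfield K" "k <= K"
 shows "card (ophom (lops k) (lact Q) (vspace k (unit_dim i)) (lact Q) (vspace K ga)) =
 card K ^ lk ga i"
proof -
 let ?n = "lk ga i"
 let ?C = "{w. ALL a. w a:K & (?n <= a --> w a = 0)}"
 let ?H = "ophom (lops k) (lact Q) (vspace k (unit_dim i)) (lact Q) (vspace K ga)"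
 let ?inc = "%w j a. if j = i then w a else (0::'f)"
 have W: "submod (lops k) (lact Q) (vspace K ga)" by (rule vspace_lsubmod[OF K])
 have u: "basis_vec i 0:vspace k (unit_dim i)" by (rule basis_vec_in[OF k]) simp
 have inc: "?inc w:vspace K ga" "lact Q (Proj i::('i,'h,'f) rep_op) (?inc w) = ?inc w" if "w:?C" for w
 using that fsubfieldD(2)[OF K(1)] by (auto simp: vspace_def rep_act_simps fun_eq_iff)
 have "bij_betw (%f. f (basis_vec i 0) i) ?H ?C"
 proof (rule bij_betwI[where g = "%w. line_map k i (?inc w)"])
 show "(%f. f (basis_vec i 0) i):?H \<rightarrow> ?C"
 proof
 fix f assume "f:?H"
 from ophomD(2)[OF this u] show "f (basis_vec i 0) i:?C" by (auto simp: vspace_def)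
 qed
 show "(%w. line_map k i (?inc w)):?C \<rightarrow> ?H"
 using line_map_hom(1)[OF k W inc] by auto
 show "line_map k i (?inc (f (basis_vec i 0) i)) = f" if f: "f:?H" for f
 proof -
 have C: "f (basis_vec i 0) i:?C" using ophomD(2)[OF f u] by (auto simp: vspace_def)
 have "?inc (f (basis_vec i 0) i) = f (basis_vec i 0)"
 using lhom_apply(2)[OF k f u, of _ i 0] by (auto simp: fun_eq_iff)
 hence "line_map k i (?inc (f (basis_vec i 0) i)) (basis_vec i 0) = f (basis_vec i 0)"
 using line_map_hom(2)[OF k W inc[OF C]] by simp
 thus ?thesis by (rule lhom_line_eqI[OF k line_map_hom(1)[OF k W inc[OF C]] f])
 qed
 show "line_map k i (?inc w) (basis_vec i 0) i = w" if "w:?C" for w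
 using line_map_hom(2)[OF k W inc[OF that]] by (simp add: fun_eq_iff)
 qed
 hence "card ?H = card ?C" by (rule bij_betw_same_card)
 also have "... = card K ^ ?n" by (rule card_coords) (use fsubfieldD[OF K(1)] in auto)
 finally show ?thesis .
qed

lemma simple_line:
 fixes Q::"('i, 'h) pre_digraph"
 assumes k: "fsubfield k"
 shows "simple_mod (lops k) (lact Q) (vspace k (unit_dim i)::('i, 'f::field) gvec set)"
proof -
 let ?V = "vspace k (unit_dim i)::('i, 'f) gvec set"
 have u: "basis_vec i 0:?V" by (rule basis_vec_in[OF k]) simp
 moreover have "basis_vec i 0 ~= (0::('i, 'f) gvec)" by (auto simp: basis_vec_def fun_eq_iff)
 moreover have "U = {0} | U = ?V" if U: "submod (lops k) (lact Q) U" "U <= ?V" for U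
 proof (cases "U = {0}")
 case False
 then obtain s where s: "s:U" "s ~= 0" using submodD(1)[OF U(1)] by auto
 hence sV: "s:?V" using U(2) by auto
 have nz: "s i 0 ~= 0"
 proof
 assume "s i 0 = 0"
 with line_vec[OF sV] have "s = (%_ _. 0)" by (simp only: mult_zero_left)
 with s(2) show False by (simp add: zero_fun_def)
 qed
 have "t:U" if t: "t:?V" for t
 proof -
 have "t i 0 * inverse (s i 0):k" using sV t fsubfieldD[OF k] by (auto simp: vspace_def)
 hence "lact Q (Scal (t i 0 * inverse (s i 0))) s:U" using submodD(5)[OF U(1) _ s(1)] by (simp add: lops_def)
 moreover have "lact Q (Scal (t i 0 * inverse (s i 0))::('i, 'h, 'f) rep_op) s = t"
 
 proof -
 have "s j a = s i 0 * basis_vec i 0 j a" "t j a = t i 0 * basis_vec i 0 j a" for j a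
 by (rule fun_cong[OF fun_cong[OF line_vec[OF sV]]], rule fun_cong[OF fun_cong[OF line_vec[OF t]]])
 thus ?thesis using nz unfolding rep_act_simps by (metis (no_types, lifting) ext field_class.field_inverse mult.assoc mult.left_neutral)
 qed
 ultimately show ?thesis by simp
 qed
 thus ?thesis using U(2) by auto
 qed auto
 ultimately show ?thesis using vspace_lsubmod[OF k order_refl] by (auto simp: simple_mod_def)
qed

lemma lops_block:
 assumes k: "fsubfield k"
 shows "shift_emb be k si:ophom (lops k) (lact Q) (vspace k si) (lact Q) (vspace k (be + si))"
 by (rule ophom_lops[THEN equalityD1, THEN subsetD,
 OF ophom_mono_ops[OF shift_emb_ophom[OF k zero_reps[OF k] zero_reps[OF k]] lops_subset_ops]])

text \<open>Adjoin the lines of the source one by one: a new basis vector may go anywhere outside the image of the previous ones.\<close>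

lemma card_injlhom:
 fixes Q::"('i, 'h) pre_digraph" and k::"'f::field set"
 assumes k: "fsubfield k" and "finite I"
 shows "Poly_Mapping.keys be <= I ==> int (card (injhom (lops k) (lact Q) (vspace k be) (lact Q) (vspace k ga))) =
 (PROD i:I. PROD l<lk be i. int (card k) ^ lk ga i - int (card k) ^ l)"
proof (induction be rule: dimvec_induct)
 case zero
 have "f = 0" if "f:ophom (lops k) (lact Q) {0} (lact Q) (vspace k ga)" for f::"('i,'f) gvec => ('i,'f) gvec"
 using ophomD(1)[OF that] ophom_zero_at[OF that] by (intro ext) (metis singletonD zero_fun_def)
 moreover have "0:ophom (lops k) (lact Q) {0} (lact Q) (vspace k ga)"
 by (rule ophom_zero[OF vspace_lsubmod[OF k order_refl]]) simp
 ultimately have "injhom (lops k) (lact Q) (vspace k 0) (lact Q) (vspace k ga) = {0}"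
 by (auto simp: injhom_def vspace_zero fsubfieldD[OF k])
 thus ?case by simp
next
 case (add be i)
 let ?q = "int (card k)" and ?g = "lk ga"
 let ?E = "unit_dim i"
 have lk: "lk (be + ?E) j = lk be j + (if i = j then 1 else 0)" for j
 by (simp add: lookup_add lookup_single when_def)
 have i: "i:I" and keys: "Poly_Mapping.keys be <= I"
 using add.prems by (auto simp: in_keys_iff lk subset_iff)
 have "int (card (injhom (lops k) (lact Q) (vspace k (be + ?E)) (lact Q) (vspace k ga))) =
 int (card (injhom (lops k) (lact Q) (vspace k be) (lact Q) (vspace k ga))) *
 int (card k ^ ?g i - card k ^ lk be i)"
 using card_injhom_adjoin[OF vspace_lsubmod[OF k order_refl] simple_line[OF k, of Q]
 lops_block[OF k, where be = be and si = "unit_dim i"] add_rep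
 shift_emb_indep add_rep vspace_lsubmod[OF k order_refl, where al = ga]] fsubfieldD(1)[OF k]
 by (simp add: vspace_add[OF k] card_lhom_line[OF k k order_refl])
 also have "... = (PROD j:I. PROD l<lk be j. ?q ^ ?g j - ?q ^ l) * int (card k ^ ?g i - card k ^ lk be i)"
 using add.IH[OF keys] by simp
 also have "... = (PROD j:I. PROD l<lk be j. ?q ^ ?g j - ?q ^ l) * (?q ^ ?g i - ?q ^ lk be i)"
 proof (cases "lk be i <= ?g i")
 case True
 hence "card k ^ lk be i <= card k ^ ?g i"
 using fsubfield_card_gt_1[OF k] by (intro power_increasing) auto
 thus ?thesis by (simp add: of_nat_diff)
 next
 case False
 hence "(PROD l<lk be i. ?q ^ ?g i - ?q ^ l) = 0" by (intro prod_zero) auto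
 hence "(PROD j:I. PROD l<lk be j. ?q ^ ?g j - ?q ^ l) = 0"
 using i \<open>finite I\<close> by (intro prod_zero) auto
 thus ?thesis by simp
 qed
 also have "... = (PROD j:I. PROD l<lk (be + ?E) j. ?q ^ ?g j - ?q ^ l)"
 proof -
 have "(PROD j:I. PROD l<lk (be + ?E) j. ?q ^ ?g j - ?q ^ l) =
 (PROD j:I. (PROD l<lk be j. ?q ^ ?g j - ?q ^ l) * (if j = i then ?q ^ ?g i - ?q ^ lk be i else 1))"
 by (rule prod.cong[OF refl]) (auto simp: lk)
 thus ?thesis using i \<open>finite I\<close> by (simp add: prod.distrib)
 qed
 finally show ?case .
qed

subsection \<open>Coordinates on stable subspaces\<close>

text \<open>Basis extension, in coordinates: as every space is some \<open>vspace k al\<close>, the source of f is enlarged until f is onto.\<close>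

lemma extend_to_coordinates:
 fixes Q::"('i, 'h) pre_digraph" and k::"'f::field set"
 assumes k: "fsubfield k" and W: "submod (lops k) (lact Q) W" "finite W"
 and supp: "!!w. w:W ==> finite {i. w i ~= 0}"
 and f: "f:injhom (lops k) (lact Q) (vspace k be) (lact Q) W"
 shows "EX al g. g:ophom (lops k) (lact Q) (vspace k al) (lact Q) W & bij_betw g (vspace k al) W &
 vspace k be <= vspace k al & (ALL v:vspace k be. g v = f v)"
 using f
proof (induction "card W - card (f ` vspace k be)" arbitrary: f be rule: less_induct)
 case less
 let ?V = "vspace k be"
 have f: "f:ophom (lops k) (lact Q) ?V (lact Q) W" "inj_on f ?V" using less.prems by (auto simp: injhom_def)
 have sub: "f ` ?V <= W" using ophomD(2)[OF f(1)] by auto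
 show ?case
 proof (cases "f ` ?V = W")
 case True
 thus ?thesis using f by (intro exI[of _ be] exI[of _ f]) (auto simp: bij_betw_def)
 next
 case False
 have sm: "submod (lops k) (lact Q) (f ` ?V)"
 by (rule ophom_image[OF f(1) vspace_lsubmod[OF k order_refl]])
 have P: "(Proj i::('i,'h,'f) rep_op):lops k" for i by (simp add: lops_def)
 obtain w where w: "w:W" "w ~: f ` ?V" using False sub by auto
 have "EX i. lact Q (Proj i::('i,'h,'f) rep_op) w ~: f ` ?V"
 proof (rule ccontr)
 assume "~  ?thesis"
 hence "(SUM i:{i. w i ~= 0}. lact Q (Proj i::('i,'h,'f) rep_op) w):f ` ?V"
 using conjunct2[OF ophom_sum[OF idon_ophom[OF sm order_refl] sm, of _ "%i. lact Q (Proj i) w"]] by simp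
 moreover have "(SUM i:{i. w i ~= 0}. lact Q (Proj i::('i,'h,'f) rep_op) w) = w"
 proof -
 have "(SUM i:{i. w i ~= 0}. if j = i then w j a else 0) = w j a" for j a
 using supp[OF w(1)] by (cases "w j = 0") (simp_all add: sum.delta')
 thus ?thesis by (simp add: fun_eq_iff sum_gvec_apply rep_act_simps)
 qed
 ultimately show False using w(2) by simp
 qed
 then obtain i where i: "lact Q (Proj i::('i,'h,'f) rep_op) w ~: f ` ?V" by auto
 define x where "x = lact Q (Proj i::('i,'h,'f) rep_op) w"
 let ?E = "unit_dim i" and ?g = "line_map k i x"
 have x: "x:W" "lact Q (Proj i::('i,'h,'f) rep_op) x = x" "x ~: f ` ?V"
 using submodD(5)[OF W(1) P w(1)] i by (auto simp: x_def rep_act_simps fun_eq_iff)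
 note g = line_map_hom[OF k W(1) x(1,2)]
 have u: "basis_vec i 0:vspace k ?E" by (rule basis_vec_in[OF k]) simp
 have gn: "indep_of (f ` ?V) ?g (vspace k ?E)"
 proof -
 have "?g ~: ophom (lops k) (lact Q) (vspace k ?E) (lact Q) (f ` ?V)"
 using ophomD(2)[OF _ u, of ?g "lops k" "lact Q" "lact Q" "f ` ?V"] g(2) x(3) by auto
 thus ?thesis using simple_indep_iff[OF simple_line[OF k] sm g(1) add_rep] by simp
 qed
 obtain ph where ph: "ph:ophom (lops k) (lact Q) (vspace k (be + ?E)) (lact Q) W"
 "!!v. v:?V ==> ph v = f v" "!!s. s:vspace k ?E ==> ph (shift_emb be k ?E s) = ?g s"
 using ophom_from_adjoin[OF vspace_lsubmod[OF k order_refl] vspace_lsubmod[OF k order_refl] lops_block[OF k]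
 add_rep shift_emb_indep add_rep W(1) f(1) g(1)] unfolding vspace_add[OF k] by metis
 have inj: "inj_on ph (vspace k (be + ?E))"
 using inj_on_adjoin_iff[OF vspace_lsubmod[OF k order_refl] vspace_lsubmod[OF k order_refl] lops_block[OF k]
 add_rep shift_emb_indep, unfolded vspace_add[OF k], OF ph(1) f(1) g(1) ph(2,3)] f(2) gn by blast
 have sub': "?V <= vspace k (be + ?E)" by (auto simp: vspace_def lookup_add)
 have "f ` ?V \<subset> ph ` vspace k (be + ?E)"
 proof
 show "f ` ?V <= ph ` vspace k (be + ?E)" using ph(2) sub' by force
 have "x:ph ` vspace k (be + ?E)"
 using ph(3)[OF u] g(2) imageI[OF ophomD(2)[OF lops_block[OF k] u], of ph be] by simp
 thus "f ` ?V ~= ph ` vspace k (be + ?E)" using x(3) by auto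
 qed
 moreover have "ph ` vspace k (be + ?E) <= W" using ophomD(2)[OF ph(1)] by auto
 ultimately have "card W - card (ph ` vspace k (be + ?E)) < card W - card (f ` ?V)"
 using W(2) by (meson card_mono diff_less_mono2 finite_subset order_less_le_trans psubset_card_mono)
 from less.hyps[OF this] ph(1) inj obtain al g' where g': "g':ophom (lops k) (lact Q) (vspace k al) (lact Q) W"
 "bij_betw g' (vspace k al) W" "vspace k (be + ?E) <= vspace k al" "ALL v:vspace k (be + ?E). g' v = ph v"
 unfolding injhom_def by blast
 thus ?thesis using sub' ph(2) by (intro exI[of _ al] exI[of _ g']) auto
 qed
qed

subsection \<open>Counting representations that contain a given one\<close>

definition mat_mult::"nat => (nat => nat => 'f::comm_semiring_1) => (nat => nat => 'f) => nat => nat => 'f" where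
 "mat_mult n A B a b = (SUM c<n. A a c * B c b)"

lemma mat_mult_assoc: "mat_mult m (mat_mult n A B) C = mat_mult n A (mat_mult m B C)"
proof (intro ext)
 fix a b
 have "mat_mult m (mat_mult n A B) C a b = (SUM d<m. SUM c<n. A a c * B c d * C d b)"
 by (simp add: mat_mult_def sum_distrib_right)
 also have "... = (SUM c<n. SUM d<m. A a c * B c d * C d b)" by (rule sum.swap)
 also have "... = mat_mult n A (mat_mult m B C) a b"
 by (simp add: mat_mult_def sum_distrib_left mult.assoc)
 finally show "mat_mult m (mat_mult n A B) C a b = mat_mult n A (mat_mult m B C) a b" .
qed

lemma card_mat_fams:
 fixes k::"'f::field set"
 assumes Q: "fin_digraph Q" and k: "fsubfield k"
 shows "finite (mat_fams Q k al be)"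
 "card (mat_fams Q k al be) = card k ^ (SUM h:arcs Q. lk be (head Q h) * lk al (tail Q h))"
proof -
 interpret Q: fin_digraph Q by (rule Q)
 let ?D = "Sigma (arcs Q) (%h. {..<lk be (head Q h)} \<times> {..<lk al (tail Q h)})"
 have b: "bij_betw (%M. restrict (%(h, a, b). M h a b) ?D) (mat_fams Q k al be) (?D \<rightarrow>\<^sub>E k)"
 proof (rule bij_betwI[where g = "%f h a b. if (h, a, b):?D then f (h, a, b) else 0"])
 show "(%M. restrict (%(h, a, b). M h a b) ?D):mat_fams Q k al be \<rightarrow> (?D \<rightarrow>\<^sub>E k)"
 by (auto simp: mat_fams_def PiE_iff)
 show "(%f h a b. if (h, a, b):?D then f (h, a, b) else 0):(?D \<rightarrow>\<^sub>E k) \<rightarrow> mat_fams Q k al be"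
 using fsubfieldD(2)[OF k] by (auto simp: mat_fams_def PiE_iff split: if_splits)
 show "(%h a b. if (h, a, b):?D then restrict (%(h, a, b). M h a b) ?D (h, a, b) else 0) = M"
 if "M:mat_fams Q k al be" for M
 using that by (intro ext) (auto simp: mat_fams_def)
 show "restrict (%(h, a, b). if (h, a, b):?D then f (h, a, b) else 0) ?D = f" if "f:?D \<rightarrow>\<^sub>E k" for f
 proof
 fix x show "restrict (%(h, a, b). if (h, a, b):?D then f (h, a, b) else 0) ?D x = f x"
 using that PiE_arb[OF that, of x] by (cases "x:?D"; cases x) auto
 qed
 qed
 have fin: "finite ?D" by auto
 have "finite (?D \<rightarrow>\<^sub>E k)" using fsubfieldD(1)[OF k] fin by (intro finite_PiE) auto
 thus "finite (mat_fams Q k al be)" using bij_betw_finite[OF b] by simp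
 have "card (mat_fams Q k al be) = card k ^ card ?D"
 using bij_betw_same_card[OF b] card_PiE[OF fin, of "%_. k"] by simp
 also have "card ?D = (SUM h:arcs Q. lk be (head Q h) * lk al (tail Q h))"
 by (subst card_SigmaI) (auto simp: card_cartesian_product)
 finally show "card (mat_fams Q k al be) = card k ^ (SUM h:arcs Q. lk be (head Q h) * lk al (tail Q h))" .
qed

lemma ophom_inverse_of_inj:
 fixes Q::"('i, 'h) pre_digraph" and k::"'f::field set"
 assumes k: "fsubfield k" and f: "f:injhom (lops k) (lact Q) (vspace k be) (lact Q) (vspace k ga)"
 obtains p where "p:ophom (lops k) (lact Q) (vspace k ga) (lact Q) (vspace k be)"
 "!!v. v:vspace k be ==> p (f v) = v"
proof -
 let ?V = "vspace k ga"
 have sm: "submod (lops k) (lact Q) ?V" by (rule vspace_lsubmod[OF k order_refl])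
 obtain al g where g: "g:ophom (lops k) (lact Q) (vspace k al) (lact Q) ?V" "bij_betw g (vspace k al) ?V"
 "vspace k be <= vspace k al" "!!v. v:vspace k be ==> g v = f v"
 using extend_to_coordinates[OF k sm finite_vspace[OF fsubfieldD(1)[OF k]] vspace_finite_support f] by metis
 note h = hinv_ophom[OF g(1,2) vspace_lsubmod[OF k order_refl]]
 define trunc where "trunc v = (%i a. if a < lk be i then v i a else 0)" for v::"('i, 'f) gvec"
 define t where "t = (%v. if v:vspace k al then trunc v else 0)"
 have al: "submod (lops k) (lact Q) (vspace k al)" by (rule vspace_lsubmod[OF k order_refl])
 have "t:ophom (lops k) (lact Q) (vspace k al) (lact Q) (vspace k be)"
 proof (rule ophomI)
 fix v w assume "v:vspace k al" "w:vspace k al"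
 thus "t (v + w) = t v + t w" using submodD(3)[OF al] by (auto simp: t_def trunc_def fun_eq_iff)
 next
 fix v assume "v:vspace k al"
 thus "t v:vspace k be" using fsubfieldD(2)[OF k] by (auto simp: t_def trunc_def vspace_def)
 next
 fix c::"('i, 'h, 'f) rep_op" and v assume "c:lops k" "v:vspace k al"
 thus "t (lact Q c v) = lact Q c (t v)" using submodD(5)[OF al, of c v]
 by (auto simp: t_def trunc_def fun_eq_iff lops_def rep_act_simps)
 qed (simp add: t_def)
 hence "t o hinv (vspace k al) g ?V:ophom (lops k) (lact Q) ?V (lact Q) (vspace k be)"
 by (rule ophom_comp[OF h(1)])
 moreover have "(t o hinv (vspace k al) g ?V) (f v) = v" if v: "v:vspace k be" for v
 proof -
 have "hinv (vspace k al) g ?V (f v) = v" using h(2)[of v] g(3,4) v by auto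
 moreover have "t v = v"
 proof -
 have "trunc v = v" using v by (auto simp: trunc_def vspace_def fun_eq_iff not_less)
 thus ?thesis using v g(3) by (auto simp: t_def)
 qed
 ultimately show ?thesis by simp
 qed
 ultimately show thesis by (rule that)
qed

lemma rep_hom_iff:
 assumes k: "fsubfield k" and N: "N:reps Q k be" and M: "M:reps Q k ga"
 and f: "f:ophom (lops k) (lact Q) (vspace k be) (lact Q) (vspace k ga)"
 shows "f:ophom (ops k) (rep_act Q be N) (vspace k be) (rep_act Q ga M) (vspace k ga) \<longleftrightarrow>
 (ALL h. ALL b<lk be (tail Q h). ALL a.
 mat_mult (lk ga (tail Q h)) (M h) (%a b. f (basis_vec (tail Q h) b) (tail Q h) a) a b =
 mat_mult (lk be (head Q h)) (%a b. f (basis_vec (head Q h) b) (head Q h) a) (N h) a b)"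
 (is "?L \<longleftrightarrow> ?R")
proof -
 let ?f = "%i a b. f (basis_vec i b) i a"
 have smN: "submod (ops k) (rep_act Q be N) (vspace k be)" by (rule vspace_submod[OF k order_refl N])
 have lhs: "rep_act Q ga M (Arr h) (f v) i a = (if i = head Q h then SUM b<lk be (tail Q h).
 v (tail Q h) b * mat_mult (lk ga (tail Q h)) (M h) (?f (tail Q h)) a b else 0)"
 if v: "v:vspace k be" for h v i a
 proof (cases "i = head Q h")
 case True
 have "rep_act Q ga M (Arr h) (f v) i a = (SUM c<lk ga (tail Q h).
 SUM b<lk be (tail Q h). v (tail Q h) b * (M h a c * ?f (tail Q h) c b))"
 using True by (simp add: rep_act_simps lhom_apply(1)[OF k f v] sum_distrib_left mult_ac)
 also have "... = (SUM b<lk be (tail Q h). SUM c<lk ga (tail Q h).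
 v (tail Q h) b * (M h a c * ?f (tail Q h) c b))" by (rule sum.swap)
 finally show ?thesis using True by (simp add: mat_mult_def sum_distrib_left)
 qed (simp add: rep_act_simps)
 have rhs: "f (rep_act Q be N (Arr h) v) i a = (if i = head Q h then SUM b<lk be (tail Q h).
 v (tail Q h) b * mat_mult (lk be (head Q h)) (?f (head Q h)) (N h) a b else 0)"
 if v: "v:vspace k be" for h v i a
 proof -
 have Nv: "rep_act Q be N (Arr h) v:vspace k be" by (rule submodD(5)[OF smN _ v]) (simp add: ops_def)
 have "f (rep_act Q be N (Arr h) v) i a = (if i = head Q h then
 SUM c<lk be (head Q h). SUM b<lk be (tail Q h).
 v (tail Q h) b * (?f (head Q h) a c * N h c b) else 0)"
 by (subst lhom_apply(1)[OF k f Nv]) (simp add: rep_act_simps sum_distrib_left sum_distrib_right mult_ac)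
 also have "... = (if i = head Q h then SUM b<lk be (tail Q h).
 SUM c<lk be (head Q h).
 v (tail Q h) b * (?f (head Q h) a c * N h c b) else 0)" by (subst sum.swap) simp
 finally show ?thesis by (simp add: mat_mult_def sum_distrib_left)
 qed
 show ?thesis
 proof
 assume L: ?L
 show ?R
 proof (intro allI impI)
 fix h b a assume b: "b < lk be (tail Q h)"
 let ?t = "tail Q h"
 have e: "basis_vec ?t b:vspace k be" by (rule basis_vec_in[OF k b])
 have "f (rep_act Q be N (Arr h) (basis_vec ?t b)) = rep_act Q ga M (Arr h) (f (basis_vec ?t b))"
 by (rule ophomD(4)[OF L _ e]) (simp add: ops_def)
 hence "rep_act Q ga M (Arr h) (f (basis_vec ?t b)) (head Q h) a = f (rep_act Q be N (Arr h) (basis_vec ?t b)) (head Q h) a"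
 by simp
 thus "mat_mult (lk ga ?t) (M h) (?f ?t) a b = mat_mult (lk be (head Q h)) (?f (head Q h)) (N h) a b"
 unfolding lhs[OF e] rhs[OF e] using b by (simp add: basis_vec_def mult_delta_left)
 qed
 next
 assume R: ?R
 have lo: "f (rep_act Q be N c v) = rep_act Q ga M c (f v)" if "c:lops k" "v:vspace k be" for c v
 using ophomD(4)[OF f that] rep_act_lops[OF that(1), of Q] by metis
 have "f (rep_act Q be N (Arr h) v) = rep_act Q ga M (Arr h) (f v)" if "v:vspace k be" for h v
 using lhs[OF that, of h] rhs[OF that, of h] R by (simp add: fun_eq_iff)
 hence "f (rep_act Q be N c v) = rep_act Q ga M c (f v)" if "c:ops k" "v:vspace k be" for c v
 using that lo by (auto simp: ops_def lops_def)
 thus ?L using ophomD(1-3)[OF f] by (intro ophomI) auto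
 qed
qed

text \<open>Being a homomorphism fixes M on the image of f, and M is free on a complement. Restriction along f maps all families onto the mixed ones, with fibres
of equal size.\<close>

lemma card_reps_containing:
 fixes Q::"('i, 'h) pre_digraph" and k::"'f::field set"
 assumes Q: "fin_digraph Q" and k: "fsubfield k" and N: "N:reps Q k be"
 and f: "f:injhom (lops k) (lact Q) (vspace k be) (lact Q) (vspace k ga)"
 shows "card {M:reps Q k ga. f:ophom (ops k) (rep_act Q be N) (vspace k be) (rep_act Q ga M) (vspace k ga)}
 * card (mat_fams Q k be ga) = card (reps Q k ga)"
proof -
 have fh: "f:ophom (lops k) (lact Q) (vspace k be) (lact Q) (vspace k ga)" using f by (simp add: injhom_def)
 obtain p where p: "p:ophom (lops k) (lact Q) (vspace k ga) (lact Q) (vspace k be)"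
 "!!v. v:vspace k be ==> p (f v) = v" using ophom_inverse_of_inj[OF k f] by blast
 note K = fsubfieldD[OF k]
 let ?b = "%i. lk be i" and ?g = "%i. lk ga i"
 define F where "F i a b = (if b < ?b i then f (basis_vec i b) i a else 0)" for i a b
 define G where "G i a b = (if b < ?g i then p (basis_vec i b) i a else 0)" for i a b
 have F: "F i a b:k" "F i a b ~= 0 ==> a < ?g i & b < ?b i" for i a b
 using ophomD(2)[OF fh basis_vec_in[OF k]] K(2)
 by (fastforce simp: F_def vspace_def not_less[symmetric] split: if_splits)+
 have G: "G i a b:k" "G i a b ~= 0 ==> a < ?b i & b < ?g i" for i a b
 using ophomD(2)[OF p(1) basis_vec_in[OF k]] K(2)
 by (fastforce simp: G_def vspace_def not_less[symmetric] split: if_splits)+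
 have GF: "mat_mult (?g i) (G i) (F i) a b = (if a = b & b < ?b i then 1 else 0)" for i a b
 proof (cases "b < ?b i")
 case True
 have "mat_mult (?g i) (G i) (F i) a b = p (f (basis_vec i b)) i a"
 using True by (subst lhom_apply(1)[OF k p(1) ophomD(2)[OF fh basis_vec_in[OF k True]]])
 (simp add: mat_mult_def F_def G_def mult.commute)
 thus ?thesis using True p(2)[OF basis_vec_in[OF k True]] by (simp add: basis_vec_def)
 qed (simp add: mat_mult_def F_def)
 have lin: "mat_mult n (%a b. A a b + B a b) C a b = mat_mult n A C a b + mat_mult n B C a b"
 "mat_mult n (%a b. A a b - B a b) C a b = mat_mult n A C a b - mat_mult n B C a b" for n A B and C::"nat => nat => 'f" and a b
 by (simp_all add: mat_mult_def sum.distrib sum_subtractf algebra_simps)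
 define RF where "RF M = (%h. mat_mult (?g (tail Q h)) (M h) (F (tail Q h)))" for M::"('h, 'f) mats_fam"
 define RG where "RG Z = (%h. mat_mult (?b (tail Q h)) (Z h) (G (tail Q h)))" for Z::"('h, 'f) mats_fam"
 define Z0 where "Z0 = (%h. mat_mult (?b (head Q h)) (F (head Q h)) (N h))"
 have prod_nz: "EX c<n. A a c ~= 0 & B c b ~= 0" if "mat_mult n A B a b ~= 0" for n a b and A B::"nat => nat => 'f"
 proof -
 from that obtain c where "c:{..<n}" "A a c * B c b ~= 0"
 unfolding mat_mult_def by (rule sum.not_neutral_contains_not_neutral)
 thus ?thesis by auto
 qed
 have fam: "M h a b:k" "M h a b ~= 0 ==> h:arcs Q & a < lk ep (head Q h) & b < lk de (tail Q h)"
 if "M:mat_fams Q k de ep" for M de ep h a b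
 using that by (auto simp: mat_fams_def)
 have in_k: "mat_mult n A B a b:k" if "!!a c. A a c:k" "!!c b. B c b:k" for n A B a b
 unfolding mat_mult_def by (rule fsubfield_sum[OF k]) (rule K(5)[OF that(1) that(2)])
 have RF: "RF M:mat_fams Q k be ga" if M: "M:reps Q k ga" for M
 unfolding mat_fams_def
 proof (intro CollectI allI conjI[OF _ impI])
 fix h a b
 show "RF M h a b:k" unfolding RF_def by (rule in_k) (use fam(1)[OF M] F(1) in auto)
 assume "RF M h a b ~= 0"
 thus "h:arcs Q & a < ?g (head Q h) & b < ?b (tail Q h)"
 unfolding RF_def using prod_nz fam(2)[OF M] F(2) by meson
 qed
 have RG: "RG Z:reps Q k ga" if Z: "Z:mat_fams Q k be ga" for Z
 unfolding mat_fams_def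
 proof (intro CollectI allI conjI[OF _ impI])
 fix h a b
 show "RG Z h a b:k" unfolding RG_def by (rule in_k) (use fam(1)[OF Z] G(1) in auto)
 assume "RG Z h a b ~= 0"
 thus "h:arcs Q & a < ?g (head Q h) & b < ?g (tail Q h)"
 unfolding RG_def using prod_nz fam(2)[OF Z] G(2) by meson
 qed
 have Z0: "Z0:mat_fams Q k be ga"
 unfolding mat_fams_def
 proof (intro CollectI allI conjI[OF _ impI])
 fix h a b
 show "Z0 h a b:k" unfolding Z0_def by (rule in_k) (use fam(1)[OF N] F(1) in auto)
 assume "Z0 h a b ~= 0"
 thus "h:arcs Q & a < ?g (head Q h) & b < ?b (tail Q h)"
 unfolding Z0_def using prod_nz fam(2)[OF N] F(2) by meson
 qed
 have RFRG: "RF (RG Z) = Z" if "Z:mat_fams Q k be ga" for Z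
 proof (intro ext)
 fix h a b
 have z: "Z h a b = 0" if "~  b < ?b (tail Q h)" using \<open>Z:mat_fams Q k be ga\<close> that by (auto simp: mat_fams_def)
 have "RF (RG Z) h a b = mat_mult (?b (tail Q h)) (Z h) (mat_mult (?g (tail Q h)) (G (tail Q h)) (F (tail Q h))) a b"
 by (simp add: RF_def RG_def mat_mult_assoc)
 also have "... = (SUM c<?b (tail Q h). Z h a c * (if c = b & b < ?b (tail Q h) then 1 else 0))"
 by (simp add: mat_mult_def[of _ "Z h"] GF)
 also have "... = Z h a b" using z by (cases "b < ?b (tail Q h)") (simp_all add: mult_delta_right)
 finally show "RF (RG Z) h a b = Z h a b" .
 qed
 define Fib where "Fib = {M:reps Q k ga. RF M = Z0}"
 have ab: "M + M':mat_fams Q k de ga" "M - M':mat_fams Q k de ga"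
 if "M:mat_fams Q k de ga" "M':mat_fams Q k de ga" for M M' de
 using that K unfolding mat_fams_def by (auto simp: fun_eq_iff) (metis add.right_neutral diff_zero)+
 have RFlin: "RF (M + M') = RF M + RF M'" "RF (M - M') = RF M - RF M'" for M M'
 by (auto simp: RF_def fun_eq_iff mat_mult_def sum.distrib sum_subtractf algebra_simps)
 have "bij_betw (%(M, Z). M + RG (Z::('h, 'f) mats_fam) - RG Z0) (Fib \<times> mat_fams Q k be ga) (reps Q k ga)"
 proof (rule bij_betwI[where g = "%M. (M - RG (RF M) + RG Z0, RF M)"])
 show "(%(M, Z). M + RG Z - RG Z0):Fib \<times> mat_fams Q k be ga \<rightarrow> reps Q k ga"
 using ab RG Z0 by (auto simp: Fib_def)
 show "(%M. (M - RG (RF M) + RG Z0, RF M)):reps Q k ga \<rightarrow> Fib \<times> mat_fams Q k be ga"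
 using ab RG RF Z0 by (auto simp: Fib_def RFlin RFRG)
 show "(case (case x of (M, Z) => M + RG Z - RG Z0) of M => (M - RG (RF M) + RG Z0, RF M)) = x"
 if "x:Fib \<times> mat_fams Q k be ga" for x
 proof -
 obtain M Z where x: "x = (M, Z)" "RF M = Z0" "Z:mat_fams Q k be ga" using \<open>x:_\<close> by (auto simp: Fib_def)
 hence "RF (M + RG Z - RG Z0) = Z" by (simp add: RFlin RFRG Z0)
 thus ?thesis by (simp add: x(1))
 qed
 qed simp
 hence "card Fib * card (mat_fams Q k be ga) = card (reps Q k ga)"
 by (metis bij_betw_same_card card_cartesian_product)
 moreover have "Fib = {M:reps Q k ga. f:ophom (ops k) (rep_act Q be N) (vspace k be) (rep_act Q ga M) (vspace k ga)}"
 proof -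
 have "RF M = Z0 \<longleftrightarrow> f:ophom (ops k) (rep_act Q be N) (vspace k be) (rep_act Q ga M) (vspace k ga)"
 if M: "M:reps Q k ga" for M
 proof -
 have 1: "RF M h a b = mat_mult (?g (tail Q h)) (M h) (%a b. f (basis_vec (tail Q h) b) (tail Q h) a) a b"
 "Z0 h a b = mat_mult (?b (head Q h)) (%a b. f (basis_vec (head Q h) b) (head Q h) a) (N h) a b"
 if "b < ?b (tail Q h)" for h a b
 using that by (auto simp: RF_def Z0_def mat_mult_def F_def)
 have 2: "RF M h a b = 0" "Z0 h a b = 0" if "~  b < ?b (tail Q h)" for h a b
 using mat_famsD(4)[OF RF[OF M] that] mat_famsD(4)[OF Z0 that] by auto
 have "RF M = Z0 \<longleftrightarrow> (ALL h. ALL b<?b (tail Q h). ALL a. RF M h a b = Z0 h a b)"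
 using 2 by (metis ext)
 thus ?thesis unfolding rep_hom_iff[OF k N M fh] using 1 by simp
 qed
 thus ?thesis by (auto simp: Fib_def)
 qed
 ultimately show ?thesis by simp
qed

text \<open>Two fields are allowed, to find representations over a subfield inside one over the large field.\<close>

lemma submod_coordinates:
 fixes Q::"('i, 'h) pre_digraph" and k::"'f::field set"
 assumes k: "fsubfield k" and K: "fsubfield K" "k <= K" and M: "M:reps Q K ga"
 and W: "W <= vspace K ga" "submod (ops k) (rep_act Q ga M) W"
 obtains al N f where "N:reps Q k al" "f:ophom (ops k) (rep_act Q al N) (vspace k al) (rep_act Q ga M) W"
 "bij_betw f (vspace k al) W"
proof -
 have lW: "submod (lops k) (lact Q) W"
 by (rule submod_lops[THEN iffD1, OF submod_mono_ops[OF W(2) lops_subset_ops]])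
 have fin: "finite W" using W(1) fsubfieldD(1)[OF K(1)] finite_vspace finite_subset by metis
 have supp: "finite {i. w i ~= 0}" if "w:W" for w
 using that W(1) vspace_finite_support by blast
 have "0:injhom (lops k) (lact Q) (vspace k 0) (lact Q) W"
 using ophom_zero[OF lW] by (auto simp: injhom_def vspace_zero fsubfieldD(2)[OF k])
 then obtain al f where f: "f:ophom (lops k) (lact Q) (vspace k al) (lact Q) W" "bij_betw f (vspace k al) W"
 using extend_to_coordinates[OF k lW fin supp] by blast
 let ?V = "vspace k al" and ?al = "%i. lk al i"
 have lV: "submod (lops k) (lact Q) ?V" by (rule vspace_lsubmod[OF k order_refl])
 note h = hinv_ophom[OF f lV]
 define y where "y c v = hinv ?V f W (rep_act Q ga M c (f v))" for c v
 define N where "N h a b = (if h:arcs Q & b < ?al (tail Q h) then y (Arr h) (basis_vec (tail Q h) b) (head Q h) a else 0)" for h a b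
 have Mf: "rep_act Q ga M c (f v):W" if "c:ops k" "v:?V" for c v
 by (rule submodD(5)[OF W(2) that(1) ophomD(2)[OF f(1) that(2)]])
 have yV: "y c v:?V" "f (y c v) = rep_act Q ga M c (f v)" if "c:ops k" "v:?V" for c v
 using ophomD(2)[OF h(1) Mf[OF that]] h(3)[OF Mf[OF that]] by (auto simp: y_def)
 have arr: "Arr h:ops k" for h by (simp add: ops_def)
 have NR: "N:reps Q k al"
 unfolding mat_fams_def
 proof (intro CollectI allI conjI[OF _ impI])
 fix h a b
 note e = yV(1)[OF arr basis_vec_in[OF k], of b "tail Q h" h]
 show "N h a b:k" using vspaceD(1)[OF e] fsubfieldD(2)[OF k] by (simp add: N_def)
 assume "N h a b ~= 0"
 thus "h:arcs Q & a < ?al (head Q h) & b < ?al (tail Q h)"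
 using vspaceD(2)[OF e] by (simp add: N_def split: if_splits)
 qed
 have "y (Arr h) v = rep_act Q al N (Arr h) v" if v: "v:?V" for h v
 proof -
 let ?m = "rep_act Q ga M" and ?t = "tail Q h"
 have "(%w. if w:W then ?m (Arr h) w else 0):ophom (Scal ` k) (lact Q) W (lact Q) W"
 proof (rule ophomI)
 fix x w assume "x:W" "w:W"
 thus "(if x + w:W then ?m (Arr h) (x + w) else 0) = (if x:W then ?m (Arr h) x else 0) + (if w:W then ?m (Arr h) w else 0)"
 using submodD(3)[OF W(2)] additive_actionD[OF add_rep] by simp
 next
 fix c::"('i, 'h, 'f) rep_op" and x assume c: "c:Scal ` k" and x: "x:W"
 hence "lact Q c x:W" using submodD(5)[OF lW, of c] by (auto simp: lops_def)
 with c x show "(if lact Q c x:W then ?m (Arr h) (lact Q c x) else 0) = lact Q c (if x:W then ?m (Arr h) x else 0)"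
 by (auto simp: rep_act_simps fun_eq_iff sum_distrib_left mult_ac)
 qed (use submodD(5)[OF W(2) arr] in auto)
 note yh = ophom_comp[OF ophom_comp[OF ophom_mono_ops[OF f(1)] this] ophom_mono_ops[OF h(1)]]
 define z where "z = hinv ?V f W o ((%w. if w:W then ?m (Arr h) w else 0) o f)"
 have z: "z:ophom (Scal ` k) (lact Q) ?V (lact Q) ?V"
 unfolding z_def by (rule yh) (auto simp: lops_def)
 have zy: "z v = y (Arr h) v" if "v:?V" for v
 using ophomD(2)[OF f(1) that] by (simp add: z_def y_def)
 have P: "Proj i:lops k" for i by (simp add: lops_def)
 have Pv: "lact Q (Proj ?t::('i, 'h, 'f) rep_op) v:?V" by (rule submodD(5)[OF lV P v])
 have sV: "submod (Scal ` k) (lact Q::('i, 'h, 'f) rep_op => _) ?V"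
 by (rule submod_mono_ops[OF lV]) (auto simp: lops_def)
 have S: "(Scal (v ?t b)::('i, 'h, 'f) rep_op):Scal ` k" for b using v by (auto simp: vspace_def)
 have "?m (Arr h) (f v) = ?m (Arr h) (f (lact Q (Proj ?t::('i, 'h, 'f) rep_op) v))"
 by (subst ophomD(4)[OF f(1) P v]) (simp add: rep_act_simps cong: if_cong)
 hence "y (Arr h) v = z (lact Q (Proj ?t::('i, 'h, 'f) rep_op) v)"
 by (simp add: zy[OF Pv] y_def)
 also have "lact Q (Proj ?t::('i, 'h, 'f) rep_op) v = (SUM b<?al ?t. lact Q (Scal (v ?t b)::('i, 'h, 'f) rep_op) (basis_vec ?t b))"
 using proj_expand[OF v, of Q "%_ _ _. 0" ?t] by (simp add: rep_act_simps)
 also have "z ... = (SUM b<?al ?t. z (lact Q (Scal (v ?t b)::('i, 'h, 'f) rep_op) (basis_vec ?t b)))"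
 by (rule conjunct1[OF ophom_sum[OF z sV]], rule submodD(5)[OF sV S], rule basis_vec_in[OF k]) simp
 also have "... = (SUM b<?al ?t. lact Q (Scal (v ?t b)::('i, 'h, 'f) rep_op) (y (Arr h) (basis_vec ?t b)))"
 by (rule sum.cong[OF refl]) (simp add: ophomD(4)[OF z S] zy basis_vec_in[OF k])
 finally have 1: "y (Arr h) v i a = (SUM b<?al ?t. v ?t b * y (Arr h) (basis_vec ?t b) i a)" for i a
 by (simp add: sum_gvec_apply rep_act_simps)
 have 2: "y (Arr h) u i a = 0" if "u:?V" "i ~= head Q h" for u i a
 proof -
 have "lact Q (Proj (head Q h)::('i, 'h, 'f) rep_op) (?m (Arr h) (f u)) = ?m (Arr h) (f u)"
 by (auto simp: rep_act_simps fun_eq_iff)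
 hence "lact Q (Proj (head Q h)::('i, 'h, 'f) rep_op) (y (Arr h) u) = y (Arr h) u"
 unfolding y_def using ophomD(4)[OF h(1) P Mf[OF arr that(1)]] by metis
 thus ?thesis using that(2) by (metis rep_act_simps(2))
 qed
 have 3: "y (Arr h) u = 0" if "u:?V" "h ~: arcs Q" for u
 proof -
 have "?m (Arr h) (f u) = 0" 
 by (simp add: rep_act_simps fun_eq_iff mat_famsD(3)[OF M that(2)])
 thus ?thesis by (simp add: y_def ophom_zero_at[OF h(1)])
 qed
 show ?thesis
 proof (intro ext)
 fix i a
 show "y (Arr h) v i a = rep_act Q al N (Arr h) v i a"
 proof (cases "i = head Q h & h:arcs Q")
 case True
 thus ?thesis unfolding 1 by (simp add: rep_act_simps N_def mult.commute)
 next
 case False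
 thus ?thesis using 2[OF v] 3[OF v] by (auto simp: rep_act_simps N_def)
 qed
 qed
 qed
 hence "f (rep_act Q al N (Arr h) v) = rep_act Q ga M (Arr h) (f v)" if "v:?V" for h v
 using yV(2)[OF arr that] that by metis
 moreover have "f (rep_act Q al N c v) = rep_act Q ga M c (f v)" if "c:lops k" "v:?V" for c v
 using ophomD(4)[OF f(1) that] rep_act_lops[OF that(1), of Q] by metis
 ultimately have "f (rep_act Q al N c v) = rep_act Q ga M c (f v)" if "c:ops k" "v:?V" for c v
 using that by (auto simp: ops_def lops_def)
 hence "f:ophom (ops k) (rep_act Q al N) ?V (rep_act Q ga M) W"
 using ophomD(1-3)[OF f(1)] by (intro ophomI) auto
 with NR f(2) show thesis using that by blast
qed

section \<open>The inverse of the mass series\<close>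

text \<open>The summand \<open>1/((1-t)...(1-t^m))\<close> of Euler's identity.\<close>

definition qe::"'a::field => nat => 'a" where
 "qe t m = 1 / (PROD i=1..m. 1 - t ^ i)"

lemma qe_0 [simp]: "qe t 0 = 1" by (simp add: qe_def)

lemma qe_Suc: "qe t (Suc m) = qe t m / (1 - t ^ Suc m)"
 by (simp add: qe_def)

lemma qe_partial_sum:
 fixes t::"'a::field"
 assumes "!!i. i >= 1 ==> t ^ i ~= 1"
 shows "(SUM m<=n. qe t m * (PROD i<m. t ^ h - t ^ i)) = qe t n * (PROD i=1..n. t ^ h - t ^ i)"
proof (induction n)
 case (Suc n)
 have nz: "1 - t ^ Suc n ~= 0" using assms[of "Suc n"] by auto
 have 1: "(PROD i<Suc n. t ^ h - t ^ i) = (t ^ h - 1) * (PROD i=1..n. t ^ h - t ^ i)"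
 unfolding prod.lessThan_Suc_shift by (simp add: prod.atLeast1_atMost_eq)
 have "(SUM m<=Suc n. qe t m * (PROD i<m. t ^ h - t ^ i)) = 
 qe t n * (PROD i=1..n. t ^ h - t ^ i) + qe t (Suc n) * ((t ^ h - 1) * (PROD i=1..n. t ^ h - t ^ i))"
 unfolding sum.atMost_Suc Suc.IH 1 ..
 also have "qe t n = qe t (Suc n) * (1 - t ^ Suc n)" using nz by (simp add: qe_Suc)
 finally show ?case by (simp add: algebra_simps)
qed simp

text \<open>The closed form of the partial sums has the factor \<open>t^h - t^h\<close> as soon as n reaches h.\<close>

lemma qe_sum_eq_0:
 fixes t::"'a::field"
 assumes "!!i. i >= 1 ==> t ^ i ~= 1" "1 <= h" "h <= n"
 shows "(SUM m<=n. qe t m * (PROD i<m. t ^ h - t ^ i)) = 0"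
proof -
 have "(PROD i=1..n. t ^ h - t ^ i) = 0" by (rule prod_zero) (use assms in auto)
 thus ?thesis by (simp add: qe_partial_sum[OF assms(1)])
qed

definition dim_scale::"nat => 'i dimvec => 'i dimvec" where
 "dim_scale n al = Poly_Mapping.map ((*) n) al"

lemma lookup_dim_scale [simp]: "lk (dim_scale n al) i = n * lk al i"
 by (auto simp: dim_scale_def map.rep_eq when_def)

lemma lookup_sum_pm: "lk (SUM x:A. f x) i = (SUM x:A. lk (f x) i)"
 for f::"_ => 'i dimvec"
 by (induction A rule: infinite_finite_induct) (auto simp: lookup_add)

abbreviation rep_hom where
 "rep_hom Q k al M be N \<equiv> ophom (ops k) (rep_act Q al M) (vspace k al) (rep_act Q be N) (vspace k be)"

abbreviation simple_rep where
 "simple_rep Q k al M \<equiv> simple_mod (ops k) (rep_act Q al M) (vspace k al)"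

definition end_card where
 "end_card Q k s = card (rep_hom Q k (fst s) (snd s) (fst s) (snd s))"

definition mult_dim::"('i dimvec \<times> 'c) set => ('i dimvec \<times> 'c => nat) => 'i dimvec" where
 "mult_dim S m = (SUM s:S. dim_scale (m s) (fst s))"

text \<open>N is the direct sum of the \<open>S^m_S\<close>. Each new summand multiplies the number of embeddings as in \<open>card_injhom_adjoin\<close>, because
\<open>Hom(S, N)\<close> only sees the copies of S already present.\<close>

lemma semisimple_exists:
 fixes Q::"('i, 'h) pre_digraph" and k::"'f::field set"
 assumes k: "fsubfield k" and S: "finite S"
 and simple: "!!s. s:S ==> snd s:reps Q k (fst s) & simple_rep Q k (fst s) (snd s)"
 and noniso: "!!s t. s:S ==> t:S ==> s ~= t ==> rep_hom Q k (fst s) (snd s) (fst t) (snd t) = {0}"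
 shows "EX N. N:reps Q k (mult_dim S m) &
 (ALL s:S. card (rep_hom Q k (fst s) (snd s) (mult_dim S m) N) = end_card Q k s ^ m s) &
 (ALL ga. ALL M:reps Q k ga. int (card (injhom (ops k) (rep_act Q (mult_dim S m) N) (vspace k (mult_dim S m)) (rep_act Q ga M) (vspace k ga))) =
 (PROD s:S. PROD i<m s. int (card (rep_hom Q k (fst s) (snd s) ga M)) - int (end_card Q k s) ^ i))"
 (is "EX N. ?P m N")
proof (induction "SUM s:S. m s" arbitrary: m)
 case 0
 hence m0: "m s = 0" if "s:S" for s using S that by simp
 hence d: "mult_dim S m = 0" by (intro poly_mapping_eqI) (simp add: mult_dim_def lookup_sum_pm)
 have one: "ophom (ops k) A R B (vspace k 0) = {0}"
 if "additive_action B" for A::"('i,'h,'f) rep_op => ('i,'f) gvec => _" and R and B::"_ => ('i,'f) gvec => _"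
 proof -
 have "f = 0" if "f:ophom (ops k) A R B {0}" for f
 using ophomD(1,2)[OF that] by (intro ext) (metis singletonD zero_fun_def)
 thus ?thesis using ophom_zero[OF submod_zero[OF that] that, of "ops k" A R] fsubfieldD(2)[OF k]
 by (auto simp: vspace_zero)
 qed
 have two: "injhom (ops k) (rep_act Q 0 (%_ _ _. 0)) (vspace k 0) (rep_act Q ga M) (vspace k ga) = {0}"
 if "M:reps Q k ga" for ga M
 proof -
 have "f = 0" if "f:ophom (ops k) (rep_act Q 0 (%_ _ _. 0)) {0} (rep_act Q ga M) (vspace k ga)" for f
 using ophomD(1)[OF that] ophom_zero_at[OF that] by (intro ext) (metis singletonD zero_fun_def)
 thus ?thesis using ophom_zero[OF vspace_submod[OF k order_refl that] add_rep, of "rep_act Q 0 (%_ _ _. 0)" "{0}"] fsubfieldD(2)[OF k]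
 by (auto simp: vspace_zero injhom_def)
 qed
 show ?case
 by (intro exI[of _ "%_ _ _. 0"]) (auto simp: d m0 one two zero_reps[OF k])
next
 case (Suc n)
 then obtain s where s: "s:S" "m s > 0" by (metis Suc_neq_Zero gr0I sum.neutral)
 obtain si M where sM: "s = (si, M)" by (cases s)
 have M: "M:reps Q k si" "simple_rep Q k si M" using simple[OF s(1)] sM by auto
 define m' where "m' = m(s := m s - 1)"
 have m: "m = m'(s := Suc (m' s))" using s by (auto simp: m'_def)
 have "(SUM s:S. m s) = (SUM s:S. m' s) + 1"
 unfolding sum.remove[OF S s(1)] using s by (auto simp: m'_def)
 hence "n = (SUM s:S. m' s)" using Suc by simp
 from Suc.hyps(1)[OF this] obtain N where N: "?P m' N" ..
 have d: "mult_dim S m = mult_dim S m' + si"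
 proof (rule poly_mapping_eqI)
 fix i
 have "(SUM x:S. m x * lk (fst x) i) = (SUM x:S. m' x * lk (fst x) i) + lk si i"
 unfolding sum.remove[OF S s(1)] by (auto simp: m sM)
 thus "lk (mult_dim S m) i = lk (mult_dim S m' + si) i"
 by (simp add: mult_dim_def lookup_sum_pm lookup_add)
 qed
 have NR: "N:reps Q k (mult_dim S m')" using N by blast
 note B = block_sum_facts[OF k NR M(1)]
 have "block_sum Q (mult_dim S m') N M:reps Q k (mult_dim S m)"
 unfolding d by (rule block_sum_reps[OF k NR M(1)])
 moreover have "card (rep_hom Q k (fst t) (snd t) (mult_dim S m) (block_sum Q (mult_dim S m') N M)) = end_card Q k t ^ m t"
 if t: "t:S" for t
 proof -
 have IH: "card (rep_hom Q k (fst t) (snd t) (mult_dim S m') N) = end_card Q k t ^ m' t" using N t by blast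
 have "card (rep_hom Q k (fst t) (snd t) si M) = (if t = s then end_card Q k t else 1)"
 using noniso[OF t s(1)] sM by (auto simp: end_card_def)
 thus ?thesis unfolding d B(2) IH by (auto simp: m)
 qed
 moreover have "int (card (injhom (ops k) (rep_act Q (mult_dim S m) (block_sum Q (mult_dim S m') N M)) (vspace k (mult_dim S m)) (rep_act Q ga L) (vspace k ga))) =
 (PROD s:S. PROD i<m s. int (card (rep_hom Q k (fst s) (snd s) ga L)) - int (end_card Q k s) ^ i)"
 if L: "L:reps Q k ga" for ga L
 proof -
 let ?H = "%s. int (card (rep_hom Q k (fst s) (snd s) ga L))" and ?e = "%s. int (end_card Q k s)"
 let ?I = "injhom (ops k) (rep_act Q (mult_dim S m') N) (vspace k (mult_dim S m')) (rep_act Q ga L) (vspace k ga)"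
 have IH: "int (card ?I) = (PROD s:S. PROD i<m' s. ?H s - ?e s ^ i)" using N L by blast
 have cN: "card (rep_hom Q k si M (mult_dim S m') N) = end_card Q k s ^ m' s" using N s(1) sM by force
 have "int (card (injhom (ops k) (rep_act Q (mult_dim S m) (block_sum Q (mult_dim S m') N M)) (vspace k (mult_dim S m)) (rep_act Q ga L) (vspace k ga)))
 = int (card ?I) * int (card (rep_hom Q k si M ga L) - end_card Q k s ^ m' s)"
 unfolding d B(3)[OF M(2) add_rep vspace_submod[OF k order_refl L] finite_vspace[OF fsubfieldD(1)[OF k]]] cN
 by simp
 also have "... = int (card ?I) * (?H s - ?e s ^ m' s)"
 proof (cases "?I = {}")
 case False
 then obtain f where f: "f:rep_hom Q k (mult_dim S m') N ga L" "inj_on f (vspace k (mult_dim S m'))"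
 by (auto simp: injhom_def)
 note sN = vspace_submod[OF k order_refl NR]
 have f': "f:ophom (ops k) (rep_act Q (mult_dim S m') N) (vspace k (mult_dim S m')) (rep_act Q ga L) (f ` vspace k (mult_dim S m'))"
 by (rule ophom_mono_codomain[OF f(1)]) auto
 have "card (rep_hom Q k si M (mult_dim S m') N) = card (ophom (ops k) (rep_act Q si M) (vspace k si) (rep_act Q ga L) (f ` vspace k (mult_dim S m')))"
 by (rule card_ophom_iso_codomain[OF f' _ sN]) (use f(2) in "simp add: bij_betw_def")
 also have "... <= card (rep_hom Q k si M ga L)"
 proof (rule card_mono)
 show "finite (rep_hom Q k si M ga L)" using fsubfieldD(1)[OF k] by (intro finite_ophom finite_vspace)
 show "ophom (ops k) (rep_act Q si M) (vspace k si) (rep_act Q ga L) (f ` vspace k (mult_dim S m')) <= rep_hom Q k si M ga L"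
 using ophomD(2)[OF f(1)] by (auto simp: ophom_def)
 qed
 finally show ?thesis using cN sM by (simp add: of_nat_diff)
 qed simp
 also have "... = (PROD s:S. PROD i<m s. ?H s - ?e s ^ i)"
 proof -
 have "(PROD t:S. PROD i<m t. ?H t - ?e t ^ i) = (PROD t:S. (PROD i<m' t. ?H t - ?e t ^ i) * (if t = s then ?H s - ?e s ^ m' s else 1))"
 by (rule prod.cong[OF refl]) (auto simp: m)
 thus ?thesis using s(1) S IH by (simp add: prod.distrib)
 qed
 finally show ?thesis .
 qed
 ultimately show ?case by blast
qed

lemma end_card_gt_1:
 fixes Q::"('i, 'h) pre_digraph" and k::"'f::field set"
 assumes k: "fsubfield k" and M: "M:reps Q k si" "simple_rep Q k si M"
 shows "end_card Q k (si, M) > 1"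
proof -
 note fin = finite_vspace[OF fsubfieldD(1)[OF k]]
 note sM = vspace_submod[OF k order_refl M(1)]
 have "idon (vspace k si) ~= (0::('i,'f) gvec => _)"
 proof
 assume z: "idon (vspace k si) = (0::('i,'f) gvec => _)"
 have "v = 0" if "v:vspace k si" for v::"('i,'f) gvec" using fun_cong[OF z, of v] that by (simp add: idon_def)
 thus False using M(2) submodD(1)[OF sM] by (auto simp: simple_mod_def)
 qed
 hence "2 = card {idon (vspace k si), 0::('i,'f) gvec => _}" by simp
 also have "... <= end_card Q k (si, M)"
 unfolding end_card_def fst_conv snd_conv
 by (rule card_mono[OF finite_ophom[OF fin fin]])
 (use idon_ophom[OF sM order_refl] ophom_zero[OF sM add_rep] in auto)
 finally show ?thesis by simp
qed

lemma card_rep_hom_power: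
 assumes k: "fsubfield k" and M: "M:reps Q k si" "simple_rep Q k si M" and L: "L:reps Q k ga"
 obtains h where "card (rep_hom Q k si M ga L) = end_card Q k (si, M) ^ h" "h = 0 \<longleftrightarrow> rep_hom Q k si M ga L = {0}"
proof -
 note fin = finite_vspace[OF fsubfieldD(1)[OF k]]
 note sL = vspace_submod[OF k order_refl L]
 note sM = vspace_submod[OF k order_refl M(1)]
 obtain h where h: "card (rep_hom Q k si M ga L) = end_card Q k (si, M) ^ h"
 unfolding end_card_def fst_conv snd_conv using card_ophom_simple_power[OF M(2) sL add_rep add_rep fin] by blast
 have zero: "0:rep_hom Q k si M ga L" by (rule ophom_zero[OF sL add_rep])
 have "end_card Q k (si, M) > 1" using end_card_gt_1[OF k M] .
 moreover have "card (rep_hom Q k si M ga L) = 1 \<longleftrightarrow> rep_hom Q k si M ga L = {0}"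
 using zero by (auto simp: card_1_singleton_iff)
 ultimately have "h = 0 \<longleftrightarrow> rep_hom Q k si M ga L = {0}" using h by (metis One_nat_def nat_power_eq_Suc_0_iff nat_neq_iff)
 with h that show thesis by blast
qed

text \<open>One representative of each isomorphism class of simple representations of dimension at most ga.\<close>

definition simple_reps_upto where
 "simple_reps_upto Q k ga S \<longleftrightarrow> finite S &
 (ALL s:S. snd s:reps Q k (fst s) & simple_rep Q k (fst s) (snd s)) &
 (ALL s:S. ALL t:S. s ~= t --> rep_hom Q k (fst s) (snd s) (fst t) (snd t) = {0}) &
 (ALL si M. (ALL i. lk si i <= lk ga i) --> M:reps Q k si --> simple_rep Q k si M -->
 (EX s:S. rep_hom Q k (fst s) (snd s) si M ~= {0}))"

lemma ophom_nonzero_iff: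
 assumes "submod P B W" "additive_action B"
 shows "ophom P A V B W ~= {0} \<longleftrightarrow> (EX f:ophom P A V B W. f ~= 0)"
 using ophom_zero[OF assms, of A V] by auto

lemma simple_rep_dim_nonzero:
 assumes "0:k" "simple_rep Q k si M"
 shows "si ~= 0"
 using assms by (auto simp: simple_mod_def vspace_zero)

lemma card_line_le_of_inj:
 fixes Q::"('i, 'h) pre_digraph" and k::"'f::field set"
 assumes k: "fsubfield k" and K: "fsubfield K" "k <= K"
 and f: "f:ophom (lops k) (lact Q) (vspace k al) (lact Q) (vspace K ga)" "inj_on f (vspace k al)"
 shows "card k ^ lk al i <= card K ^ lk ga i"
proof -
 let ?E = "vspace k (unit_dim i)::('i, 'f) gvec set"
 note fin = finite_vspace[OF fsubfieldD(1)[OF k]] finite_vspace[OF fsubfieldD(1)[OF K(1)]]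
 have f': "f:ophom (lops k) (lact Q) (vspace k al) (lact Q) (f ` vspace k al)"
 by (rule ophom_mono_codomain[OF f(1)]) auto
 have "card k ^ lk al i = card (ophom (lops k) (lact Q) ?E (lact Q) (vspace k al))"
 by (rule card_lhom_line[OF k k order_refl, symmetric])
 also have "... = card (ophom (lops k) (lact Q) ?E (lact Q) (f ` vspace k al))"
 by (rule card_ophom_iso_codomain[OF f' _ vspace_lsubmod[OF k order_refl]]) (use f(2) in "simp add: bij_betw_def")
 also have "... <= card (ophom (lops k) (lact Q) ?E (lact Q) (vspace K ga))"
 proof (rule card_mono)
 show "finite (ophom (lops k) (lact Q) ?E (lact Q) (vspace K ga))" by (intro finite_ophom fin)
 show "ophom (lops k) (lact Q) ?E (lact Q) (f ` vspace k al) <= ophom (lops k) (lact Q) ?E (lact Q) (vspace K ga)"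
 using ophomD(2)[OF f(1)] by (auto simp: ophom_def)
 qed
 also have "... = card K ^ lk ga i" by (rule card_lhom_line[OF k K])
 finally show ?thesis .
qed

lemma inj_dim_le:
 assumes k: "fsubfield k" and f: "f:ophom (lops k) (lact Q) (vspace k al) (lact Q) (vspace k ga)" "inj_on f (vspace k al)"
 shows "lk al i <= lk ga i"
 using card_line_le_of_inj[OF k k order_refl f, of i] fsubfield_card_gt_1[OF k] by (metis power_le_imp_le_exp)

lemma simple_subrep_exists:
 fixes Q::"('i, 'h) pre_digraph" and k::"'f::field set"
 assumes k: "fsubfield k" and K: "fsubfield K" "k <= K" and M: "M:reps Q K ga" and nz: "ga ~= 0"
 obtains si N f where "N:reps Q k si" "simple_rep Q k si N"
 "f:ophom (ops k) (rep_act Q si N) (vspace k si) (rep_act Q ga M) (vspace K ga)" "inj_on f (vspace k si)"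
proof -
 let ?V = "vspace K ga::('i, 'f) gvec set"
 have sm: "submod (ops k) (rep_act Q ga M) ?V" by (rule vspace_submod[OF K M])
 from nz obtain i where i: "lk ga i > 0" by (metis gr0I poly_mapping_eqI lookup_zero)
 have "basis_vec i 0:?V" by (rule basis_vec_in[OF K(1) i])
 moreover have "basis_vec i 0 ~= (0::('i, 'f) gvec)" by (auto simp: basis_vec_def fun_eq_iff)
 ultimately have "?V ~= {0}" by auto
 from exists_simple_submod[OF finite_vspace[OF fsubfieldD(1)[OF K(1)]] sm this]
 obtain U where U: "U <= ?V" "simple_mod (ops k) (rep_act Q ga M) U" by blast
 obtain si N f where f: "N:reps Q k si" "f:ophom (ops k) (rep_act Q si N) (vspace k si) (rep_act Q ga M) U"
 "bij_betw f (vspace k si) U" using submod_coordinates[OF k K M U(1) simple_submod[OF U(2)]] .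
 have "simple_rep Q k si N"
 by (rule simple_mod_image[OF f(2,3) vspace_submod[OF k order_refl f(1)] U(2)])
 moreover have "f:ophom (ops k) (rep_act Q si N) (vspace k si) (rep_act Q ga M) ?V"
 by (rule ophom_mono_codomain[OF f(2)]) (use ophomD(2)[OF f(2)] U(1) in auto)
 ultimately show thesis using that f(1,3) by (auto simp: bij_betw_def)
qed

definition mult_fams::"('i dimvec \<times> 'c) set => 'i dimvec => ('i dimvec \<times> 'c => nat) set" where
 "mult_fams S be = {m. (ALL s. s ~: S --> m s = 0) & mult_dim S m = be}"

text \<open>With \<open>#Hom(S, M) = q_S^h_S\<close> the sum factors over S into the sums of \<open>qe_sum_eq_0\<close>. As M contains some simple representation,
one \<open>h_S\<close> is positive and its factor vanishes.\<close>

lemma alternating_sum_embeddings: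
 assumes k: "fsubfield k" and S: "simple_reps_upto Q k ga S" and M: "M:reps Q k ga" and nz: "ga ~= 0"
 obtains B where "!!n. n >= B ==>
 (SUM m:S \<rightarrow>\<^sub>E {..n}. (PROD s:S. qe (of_nat (end_card Q k s)) (m s)) *
 of_int (PROD s:S. PROD i<m s. int (card (rep_hom Q k (fst s) (snd s) ga M)) - int (end_card Q k s) ^ i)) = (0::rat)"
proof -
 have fS: "finite S" using S by (simp add: simple_reps_upto_def)
 have SM: "snd s:reps Q k (fst s)" "simple_rep Q k (fst s) (snd s)" if "s:S" for s
 using S that by (auto simp: simple_reps_upto_def)
 have "EX h. ALL s:S. card (rep_hom Q k (fst s) (snd s) ga M) = end_card Q k s ^ h s & (h s = 0 \<longleftrightarrow> rep_hom Q k (fst s) (snd s) ga M = {0})"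
 by (rule bchoice) (metis card_rep_hom_power[OF k SM M] prod.collapse)
 then obtain h where h: "!!s. s:S ==> card (rep_hom Q k (fst s) (snd s) ga M) = end_card Q k s ^ h s"
 "!!s. s:S ==> h s = 0 \<longleftrightarrow> rep_hom Q k (fst s) (snd s) ga M = {0}" by metis
 have e1: "end_card Q k s > 1" if "s:S" for s
 using end_card_gt_1[OF k SM[OF that]] by simp
 have "EX s:S. h s ~= 0"
 proof -
 obtain si N f where N: "N:reps Q k si" "simple_rep Q k si N" "f:rep_hom Q k si N ga M" "inj_on f (vspace k si)"
 using simple_subrep_exists[OF k k order_refl M nz] .
 have "f:ophom (lops k) (lact Q) (vspace k si) (lact Q) (vspace k ga)"
 by (rule ophom_lops[THEN equalityD1, THEN subsetD, OF ophom_mono_ops[OF N(3) lops_subset_ops]])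
 from inj_dim_le[OF k this N(4)] have "ALL i. lk si i <= lk ga i" ..
 then obtain s where s: "s:S" "rep_hom Q k (fst s) (snd s) si N ~= {0}"
 using S N(1,2) unfolding simple_reps_upto_def by blast
 then obtain g where g: "g:rep_hom Q k (fst s) (snd s) si N" "g ~= 0"
 using ophom_nonzero_iff[OF vspace_submod[OF k order_refl N(1)] add_rep] by blast
 have "f o g ~= 0"
 proof
 assume z: "f o g = 0"
 have "g x = 0" for x
 proof (cases "x:vspace k (fst s)")
 case True
 have "f (g x) = 0" using fun_cong[OF z, of x] by simp
 thus ?thesis using N(4) ophomD(2)[OF g(1) True] ophom_inj_iff[OF N(3) vspace_submod[OF k order_refl N(1)]] by blast
 qed (use ophomD(1)[OF g(1)] in auto)
 with g(2) show False by (auto simp: fun_eq_iff)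
 qed
 hence "rep_hom Q k (fst s) (snd s) ga M ~= {0}" using ophom_comp[OF g(1) N(3)] by auto
 with s(1) h(2) show ?thesis by blast
 qed
 then obtain s0 where s0: "s0:S" "h s0 ~= 0" by blast
 show thesis
 proof (rule that[of "SUM s:S. h s"])
 fix n assume n: "n >= (SUM s:S. h s)"
 let ?t = "%s. of_nat (end_card Q k s)::rat"
 have "(SUM m:S \<rightarrow>\<^sub>E {..n}. (PROD s:S. qe (?t s) (m s)) *
 of_int (PROD s:S. PROD i<m s. int (card (rep_hom Q k (fst s) (snd s) ga M)) - int (end_card Q k s) ^ i)) =
 (SUM m:S \<rightarrow>\<^sub>E {..n}. PROD s:S. qe (?t s) (m s) * (PROD i<m s. ?t s ^ h s - ?t s ^ i))"
 by (rule sum.cong[OF refl]) (simp add: h(1) prod.distrib)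
 also have "... = (PROD s:S. SUM m<=n. qe (?t s) m * (PROD i<m. ?t s ^ h s - ?t s ^ i))"
 using fS by (subst prod_sum_PiE) auto
 also have "... = 0"
 proof (rule prod_zero[OF fS], rule bexI[OF _ s0(1)], rule qe_sum_eq_0)
 show "?t s0 ^ i ~= 1" if "1 <= i" for i
 proof -
 have "end_card Q k s0 ^ i > 1" using e1[OF s0(1)] that by (intro one_less_power) auto
 thus ?thesis by (metis less_irrefl of_nat_1 of_nat_eq_iff of_nat_power)
 qed
 show "h s0 <= n" using member_le_sum[OF s0(1), of h] fS n by auto
 qed (use s0 in auto)
 finally show "(SUM m:S \<rightarrow>\<^sub>E {..n}. (PROD s:S. qe (?t s) (m s)) *
 of_int (PROD s:S. PROD i<m s. int (card (rep_hom Q k (fst s) (snd s) ga M)) - int (end_card Q k s) ^ i)) = 0" .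
 qed
qed

lemma lhom_of_rep_hom:
 "f:ophom (ops k) (rep_act Q al M) V (rep_act Q be N) W ==> f:ophom (lops k) (lact Q) V (lact Q) W"
 by (rule ophom_lops[THEN equalityD1, THEN subsetD, OF ophom_mono_ops[OF _ lops_subset_ops]])

text \<open>Counts pairs of a graded injection and a structure M on the target for which it is a homomorphism; the number of M is the same for every injection.\<close>

lemma sum_card_embeddings:
 assumes Q: "fin_digraph Q" and k: "fsubfield k" and N: "N:reps Q k be"
 shows "(SUM M:reps Q k ga. card (injhom (ops k) (rep_act Q be N) (vspace k be) (rep_act Q ga M) (vspace k ga)))
 * card (mat_fams Q k be ga) = card (injhom (lops k) (lact Q) (vspace k be) (lact Q) (vspace k ga)) * card (reps Q k ga)"
proof -
 let ?L = "injhom (lops k) (lact Q) (vspace k be) (lact Q) (vspace k ga)"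
 let ?P = "%M f. f:rep_hom Q k be N ga M"
 note fin = finite_vspace[OF fsubfieldD(1)[OF k]]
 have fL: "finite ?L"
 by (rule finite_subset[OF _ finite_ophom[OF fin fin]]) (auto simp: injhom_def)
 have fR: "finite (reps Q k ga)" by (rule card_mat_fams(1)[OF Q k])
 have eq: "injhom (ops k) (rep_act Q be N) (vspace k be) (rep_act Q ga M) (vspace k ga) = {f:?L. ?P M f}" for M
 using lhom_of_rep_hom by (auto simp: injhom_def)
 have "(SUM M:reps Q k ga. card {f:?L. ?P M f}) = (SUM M:reps Q k ga. SUM f:?L. if ?P M f then 1 else 0)"
 by (rule sum.cong[OF refl]) (use fL in "simp add: sum.If_cases Int_def")
 also have "... = (SUM f:?L. SUM M:reps Q k ga. if ?P M f then 1 else 0)" by (rule sum.swap)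
 also have "... = (SUM f:?L. card {M:reps Q k ga. ?P M f})"
 by (rule sum.cong[OF refl]) (use fR in "simp add: sum.If_cases Int_def")
 finally have "(SUM M:reps Q k ga. card {f:?L. ?P M f}) * card (mat_fams Q k be ga) =
 (SUM f:?L. card {M:reps Q k ga. ?P M f} * card (mat_fams Q k be ga))" by (simp add: sum_distrib_right)
 also have "... = (SUM f:?L. card (reps Q k ga))"
 by (rule sum.cong[OF refl]) (rule card_reps_containing[OF Q k N])
 finally show ?thesis unfolding eq by simp
qed

definition dim_le::"'i dimvec => 'i dimvec => bool" where
 "dim_le be ga \<longleftrightarrow> (ALL i. lk be i <= lk ga i)"

definition dim_size::"'i dimvec => nat" where
 "dim_size ga = (SUM i:Poly_Mapping.keys ga. lk ga i)"

lemma finite_dim_le: "finite {be. dim_le be ga}"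
proof -
 let ?K = "Poly_Mapping.keys ga"
 have "finite {f. ALL x. (x:?K --> f x:{..dim_size ga}) & (x ~: ?K --> f x = 0)}"
 by (rule finite_set_of_finite_funs) auto
 moreover have "lk ` {be. dim_le be ga} <= {f. ALL x. (x:?K --> f x:{..dim_size ga}) & (x ~: ?K --> f x = 0)}"
 proof safe
 fix be x assume b: "dim_le be ga"
 { assume x: "x:?K"
 have "lk be x <= lk ga x" using b by (simp add: dim_le_def)
 also have "... <= dim_size ga" unfolding dim_size_def by (rule member_le_sum) (use x in auto)
 finally show "lk be x <= dim_size ga" . }
 { assume "x ~: ?K"
 thus "lk be x = 0" using b by (auto simp: dim_le_def in_keys_iff) (metis le_zero_eq) }
 qed
 ultimately have "finite (lk ` {be. dim_le be ga})" by (rule finite_subset[rotated])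
 thus ?thesis by (rule finite_imageD) (auto intro: inj_onI poly_mapping_eqI)
qed

lemma mult_dim_le_bound:
 assumes "finite S" "s:S" "fst s ~= 0" "dim_le (mult_dim S m) ga"
 shows "m s <= dim_size ga"
proof -
 from assms(3) obtain i where i: "lk (fst s) i > 0" by (metis gr0I poly_mapping_eqI lookup_zero)
 have "m s * 1 <= m s * lk (fst s) i" using i by (intro mult_le_mono) auto
 also have "... <= (SUM s:S. m s * lk (fst s) i)"
 by (rule member_le_sum[OF assms(2)]) (use assms(1) in auto)
 also have "... = lk (mult_dim S m) i" by (simp add: mult_dim_def lookup_sum_pm)
 also have "... <= lk ga i" using assms(4) by (simp add: dim_le_def)
 also have "... <= dim_size ga"
 proof (cases "i:Poly_Mapping.keys ga")
 case True
 thus ?thesis unfolding dim_size_def by (intro member_le_sum) auto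
 qed (simp add: in_keys_iff)
 finally show ?thesis by simp
qed

definition simple_mass::"('i, 'h) pre_digraph => 'f::field set => ('i dimvec \<times> ('h, 'f) mats_fam) set => 'i dimvec => rat" where
 "simple_mass Q k S be = (SUM m:mult_fams S be. PROD s:S. qe (of_nat (end_card Q k s)) (m s))"

text \<open>Sum \<open>alternating_sum_embeddings\<close> over all representations M of dimension ga and use that the number of pairs in
\<open>sum_card_embeddings\<close> depends only on the dimension of N.\<close>

theorem simple_mass_inverse:
 assumes Q: "fin_digraph Q" and k: "fsubfield k" and S: "simple_reps_upto Q k ga S" and nz: "ga ~= 0"
 shows "(SUM be | dim_le be ga. of_nat (card (injhom (lops k) (lact Q) (vspace k be) (lact Q) (vspace k ga)))
 * (of_nat (card (reps Q k ga)) / of_nat (card (mat_fams Q k be ga))) * simple_mass Q k S be) = 0"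
proof -
 have fS: "finite S" using S by (simp add: simple_reps_upto_def)
 have SM: "snd s:reps Q k (fst s)" "simple_rep Q k (fst s) (snd s)" if "s:S" for s
 using S that by (auto simp: simple_reps_upto_def)
 have Snz: "fst s ~= 0" if "s:S" for s
 by (rule simple_rep_dim_nonzero[OF fsubfieldD(2)[OF k] SM(2)[OF that]])
 let ?w = "%m. (PROD s:S. qe (of_nat (end_card Q k s)) (m s))::rat"
 let ?E = "%m M. (PROD s:S. PROD i<m s. int (card (rep_hom Q k (fst s) (snd s) ga M)) - int (end_card Q k s) ^ i)"
 let ?R = "reps Q k ga"
 let ?c = "%be. of_nat (card (injhom (lops k) (lact Q) (vspace k be) (lact Q) (vspace k ga)))
 * (of_nat (card ?R) / of_nat (card (mat_fams Q k be ga)))::rat"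
 have fR: "finite ?R" by (rule card_mat_fams(1)[OF Q k])
 have "ALL M:?R. EX B. ALL n>=B. (SUM m:S \<rightarrow>\<^sub>E {..n}. ?w m * of_int (?E m M)) = 0"
 proof
 fix M assume "M:?R"
 from alternating_sum_embeddings[OF k S this nz] show "EX B. ALL n>=B. (SUM m:S \<rightarrow>\<^sub>E {..n}. ?w m * of_int (?E m M)) = 0"
 by blast
 qed
 from bchoice[OF this] obtain B where "ALL M:?R. ALL n>=B M. (SUM m:S \<rightarrow>\<^sub>E {..n}. ?w m * of_int (?E m M)) = 0" ..
 hence B: "!!M n. M:?R ==> n >= B M ==> (SUM m:S \<rightarrow>\<^sub>E {..n}. ?w m * of_int (?E m M)) = 0"
 by blast
 have P2: "!!s t. s:S ==> t:S ==> s ~= t ==> rep_hom Q k (fst s) (snd s) (fst t) (snd t) = {0}"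
 using S by (simp add: simple_reps_upto_def)
 define n where "n = dim_size ga + (SUM M:?R. B M)"
 have nB: "B M <= n" if "M:?R" for M using member_le_sum[OF that, of B] fR by (simp add: n_def)
 have tot: "(SUM M:?R. of_int (?E m M)) = ?c (mult_dim S m)" for m
 proof -
 obtain N where N: "N:reps Q k (mult_dim S m)" "!!M. M:?R ==>
 int (card (injhom (ops k) (rep_act Q (mult_dim S m) N) (vspace k (mult_dim S m)) (rep_act Q ga M) (vspace k ga))) = ?E m M"
 using semisimple_exists[OF k fS conjI[OF SM] P2, of m] by blast
 have pos: "card (mat_fams Q k (mult_dim S m) ga) ~= 0"
 using card_mat_fams(2)[OF Q k, of "mult_dim S m" ga] fsubfield_card_gt_1[OF k] by simp
 have "(SUM M:?R. of_int (?E m M)) = (of_nat (SUM M:?R. card (injhom (ops k) (rep_act Q (mult_dim S m) N) (vspace k (mult_dim S m)) (rep_act Q ga M) (vspace k ga)))::rat)"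
 unfolding of_nat_sum by (rule sum.cong[OF refl], subst N(2)[symmetric]) simp_all
 also have "... = ?c (mult_dim S m)"
 using arg_cong[OF sum_card_embeddings[OF Q k N(1), of ga], of "of_nat::nat => rat"] pos by (simp add: field_simps)
 finally show ?thesis .
 qed
 have c0: "?c be = 0" if "~  dim_le be ga" for be
 proof -
 have "injhom (lops k) (lact Q) (vspace k be) (lact Q) (vspace k ga) = {}"
 using inj_dim_le[OF k, of _ Q be ga] that by (auto simp: injhom_def dim_le_def)
 thus ?thesis by simp
 qed
 have "0 = (SUM M:?R. SUM m:S \<rightarrow>\<^sub>E {..n}. ?w m * of_int (?E m M))" using B nB by simp
 also have "... = (SUM m:S \<rightarrow>\<^sub>E {..n}. SUM M:?R. ?w m * of_int (?E m M))" by (rule sum.swap)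
 also have "... = (SUM m:S \<rightarrow>\<^sub>E {..n}. ?w m * ?c (mult_dim S m))" by (simp only: sum_distrib_left[symmetric] tot)
 also have "... = (SUM m:{m:S \<rightarrow>\<^sub>E {..n}. dim_le (mult_dim S m) ga}. ?w m * ?c (mult_dim S m))"
 by (rule sum.mono_neutral_right) (use fS c0 in "auto intro!: finite_PiE")
 also have "... = (SUM m:(UN be:{be. dim_le be ga}. mult_fams S be). ?w m * ?c (mult_dim S m))"
 proof (rule sum.reindex_bij_witness[where i = "%m. restrict m S" and j = "%m s. if s:S then m s else 0"])
 have cong: "mult_dim S m = mult_dim S m'" if "!!s. s:S ==> m s = m' s" for m m'::"_ => nat"
 unfolding mult_dim_def using that by (intro sum.cong) auto
 fix m assume m: "m:{m:S \<rightarrow>\<^sub>E {..n}. dim_le (mult_dim S m) ga}"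
 have "mult_dim S (%s. if s:S then m s else 0) = mult_dim S m" by (rule cong) simp
 with m show "(%s. if s:S then m s else 0):(UN be:{be. dim_le be ga}. mult_fams S be)"
 "?w (%s. if s:S then m s else 0) * ?c (mult_dim S (%s. if s:S then m s else 0)) = ?w m * ?c (mult_dim S m)"
 by (auto simp: mult_fams_def)
 show "restrict (%s. if s:S then m s else 0) S = m"
 using m by (auto simp: fun_eq_iff restrict_def PiE_iff extensional_def)
 next
 have cong: "mult_dim S m = mult_dim S m'" if "!!s. s:S ==> m s = m' s" for m m'::"_ => nat"
 unfolding mult_dim_def using that by (intro sum.cong) auto
 fix m assume m: "m:(UN be:{be. dim_le be ga}. mult_fams S be)"
 have d: "mult_dim S (restrict m S) = mult_dim S m" by (rule cong) simp
 have "m s <= n" if "s:S" for s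
 using mult_dim_le_bound[OF fS that Snz[OF that], of m ga] m by (auto simp: mult_fams_def n_def)
 with m d show "restrict m S:{m:S \<rightarrow>\<^sub>E {..n}. dim_le (mult_dim S m) ga}"
 by (auto simp: mult_fams_def)
 show "(%s. if s:S then restrict m S s else 0) = m" using m by (auto simp: mult_fams_def fun_eq_iff)
 qed
 also have "... = (SUM be | dim_le be ga. SUM m:mult_fams S be. ?w m * ?c (mult_dim S m))"
 proof (rule sum.UNION_disjoint)
 show "ALL be:{be. dim_le be ga}. finite (mult_fams S be)"
 proof
 fix be assume b: "be:{be. dim_le be ga}"
 have "finite {f. ALL x. (x:S --> f x:{..dim_size ga}) & (x ~: S --> f x = 0)}"
 by (rule finite_set_of_finite_funs) (use fS in auto)
 thus "finite (mult_fams S be)"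
 by (rule finite_subset[rotated]) (use mult_dim_le_bound[OF fS _ Snz] b in "auto simp: mult_fams_def")
 qed
 qed (use finite_dim_le in "auto simp: mult_fams_def")
 also have "... = (SUM be | dim_le be ga. ?c be * simple_mass Q k S be)"
 by (rule sum.cong[OF refl], unfold simple_mass_def sum_distrib_left, rule sum.cong[OF refl])
 (simp add: mult_fams_def)
 finally show ?thesis by simp
qed

section \<open>Wedderburn's little theorem\<close>

lemma norm_diff_unit_ge:
 fixes w::complex and z::nat
 assumes "norm w = 1"
 shows "norm (of_nat z - w) >= real z - 1"
 using norm_triangle_ineq2[of "of_nat z" w] assms by simp

lemma norm_diff_unit_gt:
 fixes w::complex and z::nat
 assumes "norm w = 1" "w ~= 1" "z > 0"
 shows "norm (of_nat z - w) > real z - 1"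
proof -
 have w: "(Re w)\<^sup>2 + (Im w)\<^sup>2 = 1" using assms(1) by (metis cmod_power2 one_power2)
 have "Re w < 1"
 proof (rule ccontr)
 assume "~  Re w < 1"
 hence "(Re w)\<^sup>2 >= 1" by (simp add: one_le_power)
 with w have "Im w = 0" by (metis add_le_same_cancel1 power2_less_eq_zero_iff order_trans order_refl)
 with w \<open>~  Re w < 1\<close> have "Re w = 1" by (simp add: power2_eq_1_iff)
 with \<open>Im w = 0\<close> assms(2) show False by (simp add: complex_eq_iff)
 qed
 have "(norm (of_nat z - w))\<^sup>2 = (real z - Re w)\<^sup>2 + (Im w)\<^sup>2" by (simp add: cmod_power2)
 also have "... = (real z)\<^sup>2 - 2 * real z * Re w + 1" using w by (simp add: power2_diff algebra_simps)
 also have "... > (real z)\<^sup>2 - 2 * real z * 1 + 1" using \<open>Re w < 1\<close> assms(3) by simp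
 finally have "(real z - 1)\<^sup>2 < (norm (of_nat z - w))\<^sup>2" by (simp add: power2_diff)
 thus ?thesis by (rule power2_less_imp_less) auto
qed

lemma monom_minus_1_dvd:
 assumes "d dvd n"
 shows "(pmonom 1 d - 1::int poly) dvd pmonom 1 n - 1"
proof -
 from assms obtain k where n: "n = d * k" ..
 have "(pmonom 1 n::int poly) = pmonom 1 d ^ k" by (simp add: n monom_power)
 moreover have "(pmonom 1 d::int poly) - 1 dvd pmonom 1 d ^ k - 1"
 by (cases "k = 0") (simp_all add: power_diff_1_eq)
 ultimately show ?thesis by simp
qed

text \<open>c is the value at z of \<open>X^n - 1\<close> divided by the least common multiple of the \<open>X^d - 1\<close>, that is, of the cyclotomic
polynomial up to sign. Its roots are roots of unity other than 1, and one of them has distance greater than \<open>z - 1\<close> from z.\<close>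

lemma cyclotomic_value:
 fixes z n::nat
 assumes z: "z >= 2" and n: "n >= 2"
 obtains c::int where "c dvd int z ^ n - 1"
 "!!d. d dvd n ==> d < n ==> c * (int z ^ d - 1) dvd int z ^ n - 1" "\<bar>c\<bar> > int z - 1"
proof -
 define D where "D = {d. d dvd n & d < n}"
 have D: "finite D" "!!d. d:D ==> d > 0" using n by (auto simp: D_def intro: Nat.gr0I)
 (* With Ph the quotient of X^n - 1 by L, the number c is Ph(z). *)
 define L::"int poly" where "L = Lcm ((%d. pmonom 1 d - 1) ` D)"
 have "L dvd pmonom 1 n - 1"
 unfolding L_def by (rule Lcm_least) (auto simp: D_def intro: monom_minus_1_dvd)
 then obtain Ph where Ph: "(pmonom 1 n - 1::int poly) = L * Ph" ..
 have ev: "poly (pmonom 1 m - 1::int poly) (int z) = int z ^ m - 1" for m by (simp add: poly_monom)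
 have Phev: "int z ^ n - 1 = poly L (int z) * poly Ph (int z)"
 using ev[of n] unfolding Ph by simp
 have deg: "pdeg (pmonom 1 n - 1::int poly) = n" "plead (pmonom 1 n - 1::int poly) = 1"
 proof -
 show *: "pdeg (pmonom 1 n - 1::int poly) = n"
 using n by (intro antisym degree_le le_degree) (auto simp: coeff_1)
 show "plead (pmonom 1 n - 1::int poly) = 1" unfolding * using n by simp
 qed
 have nz: "Ph ~= 0" using deg(2) Ph by auto
 have "plead L * plead Ph = 1" using deg(2) Ph by (metis lead_coeff_mult)
 hence lc: "\<bar>plead Ph\<bar> = 1" by (metis abs_zmult_eq_1 mult.commute abs_one)
 let ?C = "map_poly (of_int::int => complex)"
 have hom: "poly (?C p) (of_int x) = of_int (poly p x)" for p x
 by (induction p) (auto simp: map_poly_pCons)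
 have homm: "?C (p * q) = ?C p * ?C q" for p q
 by (rule poly_eqI) (simp add: coeff_map_poly coeff_mult)
 have Cm: "poly (?C (pmonom 1 m - 1)) w = w ^ m - 1" for m w
 proof -
 have "?C (pmonom 1 m - 1) = pmonom 1 m - 1" by (rule poly_eqI) (auto simp: coeff_map_poly coeff_1)
 thus ?thesis by (simp add: poly_monom)
 qed
 have CPh: "?C Ph ~= 0" "plead (?C Ph) = of_int (plead Ph)"
 using nz by (auto simp: map_poly_eq_0_iff lead_coeff_map_poly_nz)
 have root1: "norm w = 1" if "poly (?C Ph) w = 0" for w
 proof -
 have "poly (?C (pmonom 1 n - 1)) w = 0" unfolding Ph homm using that by simp
 hence "w ^ n = 1" by (simp add: Cm)
 thus ?thesis using n by (metis norm_one norm_power power_eq_1_iff norm_ge_zero abs_norm_cancel not_numeral_le_zero)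
 qed
 define w where "w = cis (2 * pi / real n)"
 have wpow: "w ^ d = cis (2 * pi * real d / real n)" for d by (simp add: w_def DeMoivre mult_ac)
 have w1: "w ^ d ~= 1" if "0 < d" "d < n" for d
 proof
 assume "w ^ d = 1"
 hence "cos (2 * pi * real d / real n) = 1" unfolding wpow by (simp add: complex_eq_iff)
 then obtain x::int where "2 * pi * real d / real n = of_int x * 2 * pi"
 by (auto simp: cos_one_2pi_int)
 hence "real d = of_int x * real n" using n by (simp add: field_simps)
 hence "int d = x * int n" by (metis of_int_eq_iff of_int_mult of_int_of_nat_eq)
 thus False using that by (metis dvd_triv_right int_dvd_int_iff nat_dvd_not_less)
 qed
 have Lw: "poly (?C L) w ~= 0"
 proof
 assume 0: "poly (?C L) w = 0"
 have "L dvd (PROD d:D. pmonom 1 d - 1)"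
 unfolding L_def by (rule Lcm_least) (use D in auto)
 then obtain R where R: "(PROD d:D. pmonom 1 d - 1) = L * R" ..
 have "?C (PROD d:D. pmonom 1 d - 1) = (PROD d:D. ?C (pmonom 1 d - 1))"
 by (induction D rule: infinite_finite_induct) (simp_all add: homm)
 hence "(PROD d:D. poly (?C (pmonom 1 d - 1)) w) = 0"
 using 0 unfolding R homm by (metis mult_zero_left poly_mult poly_prod)
 then obtain d where "d:D" "w ^ d = 1" using D(1) by (auto simp: Cm prod_zero_iff)
 with w1[of d] D(2) show False by (auto simp: D_def)
 qed
 have "w ^ n = 1" using n by (simp add: wpow)
 hence "poly (?C L) w * poly (?C Ph) w = 0" using Cm[of n w] unfolding Ph homm by simp
 with Lw have wr: "poly (?C Ph) w = 0" by simp
 obtain A where A: "?C Ph = psmult (plead (?C Ph)) (\<Prod>x\<in>#A. [:-x, 1:])"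
 using alg_closed_imp_factorization[OF CPh(1)] by blast
 have evPh: "poly (?C Ph) x = of_int (plead Ph) * (\<Prod>r\<in>#A. x - r)" for x
 by (subst A) (simp add: CPh(2) poly_prod_mset image_mset.compositionality o_def)
 have rA: "poly (?C Ph) r = 0 \<longleftrightarrow> r \<in># A" for r
 unfolding evPh using lc by auto
 obtain A' where A': "A = add_mset w A'" using wr rA by (metis multi_member_split)
 have wn: "norm w = 1" "w ~= 1" using w1[of 1] n by (auto simp: w_def)
 have ge1: "1 <= norm (\<Prod>r\<in>#A'. of_nat z - r)"
 proof -
 have "\<forall>r\<in>#A'. 1 <= norm (of_nat z - r)"
 proof
 fix r assume "r \<in># A'"
 hence "norm r = 1" using root1 rA A' by auto
 from norm_diff_unit_ge[OF this, of z] z show "1 <= norm (of_nat z - r)" by simp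
 qed
 thus ?thesis
 proof (induction A')
 case (add r A')
 hence "1 * 1 <= norm (of_nat z - r) * norm (\<Prod>r\<in>#A'. of_nat z - r)" by (intro mult_mono) auto
 thus ?case by (simp add: norm_mult)
 qed simp
 qed
 have "real_of_int \<bar>poly Ph (int z)\<bar> = norm (poly (?C Ph) (of_nat z))"
 using hom[of Ph "int z"] by (metis norm_of_int of_int_of_nat_eq of_int_abs)
 also have "... = norm (of_nat z - w) * norm (\<Prod>r\<in>#A'. of_nat z - r)"
 using lc unfolding evPh A' by (simp add: norm_mult) (metis of_int_1 of_int_abs)
 finally have "real_of_int \<bar>poly Ph (int z)\<bar> >= norm (of_nat z - w) * 1"
 using ge1 mult_left_mono[OF ge1, of "norm (of_nat z - w)"] by simp
 moreover have "norm (of_nat z - w) > real z - 1" by (rule norm_diff_unit_gt[OF wn]) (use z in simp)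
 ultimately have "\<bar>poly Ph (int z)\<bar> > int z - 1" by linarith
 moreover have "poly Ph (int z) dvd int z ^ n - 1" unfolding Phev by simp
 moreover have "poly Ph (int z) * (int z ^ d - 1) dvd int z ^ n - 1" if "d dvd n" "d < n" for d
 proof -
 have "(pmonom 1 d - 1::int poly) dvd L" unfolding L_def by (rule dvd_Lcm) (use that in "auto simp: D_def")
 then obtain R where "L = (pmonom 1 d - 1) * R" ..
 hence "poly L (int z) = (int z ^ d - 1) * poly R (int z)" using ev[of d] by simp
 thus ?thesis unfolding Phev by simp
 qed
 ultimately show thesis using that by blast
qed

text \<open>Finite division rings whose elements are maps and whose product is composition.\<close>

definition division_maps::"('a => 'a::ab_group_add) => ('a => 'a) set => bool" where
 "division_maps e D \<longleftrightarrow> finite D & 0:D & e:D & e ~= 0 &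
 (ALL f:D. ALL g:D. f - g:D & f o g:D) & (ALL f:D. f o e = f & e o f = f) &
 (ALL f:D. ALL g:D. ALL h:D. f o (g + h) = (f o g) + (f o h)) &
 (ALL f:D. f ~= 0 --> (EX g:D. f o g = e & g o f = e))"

lemma division_mapsD:
 assumes "division_maps e D"
 shows "finite D" "0:D" "e:D" "e ~= 0" "f:D ==> g:D ==> f - g:D" "f:D ==> g:D ==> f o g:D"
 "f:D ==> f o e = f" "f:D ==> e o f = f"
 "f:D ==> g:D ==> h:D ==> f o (g + h) = (f o g) + (f o h)"
 "f:D ==> f ~= 0 ==> EX g:D. f o g = e & g o f = e"
 using assms by (auto simp: division_maps_def)

lemma division_maps_card_power:
 assumes C: "division_maps e C" and D: "division_maps e D" and sub: "C <= D"
 obtains n where "card D = card C ^ n"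
proof -
 let ?A = "%c x. x o (c::'a => 'a)"
 note c = division_mapsD[OF C] and d = division_mapsD[OF D]
 have z: "f o 0 = 0" if "f:D" for f using d(9)[OF that d(2) d(2)] by (simp add: fun_eq_iff)
 have A: "additive_action ?A" by (simp add: additive_action_def fun_eq_iff)
 have sC: "submod C ?A C" and sD: "submod C ?A D" using c(2,5,6) d(2,5,6) sub by (auto simp: submod_def)
 have "U = {0} | U = C" if U: "submod C ?A U" "U <= C" for U
 proof (cases "U = {0}")
 case False
 then obtain u where u: "u:U" "u ~= 0" using submodD(1)[OF U(1)] by auto
 then obtain g where g: "g:C" "u o g = e" using c(10) U(2) by blast
 hence "e:U" using submodD(5)[OF U(1) g(1) u(1)] by simp
 hence "f:U" if "f:C" for f using submodD(5)[OF U(1) that] c(8)[OF that] by metis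
 with U(2) show ?thesis by auto
 qed auto
 hence simple: "simple_mod C ?A C" using sC c(3,4) by (auto simp: simple_mod_def)
 have "EX g:ophom C ?A C ?A D. v:g ` C" if v: "v:D" for v
 proof (intro bexI[of _ "%x. if x:C then (v o x) else 0"])
 show "v:(%x. if x:C then (v o x) else 0) ` C" using c(3) d(7)[OF v] by (intro image_eqI[of _ _ e]) simp_all
 show "(%x. if x:C then (v o x) else 0):ophom C ?A C ?A D"
 proof (rule ophomI)
 fix x y assume "x:C" "y:C"
 thus "(if x + y:C then (v o (x + y)) else 0) = (if x:C then (v o x) else 0) + (if y:C then (v o y) else 0)"
 using submodD(3)[OF sC] d(9)[OF v] subsetD[OF sub] by auto
 qed (use d(6)[OF v] sub c(6) in "auto simp: o_assoc")
 qed
 from isotypic_total[OF simple sD A A d(1) this] obtain n where "isotypic C ?A C ?A D D n" .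
 from isotypic_card[OF simple sD A A this] show thesis using that by blast
qed

lemma division_maps_group:
 assumes D: "division_maps e D"
 shows "group \<lparr>carrier = D - {0}, monoid.mult = (o), one = e\<rparr>"
proof -
 note d = division_mapsD[OF D]
 have dz: "f o 0 = 0" if "f:D" for f using d(9)[OF that d(2) d(2)] by (simp add: fun_eq_iff)
 have z0: "0 o f = 0" for f::"'a => 'a" by (simp add: fun_eq_iff)
 have nz: "f o g ~= 0" if fg: "f:D" "g:D" "f ~= 0" "g ~= 0" for f g
 proof
 assume *: "f o g = 0"
 obtain i where i: "i:D" "i o f = e" using d(10)[OF fg(1,3)] by blast
 have "g = (i o f) o g" using d(8)[OF fg(2)] i by simp
 also have "... = 0" using * dz[OF i(1)] by (simp add: comp_assoc)
 finally show False using fg(4) by simp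
 qed
 let ?G = "\<lparr>carrier = D - {0}, monoid.mult = (o), one = e\<rparr>"
 show ?thesis
 proof (rule groupI)
 fix x assume x: "x:carrier ?G"
 then obtain i where i: "i:D" "i o x = e" using d(10) by auto
 moreover have "i ~= 0" using i d(4) z0 by auto
 ultimately show "EX y:carrier ?G. y \<otimes>\<^bsub>?G\<^esub> x = \<one>\<^bsub>?G\<^esub>" by auto
 qed (use d(3,4,6,8) nz in "auto simp: comp_assoc")
qed

lemma division_maps_pow:
 assumes D: "division_maps e D" and t: "th:D" "th ~= 0" and f: "f o e = f"
 shows "((%f. f o th) ^^ (card D - 1)) f = f"
proof -
 define G where "G = \<lparr>carrier = D - {0}, monoid.mult = (o), one = e\<rparr>"
 interpret G: group G unfolding G_def by (rule division_maps_group[OF D])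
 have "((%f. f o th) ^^ i) f = f o (th [^]\<^bsub>G\<^esub> i)" for i::nat
 by (induction i) (simp_all add: G_def f comp_assoc)
 moreover have "th [^]\<^bsub>G\<^esub> order G = \<one>\<^bsub>G\<^esub>" by (rule G.pow_order_eq_1) (use t in "simp add: G_def")
 moreover have "order G = card D - 1"
 using division_mapsD(1,2)[OF D] by (simp add: order_def G_def card_Diff_singleton)
 ultimately show ?thesis using f by (simp add: G_def)
qed

text \<open>Witt's proof by the class equation of the group of units: with \<open>z = #Z\<close> for the centre Z, the number c of \<open>cyclotomic_value\<close>
divides the order \<open>z^n - 1\<close> and the size of every nontrivial conjugacy class, hence \<open>z - 1\<close>, but it is too large for that.\<close>

theorem wedderburn:
 assumes D: "division_maps e D" and fg: "f:D" "g:D"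
 shows "f o g = g o f"
proof -
 note d = division_mapsD[OF D]
 have dz: "f o 0 = 0" if "f:D" for f using d(9)[OF that d(2) d(2)] by (simp add: fun_eq_iff)
 have z0: "0 o f = 0" for f::"'a => 'a" by (simp add: fun_eq_iff)
 have dsub: "f o (g - h) = (f o g) - (f o h)" if "f:D" "g:D" "h:D" for f g h
 using d(9)[OF that(1) d(5)[OF that(2,3)] that(3)] by (simp add: algebra_simps)
 have subd: "(g - h) o f = (g o f) - (h o f)" for f g h::"'a => 'a" by (simp add: fun_eq_iff)
 have pf: "(g + h) o f = (g o f) + (h o f)" for f g h::"'a => 'a" by (simp add: fun_eq_iff)
 (* All centralizers are division rings again; their sizes are powers of the size of the centre. *)
 define Cent where "Cent T = {f:D. ALL g:T. f o g = g o f}" for T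
 have Cent: "division_maps e (Cent T)" if T: "T <= D" for T
 unfolding division_maps_def
 proof (intro conjI ballI impI)
 show "finite (Cent T)" "0:Cent T" "e:Cent T" "e ~= 0"
 using d(1-4) T dz d(7,8) by (auto simp: Cent_def z0 subset_iff)
 fix f assume f: "f:Cent T"
 hence fD: "f:D" by (simp add: Cent_def)
 show "f o e = f" "e o f = f" using d(7,8) fD by auto
 {
 fix g assume g: "g:Cent T"
 hence gD: "g:D" by (simp add: Cent_def)
 show "f - g:Cent T" using f g d(5)[OF fD gD] dsub T by (auto simp: Cent_def subd)
 have "(f o g) o t = t o (f o g)" if "t:T" for t
 using f g that unfolding Cent_def by (metis (mono_tags, lifting) comp_assoc mem_Collect_eq)
 thus "f o g:Cent T" using d(6)[OF fD gD] by (simp add: Cent_def)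
 fix h assume h: "h:Cent T"
 thus "f o (g + h) = (f o g) + (f o h)" using d(9)[OF fD gD] by (simp add: Cent_def)
 }
 assume "f ~= 0"
 then obtain i where i: "i:D" "f o i = e" "i o f = e" using d(10)[OF fD] by blast
 have "i o t = t o i" if t: "t:T" for t
 proof -
 have ft: "f o t = t o f" and tD: "t:D" using f t T by (auto simp: Cent_def)
 have "i o t = i o t o (f o i)" using i d(7)[OF d(6)[OF i(1) tD]] by simp
 also have "... = i o (f o t) o i" by (simp add: ft comp_assoc)
 also have "... = (i o f) o (t o i)" by (simp add: comp_assoc)
 also have "... = t o i" using i d(8)[OF d(6)[OF tD i(1)]] by simp
 finally show ?thesis .
 qed
 with i show "EX g:Cent T. f o g = e & g o f = e" by (auto simp: Cent_def)
 qed
 define Z where "Z = Cent D"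
 have ZD: "Z <= D" by (auto simp: Z_def Cent_def)
 note Zd = Cent[OF order_refl, folded Z_def]
 have "Z = D"
 proof (rule ccontr)
 assume "Z ~= D"
 obtain n where n: "card D = card Z ^ n" using division_maps_card_power[OF Zd D ZD] .
 let ?z = "card Z"
 have z2: "?z >= 2"
 proof -
 have "card {0, e} <= ?z" using division_mapsD(1-3)[OF Zd] by (intro card_mono) auto
 thus ?thesis using d(4) by auto
 qed
 have "?z < card D" using ZD \<open>Z ~= D\<close> d(1) by (simp add: psubset_card_mono psubsetI)
 hence n2: "n >= 2" unfolding n using z2 by (cases n; cases "n - 1") auto
 obtain c::int where c: "c dvd int ?z ^ n - 1"
 "!!d. d dvd n ==> d < n ==> c * (int ?z ^ d - 1) dvd int ?z ^ n - 1" "\<bar>c\<bar> > int ?z - 1"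
 using cyclotomic_value[OF z2 n2] by blast
 define G where "G = \<lparr>carrier = D - {0}, monoid.mult = (o), one = e\<rparr>"
 have cG: "carrier G = D - {0}" "x \<otimes>\<^bsub>G\<^esub> y = x o y" "\<one>\<^bsub>G\<^esub> = e" for x y
 by (simp_all add: G_def)
 interpret G: group G unfolding G_def by (rule division_maps_group[OF D])
 interpret A: group_action G "carrier G" "%h. \<lambda>g\<in>carrier G. h \<otimes>\<^bsub>G\<^esub> g \<otimes>\<^bsub>G\<^esub> inv\<^bsub>G\<^esub> h"
 by (rule G.action_by_conjugation)
 let ?ph = "%h. \<lambda>g\<in>carrier G. h \<otimes>\<^bsub>G\<^esub> g \<otimes>\<^bsub>G\<^esub> inv\<^bsub>G\<^esub> h"
 have fG: "finite (carrier G)" using d(1) by (simp add: cG)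
 have ordG: "int (order G) = int ?z ^ n - 1"
 using n d(1,2) z2 by (simp add: order_def cG card_Diff_singleton of_nat_diff)
 have stab: "stabilizer G ?ph x = Cent {x} - {0}" if x: "x:carrier G" for x
 proof -
 have "?ph g x = x \<longleftrightarrow> g \<otimes>\<^bsub>G\<^esub> x = x \<otimes>\<^bsub>G\<^esub> g" if "g:carrier G" for g
 using x that G.inv_solve_right'[of x "g \<otimes>\<^bsub>G\<^esub> x" g] by auto
 hence "stabilizer G ?ph x = {g:carrier G. g \<otimes>\<^bsub>G\<^esub> x = x \<otimes>\<^bsub>G\<^esub> g}"
 unfolding stabilizer_def by blast
 thus ?thesis by (auto simp: Cent_def cG)
 qed
 define N where "N = carrier G - Z"
 have orb_div: "c dvd int (card (orbit G ?ph x))" if x: "x:N" for x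
 proof -
 have xG: "x:carrier G" "x:D" using x by (auto simp: N_def cG)
 have sx: "{x} <= D" using xG by simp
 note Cx = Cent[OF sx]
 have ZC: "Z <= Cent {x}" "Cent {x} <= D" using xG by (auto simp: Z_def Cent_def)
 obtain m where m: "card (Cent {x}) = ?z ^ m" using division_maps_card_power[OF Zd Cx ZC(1)] .
 obtain t where t: "card D = card (Cent {x}) ^ t" using division_maps_card_power[OF Cx D ZC(2)] .
 have "n = m * t" using n t z2 by (simp add: m power_mult[symmetric])
 have "Cent {x} ~= D"
 proof
 assume "Cent {x} = D"
 hence "x o g = g o x" if "g:D" for g
 proof -
 have "g:Cent {x}" using that \<open>Cent {x} = D\<close> by simp
 thus ?thesis by (simp add: Cent_def)
 qed
 hence "x:Z" using xG(2) by (simp add: Z_def Cent_def)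
 with x show False by (simp add: N_def)
 qed
 hence "card (Cent {x}) < card D" using ZC(2) d(1) by (simp add: psubset_card_mono psubsetI)
 hence "m < n" using z2 by (simp add: m n)
 have "int (card (stabilizer G ?ph x)) = int ?z ^ m - 1"
 unfolding stab[OF xG(1)] using m division_mapsD(1,2)[OF Cx] z2 by (simp add: card_Diff_singleton of_nat_diff)
 hence "int ?z ^ n - 1 = int (card (orbit G ?ph x)) * (int ?z ^ m - 1)"
 using arg_cong[OF A.orbit_stabilizer_theorem[OF xG(1)], of int] ordG
 by (simp add: restrict_def)
 moreover have "c * (int ?z ^ m - 1) dvd int ?z ^ n - 1" using c(2) \<open>n = m * t\<close> \<open>m < n\<close> by simp
 moreover have "int ?z ^ m - 1 ~= 0"
 proof
 assume "int ?z ^ m - 1 = 0"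
 with calculation(1) have "int ?z ^ n = 1" by simp
 moreover have "int ?z ^ n > 1" using z2 n2 by (intro one_less_power) auto
 ultimately show False by simp
 qed
 ultimately show ?thesis by simp
 qed
 have orbN: "orbit G ?ph x <= N" if x: "x:N" for x
 proof
 fix y assume y: "y:orbit G ?ph x"
 then obtain g where g: "g:carrier G" "y = g \<otimes>\<^bsub>G\<^esub> x \<otimes>\<^bsub>G\<^esub> inv\<^bsub>G\<^esub> g" "y:carrier G" and xG: "x:carrier G"
 using x by (auto simp: orbit_def N_def)
 have "y ~: Z"
 proof
 assume "y:Z"
 hence "y \<otimes>\<^bsub>G\<^esub> g = g \<otimes>\<^bsub>G\<^esub> y" using g(1) by (auto simp: Z_def Cent_def cG)
 hence "g \<otimes>\<^bsub>G\<^esub> x = g \<otimes>\<^bsub>G\<^esub> y"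
 using g xG G.inv_solve_right[of y "g \<otimes>\<^bsub>G\<^esub> x" g] by simp
 hence "x = y" using g xG by simp
 with \<open>y:Z\<close> x show False by (simp add: N_def)
 qed
 with g show "y:N" by (simp add: N_def)
 qed
 have "\<Union>((%x. orbit G ?ph x) ` N) = N"
 proof
 show "\<Union>((%x. orbit G ?ph x) ` N) <= N" using orbN by blast
 show "N <= \<Union>((%x. orbit G ?ph x) ` N)" using A.orbit_refl by (auto simp: N_def)
 qed
 moreover have "nat \<bar>c\<bar> dvd card (\<Union>((%x. orbit G ?ph x) ` N))"
 proof (rule dvd_partition)
 show "finite (\<Union>((%x. orbit G ?ph x) ` N))" using calculation fG by (simp add: N_def)
 show "ALL c1:(%x. orbit G ?ph x) ` N. ALL c2:(%x. orbit G ?ph x) ` N. c1 ~= c2 --> c1 \<inter> c2 = {}"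
 using A.disjoint_union[unfolded orbits_def] by (auto simp: N_def)
 qed (use orb_div in "auto simp: nat_abs_dvd_iff")
 ultimately have "c dvd int (card N)" by (simp add: nat_abs_dvd_iff)
 moreover have "int (card N) = (int ?z ^ n - 1) - (int ?z - 1)"
 proof -
 have "N = carrier G - (Z - {0})" by (auto simp: N_def cG)
 moreover have "Z - {0} <= carrier G" using ZD by (auto simp: cG)
 ultimately have "card N = order G - card (Z - {0})" "card (Z - {0}) <= order G"
 using fG card_Diff_subset[of "Z - {0}" "carrier G"] finite_subset[of "Z - {0}" "carrier G"]
 by (auto simp: order_def intro: card_mono)
 moreover have "int (card (Z - {0})) = int ?z - 1"
 using division_mapsD(1,2)[OF Zd] z2 by (simp add: card_Diff_singleton of_nat_diff)
 ultimately show ?thesis using ordG by (simp add: of_nat_diff)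
 qed
 hence "int ?z - 1 = (int ?z ^ n - 1) - int (card N)" by simp
 ultimately have "c dvd int ?z - 1" using c(1) by (metis dvd_diff)
 hence "\<bar>c\<bar> <= int ?z - 1" using z2 by (intro zdvd_imp_le) auto
 with c(3) show False by simp
 qed
 thus ?thesis using fg by (auto simp: Z_def Cent_def)
qed

section \<open>Finite fields inside an algebraically closed field\<close>

definition char_power::"'f::field itself => nat => bool" where
 "char_power _ q \<longleftrightarrow> CHAR('f) > 0 & (EX r>0. q = CHAR('f) ^ r)"

definition FF::"nat => 'f::field set" where
 "FF q = {x. x ^ q = x}"

lemma char_power_ge_2:
 assumes "char_power TYPE('f::field) q"
 shows "q >= 2"
proof -
 obtain r where r: "r > 0" "q = CHAR('f) ^ r" "CHAR('f) > 0" using assms by (auto simp: char_power_def)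
 have "CHAR('f) >= 2" using prime_CHAR_semidom[OF r(3)] prime_ge_2_nat by blast
 also have "CHAR('f) = CHAR('f) ^ 1" by simp
 also have "... <= CHAR('f) ^ r" using r by (intro power_increasing) auto
 finally show ?thesis using r by simp
qed

lemma char_power_pow:
 assumes "char_power TYPE('f::field) q" "m > 0"
 shows "char_power TYPE('f) (q ^ m)"
proof -
 obtain r where "r > 0" "q = CHAR('f) ^ r" "CHAR('f) > 0" using assms(1) by (auto simp: char_power_def)
 thus ?thesis using assms(2) by (auto simp: char_power_def power_mult[symmetric] intro!: exI[of _ "r * m"])
qed

lemma char_power_add:
 assumes "char_power TYPE('f::field) q"
 shows "(x + y::'f) ^ q = x ^ q + y ^ q"
proof -
 obtain r where r: "q = CHAR('f) ^ r" "CHAR('f) > 0" using assms by (auto simp: char_power_def)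
 show ?thesis by (rule freshmans_dream'[OF prime_CHAR_semidom[OF r(2)] r(1)])
qed

lemma char_power_sum: "char_power TYPE('f::field) q ==> (SUM i:A. f i::'f) ^ q = (SUM i:A. f i ^ q)"
 using char_power_ge_2[where ?'f = 'f and q = q] by (induction A rule: infinite_finite_induct) (auto simp: char_power_add)

lemma char_power_diff:
 assumes "char_power TYPE('f::field) q"
 shows "(x - y::'f) ^ q = x ^ q - y ^ q"
 using char_power_add[OF assms, of "x - y" y] by (simp add: algebra_simps)

lemma char_power_inj:
 assumes "char_power TYPE('f::field) q" "(x::'f) ^ q = y ^ q"
 shows "x = y"
 using char_power_diff[OF assms(1), of x y] assms(2) by (simp)

lemma FF_prod:
 fixes q::nat
 assumes q: "char_power TYPE('f::alg_closed_field) q"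
 shows "finite (FF q::'f set)" "card (FF q::'f set) = q"
 "(pmonom 1 q - pmonom 1 1::'f poly) = (PROD x:FF q. [:- x, 1:])"
proof -
 let ?p = "pmonom 1 q - pmonom 1 1::'f poly"
 have q2: "q >= 2" by (rule char_power_ge_2[OF q])
 have deg: "pdeg ?p = q"
 by (intro antisym degree_le le_degree) (use q2 in "auto simp: coeff_diff")
 have lc: "plead ?p = 1" unfolding deg using q2 by simp
 hence nz: "?p ~= 0" by (metis leading_coeff_0_iff zero_neq_one)
 have root: "poly ?p x = 0 \<longleftrightarrow> x:FF q" for x by (simp add: poly_monom FF_def)
 obtain A where A: "size A = q" "?p = (\<Prod>x\<in>#A. [:- x, 1:])"
 using alg_closed_imp_factorization[OF nz] lc deg by auto
 have "(of_nat q::'f) = 0"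
 using q by (auto simp: char_power_def of_nat_eq_0_iff_char_dvd)
 hence pd: "pderiv ?p = - 1" by (simp add: pderiv_diff pderiv_monom)
 have cnt: "count A x <= 1" for x
 proof (rule ccontr)
 assume "~  count A x <= 1"
 hence "{#x, x#} <=# A" by (intro mset_subset_eqI) auto
 then obtain B where "A = {#x, x#} + B" by (metis subset_mset.le_iff_add)
 hence "?p = [:-x, 1:] * ([:-x, 1:] * (\<Prod>x\<in>#B. [:- x, 1:]))" using A(2) by simp
 hence "poly (pderiv ?p) x = 0" by (simp only: pderiv_mult) simp
 thus False unfolding pd by simp
 qed
 have set: "set_mset A = FF q"
 proof -
 have "poly ?p x = 0 \<longleftrightarrow> x \<in># A" for x by (subst A(2)) (auto simp: poly_prod_mset)
 thus ?thesis using root by blast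
 qed
 thus fin: "finite (FF q::'f set)" by (metis finite_set_mset)
 have "count A x = count (mset_set (FF q)) x" for x
 proof (cases "x \<in># A")
 case True
 hence "count A x = 1" using cnt[of x] by (metis count_greater_zero_iff le_antisym Suc_leI One_nat_def)
 with True set fin show ?thesis by simp
 qed (use set fin in "auto simp: count_eq_zero_iff")
 hence A': "A = mset_set (FF q)" by (rule multiset_eqI)
 show "card (FF q::'f set) = q" using A(1) unfolding A' by simp
 show "?p = (PROD x:FF q. [:- x, 1:])" unfolding A(2) A' prod_unfold_prod_mset ..
qed

lemma FF_fsubfield:
 assumes q: "char_power TYPE('f::alg_closed_field) q"
 shows "fsubfield (FF q::'f set)"
 using FF_prod(1)[OF q] char_power_ge_2[OF q] char_power_diff[OF q]
 by (auto simp: fsubfield_def FF_def power_mult_distrib power_inverse power_0_left)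

lemma FF_mono: "FF q <= FF (q ^ m)"
proof
 fix x::'a assume x: "x:FF q"
 have "x ^ (q ^ m) = x" for m
 by (induction m) (use x in "auto simp: FF_def power_mult mult.commute[of q]")
 thus "x:FF (q ^ m)" by (simp add: FF_def)
qed

lemma finite_group_power:
 assumes "fsubfield L" "x:L"
 shows "x ^ card L = x"
proof (cases "x = 0")
 case False
 note L = fsubfieldD[OF assms(1)]
 let ?U = "L - {0}"
 have b: "bij_betw ((*) x) ?U ?U"
 by (rule bij_betwI[where g = "%y. inverse x * y"])
 (use L(5,6) False assms(2) in "auto simp: mult.assoc[symmetric]")
 have "(PROD y:?U. y) = (PROD y:?U. x * y)" using prod.reindex_bij_betw[OF b, of "%y. y"] by simp
 also have "... = x ^ card ?U * (PROD y:?U. y)" by (simp add: prod.distrib)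
 finally have "x ^ card ?U = 1" using L(1) by (simp add: prod_zero_iff)
 moreover have "card L = Suc (card ?U)" using L(1,2) by (metis card.remove)
 ultimately show ?thesis by simp
qed (use fsubfieldD(1,2)[OF assms(1)] in "auto simp: zero_power card_gt_0_iff")

lemma fsubfield_eq_FF:
 assumes "fsubfield (L::'f::alg_closed_field set)" "char_power TYPE('f) (card L)"
 shows "L = FF (card L)"
 by (rule card_subset_eq[OF FF_prod(1)[OF assms(2)]])
 (use finite_group_power[OF assms(1)] FF_prod(2)[OF assms(2)] in "auto simp: FF_def")

lemma FF_generator:
 assumes q: "char_power TYPE('f::alg_closed_field) q"
 obtains g::"'f::alg_closed_field" where "g:FF q" "!!x. x:FF q ==> x = 0 | (EX i::nat. x = g ^ i)"
proof -
 define R::"'f ring" where "R = \<lparr>carrier = FF q, monoid.mult = (*), one = 1, ring.zero = 0, add = (+)\<rparr>"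
 have R: "carrier R = FF q" "!!x y. x \<otimes>\<^bsub>R\<^esub> y = x * y" "\<one>\<^bsub>R\<^esub> = 1" "\<zero>\<^bsub>R\<^esub> = 0" "!!x y. x \<oplus>\<^bsub>R\<^esub> y = x + y"
 by (simp_all add: R_def)
 note k = fsubfieldD[OF FF_fsubfield[OF q]]
 have cr: "cring R"
 proof (rule cringI)
 show "abelian_group R"
 by (rule abelian_groupI) (use k(2,7,8) in \<open>auto simp: R add_ac intro: bexI[of _ "- _"]\<close>)
 show "Group.comm_monoid R" by (rule comm_monoidI) (use k in "auto simp: R mult_ac")
 qed (auto simp: R algebra_simps)
 interpret R: Ring.field R
 proof (rule cring.cring_fieldI2[OF cr])
 fix a assume "a:carrier R" "a ~= \<zero>\<^bsub>R\<^esub>"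
 thus "EX b:carrier R. a \<otimes>\<^bsub>R\<^esub> b = \<one>\<^bsub>R\<^esub>" using k(6) by (auto simp: R intro!: bexI[of _ "inverse a"])
 qed (simp add: R)
 have pow: "a [^]\<^bsub>R\<^esub> (i::nat) = a ^ i" for a i
 by (induction i) (simp_all add: R mult.commute)
 have "finite (carrier R)" using k(1) by (simp add: R)
 from R.finite_field_mult_group_has_gen[OF this] obtain g where g: "g:carrier (Multiplicative_Group.mult_of R)"
 "carrier (Multiplicative_Group.mult_of R) = {g [^]\<^bsub>R\<^esub> i | i::nat. i:UNIV}"
 by (elim bexE) (rule that)
 have "x = 0 | (EX i::nat. x = g ^ i)" if "x:FF q" for x
 proof (cases "x = 0")
 case False
 hence "x:carrier (Multiplicative_Group.mult_of R)" using that by (simp add: R Multiplicative_Group.carrier_mult_of)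
 hence "x:{g ^ i | i::nat. i:UNIV}" using g(2) unfolding pow by blast
 thus ?thesis by blast
 qed simp
 thus thesis using that[of g] g(1) by (simp add: R Multiplicative_Group.carrier_mult_of)
qed

text \<open>The image of a generator is a root of the product of the \<open>X - g^(q^j)\<close>, which has coefficients in FF q.\<close>

lemma FF_automorphism:
 fixes si::"'f::alg_closed_field => 'f::alg_closed_field"
 assumes q: "char_power TYPE('f::alg_closed_field) q" and d: "d > 0"
 and hom: "!!x y. x:FF (q ^ d) ==> y:FF (q ^ d) ==> si (x + y) = si x + si y"
 "!!x y. x:FF (q ^ d) ==> y:FF (q ^ d) ==> si (x * y) = si x * si y"
 and fixk: "!!x. x:FF q ==> si x = x"
 obtains j where "j < d" "!!x. x:FF (q ^ d) ==> si x = x ^ (q ^ j)"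
proof -
 let ?K = "FF (q ^ d)::'f set"
 note qd = char_power_pow[OF q d]
 note K = fsubfieldD[OF FF_fsubfield[OF qd]]
 have k1: "(0::'f):FF q" "(1::'f):FF q" using fsubfieldD[OF FF_fsubfield[OF q]] by auto
 obtain g::'f where g: "g:?K" "!!x. x:?K ==> x = 0 | (EX i::nat. x = g ^ i)"
 using FF_generator[OF qd] by blast
 have Kpow: "x ^ i:?K" if "x:?K" for x i using that K by (induction i) auto
 have sipow: "si (x ^ i) = si x ^ i" if "x:?K" for x i
 by (induction i) (use that hom(2) Kpow fixk[OF k1(2)] in auto)
 define P where "P = (PROD j<d. [:- (g ^ (q ^ j)), 1:])"
 let ?F = "map_poly (%x::'f. x ^ q)"
 have q0: "q > 0" using char_power_ge_2[OF q] by simp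
 have Fm: "?F (a * b) = ?F a * ?F b" for a b
 by (rule poly_eqI) (simp add: coeff_map_poly coeff_mult char_power_sum[OF q] power_mult_distrib q0)
 have F1: "?F 1 = 1" by (rule poly_eqI) (simp add: coeff_map_poly q0)
 have "?F P = (PROD j<d. ?F [:- (g ^ (q ^ j)), 1:])"
 unfolding P_def by (induction d) (simp_all add: Fm F1 del: mult_pCons_left mult_pCons_right)
 also have "... = (PROD j<d. [:- (g ^ (q ^ Suc j)), 1:])"
 proof (rule prod.cong[OF refl])
 fix j
 have "(- y) ^ q = - (y ^ q)" for y::'f using char_power_diff[OF q, of 0 y] q0 by simp
 thus "?F [:- (g ^ (q ^ j)), 1:] = [:- (g ^ (q ^ Suc j)), 1:]"
 by (simp add: map_poly_pCons q0 power_mult[symmetric] mult.commute)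
 qed
 also have "... = P"
 proof -
 define f where "f j = [:- (g ^ (q ^ j)), 1:]" for j
 have f0: "f d = f 0" "f 0 ~= 0" using g(1) by (simp_all add: FF_def f_def)
 have "f 0 * (PROD j<d. f (Suc j)) = (PROD j<Suc d. f j)" by (rule prod.lessThan_Suc_shift[symmetric])
 also have "... = P * f 0" by (simp only: prod.lessThan_Suc f0) (simp add: P_def f_def)
 finally have "(PROD j<d. f (Suc j)) = P" using f0(2) by (simp only: mult.commute[of P] mult_cancel_left) simp
 thus ?thesis by (simp only: f_def)
 qed
 finally have "?F P = P" .
 moreover have "pcoeff (?F P) i = pcoeff P i ^ q" for i
 by (simp add: coeff_map_poly q0)
 ultimately have Pk: "pcoeff P i:FF q" for i by (simp add: FF_def)
 have kK: "FF q <= ?K" by (rule FF_mono)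
 have ev: "si (poly R g) = poly R (si g) & poly R g:?K" if "!!i. pcoeff R i:FF q" for R
 using that
 proof (induction R)
 case 0
 thus ?case using fixk[OF k1(1)] K(2) by simp
 next
 case (pCons a R)
 have a: "a:FF q" using pCons.prems[of 0] by simp
 have R: "pcoeff R i:FF q" for i using pCons.prems[of "Suc i"] by simp
 note IH = pCons.IH[OF R]
 have aK: "a:?K" using a kK by auto
 have gR: "g * poly R g:?K" using g(1) IH K(5) by blast
 show ?case using IH hom(1)[OF aK gR] hom(2)[OF g(1)] fixk[OF a] K(7)[OF aK gR] by simp
 qed
 have "poly P g = 0" using d by (auto simp: P_def poly_prod intro!: prod_zero bexI[of _ 0])
 hence "poly P (si g) = 0" using ev[of P] Pk fixk[OF k1(1)] by simp
 then obtain j where j: "j < d" "si g = g ^ (q ^ j)" by (auto simp: P_def poly_prod prod_zero_iff)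
 have "si x = x ^ (q ^ j)" if "x:?K" for x
 proof (cases "x = 0")
 case False
 then obtain i where "x = g ^ i" using g(2)[OF \<open>x:?K\<close>] by blast
 thus ?thesis using sipow[OF g(1), of i] j(2) by (simp add: power_mult[symmetric] mult.commute)
 qed (use fixk[OF k1(1)] q0 in simp)
 with j(1) that show thesis by blast
qed

section \<open>Simple representations over an extension field\<close>

lemma ophom_division_maps:
 assumes S: "simple_mod P A V" and A: "additive_action A" and fin: "finite V"
 shows "division_maps (idon V) (ophom P A V A V)"
 unfolding division_maps_def
proof (intro conjI ballI impI)
 note sV = simple_submod[OF S]
 show "finite (ophom P A V A V)" by (intro finite_ophom fin)
 show "0:ophom P A V A V" by (rule ophom_zero[OF sV A])
 show e: "idon V:ophom P A V A V" by (rule idon_ophom[OF sV order_refl])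
 show "idon V ~= 0"
 proof
 assume z: "idon V = 0"
 have "v = 0" if "v:V" for v using fun_cong[OF z, of v] that by (simp add: idon_def)
 thus False using S submodD(1)[OF sV] by (auto simp: simple_mod_def)
 qed
 fix f assume f: "f:ophom P A V A V"
 show "f o idon V = f" "idon V o f = f"
 by (rule ophom_eqI[OF ophom_comp[OF e f] f], simp add: idon_def)
 (rule ophom_eqI[OF ophom_comp[OF f e] f], simp add: idon_def ophomD(2)[OF f])
 {
 fix g assume g: "g:ophom P A V A V"
 show "f - g:ophom P A V A V" by (rule ophom_diff[OF f g sV A])
 show "f o g:ophom P A V A V" by (rule ophom_comp[OF g f])
 fix h assume h: "h:ophom P A V A V"
 show "f o (g + h) = (f o g) + (f o h)"
 proof (rule ext)
 fix x
 show "(f o (g + h)) x = ((f o g) + (f o h)) x"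
 by (cases "x:V") (simp_all add: ophomD(3)[OF f] ophomD(2)[OF g] ophomD(2)[OF h]
 ophomD(1)[OF g] ophomD(1)[OF h] ophom_zero_at[OF f])
 qed
 }
 assume nz: "f ~= 0"
 note b = simple_ophom_bij[OF S S f A nz]
 note h = hinv_ophom[OF f b sV]
 have "f o hinv V f V = idon V"
 by (rule ophom_eqI[OF ophom_comp[OF h(1) f] e]) (simp add: idon_def h(3))
 moreover have "hinv V f V o f = idon V"
 by (rule ophom_eqI[OF ophom_comp[OF f h(1)] e]) (simp add: idon_def h(2))
 ultimately show "EX g:ophom P A V A V. f o g = idon V & g o f = idon V" using h(1) by blast
qed

definition scal::"'f::times => ('i, 'f) gvec => ('i, 'f) gvec" where
 "scal t v = (%i a. t * v i a)"

lemma rep_act_scal: "rep_act Q al M (Scal t) = scal t"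
 by (simp add: fun_eq_iff rep_act_simps scal_def)

lemma scal_simps:
 "scal t (v + w) = scal t v + scal t w" "scal (s + t) v = scal s v + scal t v"
 "scal (s * t) v = scal s (scal t v)" "scal 1 v = v" "scal 0 v = 0" "scal t 0 = 0"
 for s t::"'f::field"
 by (simp_all add: scal_def fun_eq_iff algebra_simps)

lemma scal_eq_iff: "scal s v = scal t v \<longleftrightarrow> s = t | v = 0" for s t::"'f::field"
 by (auto simp: scal_def fun_eq_iff)

definition ev_poly::"('v => 'v) => ('f => 'v => 'v) => 'f::field poly => 'v => 'v::ab_group_add" where
 "ev_poly R sc p f = (SUM i<=pdeg p. sc (pcoeff p i) ((R ^^ i) f))"

lemma ev_poly_bound:
 assumes "!!v. sc 0 v = 0" "pdeg p <= n"
 shows "ev_poly R sc p f = (SUM i<=n. sc (pcoeff p i) ((R ^^ i) f))"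
 unfolding ev_poly_def using assms by (intro sum.mono_neutral_left) (auto simp: coeff_eq_0)

lemma ev_poly_linear_factor:
 assumes sc: "!!v. sc 0 v = 0" "!!s t v. sc (s + t) v = sc s v + sc t v" "!!s t v. sc (s * t) v = sc s (sc t v)"
 "!!t v w. sc t (v + w) = sc t v + sc t w"
 and R: "!!v w. R (v + w) = R v + R w" "!!t v. R (sc t v) = sc t (R v)"
 shows "ev_poly R sc ([:- c, 1:] * p) f = R (ev_poly R sc p f) - sc c (ev_poly R sc p f)"
proof -
 let ?n = "pdeg p"
 have R0: "R 0 = 0" using R(1)[of 0 0] by simp
 have sc0: "sc t 0 = 0" for t using sc(4)[of t 0 0] by simp
 have Rsum: "R (SUM i:I. g i) = (SUM i:I. R (g i))" for g::"nat => _" and I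
 by (induction I rule: infinite_finite_induct) (auto simp: R0 R(1))
 have scsum: "sc t (SUM i:I. g i) = (SUM i:I. sc t (g i))" for t and g::"nat => _" and I
 by (induction I rule: infinite_finite_induct) (auto simp: sc0 sc(4))
 have scm: "sc (- t) v = - sc t v" for t v using sc(2)[of t "- t" v] sc(1) by (simp add: eq_neg_iff_add_eq_0 add.commute)
 have scd: "sc (s - t) v = sc s v - sc t v" for s t v using sc(2)[of s "- t" v] scm by simp
 have "pdeg ([:- c, 1:] * p) <= Suc ?n"
 using degree_mult_le[of "[:- c, 1:]" p] by simp
 hence "ev_poly R sc ([:- c, 1:] * p) f = (SUM i<=Suc ?n. sc (pcoeff ([:- c, 1:] * p) i) ((R ^^ i) f))"
 by (rule ev_poly_bound[of sc, OF sc(1)])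
 also have "... = (SUM i<=Suc ?n. - sc c (sc (pcoeff p i) ((R ^^ i) f)) +
 (case i of 0 => 0 | Suc j => sc (pcoeff p j) ((R ^^ i) f)))"
 by (rule sum.cong[OF refl]) (simp add: coeff_pCons scd scm sc(1,3) split: nat.split)
 also have "... = - (SUM i<=Suc ?n. sc c (sc (pcoeff p i) ((R ^^ i) f))) +
 (SUM i<=Suc ?n. case i of 0 => 0 | Suc j => sc (pcoeff p j) ((R ^^ i) f))"
 by (simp only: sum.distrib sum_negf)
 also have "(SUM i<=Suc ?n. case i of 0 => 0 | Suc j => sc (pcoeff p j) ((R ^^ i) f)) =
 (SUM j<=?n. R (sc (pcoeff p j) ((R ^^ j) f)))"
 unfolding sum.atMost_Suc_shift by (simp add: R(2))
 also have "(SUM i<=Suc ?n. sc c (sc (pcoeff p i) ((R ^^ i) f))) = sc c (ev_poly R sc p f)"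
 by (subst ev_poly_bound[of sc p "Suc ?n" R f, OF sc(1)]) (simp_all only: scsum le_SucI order_refl)
 also have "(SUM j<=?n. R (sc (pcoeff p j) ((R ^^ j) f))) = R (ev_poly R sc p f)"
 by (simp add: ev_poly_def Rsum)
 finally show ?thesis by simp
qed

text \<open>Apply the linear factors one after another: the last nonzero vector is an eigenvector.\<close>

lemma eigenvector_exists:
 assumes sc: "!!v. sc 0 v = 0" "!!s t v. sc (s + t) v = sc s v + sc t v" "!!s t v. sc (s * t) v = sc s (sc t v)"
 "!!t v w. sc t (v + w) = sc t v + sc t w" "!!v. sc 1 v = v"
 and R: "!!v w. R (v + w) = R v + R w" "!!t v. R (sc t v) = sc t (R v)"
 and H: "!!v w. v:H ==> w:H ==> v - w:H" "!!t v. t:L ==> v:H ==> sc t v:H" "!!v. v:H ==> R v:H"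
 and A: "set_mset A <= (L::'f::field set)" "ev_poly R sc (\<Prod>x\<in>#A. [:- x, 1:]) f = 0" "f:H" "f ~= 0"
 obtains g x where "x:L" "g:H" "g ~= 0" "R g = sc x g"
proof -
 have "(EX x:L. EX g:H. g ~= 0 & R g = sc x g) | (ev_poly R sc (\<Prod>x\<in>#A. [:- x, 1:]) f ~= 0 & ev_poly R sc (\<Prod>x\<in>#A. [:- x, 1:]) f:H)"
 using A(1)
 proof (induction A)
 case empty
 have "ev_poly R sc 1 f = f" by (simp add: ev_poly_def sc(5))
 thus ?case using A(3,4) by simp
 next
 case (add x A)
 let ?g = "ev_poly R sc (\<Prod>x\<in>#A. [:- x, 1:]) f"
 have step: "ev_poly R sc (\<Prod>x\<in>#add_mset x A. [:- x, 1:]) f = R ?g - sc x ?g"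
 using ev_poly_linear_factor[of sc R x, OF sc(1-4) R] by (simp del: mult_pCons_left)
 from add have x: "x:L" and "set_mset A <= L" by auto
 with add.IH consider "EX x:L. EX g:H. g ~= 0 & R g = sc x g" | "?g ~= 0" "?g:H" by blast
 thus ?case
 proof cases
 case 2
 show ?thesis
 proof (cases "R ?g = sc x ?g")
 case True
 with 2 x show ?thesis by blast
 next
 case False
 hence "R ?g - sc x ?g ~= 0" by simp
 moreover have "R ?g - sc x ?g:H" by (intro H 2 x)
 ultimately show ?thesis unfolding step by simp
 qed
 qed simp
 qed
 with A(2) that show thesis by blast
qed

definition end_deg::"('i, 'h) pre_digraph => nat => 'i dimvec \<times> ('h, 'f::field) mats_fam => nat" where
 "end_deg Q q s = (SOME d. end_card Q (FF q) s = q ^ d)"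

text \<open>A simple representation S over the small field together with a simple T over the extension of degree m in which S occurs. H is the space of
homomorphisms over the small field from S to T, on which K acts through T and \<open>D = End(S)\<close> through S; E is End(T).\<close>

locale ext_rep =
 fixes Q::"('i, 'h) pre_digraph" and q m::nat and si ta::"'i dimvec"
 and S T::"('h, 'f::alg_closed_field) mats_fam"
 assumes q: "char_power TYPE('f) q" and m: "m > 0"
 and S: "S:reps Q (FF q) si" "simple_rep Q (FF q) si S"
 and T: "T:reps Q (FF (q ^ m)) ta" "simple_rep Q (FF (q ^ m)) ta T"
 and nonzero_hom: "EX f. f:ophom (ops (FF q)) (rep_act Q si S) (vspace (FF q) si)
 (rep_act Q ta T) (vspace (FF (q ^ m)) ta) & f ~= 0"
begin

abbreviation "k \<equiv> FF q::'f set"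
abbreviation "K \<equiv> FF (q ^ m)::'f set"
abbreviation "V \<equiv> vspace k si::('i, 'f) gvec set"
abbreviation "W \<equiv> vspace K ta::('i, 'f) gvec set"
abbreviation "A \<equiv> rep_act Q si S"
abbreviation "B \<equiv> rep_act Q ta T"
abbreviation "D \<equiv> ophom (ops k) A V A V"
abbreviation "H \<equiv> ophom (ops k) A V B W"
abbreviation "E \<equiv> ophom (ops K) B W B W"

lemma k: "fsubfield k" and K: "fsubfield K" "k <= K"
 using FF_fsubfield[OF q] FF_fsubfield[OF char_power_pow[OF q m]] FF_mono by auto

lemma card_k: "card k = q" and card_K: "card K = q ^ m" and q2: "q >= 2"
 using FF_prod(2)[OF q] FF_prod(2)[OF char_power_pow[OF q m]] char_power_ge_2[OF q] by auto

lemma finV: "finite V" and finW: "finite W"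
 using finite_vspace fsubfieldD(1)[OF k] fsubfieldD(1)[OF K(1)] by auto

lemma sV: "submod (ops k) A V" and sW: "submod (ops K) B W" and sWk: "submod (ops k) B W"
 by (rule vspace_submod[OF k order_refl S(1)] vspace_submod[OF K(1) order_refl T(1)] vspace_submod[OF K T(1)])+

lemma D_division: "division_maps (idon V) D"
 by (rule ophom_division_maps[OF S(2) add_rep finV])

lemma D_comm: "th:D ==> th':D ==> th o th' = th' o th"
 by (rule wedderburn[OF D_division])

lemma rep_act_scal_commute: "rep_act Q al M c (scal t v) = scal t (rep_act Q al M c v)"
 by (cases c) (auto simp: rep_act_simps scal_def fun_eq_iff sum_distrib_left mult_ac)

lemma scal_in_W: "c:K ==> w:W ==> scal c w:W"
 using submodD(5)[OF sW, of "Scal c"] by (simp add: ops_def rep_act_scal)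

lemma scal_H: assumes "c:K" "f:H" shows "scal c o f:H"
 by (rule ophomI) (use ophomD[OF assms(2)] scal_in_W[OF assms(1)] in
 \<open>auto simp: scal_simps rep_act_scal_commute\<close>)

definition kscal::"'f => ('i, 'f) gvec => ('i, 'f) gvec" where
 "kscal t v = (if v:V then scal t v else 0)"

lemma kscal_D: assumes "t:k" shows "kscal t:D"
proof (rule ophomI)
 have *: "scal t v:V" if "v:V" for v
 using submodD(5)[OF sV, of "Scal t"] that assms by (simp add: ops_def rep_act_scal)
 thus "v:V ==> kscal t v:V" for v by (simp add: kscal_def)
 show "kscal t (x + y) = kscal t x + kscal t y" if "x:V" "y:V" for x y
 using that submodD(3)[OF sV that] by (simp add: kscal_def scal_simps)
 show "kscal t (A c x) = A c (kscal t x)" if "c:ops k" "x:V" for c x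
 using that submodD(5)[OF sV that] by (simp add: kscal_def rep_act_scal_commute)
qed (simp add: kscal_def)

lemma V_nonzero: obtains v where "v:V" "v ~= 0"
 using S(2) submodD(1)[OF sV] by (auto simp: simple_mod_def)

lemma card_D_power: obtains d where "card D = q ^ d"
proof -
 have sc: "kscal s - kscal t = kscal (s - t)" "kscal 0 = 0" "kscal 1 = idon V" for s t
 by (auto simp: kscal_def fun_eq_iff scal_def idon_def algebra_simps)
 have mul: "kscal s o kscal t = kscal (s * t)" if "t:k" for s t
 using ophomD(2)[OF kscal_D[OF that]] by (auto simp: kscal_def fun_eq_iff scal_def mult.assoc)
 have inj: "kscal s = kscal t ==> s = t" for s t
 proof -
 assume e: "kscal s = kscal t"
 obtain v where v: "v:V" "v ~= 0" using V_nonzero .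
 from fun_cong[OF e, of v] v show "s = t" by (simp add: kscal_def scal_eq_iff)
 qed
 note kk = fsubfieldD[OF k] and d = division_mapsD[OF D_division]
 have "division_maps (idon V) (kscal ` k)"
 unfolding division_maps_def
 proof (intro conjI ballI impI)
 show "finite (kscal ` k)" using kk by simp
 show "0:kscal ` k" "idon V:kscal ` k" using sc(2,3) kk by (metis imageI)+
 show "idon V ~= 0" by (rule d(4))
 fix f assume "f:kscal ` k"
 then obtain s where s: "s:k" "f = kscal s" by blast
 have fD: "f:D" using s kscal_D by simp
 show "f o idon V = f" "idon V o f = f" using d(7,8)[OF fD] by auto
 {
 fix g assume "g:kscal ` k"
 then obtain t where t: "t:k" "g = kscal t" by blast
 show "f - g:kscal ` k" "f o g:kscal ` k" using s t kk(4,5) by (auto simp: sc mul)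
 fix h assume "h:kscal ` k"
 thus "f o (g + h) = (f o g) + (f o h)" using d(9)[OF fD] t kscal_D by auto
 }
 assume "f ~= 0"
 hence "s ~= 0" using s sc by auto
 thus "EX g:kscal ` k. f o g = idon V & g o f = idon V"
 using s kk(6)[OF s(1)] by (intro bexI[of _ "kscal (inverse s)"]) (auto simp: mul sc)
 qed
 moreover have "kscal ` k <= D" using kscal_D by auto
 ultimately obtain d where "card D = card (kscal ` k) ^ d" using division_maps_card_power[OF _ D_division] by blast
 moreover have "card (kscal ` k) = q" using inj by (metis card_image card_k inj_onI)
 ultimately show thesis using that by simp
qed

abbreviation "d \<equiv> end_deg Q q (si, S)"

lemma card_D: "card D = q ^ d"
 unfolding end_deg_def end_card_def fst_conv snd_conv by (rule someI_ex) (use card_D_power in blast)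

lemma card_D_gt_1: "card D > 1"
 using end_card_gt_1[OF k S] by (simp add: end_card_def)

lemma d_pos: "d > 0" using card_D_gt_1 card_D by (cases d) auto

text \<open>H is an irreducible bimodule over K and D: a sub-bimodule corresponds to a subrepresentation of T over the large field.\<close>

lemma gen:
 assumes G: "G <= H" "0:G" "!!f g. f:G ==> g:G ==> f + g:G"
 "!!f th. f:G ==> th:D ==> f o th:G" "!!f c. f:G ==> c:K ==> scal c o f:G"
 and nz: "f0:G" "f0 ~= 0"
 shows "G = H" "EX n. isotypic (ops k) A V B W W n"
proof -
 note [simp] = add_rep
 obtain U n where U: "isotypic (ops k) A V B W U n" "ophom (ops k) A V B U = G"
 using isotypic_of_homs[OF S(2) sWk add_rep add_rep finW G(1-4)] by blast
 have sU: "submod (ops k) B U" "U <= W" using isotypic_submod[OF S(2) sWk add_rep add_rep U(1)] by auto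
 have "scal c u:U" if c: "c:K" and u: "u:U" for c u
 proof -
 have "U <= {u. scal c u:U}"
 proof (rule isotypic_span[OF S(2) sWk add_rep add_rep U(1)])
 fix f s assume f: "f:ophom (ops k) A V B U" and s: "s:V"
 have "scal c o f:ophom (ops k) A V B U" using G(5)[OF _ c] f unfolding U(2) .
 from ophomD(2)[OF this s] show "f s:{u. scal c u:U}" by simp
 qed (use submodD[OF sU(1)] in "auto simp: scal_simps")
 with u show ?thesis by blast
 qed
 hence "submod (ops K) B U"
 using sU(1) by (auto simp: submod_def ops_def rep_act_scal)
 moreover have "U ~= {0}"
 proof
 assume "U = {0}"
 hence f: "f0:ophom (ops k) A V B {0}" using nz(1) U(2) by simp
 have "f0 = 0" using ophomD(1,2)[OF f] by (intro ext) (metis singletonD zero_fun_def)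
 with nz(2) show False by simp
 qed
 ultimately have "U = W" using T(2) sU(2) by (auto simp: simple_mod_def)
 with U show "G = H" "EX n. isotypic (ops k) A V B W W n" by auto
qed

lemma H_closed: "0:H" "f:H ==> g:H ==> f + g:H" "f:H ==> g:H ==> f - g:H"
 "f:H ==> th:D ==> f o th:H"
 using ophom_zero[OF sWk] ophom_add[OF _ _ sWk] ophom_diff[OF _ _ sWk] ophom_comp by auto

lemma W_isotypic: obtains n where "isotypic (ops k) A V B W W n"
 using nonzero_hom gen(2)[OF order_refl H_closed(1,2,4) scal_H] by blast

lemma span_W:
 assumes "0:Y" "!!x y. x:Y ==> y:Y ==> x + y:Y" "!!f s. f:H ==> s:V ==> f s:Y"
 shows "W <= Y"
proof -
 obtain n where n: "isotypic (ops k) A V B W W n" using W_isotypic .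
 show ?thesis
 by (rule isotypic_span[OF S(2) sWk add_rep add_rep n]) (use assms in auto)
qed

text \<open>Each endomorphism of S acts on H as a scalar of K. It follows both if K is large enough to contain D and if T is absolutely simple.\<close>

definition eig::bool where
 "eig \<longleftrightarrow> (ALL th:D. EX c:K. ALL f:H. f o th = scal c o f)"

text \<open>Precomposition with th satisfies \<open>R^(q^d) = R\<close> and so has an eigenvalue in \<open>FF (q^d)\<close>, contained in K. As D is commutative,
the eigenspace is a sub-bimodule of H, hence all of it.\<close>

lemma eig_if_dvd:
 assumes "d dvd m"
 shows eig
 unfolding eig_def
proof
 fix th assume t: "th:D"
 show "EX c:K. ALL f:H. f o th = scal c o f"
 proof (cases "th = 0")
 case True
 have "f o th = scal 0 o f" if "f:H" for f
 by (rule ext) (simp add: True ophom_zero_at[OF that] scal_simps)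
 thus ?thesis using fsubfieldD(2)[OF K(1)] by blast
 next
 case False
 define R where "R = (%f::('i, 'f) gvec => ('i, 'f) gvec. f o th)"
 define sc where "sc = (%c (f::('i, 'f) gvec => ('i, 'f) gvec). scal c o f)"
 let ?N = "q ^ d"
 have N: "?N > 1" using card_D card_D_gt_1 by simp
 note cp = char_power_pow[OF q d_pos]
 obtain f0 where f0: "f0:H" "f0 ~= 0" using nonzero_hom by blast
 have "idon V:D" by (rule division_mapsD(3)[OF D_division])
 hence "f0 o idon V = f0"
 by (intro ophom_eqI[OF H_closed(4)[OF f0(1)] f0(1)]) (simp_all add: idon_def)
 from division_maps_pow[OF D_division t False this] have "(R ^^ (?N - 1)) f0 = f0"
 by (simp add: R_def card_D)
 hence RN: "(R ^^ ?N) f0 = R f0" using N by (cases ?N) auto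
 have sub: "FF ?N <= K"
 proof -
 from assms obtain e where "m = d * e" ..
 thus ?thesis using FF_mono[of ?N e] by (simp add: power_mult)
 qed
 (* The roots of X^N - X are the elements of FF N, all in K. *)
 let ?p = "pmonom 1 ?N - pmonom 1 1::'f poly"
 have sc: "sc 0 v = 0" "sc (s + t) v = sc s v + sc t v" "sc (s * t) v = sc s (sc t v)" "sc t (v + w) = sc t v + sc t w" "sc 1 v = v"
 "R (v + w) = R v + R w" "R (sc t v) = sc t (R v)" for s t v w
 by (simp_all add: sc_def R_def fun_eq_iff scal_simps)
 have "pdeg ?p <= ?N" by (intro degree_diff_le order_trans[OF degree_monom_le]) (use N in auto)
 hence "ev_poly R sc ?p f0 = (SUM i<=?N. sc (pcoeff ?p i) ((R ^^ i) f0))"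
 by (rule ev_poly_bound[of sc, OF sc(1)])
 also have "... = (SUM i<=?N. (if i = ?N then (R ^^ ?N) f0 else 0) - (if i = 1 then R f0 else 0))"
 proof (rule sum.cong[OF refl])
 have m1: "sc (- 1) v = - v" for v by (simp add: sc_def fun_eq_iff scal_def)
 fix i show "sc (pcoeff ?p i) ((R ^^ i) f0) = (if i = ?N then (R ^^ ?N) f0 else 0) - (if i = 1 then R f0 else 0)"
 using N by (cases "i = ?N"; cases "i = 1") (auto simp: sc m1)
 qed
 also have "... = 0" using N by (simp add: sum_subtractf RN)
 finally have ev: "ev_poly R sc (\<Prod>x\<in>#mset_set (FF ?N). [:- x, 1:]) f0 = 0"
 unfolding FF_prod(3)[OF cp] prod_unfold_prod_mset .
 obtain g x where g: "x:K" "g:H" "g ~= 0" "R g = sc x g"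
 proof (rule eigenvector_exists[of sc R H K "mset_set (FF ?N)" f0])
 show "set_mset (mset_set (FF ?N)) <= K" using sub FF_prod(1)[OF cp] by simp
 qed (use sc ev f0 H_closed(3) scal_H H_closed(4)[OF _ t] in "auto simp: sc_def R_def")
 let ?G = "{f:H. f o th = scal x o f}"
 have "?G = H"
 proof (rule gen(1)[of ?G g])
 show "f + h:?G" if "f:?G" "h:?G" for f h
 using that H_closed(2) by (auto simp: fun_eq_iff scal_simps)
 show "f o th':?G" if "f:?G" "th':D" for f th'
 using that H_closed(4) D_comm[OF t that(2)] by (auto simp: comp_assoc) (metis comp_assoc)
 show "scal c o f:?G" if "f:?G" "c:K" for f c
 using that scal_H by (auto simp: fun_eq_iff scal_def mult_ac)
 show "0:?G" using H_closed(1) by (auto simp: fun_eq_iff scal_simps)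
 show "g:?G" using g by (simp add: R_def sc_def)
 qed (use g in auto)
 with g(1) show ?thesis by blast
 qed
qed

definition Kscal::"'f => ('i, 'f) gvec => ('i, 'f) gvec" where
 "Kscal t v = (if v:W then scal t v else 0)"

lemma Kscal_E: assumes "t:K" shows "Kscal t:E"
proof (rule ophomI)
 show "v:W ==> Kscal t v:W" for v using scal_in_W[OF assms] by (simp add: Kscal_def)
 show "Kscal t (x + y) = Kscal t x + Kscal t y" if "x:W" "y:W" for x y
 using that submodD(3)[OF sW that] by (simp add: Kscal_def scal_simps)
 show "Kscal t (B c x) = B c (Kscal t x)" if "c:ops K" "x:W" for c x
 using that submodD(5)[OF sW that] by (simp add: Kscal_def rep_act_scal_commute)
qed (simp add: Kscal_def)

lemma card_Kscal: "card (Kscal ` K) = q ^ m" and Kscal_sub: "Kscal ` K <= E"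
proof -
 obtain w where w: "w:W" "w ~= 0" using T(2) submodD(1)[OF sW] by (auto simp: simple_mod_def)
 have "inj_on Kscal K"
 proof (rule inj_onI)
 fix s t assume "Kscal s = Kscal t"
 from fun_cong[OF this, of w] w show "s = t" by (simp add: Kscal_def scal_eq_iff)
 qed
 thus "card (Kscal ` K) = q ^ m" using card_K by (simp add: card_image)
 show "Kscal ` K <= E" using Kscal_E by auto
qed

text \<open>T is over the small field a sum of copies of S, and th acting on all copies at once gives a K-linear endomorphism of T because D is commutative. All
these are scalars here.\<close>

lemma eig_if_end:
 assumes "card E = q ^ m"
 shows eig
 unfolding eig_def
proof
 fix th assume t: "th:D"
 have EK: "E = Kscal ` K"
 using card_subset_eq[OF finite_ophom[OF finW finW] Kscal_sub] assms card_Kscal by simp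
 obtain n where n: "isotypic (ops k) A V B W W n" using W_isotypic .
 (* th acting diagonally on the copies of V that make up U. *)
 have "EX ps:ophom (ops k) B U B W. ALL f:ophom (ops k) A V B U. ps o f = f o th"
 if "isotypic (ops k) A V B W U n" for U n
 using that
 proof (induction rule: isotypic.induct)
 case isotypic_zero
 have "0 o f = f o th" if f: "f:ophom (ops k) A V B {0}" for f
 proof -
 have "f = 0" using ophomD(1,2)[OF f] by (intro ext) (metis singletonD zero_fun_def)
 thus ?thesis by (simp add: fun_eq_iff)
 qed
 thus ?case using ophom_zero[OF sWk add_rep, of B "{0}"] by blast
 next
 case (isotypic_adjoin U n g)
 then obtain ps where ps: "ps:ophom (ops k) B U B W" "!!f. f:ophom (ops k) A V B U ==> ps o f = f o th" by blast
 have sU: "submod (ops k) B U" using isotypic_submod[OF S(2) sWk add_rep add_rep isotypic_adjoin(1)] by simp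
 note ind = isotypic_indep[OF S(2) sWk add_rep add_rep isotypic_adjoin(1-3)]
 have gt: "g o th:H" using H_closed(4) isotypic_adjoin(2) t by simp
 obtain ph where ph: "ph:ophom (ops k) B (adjoin U g V) B W" "!!x. x:U ==> ph x = ps x"
 "!!s. s:V ==> ph (g s) = (g o th) s"
 using ophom_from_adjoin[OF sU sV isotypic_adjoin(2) add_rep ind add_rep sWk ps(1) gt] by blast
 note adj = adjoin_submod[OF sU sV isotypic_adjoin(2) add_rep]
 have "ph o f = f o th" if f: "f:ophom (ops k) A V B (adjoin U g V)" for f
 proof -
 have "f:(%(u, de). u + (g o de)) ` (ophom (ops k) A V B U \<times> D)"
 using ophom_into_adjoin[OF sU sV isotypic_adjoin(2) add_rep ind add_rep, of A V] f
 by (simp add: bij_betw_def)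
 then obtain u de where u: "u:ophom (ops k) A V B U" and dl: "de:D" and fe: "f = u + (g o de)" by auto
 show ?thesis
 proof (rule ophom_eqI[OF ophom_comp[OF f ph(1)] ophom_comp[OF t f]])
 fix s assume s: "s:V"
 have us: "u s:adjoin U g V" using ophomD(2)[OF u s] adj(2) by auto
 have gs: "g (de s):adjoin U g V" using ophomD(2)[OF dl s] adj(3) by auto
 have "ph (f s) = ph (u s) + ph (g (de s))" using ophomD(3)[OF ph(1) us gs] by (simp add: fe)
 also have "... = u (th s) + g (th (de s))"
 using ph(2)[OF ophomD(2)[OF u s]] ph(3)[OF ophomD(2)[OF dl s]] fun_cong[OF ps(2)[OF u], of s] by simp
 also have "... = f (th s)" using fun_cong[OF D_comm[OF t dl], of s] by (simp add: fe)
 finally show "(ph o f) s = (f o th) s" by simp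
 qed
 qed
 with ph(1) show ?case by blast
 qed
 from this[OF n] obtain ps where ps: "ps:ophom (ops k) B W B W" "!!f. f:H ==> ps o f = f o th" by blast
 have lin: "ps (scal c w) = scal c (ps w)" if c: "c:K" and w: "w:W" for c w
 proof -
 have "W <= {w:W. ps (scal c w) = scal c (ps w)}"
 proof (rule span_W)
 fix f s assume f: "f:H" and s: "s:V"
 have "ps (scal c (f s)) = (scal c o f) (th s)" using fun_cong[OF ps(2)[OF scal_H[OF c f]], of s] by simp
 also have "... = scal c (ps (f s))" using fun_cong[OF ps(2)[OF f], of s] by simp
 finally show "f s:{w:W. ps (scal c w) = scal c (ps w)}" using ophomD(2)[OF f s] by simp
 qed (use submodD[OF sW] ophomD(3)[OF ps(1)] scal_in_W[OF c] ophom_zero_at[OF ps(1)] in "auto simp: scal_simps")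
 with w show ?thesis by blast
 qed
 have "ps:E"
 by (rule ophomI) (use ophomD[OF ps(1)] lin in "auto simp: ops_def rep_act_scal")
 then obtain c where c: "c:K" "ps = Kscal c" unfolding EK by blast
 have "f o th = scal c o f" if f: "f:H" for f
 proof
 fix s show "(f o th) s = (scal c o f) s"
 proof (cases "s:V")
 case True
 thus ?thesis using fun_cong[OF ps(2)[OF f], of s] ophomD(2)[OF f True] by (simp add: c(2) Kscal_def)
 next
 case False
 thus ?thesis using ophomD(1)[OF f False] ophomD(1)[OF t False] ophom_zero_at[OF f] by (simp add: scal_simps)
 qed
 qed
 with c(1) show "EX c:K. ALL f:H. f o th = scal c o f" by blast
qed

context
 assumes eig: eig
begin

text \<open>If D acts through scalars, then every K-line of the irreducible bimodule H is a sub-bimodule.\<close>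

lemma H_line:
 assumes f0: "f0:H" "f0 ~= 0"
 shows "H = (%c. scal c o f0) ` K" "inj_on (%c. scal c o f0) K"
proof -
 note KK = fsubfieldD[OF K(1)]
 have "(%c. scal c o f0) ` K = H"
 proof (rule gen(1))
 show "(%c. scal c o f0) ` K <= H" using scal_H f0(1) by auto
 show "0:(%c. scal c o f0) ` K"
 by (rule image_eqI[OF _ KK(2)]) (simp add: fun_eq_iff scal_simps)
 show "f0:(%c. scal c o f0) ` K"
 by (rule image_eqI[OF _ KK(3)]) (simp add: fun_eq_iff scal_simps)
 show "f + g:(%c. scal c o f0) ` K" if "f:(%c. scal c o f0) ` K" "g:(%c. scal c o f0) ` K" for f g
 proof -
 from that obtain a b where "a:K" "b:K" "f = scal a o f0" "g = scal b o f0" by blast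
 thus ?thesis by (intro image_eqI[OF _ KK(7)[of a b]]) (simp_all add: fun_eq_iff scal_simps)
 qed
 show "scal c o f:(%c. scal c o f0) ` K" if "f:(%c. scal c o f0) ` K" "c:K" for f c
 proof -
 from that(1) obtain a where "a:K" "f = scal a o f0" by blast
 moreover from this have "scal c o f = scal (c * a) o f0" by (intro ext) (simp add: scal_simps)
 ultimately show ?thesis using that(2) KK(5) by blast
 qed
 show "f o th:(%c. scal c o f0) ` K" if f: "f:(%c. scal c o f0) ` K" and t: "th:D" for f th
 proof -
 obtain x where x: "x:K" "ALL f:H. f o th = scal x o f" using eig t by (auto simp: eig_def)
 from f obtain a where a: "a:K" "f = scal a o f0" by blast
 have "f o th = scal x o f" using x(2) scal_H[OF a(1) f0(1)] a(2) by blast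
 thus ?thesis using a x(1) by (intro image_eqI[OF _ KK(5)[of x a]]) (simp_all add: fun_eq_iff scal_simps)
 qed
 qed (rule f0(2))
 thus "H = (%c. scal c o f0) ` K" ..
 obtain s where s: "f0 s ~= 0" using f0(2) by (auto simp: fun_eq_iff)
 show "inj_on (%c. scal c o f0) K"
 proof (rule inj_onI)
 fix a b assume "scal a o f0 = scal b o f0"
 from fun_cong[OF this, of s] s show "a = b" by (simp add: scal_eq_iff)
 qed
qed

lemma card_H: "card H = q ^ m"
proof -
 obtain f0 where f0: "f0:H" "f0 ~= 0" using nonzero_hom by blast
 show ?thesis by (subst H_line(1)[OF f0]) (simp add: card_image[OF H_line(2)[OF f0]] card_K)
qed

text \<open>Over the small field T is a sum of n copies of S. Counting H gives \<open>q^m = (q^d)^n\<close>, and counting vectors at a vertex gives \<open>m dim T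
= n dim S\<close>.\<close>

theorem dims: "d dvd m" "si = dim_scale d ta"
proof -
 obtain n where n: "isotypic (ops k) A V B W W n" using W_isotypic .
 have "q ^ m = q ^ (d * n)"
 using isotypic_card_ophom[OF S(2) sWk add_rep add_rep n order_refl, of A V] card_H card_D
 by (simp add: power_mult)
 hence mn: "m = d * n" using q2 by simp
 thus "d dvd m" by simp
 have n0: "n > 0" using mn m by (cases n) auto
 show "si = dim_scale d ta"
 proof (rule poly_mapping_eqI)
 fix i
 let ?L = "vspace k (unit_dim i)::('i, 'f) gvec set"
 have "card (ophom (lops k) (lact Q) ?L B W) = card (ophom (lops k) (lact Q) ?L A V) ^ n"
 by (rule isotypic_card_ophom[OF S(2) sWk add_rep add_rep n lops_subset_ops])
 hence "card (ophom (lops k) (lact Q) ?L (lact Q) W) = card (ophom (lops k) (lact Q) ?L (lact Q) V) ^ n"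
 using ophom_lops[of k Q 0 "%_ _ _. 0" ?L ta T W] ophom_lops[of k Q 0 "%_ _ _. 0" ?L si S V] by simp
 hence "(q ^ m) ^ lk ta i = (q ^ lk si i) ^ n"
 by (simp add: card_lhom_line[OF k K] card_lhom_line[OF k k order_refl] card_k card_K)
 hence "m * lk ta i = lk si i * n"
 using q2 by (simp add: power_mult[symmetric])
 thus "lk si i = lk (dim_scale d ta) i"
 using n0 mn by (simp add: mult.commute)
 qed
qed

theorem card_E: "card E = q ^ m"
proof -
 obtain f0 where f0: "f0:H" "f0 ~= 0" using nonzero_hom by blast
 have "E <= Kscal ` K"
 proof
 fix g assume g: "g:E"
 have gk: "g:ophom (ops k) B W B W" by (rule ophom_mono_ops[OF g ops_mono(1)[OF K(2)]])
 have "g o f0:H" by (rule ophom_comp[OF f0(1) gk])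
 then obtain c where c: "c:K" "g o f0 = scal c o f0" using H_line(1)[OF f0] by blast
 have "W <= {w:W. g w = scal c w}"
 proof (rule span_W)
 fix f s assume f: "f:H" and s: "s:V"
 then obtain a where a: "a:K" "f = scal a o f0" using H_line(1)[OF f0] by blast
 have fW: "f0 s:W" by (rule ophomD(2)[OF f0(1) s])
 have "g (scal a (f0 s)) = scal a (g (f0 s))"
 using ophomD(4)[OF g _ fW, of "Scal a"] a(1) by (simp add: ops_def rep_act_scal)
 also have "... = scal c (scal a (f0 s))"
 using fun_cong[OF c(2), of s] by (simp add: scal_def mult_ac)
 finally show "f s:{w:W. g w = scal c w}" using a(2) ophomD(2)[OF f s] by simp
 qed (use submodD[OF sW] ophomD(3)[OF g] ophom_zero_at[OF g] in "auto simp: scal_simps")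
 hence "g = Kscal c"
 by (intro ophom_eqI[OF g Kscal_E[OF c(1)]]) (auto simp: Kscal_def)
 with c(1) show "g:Kscal ` K" by blast
 qed
 with Kscal_sub have "E = Kscal ` K" by blast
 thus ?thesis by (simp add: card_Kscal)
qed

text \<open>The resulting embedding of D into K; which of its d Galois conjugates occurs tells the components of S over K apart.\<close>

definition "iota th = (THE c. c:K & (ALL f:H. f o th = scal c o f))"

lemma iota_unique:
 assumes "f0:H" "f0 ~= 0" "th:D"
 shows "iota th:K" "f:H ==> f o th = scal (iota th) o f" "f0 o th = scal c o f0 ==> iota th = c"
proof -
 obtain s where s: "f0 s ~= 0" using assms(2) by (auto simp: fun_eq_iff)
 have uni: "a = b" if "f0 o th = scal a o f0" "f0 o th = scal b o f0" for a b
 proof -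
 have "scal a (f0 s) = scal b (f0 s)" using fun_cong[OF that(1), of s] fun_cong[OF that(2), of s] by simp
 thus ?thesis using s by (simp add: scal_eq_iff)
 qed
 obtain x where x: "x:K" "ALL f:H. f o th = scal x o f" using eig assms(3) by (auto simp: eig_def)
 have "iota th = x"
 unfolding iota_def by (rule the_equality) (use x uni assms(1) in auto)
 thus "iota th:K" "f:H ==> f o th = scal (iota th) o f" "f0 o th = scal c o f0 ==> iota th = c"
 using x uni assms(1) by auto
qed

lemma iota_hom:
 shows "th:D ==> th':D ==> iota (th + th') = iota th + iota th'"
 "th:D ==> th':D ==> iota (th o th') = iota th * iota th'"
 "t:k ==> iota (kscal t) = t" "inj_on iota D" "iota ` D = FF (q ^ d)"
proof -
 obtain f0 where f0: "f0:H" "f0 ~= 0" using nonzero_hom by blast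
 note u = iota_unique[OF f0]
 have D_add: "th + th':D" if "th:D" "th':D" for th th' by (rule ophom_add[OF that sV add_rep])
 have D_comp: "th o th':D" if "th:D" "th':D" for th th' by (rule ophom_comp[OF that(2,1)])
 have D_diff: "th - th':D" if "th:D" "th':D" for th th' by (rule ophom_diff[OF that sV add_rep])
 have ap: "f0 (th s) = scal (iota th) (f0 s)" if "th:D" for th s using fun_cong[OF u(2)[OF that f0(1)], of s] by simp
 have f0_add: "f0 (th s + th' s) = f0 (th s) + f0 (th' s)" if "th:D" "th':D" for th th' s
 proof (cases "s:V")
 case True
 thus ?thesis using ophomD(3)[OF f0(1) ophomD(2)[OF that(1)] ophomD(2)[OF that(2)]] by simp
 qed (simp add: ophomD(1)[OF that(1)] ophomD(1)[OF that(2)] ophom_zero_at[OF f0(1)])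
 show add: "iota (th + th') = iota th + iota th'" if "th:D" "th':D" for th th'
 by (rule u(3)[OF D_add[OF that]], rule ext) (simp add: f0_add[OF that] ap that scal_simps)
 show mult: "iota (th o th') = iota th * iota th'" if "th:D" "th':D" for th th'
 by (rule u(3)[OF D_comp[OF that]]) (simp add: fun_eq_iff ap that scal_def algebra_simps)
 show ks: "iota (kscal t) = t" if "t:k" for t
 proof (rule u(3)[OF kscal_D[OF that]], rule ext)
 fix s show "(f0 o kscal t) s = (scal t o f0) s"
 proof (cases "s:V")
 case True
 thus ?thesis using ophomD(4)[OF f0(1) _ True, of "Scal t"] that by (simp add: ops_def rep_act_scal kscal_def)
 qed (simp add: kscal_def ophomD(1)[OF f0(1)] ophom_zero_at[OF f0(1)] scal_simps)
 qed
 have z: "th = 0" if t: "th:D" "iota th = 0" for th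
 proof (rule ccontr)
 assume "th ~= 0"
 then obtain th' where t': "th':D" "th o th' = idon V" using division_mapsD(10)[OF D_division t(1)] by blast
 have "f0 s = 0" for s
 proof (cases "s:V")
 case True
 have "f0 (th (th' s)) = 0" using ap[OF t(1)] t(2) by (simp add: scal_simps)
 moreover have "th (th' s) = s" using fun_cong[OF t'(2), of s] True by (simp add: idon_def)
 ultimately show ?thesis by simp
 qed (rule ophomD(1)[OF f0(1)])
 with f0(2) show False by (auto simp: fun_eq_iff)
 qed
 have neg: "iota (th - th') = iota th - iota th'" if "th:D" "th':D" for th th'
 using add[OF D_diff[OF that] that(2)] by simp
 show inj: "inj_on iota D"
 proof (rule inj_onI)
 fix th th' assume t: "th:D" "th':D" "iota th = iota th'"
 hence "th - th' = 0" using neg[OF t(1,2)] z[OF D_diff[OF t(1,2)]] by simp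
 thus "th = th'" by simp
 qed
 have "fsubfield (iota ` D)"
 unfolding fsubfield_def
 proof (intro conjI ballI)
 show "finite (iota ` D)" using division_mapsD(1)[OF D_division] by simp
 show "0:iota ` D" "1:iota ` D"
 using ks[OF fsubfieldD(2)[OF k]] ks[OF fsubfieldD(3)[OF k]] kscal_D[OF fsubfieldD(2)[OF k]] kscal_D[OF fsubfieldD(3)[OF k]]
 by (metis imageI)+
 fix x assume "x:iota ` D"
 then obtain th where t: "th:D" "x = iota th" by blast
 {
 fix y assume "y:iota ` D"
 then obtain th' where t': "th':D" "y = iota th'" by blast
 show "x - y:iota ` D" "x * y:iota ` D"
 using neg[OF t(1) t'(1)] mult[OF t(1) t'(1)] D_diff[OF t(1) t'(1)] D_comp[OF t(1) t'(1)] t t' by (metis imageI)+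
 }
 show "inverse x:iota ` D"
 proof (cases "th = 0")
 case True
 hence "x = 0" using t neg[of 0 0] division_mapsD(2)[OF D_division] by simp
 thus ?thesis using \<open>0:iota ` D\<close> by simp
 next
 case False
 then obtain th' where t': "th':D" "th o th' = idon V" using division_mapsD(10)[OF D_division t(1)] by blast
 have "kscal 1 = idon V" by (auto simp: kscal_def fun_eq_iff scal_def idon_def)
 hence "x * iota th' = 1" using mult[OF t(1) t'(1)] t'(2) ks[OF fsubfieldD(3)[OF k]] t(2) by simp
 hence "inverse x = iota th'" by (rule inverse_unique)
 with t'(1) show ?thesis by simp
 qed
 qed
 moreover have "card (iota ` D) = q ^ d" using inj card_D by (simp add: card_image)
 ultimately show "iota ` D = FF (q ^ d)" using fsubfield_eq_FF char_power_pow[OF q d_pos] by metis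
qed

end

end

text \<open>T is a sum of copies of S over the small field; sending the elements \<open>c f0\<close> of the line H to \<open>c f0'\<close> is defined copy by
copy, and equality of the two \<open>iota\<close> makes it consistent.\<close>

lemma same_iota_iso:
 assumes 1: "ext_rep Q q m si ta S T" and 2: "ext_rep Q q m si ta' S T'"
 and e1: "ext_rep.eig Q q m si ta S T" and e2: "ext_rep.eig Q q m si ta' S T'"
 and iota: "!!th. th:rep_hom Q (FF q) si S si S ==> ext_rep.iota Q q m si ta S T th = ext_rep.iota Q q m si ta' S T' th"
 shows "rep_hom Q (FF (q ^ m)) ta T ta' T' ~= {0}"
proof -
 interpret T: ext_rep Q q m si ta S T by (rule 1)
 interpret T': ext_rep Q q m si ta' S T' by (rule 2)
 note KK = fsubfieldD[OF T.K(1)]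
 obtain f0 where f0: "f0:T.H" "f0 ~= 0" using T.nonzero_hom by blast
 obtain f0' where f0': "f0':T'.H" "f0' ~= 0" using T'.nonzero_hom by blast
 obtain n where n: "isotypic (ops T.k) T.A T.V T.B T.W T.W n" using T.W_isotypic .
 have "EX ps:ophom (ops T.k) T.B U T'.B T'.W. ALL c:T.K. scal c o f0:ophom (ops T.k) T.A T.V T.B U -->
 ps o (scal c o f0) = scal c o f0'"
 if "isotypic (ops T.k) T.A T.V T.B T.W U n" for U n
 using that
 proof (induction rule: isotypic.induct)
 case isotypic_zero
 have "0 o (scal c o f0) = scal c o f0'" if f: "scal c o f0:ophom (ops T.k) T.A T.V T.B {0}" for c
 proof -
 obtain s where s: "f0 s ~= 0" using f0(2) by (auto simp: fun_eq_iff)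
 have "scal c (f0 s) = scal 0 (f0 s)" using ophomD(1,2)[OF f, of s] by (cases "s:T.V") (auto simp: scal_simps)
 hence "c = 0" using s by (simp add: scal_eq_iff)
 thus ?thesis by (intro ext) (simp add: scal_simps)
 qed
 thus ?case using ophom_zero[OF T'.sWk add_rep, of T.B "{0}"] by blast
 next
 case (isotypic_adjoin U n g)
 then obtain ps where ps: "ps:ophom (ops T.k) T.B U T'.B T'.W"
 "!!c. c:T.K ==> scal c o f0:ophom (ops T.k) T.A T.V T.B U ==> ps o (scal c o f0) = scal c o f0'" by blast
 have sU: "submod (ops T.k) T.B U"
 using isotypic_submod[OF T.S(2) T.sWk add_rep add_rep isotypic_adjoin(1)] by simp
 note ind = isotypic_indep[OF T.S(2) T.sWk add_rep add_rep isotypic_adjoin(1-3)]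
 obtain mu where mu: "mu:T.K" "g = scal mu o f0" using T.H_line(1)[OF e1 f0] isotypic_adjoin(2) by blast
 note w = T'.scal_H[OF mu(1) f0'(1)]
 obtain ph where ph: "ph:ophom (ops T.k) T.B (adjoin U g T.V) T'.B T'.W" "!!x. x:U ==> ph x = ps x"
 "!!s. s:T.V ==> ph (g s) = (scal mu o f0') s"
 using ophom_from_adjoin[OF sU T.sV isotypic_adjoin(2) add_rep ind add_rep T'.sWk ps(1) w] by blast
 note adj = adjoin_submod[OF sU T.sV isotypic_adjoin(2) add_rep]
 have "ph o (scal c o f0) = scal c o f0'"
 if c: "c:T.K" and f: "scal c o f0:ophom (ops T.k) T.A T.V T.B (adjoin U g T.V)" for c
 proof -
 have "scal c o f0:(%(u, de). u + (g o de)) ` (ophom (ops T.k) T.A T.V T.B U \<times> T.D)"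
 using ophom_into_adjoin[OF sU T.sV isotypic_adjoin(2) add_rep ind add_rep, of T.A T.V] f
 by (simp add: bij_betw_def)
 then obtain u de where u: "u:ophom (ops T.k) T.A T.V T.B U" and dl: "de:T.D" and fe: "scal c o f0 = u + (g o de)" by auto
 let ?i = "T.iota de"
 have iK: "?i:T.K" and f0d: "f0 (de s) = scal ?i (f0 s)" for s
 using T.iota_unique(1,2)[OF e1 f0 dl] f0(1) by (auto simp: fun_eq_iff)
 have f0d': "f0' (de s) = scal ?i (f0' s)" for s
 using T'.iota_unique(2)[OF e2 f0' dl f0'(1)] iota[OF dl] by (auto simp: fun_eq_iff)
 have cK: "c - mu * ?i:T.K" using c mu(1) iK KK by blast
 have ue: "u = scal (c - mu * ?i) o f0"
 proof
 fix s
 have "scal c (f0 s) = u s + scal mu (scal ?i (f0 s))" using fun_cong[OF fe, of s] by (simp add: mu(2) f0d)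
 thus "u s = (scal (c - mu * ?i) o f0) s" by (simp add: scal_def fun_eq_iff algebra_simps)
 qed
 show ?thesis
 proof
 fix s
 show "(ph o (scal c o f0)) s = (scal c o f0') s"
 proof (cases "s:T.V")
 case True
 have us: "u s:adjoin U g T.V" using ophomD(2)[OF u True] adj(2) by auto
 have gs: "g (de s):adjoin U g T.V" using ophomD(2)[OF dl True] adj(3) by auto
 have "ph (scal c (f0 s)) = ph (u s) + ph (g (de s))" using ophomD(3)[OF ph(1) us gs] fun_cong[OF fe, of s] by simp
 also have "... = scal (c - mu * ?i) (f0' s) + scal mu (scal ?i (f0' s))"
 using ph(2)[OF ophomD(2)[OF u True]] ph(3)[OF ophomD(2)[OF dl True]] fun_cong[OF ps(2)[OF cK], of s] u ue f0d' by simp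
 also have "... = scal c (f0' s)" by (simp add: scal_def fun_eq_iff algebra_simps)
 finally show ?thesis by simp
 next
 case False
 thus ?thesis using ophomD(1)[OF f0(1)] ophomD(1)[OF f0'(1)] ophom_zero_at[OF ph(1)] by (simp add: scal_simps)
 qed
 qed
 qed
 with ph(1) show ?case by blast
 qed
 from this[OF n] obtain ps where ps: "ps:ophom (ops T.k) T.B T.W T'.B T'.W"
 "!!c. c:T.K ==> ps o (scal c o f0) = scal c o f0'" using T.scal_H f0(1) by blast
 have lin: "ps (scal c w) = scal c (ps w)" if c: "c:T.K" and w: "w:T.W" for c w
 proof -
 have "T.W <= {w:T.W. ps (scal c w) = scal c (ps w)}"
 proof (rule T.span_W)
 fix f s assume f: "f:T.H" and s: "s:T.V"
 then obtain a where a: "a:T.K" "f = scal a o f0" using T.H_line(1)[OF e1 f0] by blast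
 have "ps (scal c (f s)) = scal (c * a) (f0' s)"
 using fun_cong[OF ps(2)[OF KK(5)[OF c a(1)]], of s] by (simp add: a(2) scal_simps)
 also have "... = scal c (ps (f s))" using fun_cong[OF ps(2)[OF a(1)], of s] by (simp add: a(2) scal_simps)
 finally show "f s:{w:T.W. ps (scal c w) = scal c (ps w)}" using ophomD(2)[OF f s] by simp
 qed (use submodD[OF T.sW] ophomD(3)[OF ps(1)] T.scal_in_W[OF c] ophom_zero_at[OF ps(1)] in "auto simp: scal_simps")
 with w show ?thesis by blast
 qed
 have "ps:rep_hom Q T.K ta T ta' T'"
 by (rule ophomI) (use ophomD[OF ps(1)] lin in "auto simp: ops_def rep_act_scal")
 moreover have "ps ~= 0"
 proof
 assume "ps = 0"
 have "f0' s = 0" for s using fun_cong[OF ps(2)[OF KK(3)], of s] \<open>ps = 0\<close> by (simp add: scal_simps)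
 with f0'(2) show False by (auto simp: fun_eq_iff)
 qed
 ultimately show ?thesis by blast
qed

lemma iso_same_iota:
 assumes 1: "ext_rep Q q m si ta S T" and 2: "ext_rep Q q m si ta' S T'"
 and e1: "ext_rep.eig Q q m si ta S T" and e2: "ext_rep.eig Q q m si ta' S T'"
 and nz: "rep_hom Q (FF (q ^ m)) ta T ta' T' ~= {0}" and t: "th:rep_hom Q (FF q) si S si S"
 shows "ext_rep.iota Q q m si ta S T th = ext_rep.iota Q q m si ta' S T' th"
proof -
 interpret T: ext_rep Q q m si ta S T by (rule 1)
 interpret T': ext_rep Q q m si ta' S T' by (rule 2)
 obtain f0 where f0: "f0:T.H" "f0 ~= 0" using T.nonzero_hom by blast
 obtain ps where ps: "ps:rep_hom Q T.K ta T ta' T'" "ps ~= 0"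
 using nz ophom_nonzero_iff[OF T'.sW add_rep] by blast
 have inj: "inj_on ps T.W" by (rule simple_ophom_inj[OF T.T(2) ps(1) add_rep ps(2)])
 have psk: "ps:ophom (ops T.k) T.B T.W T'.B T'.W" by (rule ophom_mono_ops[OF ps(1) ops_mono(1)[OF T.K(2)]])
 have H': "ps o f0:T'.H" by (rule ophom_comp[OF f0(1) psk])
 have nz': "ps o f0 ~= 0"
 proof
 assume z: "ps o f0 = 0"
 have "f0 s = 0" for s
 proof (cases "s:T.V")
 case True
 have "ps (f0 s) = 0" using fun_cong[OF z, of s] by simp
 thus ?thesis using inj ophomD(2)[OF f0(1) True] ophom_inj_iff[OF ps(1) T.sW] by blast
 qed (rule ophomD(1)[OF f0(1)])
 with f0(2) show False by (auto simp: fun_eq_iff)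
 qed
 note i = T.iota_unique[OF e1 f0 t]
 have "(ps o f0) o th = scal (T.iota th) o (ps o f0)"
 proof
 fix s
 show "((ps o f0) o th) s = (scal (T.iota th) o (ps o f0)) s"
 proof (cases "s:T.V")
 case True
 have "ps (f0 (th s)) = ps (rep_act Q ta T (Scal (T.iota th)) (f0 s))"
 using fun_cong[OF i(2)[OF f0(1)], of s] by (simp add: rep_act_scal)
 also have "... = scal (T.iota th) (ps (f0 s))"
 by (subst ophomD(4)[OF ps(1) _ ophomD(2)[OF f0(1) True]]) (use i(1) in "auto simp: ops_def rep_act_scal")
 finally show ?thesis by simp
 next
 case False
 thus ?thesis using ophomD(1)[OF f0(1) False] ophomD(1)[OF t False] ophom_zero_at[OF f0(1)] ophom_zero_at[OF ps(1)]
 by (simp add: scal_simps)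
 qed
 qed
 from T'.iota_unique(3)[OF e2 H' nz' t this] show ?thesis by simp
qed

subsection \<open>Frobenius twists\<close>

definition frob_fam::"nat => ('h, 'f::field) mats_fam => ('h, 'f) mats_fam" where
 "frob_fam r M = (%h a b. M h a b ^ r)"

definition frob_vec::"nat => ('i, 'f::field) gvec => ('i, 'f) gvec" where
 "frob_vec r v = (%i a. v i a ^ r)"

context ext_rep
begin

text \<open>Raising all entries to the power \<open>q^j\<close> fixes S and is semilinear, so it carries H for T to H for the twisted T.\<close>

lemma twist:
 fixes j::nat
 defines "r \<equiv> q ^ j"
 shows "ext_rep Q q m si ta S (frob_fam r T)"
 and "th:D ==> eig ==> ext_rep.eig Q q m si ta S (frob_fam r T) ==>
 ext_rep.iota Q q m si ta S (frob_fam r T) th = iota th ^ r"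
proof -
 have r0: "r > 0" using q2 by (simp add: r_def)
 have cp: "char_power TYPE('f) r | r = 1" using char_power_pow[OF q, of j] by (cases "j = 0") (auto simp: r_def)
 have radd: "(x + y::'f) ^ r = x ^ r + y ^ r" for x y using cp char_power_add by auto
 have rinj: "x = y" if "(x::'f) ^ r = y ^ r" for x y using cp char_power_inj[of r x y] that by auto
 have rsum: "(SUM i:I. g i::'f) ^ r = (SUM i:I. g i ^ r)" for g::"nat => 'f" and I using cp char_power_sum by auto
 have kr: "x ^ r = x" if "x:k" for x using FF_mono[of q j] that by (auto simp: r_def FF_def)
 have Kr: "x ^ r:K" if "x:K" for x using that fsubfieldD(3,5)[OF K(1)] by (induction r) auto
 let ?F = "frob_vec r::('i, 'f) gvec => ('i, 'f) gvec" and ?B = "rep_act Q ta (frob_fam r T)"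
 have Fadd: "?F (v + w) = ?F v + ?F w" for v w by (simp add: frob_vec_def fun_eq_iff radd)
 have F0: "?F 0 = 0" using r0 by (simp add: frob_vec_def fun_eq_iff)
 have Fscal: "?F (scal c v) = scal (c ^ r) (?F v)" for c v by (simp add: frob_vec_def scal_def fun_eq_iff power_mult_distrib)
 have Fact: "?F (B c v) = ?B c (?F v)" if "c:range Proj \<union> range Arr" for c v
 using that r0 by (auto simp: rep_act_simps frob_vec_def frob_fam_def fun_eq_iff rsum power_mult_distrib power_0_left)
 have FW: "?F v:W" if "v:W" for v
 using that Kr r0 by (auto simp: vspace_def frob_vec_def power_0_left)
 have Finj: "inj_on ?F W" by (rule inj_onI) (auto simp: frob_vec_def fun_eq_iff dest: rinj)
 have FWW: "?F ` W = W" by (rule endo_inj_surj[OF finW _ Finj]) (use FW in auto)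
 have TR: "frob_fam r T:reps Q K ta"
 using T(1) Kr r0 by (auto simp: mat_fams_def frob_fam_def)
 have sB: "submod (ops K) ?B W" by (rule vspace_submod[OF K(1) order_refl TR])
 have simple: "simple_mod (ops K) ?B W"
 unfolding simple_mod_def
 proof (intro conjI allI impI)
 show "submod (ops K) ?B W" by (rule sB)
 show "W ~= {0}" using T(2) by (simp add: simple_mod_def)
 fix U assume U: "submod (ops K) ?B U" "U <= W"
 let ?U = "{v:W. ?F v:U}"
 have "submod (ops K) B ?U"
 unfolding submod_def
 proof (intro conjI ballI)
 show "0:?U" using submodD(1)[OF U(1)] submodD(1)[OF sW] F0 by simp
 fix v assume v: "v:?U"
 {
 fix w assume w: "w:?U"
 have "?F (v - w) = ?F v - ?F w" using Fadd[of "v - w" w] by simp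
 thus "v - w:?U" using v w submodD(2)[OF U(1)] submodD(2)[OF sW] by simp
 }
 fix c::"('i, 'h, 'f) rep_op" assume c: "c:ops K"
 show "B c v:?U"
 proof (cases c)
 case (Scal t)
 hence tK: "t:K" using c by (auto simp: ops_def)
 have "scal (t ^ r) (?F v):U"
 using submodD(5)[OF U(1), of "Scal (t ^ r)"] v Kr[OF tK] by (simp add: ops_def rep_act_scal)
 thus ?thesis using v scal_in_W[OF tK] by (simp add: Scal rep_act_scal Fscal)
 qed (use v c submodD(5)[OF sW c] submodD(5)[OF U(1) c] Fact[of c] in auto)
 qed
 hence "?U = {0} | ?U = W" using T(2) by (auto simp: simple_mod_def)
 moreover have "U = ?F ` ?U" using U(2) FWW by auto
 ultimately show "U = {0} | U = W" using FWW F0 by auto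
 qed
 have FH: "?F o f:ophom (ops k) A V ?B W" if f: "f:H" for f
 proof (rule ophomI)
 fix c::"('i, 'h, 'f) rep_op" and v assume c: "c:ops k" and v: "v:V"
 show "(?F o f) (A c v) = ?B c ((?F o f) v)"
 proof (cases c)
 case (Scal t)
 hence "t:k" using c by (auto simp: ops_def)
 thus ?thesis using ophomD(4)[OF f c v] kr by (simp add: Scal rep_act_scal Fscal)
 qed (use ophomD(4)[OF f c v] Fact[of c] in auto)
 qed (use ophomD(1-3)[OF f] FW F0 Fadd in auto)
 obtain f0 where f0: "f0:H" "f0 ~= 0" using nonzero_hom by blast
 have nz: "?F o f0 ~= 0"
 proof
 assume z: "?F o f0 = 0"
 have "f0 s i a = 0" for s i a
 using fun_cong[OF fun_cong[OF fun_cong[OF z, of s], of i], of a] by (simp add: frob_vec_def)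
 with f0(2) show False by (auto simp: fun_eq_iff)
 qed
 show extr: "ext_rep Q q m si ta S (frob_fam r T)"
 by unfold_locales (use q m S TR simple FH[OF f0(1)] nz in auto)
 interpret T': ext_rep Q q m si ta S "frob_fam r T" by (rule extr)
 show "T'.iota th = iota th ^ r" if t: "th:D" "eig" "T'.eig"
 proof -
 have "(?F o f0) o th = scal (iota th ^ r) o (?F o f0)"
 proof (rule ext)
 fix s show "((?F o f0) o th) s = (scal (iota th ^ r) o (?F o f0)) s"
 using fun_cong[OF iota_unique(2)[OF t(2) f0 t(1) f0(1)], of s] by (simp add: Fscal)
 qed
 from T'.iota_unique(3)[OF t(3) FH[OF f0(1)] nz t(1) this] show ?thesis .
 qed
qed

end

text \<open>A simple subrepresentation T of S over the large field contains, over the small field, some simple R. Over the small field the extended S is a sum of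
copies of S, so R is isomorphic to S.\<close>

lemma lift_exists:
 fixes S::"('h, 'f::alg_closed_field) mats_fam"
 assumes q: "char_power TYPE('f) q" and m: "m > 0"
 and S: "S:reps Q (FF q) si" "simple_rep Q (FF q) si S"
 obtains ta T f where "ext_rep Q q m si ta S T"
 "f:rep_hom Q (FF (q ^ m)) ta T si S" "inj_on f (vspace (FF (q ^ m)) ta)"
proof -
 let ?k = "FF q::'f set" and ?K = "FF (q ^ m)::'f set"
 let ?A = "rep_act Q si S" and ?V = "vspace (FF q) si::('a, 'f) gvec set" and ?VK = "vspace (FF (q ^ m)) si::('a, 'f) gvec set"
 have k: "fsubfield ?k" and K: "fsubfield ?K" "?k <= ?K"
 using FF_fsubfield[OF q] FF_fsubfield[OF char_power_pow[OF q m]] FF_mono by auto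
 note SK = reps_mono[OF K(2) S(1)]
 have sVK: "submod (ops ?k) ?A ?VK" by (rule vspace_submod[OF K SK])
 have sV: "submod (ops ?k) ?A ?V" by (rule vspace_submod[OF k order_refl S(1)])
 have finVK: "finite ?VK" by (rule finite_vspace[OF fsubfieldD(1)[OF K(1)]])
 have nz: "si ~= 0" by (rule simple_rep_dim_nonzero[OF fsubfieldD(2)[OF k] S(2)])
 obtain ta N f where N: "N:reps Q ?K ta" "simple_rep Q ?K ta N" "f:rep_hom Q ?K ta N si S" "inj_on f (vspace ?K ta)"
 using simple_subrep_exists[OF K(1) K(1) order_refl SK nz] .
 have nzt: "ta ~= 0" by (rule simple_rep_dim_nonzero[OF fsubfieldD(2)[OF K(1)] N(2)])
 obtain rh R g where R: "R:reps Q ?k rh" "simple_rep Q ?k rh R"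
 "g:ophom (ops ?k) (rep_act Q rh R) (vspace ?k rh) (rep_act Q ta N) (vspace ?K ta)" "inj_on g (vspace ?k rh)"
 using simple_subrep_exists[OF k K N(1) nzt] .
 obtain U n where U: "isotypic (ops ?k) ?A ?V ?A ?VK U n" "ophom (ops ?k) ?A ?V ?A U = ophom (ops ?k) ?A ?V ?A ?VK"
 using isotypic_maximal[OF S(2) sVK add_rep add_rep finVK] .
 have sU: "submod (ops ?k) ?A U" "U <= ?VK"
 using isotypic_submod[OF S(2) sVK add_rep add_rep U(1)] by auto
 have scV: "scal c v:U" if c: "c:?K" and v: "v:?V" for c v
 proof -
 define h where "h v = (if v:?V then scal c v else 0)" for v
 have VVK: "?V <= ?VK" using K(2) by (auto simp: vspace_def)
 have cVK: "scal c v:?VK" if "v:?V" for v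
 using submodD(5)[OF vspace_submod[OF K(1) order_refl SK], of "Scal c" v] that c VVK by (auto simp: ops_def rep_act_scal)
 have "h:ophom (ops ?k) ?A ?V ?A ?VK"
 proof (rule ophomI)
 show "h (x + y) = h x + h y" if "x:?V" "y:?V" for x y
 using that submodD(3)[OF sV that] by (simp add: h_def scal_simps)
 show "h (?A o' x) = ?A o' (h x)" if "o':ops ?k" "x:?V" for o' x
 using that submodD(5)[OF sV that] 
 by (cases o') (auto simp: h_def rep_act_simps scal_def fun_eq_iff sum_distrib_left mult_ac)
 qed (use cVK in "auto simp: h_def")
 hence "h:ophom (ops ?k) ?A ?V ?A U" using U(2) by simp
 from ophomD(2)[OF this v] v show ?thesis by (simp add: h_def)
 qed
 have "?VK <= U"
 proof
 fix v assume v: "v:?VK"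
 have Usum: "(SUM x:I. e x):U" if "!!x. x:I ==> e x:U" for I and e::"_ => ('a, 'f) gvec"
 using conjunct2[OF ophom_sum[OF idon_ophom[OF sU(1) order_refl] sU(1) that]] .
 have "(SUM i:Poly_Mapping.keys si. SUM b<lk si i. scal (v i b) (basis_vec i b)):U"
 by (intro Usum scV basis_vec_in[OF k]) (use v in "auto simp: vspace_def")
 moreover have "v = (SUM i:Poly_Mapping.keys si. SUM b<lk si i. scal (v i b) (basis_vec i b))"
 proof (intro ext)
 fix j a
 have "(SUM i:Poly_Mapping.keys si. SUM b<lk si i. scal (v i b) (basis_vec i b)) j a
 = (SUM i:Poly_Mapping.keys si. rep_act Q si S (Proj i) v j a)"
 by (simp add: sum_gvec_apply proj_expand[OF v] rep_act_scal)
 also have "... = (SUM i:Poly_Mapping.keys si. if i = j then v j a else 0)"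
 by (rule sum.cong) (auto simp: rep_act_simps)
 also have "... = v j a" using vspaceD(2)[OF v, of j a] by (cases "v j a = 0") (auto simp: in_keys_iff)
 finally show "v j a = (SUM i:Poly_Mapping.keys si. SUM b<lk si i. scal (v i b) (basis_vec i b)) j a" ..
 qed
 ultimately show "v:U" by simp
 qed
 with sU(2) have UVK: "U = ?VK" by auto
 have fk: "f:ophom (ops ?k) (rep_act Q ta N) (vspace ?K ta) ?A ?VK" by (rule ophom_mono_ops[OF N(3) ops_mono(1)[OF K(2)]])
 have sR: "submod (ops ?k) (rep_act Q rh R) (vspace ?k rh)" by (rule vspace_submod[OF k order_refl R(1)])
 have sN: "submod (ops ?k) (rep_act Q ta N) (vspace ?K ta)" by (rule vspace_submod[OF K N(1)])
 have fg: "f o g:ophom (ops ?k) (rep_act Q rh R) (vspace ?k rh) ?A ?VK" by (rule ophom_comp[OF R(3) fk])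
 have injfg: "inj_on (f o g) (vspace ?k rh)"
 by (rule comp_inj_on[OF R(4)], rule inj_on_subset[OF N(4)]) (use ophomD(2)[OF R(3)] in auto)
 obtain x where x: "x:vspace ?k rh" "x ~= 0" using R(2) submodD(1)[OF sR] by (auto simp: simple_mod_def)
 have "rep_hom Q ?k rh R si S ~= {0}"
 proof
 assume "rep_hom Q ?k rh R si S = {0}"
 hence "card (ophom (ops ?k) (rep_act Q rh R) (vspace ?k rh) ?A ?VK) = 1"
 using isotypic_card_ophom[OF S(2) sVK add_rep add_rep U(1) order_refl, of "rep_act Q rh R" "vspace ?k rh"] UVK by simp
 hence "f o g = 0" using fg ophom_zero[OF sVK add_rep, of "rep_act Q rh R" "vspace ?k rh"]
 by (metis card_1_singletonE singletonD)
 hence "(f o g) x = (f o g) 0" by simp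
 thus False using injfg x submodD(1)[OF sR] by (metis inj_onD)
 qed
 then obtain e where e: "e:rep_hom Q ?k rh R si S" "e ~= 0" using ophom_nonzero_iff[OF sV add_rep] by blast
 note be = simple_ophom_bij[OF R(2) S(2) e(1) add_rep e(2)]
 note he = hinv_ophom[OF e(1) be sR]
 have "g o hinv (vspace ?k rh) e ?V:ophom (ops ?k) ?A ?V (rep_act Q ta N) (vspace ?K ta)" by (rule ophom_comp[OF he(1) R(3)])
 moreover have "g o hinv (vspace ?k rh) e ?V ~= 0"
 proof
 assume "g o hinv (vspace ?k rh) e ?V = 0"
 from fun_cong[OF this, of "e x"] have "g x = 0" by (simp add: he(2)[OF x(1)])
 thus False using R(4) x ophom_inj_iff[OF R(3) sR] by blast
 qed
 ultimately have "ext_rep Q q m si ta S N"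
 by unfold_locales (use q m S N in auto)
 thus thesis using N(3,4) by (rule that)
qed

subsection \<open>Counting absolutely irreducible representations\<close>

definition abs_simple_reps where
 "abs_simple_reps Q K al = {T:reps Q K al. simple_rep Q K al T & end_card Q K (al, T) = card K}"

definition iso_rel where
 "iso_rel Q K al = {(T, T'). T:reps Q K al & T':reps Q K al &
 (EX f:rep_hom Q K al T al T'. bij_betw f (vspace K al) (vspace K al))}"

lemma iso_rel_sym:
 assumes K: "fsubfield K" and iso: "(T, T'):iso_rel Q K al"
 shows "(T', T):iso_rel Q K al"
proof -
 from iso obtain f where f: "f:rep_hom Q K al T al T'" "bij_betw f (vspace K al) (vspace K al)"
 and R: "T:reps Q K al" "T':reps Q K al" by (auto simp: iso_rel_def)
 note sT = vspace_submod[OF K order_refl R(1)]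
 show ?thesis using hinv_ophom(1)[OF f sT] bij_hinv[OF f sT] R by (auto simp: iso_rel_def)
qed

lemma iso_rel_equiv:
 assumes K: "fsubfield K"
 shows "equiv (reps Q K al) (iso_rel Q K al)"
proof (rule equivI)
 show "refl_on (reps Q K al) (iso_rel Q K al)"
 proof (rule refl_onI)
 fix T assume T: "T:reps Q K al"
 have "idon (vspace K al):rep_hom Q K al T al T" by (rule idon_ophom[OF vspace_submod[OF K order_refl T] order_refl])
 moreover have "bij_betw (idon (vspace K al)) (vspace K al) (vspace K al)"
 by (rule bij_betwI[where g = "%v. v"]) (auto simp: idon_def)
 ultimately show "(T, T):iso_rel Q K al" using T by (auto simp: iso_rel_def)
 qed
 show "sym (iso_rel Q K al)" using iso_rel_sym[OF K] by (rule symI)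
 show "trans (iso_rel Q K al)"
 by (rule transI) (auto simp: iso_rel_def intro: ophom_comp bij_betw_trans)
 show "iso_rel Q K al <= reps Q K al \<times> reps Q K al" by (auto simp: iso_rel_def)
qed

lemma simple_iso_iff:
 assumes K: "fsubfield K" and T: "T:reps Q K al" "simple_rep Q K al T" and T': "T':reps Q K al" "simple_rep Q K al T'"
 shows "(T, T'):iso_rel Q K al \<longleftrightarrow> rep_hom Q K al T al T' ~= {0}"
proof
 note sT = vspace_submod[OF K order_refl T(1)] and sT' = vspace_submod[OF K order_refl T'(1)]
 assume "rep_hom Q K al T al T' ~= {0}"
 then obtain f where f: "f:rep_hom Q K al T al T'" "f ~= 0" using ophom_nonzero_iff[OF sT' add_rep] by blast
 from simple_ophom_bij[OF T(2) T'(2) f(1) add_rep f(2)] f(1) T(1) T'(1) show "(T, T'):iso_rel Q K al"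
 by (auto simp: iso_rel_def)
next
 assume "(T, T'):iso_rel Q K al"
 then obtain f where f: "f:rep_hom Q K al T al T'" "bij_betw f (vspace K al) (vspace K al)" by (auto simp: iso_rel_def)
 have "f ~= 0"
 proof
 assume "f = 0"
 hence "vspace K al = {0}" using f(2) vspace_submod[OF K order_refl T(1)] submodD(1) by (auto simp: bij_betw_def)
 with T(2) show False by (simp add: simple_mod_def)
 qed
 with f(1) show "rep_hom Q K al T al T' ~= {0}" by blast
qed

text \<open>The components are classified by their embedding \<open>iota\<close> of End(S). One exists, its Frobenius twists realise all d embeddings that are the
identity on the small field, and these are distinct.\<close>

lemma lifts_of_simple:
 fixes S::"('h, 'f::alg_closed_field) mats_fam" and Q::"('i, 'h) pre_digraph"
 assumes q: "char_power TYPE('f) q" and m: "m > 0"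
 and S: "S:reps Q (FF q) si" "simple_rep Q (FF q) si S"
 and d: "end_deg Q q (si, S) dvd m" "si = dim_scale (end_deg Q q (si, S)) al"
 shows "card ((%T. iso_rel Q (FF (q ^ m)) al `` {T}) ` {T:abs_simple_reps Q (FF (q ^ m)) al. ext_rep Q q m si al S T})
 = end_deg Q q (si, S)" (is "card (?cl ` ?Ts) = ?d")
proof -
 let ?K = "FF (q ^ m)::'f set"
 have K: "fsubfield ?K" by (rule FF_fsubfield[OF char_power_pow[OF q m]])
 have cardK: "card ?K = q ^ m" by (rule FF_prod(2)[OF char_power_pow[OF q m]])
 obtain ta T0 where "ext_rep Q q m si ta S T0" using lift_exists[OF q m S] by blast
 then interpret T0: ext_rep Q q m si ta S T0 .
 have eq: "ta = al"
 proof (rule poly_mapping_eqI)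
 fix i
 have "dim_scale ?d ta = dim_scale ?d al" using T0.dims(2)[OF T0.eig_if_dvd[OF d(1)]] d(2) by simp
 from arg_cong[OF this, of "%p. lk p i"] show "lk ta i = lk al i"
 using T0.d_pos by simp
 qed
 define Tj where "Tj j = frob_fam (q ^ j) T0" for j
 have ext: "ext_rep Q q m si al S (Tj j)" for j using T0.twist(1)[of j] by (simp add: Tj_def eq)
 have eig: "ext_rep.eig Q q m si al S T" if "ext_rep Q q m si al S T" for T
 by (rule ext_rep.eig_if_dvd[OF that d(1)])
 have e0: T0.eig by (rule T0.eig_if_dvd[OF d(1)])
 have abs: "T:abs_simple_reps Q ?K al" if "ext_rep Q q m si al S T" for T
 using ext_rep.T[OF that] ext_rep.card_E[OF that eig[OF that]] by (simp add: abs_simple_reps_def end_card_def cardK)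
 have iotaj: "ext_rep.iota Q q m si al S (Tj j) th = T0.iota th ^ (q ^ j)" if "th:T0.D" for j th
 using T0.twist(2)[OF that e0, of j] eig[OF ext[of j]] by (simp add: Tj_def eq)
 have rel: "(T, T'):iso_rel Q ?K al \<longleftrightarrow> (ALL th:T0.D. ext_rep.iota Q q m si al S T th = ext_rep.iota Q q m si al S T' th)"
 if T: "ext_rep Q q m si al S T" and T': "ext_rep Q q m si al S T'" for T T'
 unfolding simple_iso_iff[OF K ext_rep.T[OF T] ext_rep.T[OF T']]
 using same_iota_iso[OF T T' eig[OF T] eig[OF T']] iso_same_iota[OF T T' eig[OF T] eig[OF T']] by blast
 note ih = T0.iota_hom[OF e0]
 have cl_eq: "?cl T = ?cl T' \<longleftrightarrow> (T, T'):iso_rel Q ?K al" if "T:?Ts" "T':?Ts" for T T'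
 using eq_equiv_class_iff[OF iso_rel_equiv[OF K], of T Q al T'] that by (simp add: abs_simple_reps_def)
 have "?cl ` ?Ts = (%j. ?cl (Tj j)) ` {..<?d}"
 proof (intro equalityI subsetI)
 fix c assume "c:?cl ` ?Ts"
 then obtain T where T: "T:?Ts" "c = ?cl T" by blast
 hence TE: "ext_rep Q q m si al S T" by simp
 interpret T: ext_rep Q q m si al S T by (rule TE)
 note th = T.iota_hom[OF eig[OF TE]]
 (* Comparing the two embeddings of D gives an automorphism of FF (q^d), a power of Frobenius. *)
 define rh where "rh = inv_into T0.D T0.iota"
 have rh: "rh x:T0.D" "T0.iota (rh x) = x" if "x:FF (q ^ ?d)" for x
 using that inv_into_into[of x T0.iota T0.D] f_inv_into_f[of x T0.iota T0.D] ih(5) by (auto simp: rh_def)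
 have rhi: "rh (T0.iota th) = th" if "th:T0.D" for th using inv_into_f_f[OF ih(4) that] by (simp add: rh_def)
 have addD: "th + th':T0.D" if "th:T0.D" "th':T0.D" for th th' by (rule ophom_add[OF that T0.sV add_rep])
 have compD: "th o th':T0.D" if "th:T0.D" "th':T0.D" for th th' by (rule ophom_comp[OF that(2,1)])
 obtain j where j: "j < ?d" "!!x. x:FF (q ^ ?d) ==> T.iota (rh x) = x ^ (q ^ j)"
 proof (rule FF_automorphism[OF q T0.d_pos, of "%x. T.iota (rh x)"])
 fix x y::'f assume xy: "x:FF (q ^ ?d)" "y:FF (q ^ ?d)"
 have "rh (x + y) = rh x + rh y" using rhi[OF addD[OF rh(1)[OF xy(1)] rh(1)[OF xy(2)]]] ih(1)[OF rh(1)[OF xy(1)] rh(1)[OF xy(2)]] rh(2) xy by simp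
 thus "T.iota (rh (x + y)) = T.iota (rh x) + T.iota (rh y)" using th(1) rh(1) xy by simp
 have "rh (x * y) = rh x o rh y" using rhi[OF compD[OF rh(1)[OF xy(1)] rh(1)[OF xy(2)]]] ih(2)[OF rh(1)[OF xy(1)] rh(1)[OF xy(2)]] rh(2) xy by simp
 thus "T.iota (rh (x * y)) = T.iota (rh x) * T.iota (rh y)" using th(2) rh(1) xy by simp
 next
 fix x::'f assume x: "x:FF q"
 have "rh x = T0.kscal x" using rhi[OF T0.kscal_D[OF x]] ih(3)[OF x] by simp
 thus "T.iota (rh x) = x" using th(3)[OF x] by simp
 qed (rule that)
 have "T.iota th = ext_rep.iota Q q m si al S (Tj j) th" if "th:T0.D" for th
 proof -
 have "T0.iota th:FF (q ^ ?d)" using ih(5) that by blast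
 from j(2)[OF this] show ?thesis using iotaj[OF that] rhi[OF that] by simp
 qed
 hence "(T, Tj j):iso_rel Q ?K al" using rel[OF TE ext] by blast
 hence "c = ?cl (Tj j)" using cl_eq[OF T(1), of "Tj j"] T(2) abs[OF ext] ext by simp
 with j(1) show "c:(%j. ?cl (Tj j)) ` {..<?d}" by blast
 next
 fix c assume "c:(%j. ?cl (Tj j)) ` {..<?d}"
 thus "c:?cl ` ?Ts" using abs[OF ext] ext by blast
 qed
 moreover have "inj_on (%j. ?cl (Tj j)) {..<?d}"
 proof (rule linorder_inj_onI)
 fix i j assume ij: "i < j" "i:{..<?d}" "j:{..<?d}"
 show "?cl (Tj i) ~= ?cl (Tj j)"
 proof
 assume "?cl (Tj i) = ?cl (Tj j)"
 hence "(Tj i, Tj j):iso_rel Q ?K al" using cl_eq[of "Tj i" "Tj j"] abs[OF ext] ext by blast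
 hence same': "ext_rep.iota Q q m si al S (Tj i) th = ext_rep.iota Q q m si al S (Tj j) th" if "th:T0.D" for th
 using rel[OF ext ext, of i j] that by blast
 have same: "x ^ (q ^ i) = x ^ (q ^ j)" if x: "x:FF (q ^ ?d)" for x::'f
 proof -
 have "x:T0.iota ` T0.D" using x ih(5) by simp
 then obtain th where t: "x = T0.iota th" "th:T0.D" by (rule imageE)
 show ?thesis using same'[OF t(2)] iotaj[OF t(2)] t(1) by simp
 qed
 have "FF (q ^ ?d) <= (FF (q ^ (j - i))::'f set)"
 proof
 fix x::'f assume "x:FF (q ^ ?d)"
 from same[OF this] have "(x ^ (q ^ (j - i))) ^ (q ^ i) = x ^ (q ^ i)"
 using ij(1) by (simp add: power_mult[symmetric] power_add[symmetric])
 hence "x ^ (q ^ (j - i)) = x"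
 using char_power_inj[OF char_power_pow[OF q], of i "x ^ (q ^ (j - i))" x] by (cases "i = 0") auto
 thus "x:FF (q ^ (j - i))" by (simp add: FF_def)
 qed
 from card_mono[OF _ this] have "q ^ ?d <= q ^ (j - i)"
 using FF_prod(1,2)[OF char_power_pow[OF q]] T0.d_pos ij by auto
 thus False using ij T0.q2 by simp
 qed
 qed auto
 ultimately show ?thesis by (simp add: card_image)
qed

lemma simple_rep_end_deg:
 fixes S::"('h, 'f::alg_closed_field) mats_fam" and Q::"('i, 'h) pre_digraph"
 assumes q: "char_power TYPE('f) q" and S: "S:reps Q (FF q) si" "simple_rep Q (FF q) si S"
 shows "end_card Q (FF q) (si, S) = q ^ end_deg Q q (si, S)" "end_deg Q q (si, S) > 0"
 "EX ta. si = dim_scale (end_deg Q q (si, S)) ta"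
proof -
 have 1: "end_card Q (FF q) (si, S) = q ^ end_deg Q q (si, S) & end_deg Q q (si, S) > 0"
 proof -
 have "(0::nat) < 1" by simp
 from lift_exists[OF q this S] obtain ta T where "ext_rep Q q 1 si ta S T" by blast
 then interpret E: ext_rep Q q 1 si ta S T .
 show ?thesis using E.card_D E.d_pos by (simp add: end_card_def)
 qed
 thus "end_card Q (FF q) (si, S) = q ^ end_deg Q q (si, S)" "end_deg Q q (si, S) > 0" by auto
 obtain ta T where "ext_rep Q q (end_deg Q q (si, S)) si ta S T" using lift_exists[OF q conjunct2[OF 1] S] by blast
 then interpret E: ext_rep Q q "end_deg Q q (si, S)" si ta S T .
 show "EX ta. si = dim_scale (end_deg Q q (si, S)) ta" using E.dims(2)[OF E.eig_if_dvd[OF dvd_refl]] by blast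
qed

text \<open>Every absolutely simple T contains a simple representation over the small field, unique up to isomorphism as T is isotypic, and \<open>dims\<close>
gives the conditions on it.\<close>

theorem count_abs_simple:
 fixes R::"('i dimvec \<times> ('h, 'f::alg_closed_field) mats_fam) set" and Q::"('i, 'h) pre_digraph"
 assumes q: "char_power TYPE('f) q" and m: "m > 0"
 and R: "simple_reps_upto Q (FF q) ga R" and le: "dim_le (dim_scale m al) ga"
 shows "card (abs_simple_reps Q (FF (q ^ m)::'f set) al // iso_rel Q (FF (q ^ m)) al) =
 (SUM s | s:R & end_deg Q q s dvd m & fst s = dim_scale (end_deg Q q s) al. end_deg Q q s)"
proof -
 let ?k = "FF q::'f set" and ?K = "FF (q ^ m)::'f set"
 let ?d = "end_deg Q q" and ?cl = "%T. iso_rel Q (FF (q ^ m)::'f set) al `` {T}"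
 have k: "fsubfield ?k" and K: "fsubfield ?K" "?k <= ?K"
 using FF_fsubfield[OF q] FF_fsubfield[OF char_power_pow[OF q m]] FF_mono by auto
 have cardk: "card ?k = q" and cardK: "card ?K = q ^ m"
 using FF_prod(2)[OF q] FF_prod(2)[OF char_power_pow[OF q m]] by auto
 define P where "P = {s:R. ?d s dvd m & fst s = dim_scale (?d s) al}"
 define Ts where "Ts s = {T:abs_simple_reps Q ?K al. ext_rep Q q m (fst s) al (snd s) T}" for s
 have RS: "snd s:reps Q ?k (fst s)" "simple_rep Q ?k (fst s) (snd s)" if "s:R" for s
 using R that by (auto simp: simple_reps_upto_def)
 have cover: "EX s:P. T:Ts s" if T: "T:abs_simple_reps Q ?K al" for T
 proof -
 have T': "T:reps Q ?K al" "simple_rep Q ?K al T" "end_card Q ?K (al, T) = q ^ m"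
 using T by (auto simp: abs_simple_reps_def cardK)
 have nz: "al ~= 0" by (rule simple_rep_dim_nonzero[OF fsubfieldD(2)[OF K(1)] T'(2)])
 obtain si N f where N: "N:reps Q ?k si" "simple_rep Q ?k si N"
 "f:ophom (ops ?k) (rep_act Q si N) (vspace ?k si) (rep_act Q al T) (vspace ?K al)" "inj_on f (vspace ?k si)"
 using simple_subrep_exists[OF k K T'(1) nz] .
 note sN = vspace_submod[OF k order_refl N(1)]
 have "lk si i <= lk ga i" for i
 proof -
 have "f:ophom (lops ?k) (lact Q) (vspace ?k si) (lact Q) (vspace ?K al)"
 using ophom_mono_ops[OF N(3) lops_subset_ops] ophom_lops[of ?k Q si N] by blast
 from card_line_le_of_inj[OF k K this N(4), of i] have "q ^ lk si i <= q ^ (m * lk al i)"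
 by (simp add: cardk cardK power_mult)
 hence "lk si i <= m * lk al i"
 by (rule power_le_imp_le_exp[rotated]) (use char_power_ge_2[OF q] in simp)
 also have "... <= lk ga i" using le by (simp add: dim_le_def)
 finally show ?thesis .
 qed
 hence "EX s:R. rep_hom Q ?k (fst s) (snd s) si N ~= {0}"
 using conjunct2[OF conjunct2[OF conjunct2[OF R[unfolded simple_reps_upto_def]]]] N(1,2) by simp
 then obtain s where s: "s:R" "rep_hom Q ?k (fst s) (snd s) si N ~= {0}" by (rule bexE)
 then obtain g where g: "g:rep_hom Q ?k (fst s) (snd s) si N" "g ~= 0"
 using ophom_nonzero_iff[OF sN add_rep] by blast
 have "f o g ~= 0"
 proof
 assume z: "f o g = 0"
 obtain x where x: "g x ~= 0" using g(2) by (auto simp: fun_eq_iff)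
 have "x:vspace ?k (fst s)" using ophomD(1)[OF g(1)] x by blast
 hence "g x:vspace ?k si" using ophomD(2)[OF g(1)] by blast
 moreover have "f (g x) = f 0" using fun_cong[OF z, of x] ophom_zero_at[OF N(3)] by simp
 ultimately show False using N(4) x submodD(1)[OF sN] by (auto dest: inj_onD)
 qed
 hence E: "ext_rep Q q m (fst s) al (snd s) T"
 using ophom_comp[OF g(1) N(3)] RS[OF s(1)] q m T' by unfold_locales auto
 then interpret E: ext_rep Q q m "fst s" al "snd s" T .
 have e: "E.eig" by (rule E.eig_if_end) (use T'(3) in "simp add: end_card_def")
 have "s:P" using E.dims[OF e] s(1) by (simp add: P_def)
 moreover have "T:Ts s" using T E by (simp add: Ts_def)
 ultimately show ?thesis by blast
 qed
 have disj: "?cl ` Ts s \<inter> ?cl ` Ts t = {}" if s: "s:P" and t: "t:P" and ne: "s ~= t" for s t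
 proof (rule ccontr)
 assume "?cl ` Ts s \<inter> ?cl ` Ts t ~= {}"
 then obtain T T' where TT: "T:Ts s" "T':Ts t" "?cl T = ?cl T'" by blast
 then interpret E: ext_rep Q q m "fst s" al "snd s" T by (simp add: Ts_def)
 from TT interpret E': ext_rep Q q m "fst t" al "snd t" T' by (simp add: Ts_def)
 have "(T, T'):iso_rel Q ?K al"
 using eq_equiv_class_iff[OF iso_rel_equiv[OF K(1)], of T Q al T'] TT(3) E.T(1) E'.T(1) by simp
 then obtain f where f: "f:rep_hom Q ?K al T al T'" "bij_betw f (vspace ?K al) (vspace ?K al)"
 by (auto simp: iso_rel_def)
 note sW = vspace_submod[OF k order_refl RS(1)]
 obtain g where g: "g:E.H" "g ~= 0" using E.nonzero_hom by blast
 have fg: "f o g:ophom (ops ?k) (rep_act Q (fst s) (snd s)) (vspace ?k (fst s)) (rep_act Q al T') (vspace ?K al)"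
 by (rule ophom_comp[OF g(1) ophom_mono_ops[OF f(1) ops_mono(1)[OF K(2)]]])
 have fg0: "f o g ~= 0"
 proof
 assume z: "f o g = 0"
 obtain x where x: "g x ~= 0" using g(2) by (auto simp: fun_eq_iff)
 have "x:vspace ?k (fst s)" using ophomD(1)[OF g(1)] x by blast
 hence "g x:vspace ?K al" using ophomD(2)[OF g(1)] by blast
 moreover have "f (g x) = f 0" using fun_cong[OF z, of x] ophom_zero_at[OF f(1)] by simp
 ultimately show False using f(2) x submodD(1)[OF E.sW] by (auto dest: inj_onD simp: bij_betw_def)
 qed
 obtain n where n: "isotypic (ops ?k) E'.A E'.V E'.B E'.W E'.W n" using E'.W_isotypic .
 have "s:R" "t:R" using s t by (auto simp: P_def)
 hence "rep_hom Q ?k (fst s) (snd s) (fst t) (snd t) = {0}"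
 using conjunct1[OF conjunct2[OF conjunct2[OF R[unfolded simple_reps_upto_def]]]] ne by blast
 hence "card (ophom (ops ?k) E.A E.V E'.B E'.W) = 1"
 using isotypic_card_ophom[OF E'.S(2) E'.sWk add_rep add_rep n order_refl, of E.A E.V] by simp
 then obtain z where "ophom (ops ?k) E.A E.V E'.B E'.W = {z}" by (auto simp: card_1_singleton_iff)
 thus False using fg fg0 ophom_zero[OF E'.sWk add_rep, of E.A E.V] by auto
 qed
 have fin: "finite P" using R by (auto simp: P_def simple_reps_upto_def)
 have cardP: "card (?cl ` Ts s) = ?d s" if "s:P" for s
 proof -
 have *: "s:R" "?d s dvd m" "fst s = dim_scale (?d s) al" using that by (auto simp: P_def)
 show ?thesis using lifts_of_simple[OF q m RS(1)[OF *(1)] RS(2)[OF *(1)], of al] *(2,3) unfolding prod.collapse by (simp add: Ts_def)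
 qed
 have "abs_simple_reps Q ?K al // iso_rel Q ?K al = ?cl ` abs_simple_reps Q ?K al" by (auto simp: quotient_def)
 also have "... = (UN s:P. ?cl ` Ts s)" 
 proof
 show "?cl ` abs_simple_reps Q ?K al <= (UN s:P. ?cl ` Ts s)" using cover by blast
 qed (auto simp: Ts_def)
 also have "card ... = (SUM s:P. card (?cl ` Ts s))"
 proof (rule card_UN_disjoint[OF fin])
 show "ALL s:P. finite (?cl ` Ts s)"
 using cardP simple_rep_end_deg(2)[OF q RS] by (auto simp: P_def intro!: card_ge_0_finite)
 qed (use disj in blast)
 also have "... = (SUM s:P. ?d s)" using cardP by simp
 finally show ?thesis by (simp add: P_def)
qed

lemma simple_reps_upto_exists:
 assumes Q: "fin_digraph Q" and k: "fsubfield k"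
 obtains R where "simple_reps_upto Q k ga R"
proof -
 let ?C = "SIGMA si:{si. dim_le si ga}. {M:reps Q k si. simple_rep Q k si M}"
 let ?good = "%R. R <= ?C & (ALL s:R. ALL t:R. s ~= t --> rep_hom Q k (fst s) (snd s) (fst t) (snd t) = {0})"
 have finC: "finite ?C"
 by (intro finite_SigmaI finite_dim_le finite_subset[OF _ card_mat_fams(1)[OF Q k]]) auto
 have "finite (Collect ?good)" by (rule finite_subset[of _ "Pow ?C"]) (use finC in auto)
 moreover have "{}:Collect ?good" by simp
 ultimately obtain R where R: "?good R" and max: "!!R'. ?good R' ==> R <= R' ==> R' = R"
 proof -
 assume fin: "finite (Collect ?good)" and e: "{}:Collect ?good"
 from finite_has_maximal2[OF this] obtain R where R: "R:Collect ?good" "ALL R':Collect ?good. R <= R' --> R = R'" by (elim bexE conjE)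
 show thesis
 proof (rule that)
 show "?good R" using R(1) by (rule CollectD)
 show "R' = R" if "?good R'" "R <= R'" for R' using R(2)[THEN bspec, OF CollectI, OF that(1)] that(2) by (rule mp[THEN sym])
 qed
 qed
 have sub: "submod (ops k) (rep_act Q (fst s) (snd s)) (vspace k (fst s))" if "s:?C" for s
 using vspace_submod[OF k order_refl, of "snd s" Q "fst s"] that by auto
 have "EX s:R. rep_hom Q k (fst s) (snd s) si M ~= {0}"
 if le: "ALL i. lk si i <= lk ga i" and M: "M:reps Q k si" "simple_rep Q k si M" for si M
 proof -
 have C: "(si, M):?C" using le M by (auto simp: dim_le_def)
 note sM = vspace_submod[OF k order_refl M(1)]
 show ?thesis
 proof (cases "(si, M):R")
 case True
 have "idon (vspace k si):rep_hom Q k si M si M" by (rule idon_ophom[OF sM order_refl])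
 moreover have "idon (vspace k si) ~= 0"
 proof
 assume z: "idon (vspace k si) = 0"
 have "v = 0" if "v:vspace k si" for v using fun_cong[OF z, of v] that by (simp add: idon_def)
 with M(2) submodD(1)[OF sM] show False by (auto simp: simple_mod_def)
 qed
 ultimately show ?thesis using True by force
 next
 case False
 have ng: "~  ?good (insert (si, M) R)"
 proof
 assume "?good (insert (si, M) R)"
 from max[OF this] False show False by blast
 qed
 then obtain s t where st: "s:insert (si, M) R" "t:insert (si, M) R" "s ~= t"
 "rep_hom Q k (fst s) (snd s) (fst t) (snd t) ~= {0}"
 proof -
 have "insert (si, M) R <= ?C" using C R by blast
 hence "~  (ALL s:insert (si, M) R. ALL t:insert (si, M) R. s ~= t --> rep_hom Q k (fst s) (snd s) (fst t) (snd t) = {0})"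
 using ng by argo
 thus thesis using that by blast
 qed
 hence C2: "s:?C" "t:?C" using C R by blast+
 hence s2: "simple_rep Q k (fst s) (snd s)" "simple_rep Q k (fst t) (snd t)" by auto
 consider "t = (si, M)" "s:R" | "s = (si, M)" "t:R" using st(1-4) R by blast
 thus ?thesis
 proof cases
 case 1
 thus ?thesis using st(4) by auto
 next
 case 2
 obtain f where f: "f:rep_hom Q k (fst s) (snd s) (fst t) (snd t)" "f ~= 0"
 using st(4) ophom_nonzero_iff[OF sub[OF C2(2)] add_rep] by blast
 have bij: "bij_betw f (vspace k (fst s)) (vspace k (fst t))"
 by (rule simple_ophom_bij[OF s2 f(1) add_rep f(2)])
 let ?g = "hinv (vspace k (fst s)) f (vspace k (fst t))"
 have g: "?g:rep_hom Q k (fst t) (snd t) (fst s) (snd s)" "bij_betw ?g (vspace k (fst t)) (vspace k (fst s))"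
 using hinv_ophom(1)[OF f(1) bij sub[OF C2(1)]] bij_hinv[OF f(1) bij sub[OF C2(1)]] by auto
 have "?g ~= 0"
 proof
 assume "?g = 0"
 hence "vspace k (fst s) = {0}" using g(2) submodD(1)[OF sub[OF C2(2)]] by (auto simp: bij_betw_def)
 with s2(1) show False by (simp add: simple_mod_def)
 qed
 with g(1) have "rep_hom Q k (fst t) (snd t) si M ~= {0}" using 2(1) by auto
 with 2(2) show ?thesis by blast
 qed
 qed
 qed
 hence "simple_reps_upto Q k ga R" using R finite_subset[OF _ finC] unfolding simple_reps_upto_def by auto
 thus thesis by (rule that)
qed

section \<open>The logarithm of the mass series\<close>

text \<open>Taking \<open>m = 1, 2, ...\<close>, this is \<open>E f = (E g) f\<close> for \<open>f = \<Sum> qe t m x^m\<close> and \<open>g = \<Sum>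
x^n/(n(1-t^n))\<close>.\<close>

lemma qe_log:
 fixes t::"'a::field_char_0"
 assumes t: "!!i. i >= 1 ==> t ^ i ~= 1"
 shows "of_nat m * qe t m = (SUM n=1..m. qe t (m - n) / (1 - t ^ n))"
proof -
 have nz: "1 - t ^ Suc n ~= 0" for n using t[of "Suc n"] by auto
 have "of_nat m * qe t m = (SUM n<m. qe t (m - Suc n) / (1 - t ^ Suc n))"
 proof (induction m)
 case (Suc m)
 have e: "(1 - t ^ (m - n)) * qe t (m - n) = (if n < m then qe t (m - Suc n) else 0)" if "n < Suc m" for n
 proof (cases "n < m")
 case True
 hence "m - n = Suc (m - Suc n)" by simp
 thus ?thesis using True nz[of "m - Suc n"] by (simp add: qe_Suc del: power_Suc)
 qed (use that in auto)
 have "(1 - t ^ Suc m) * (SUM n<Suc m. qe t (m - n) / (1 - t ^ Suc n)) =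
 (SUM n<Suc m. qe t (m - n) + t ^ Suc n / (1 - t ^ Suc n) * ((1 - t ^ (m - n)) * qe t (m - n)))"
 unfolding sum_distrib_left
 proof (rule sum.cong[OF refl])
 fix n assume "n:{..<Suc m}"
 hence "Suc m = Suc n + (m - n)" by simp
 hence "t ^ Suc m = t ^ Suc n * t ^ (m - n)" by (metis power_add)
 hence *: "1 - t ^ Suc m = (1 - t ^ Suc n) + t ^ Suc n * (1 - t ^ (m - n))"
 by (simp add: right_diff_distrib del: power_Suc)
 thus "(1 - t ^ Suc m) * (qe t (m - n) / (1 - t ^ Suc n)) =
 qe t (m - n) + t ^ Suc n / (1 - t ^ Suc n) * ((1 - t ^ (m - n)) * qe t (m - n))"
 unfolding * using nz[of n] by (simp add: distrib_right add_divide_distrib mult.assoc del: power_Suc)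
 qed
 also have "... = (SUM n<Suc m. qe t (m - n) + t ^ Suc n / (1 - t ^ Suc n) * (if n < m then qe t (m - Suc n) else 0))"
 by (intro sum.cong[OF refl]) (simp only: e lessThan_iff)
 also have "... = (SUM n<Suc m. qe t (m - n)) + (SUM n<m. t ^ Suc n / (1 - t ^ Suc n) * qe t (m - Suc n))"
 unfolding sum.distrib by (simp add: sum.lessThan_Suc del: power_Suc)
 also have "(SUM n<m. t ^ Suc n / (1 - t ^ Suc n) * qe t (m - Suc n)) =
 (SUM n<m. qe t (m - Suc n) / (1 - t ^ Suc n)) - (SUM n<m. qe t (m - Suc n))"
 unfolding sum_subtractf[symmetric]
 proof (rule sum.cong[OF refl])
 fix n
 have "t ^ Suc n = 1 - (1 - t ^ Suc n)" by simp
 thus "t ^ Suc n / (1 - t ^ Suc n) * qe t (m - Suc n) = qe t (m - Suc n) / (1 - t ^ Suc n) - qe t (m - Suc n)"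
 using nz[of n] by (simp add: divide_simps del: power_Suc) (simp add: algebra_simps)
 qed
 also have "(SUM n<Suc m. qe t (m - n)) = qe t m + (SUM n<m. qe t (m - Suc n))"
 by (subst sum.lessThan_Suc_shift) simp
 finally have "(1 - t ^ Suc m) * (SUM n<Suc m. qe t (m - n) / (1 - t ^ Suc n)) = qe t m + of_nat m * qe t m"
 using Suc.IH by simp
 thus ?case using nz[of m] by (simp add: qe_Suc field_simps del: power_Suc sum.lessThan_Suc)
 qed simp
 thus ?thesis by (simp add: sum.atLeast1_atMost_eq)
qed

lemma dim_size_superset:
 assumes "finite A" "Poly_Mapping.keys ga <= A"
 shows "dim_size ga = (SUM i:A. lk ga i)"
 unfolding dim_size_def by (rule sum.mono_neutral_left) (use assms in "auto simp: in_keys_iff")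

lemma dim_size_add: "dim_size (al + be) = dim_size al + dim_size be"
proof -
 let ?A = "Poly_Mapping.keys al \<union> Poly_Mapping.keys be"
 have "finite ?A" "Poly_Mapping.keys (al + be) <= ?A" by (auto simp: in_keys_iff lookup_add)
 thus ?thesis
 using dim_size_superset[of ?A "al + be"] dim_size_superset[of ?A al] dim_size_superset[of ?A be]
 by (simp add: lookup_add sum.distrib)
qed

lemma dim_size_zero [simp]: "dim_size 0 = 0" by (simp add: dim_size_def)

lemma dim_size_eq_0_iff: "dim_size ga = 0 \<longleftrightarrow> ga = 0"
 by (auto simp: dim_size_def in_keys_iff intro!: poly_mapping_eqI)

lemma dim_scale_Suc: "dim_scale (Suc n) al = al + dim_scale n al"
 by (rule poly_mapping_eqI) (simp add: lookup_add)

lemma dim_scale_0 [simp]: "dim_scale 0 al = 0"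
 by (rule poly_mapping_eqI) simp

lemma dim_size_scale [simp]: "dim_size (dim_scale n al) = n * dim_size al"
 by (induction n) (simp_all add: dim_scale_Suc dim_size_add)

lemma dim_size_mult_dim: "finite S ==> dim_size (mult_dim S m) = (SUM s:S. m s * dim_size (fst s))"
 by (induction S rule: finite_induct) (simp_all add: mult_dim_def dim_size_add)

lemma finite_mult_fams:
 assumes S: "finite S" "!!s. s:S ==> fst s ~= 0"
 shows "finite (mult_fams S ga)"
proof (rule finite_subset)
 show "mult_fams S ga <= {m. ALL s. (s:S --> m s:{..dim_size ga}) & (s ~: S --> m s = 0)}"
 proof safe
 fix m s assume m: "m:mult_fams S ga"
 { assume s: "s:S"
 have "dim_le (mult_dim S m) ga" using m by (simp add: mult_fams_def dim_le_def)
 from mult_dim_le_bound[OF S(1) s S(2)[OF s] this] show "m s <= dim_size ga" . }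
 { assume "s ~: S" with m show "m s = 0" unfolding mult_fams_def by blast }
 qed
qed (rule finite_set_of_finite_funs[OF S(1)], simp)

lemma mult_dim_upd:
 assumes "finite S" "s:S"
 shows "mult_dim S (m(s := m s + n)) = mult_dim S m + dim_scale n (fst s)"
proof -
 have "dim_scale (m s + n) (fst s) = dim_scale (m s) (fst s) + dim_scale n (fst s)"
 by (rule poly_mapping_eqI) (simp add: lookup_add algebra_simps)
 hence 1: "dim_scale ((m(s := m s + n)) t) (fst t) = dim_scale (m t) (fst t) + (if t = s then dim_scale n (fst s) else 0)" for t
 by simp
 show ?thesis unfolding mult_dim_def 1 sum.distrib using assms by (simp add: sum.delta)
qed

definition qmass::"('i dimvec \<times> 'c) set => ('i dimvec \<times> 'c => 'a::field) => 'i dimvec => 'a" where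
 "qmass S w be = (SUM m:mult_fams S be. PROD s:S. qe (w s) (m s))"

text \<open>The series of S is a product over S of series in one variable, so the logarithms of \<open>qe_log\<close> add up. In coefficients: weigh m by
\<open>\<Sum>_S m_S dim S\<close> and split the term at S.\<close>

theorem qmass_log:
 fixes S::"('i dimvec \<times> 'c) set" and w::"'i dimvec \<times> 'c => 'a::field_char_0"
 assumes S: "finite S" "!!s. s:S ==> fst s ~= 0" and w: "!!s n. s:S ==> n >= 1 ==> w s ^ n ~= 1"
 shows "of_nat (dim_size ga) * qmass S w ga =
 (SUM (s, n) | s:S & n > 0 & dim_le (dim_scale n (fst s)) ga.
 of_nat (dim_size (fst s)) / (1 - w s ^ n) * qmass S w (ga - dim_scale n (fst s)))"
proof -
 let ?e = "%m. PROD s:S. qe (w s) (m s)"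
 let ?P = "{(s, n). s:S & n > 0 & dim_le (dim_scale n (fst s)) ga}"
 let ?g = "%s n. of_nat (dim_size (fst s)) / (1 - w s ^ n)"
 let ?M = "mult_fams S::'i dimvec => ('i dimvec \<times> 'c => nat) set"
 note fM = finite_mult_fams[OF S]
 have e_upd: "of_nat (m s) * ?e m = (SUM n=1..m s. ?e (m(s := m s - n)) / (1 - w s ^ n))" if s: "s:S" for m s
 proof -
 have sp: "?e m' = qe (w s) (m' s) * (PROD t:S - {s}. qe (w t) (m' t))" for m' by (rule prod.remove[OF S(1) s])
 have "(PROD t:S - {s}. qe (w t) ((m(s := m s - n)) t)) = (PROD t:S - {s}. qe (w t) (m t))" for n
 by (rule prod.cong) auto
 hence "(SUM n=1..m s. ?e (m(s := m s - n)) / (1 - w s ^ n)) =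
 (SUM n=1..m s. qe (w s) (m s - n) / (1 - w s ^ n)) * (PROD t:S - {s}. qe (w t) (m t))"
 unfolding sp sum_distrib_right by simp
 also have "(SUM n=1..m s. qe (w s) (m s - n) / (1 - w s ^ n)) = of_nat (m s) * qe (w s) (m s)"
 by (rule qe_log[symmetric]) (use w s in auto)
 finally show ?thesis by (simp add: sp[of m] mult.assoc)
 qed
 have upd: "mult_dim S m = mult_dim S (m(s := m s - n)) + dim_scale n (fst s)" if "s:S" "n <= m s" for m s n
 using mult_dim_upd[OF S(1) that(1), of "m(s := m s - n)" n] that(2) by simp
 have finP: "finite ?P"
 proof (rule finite_subset)
 show "?P <= S \<times> {..dim_size ga}"
 proof
 fix x assume "x:?P"
 then obtain s n where x: "x = (s, n)" and s: "s:S" and n: "dim_le (dim_scale n (fst s)) ga" by blast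
 have "mult_dim S (%t. if t = s then n else 0) = dim_scale n (fst s)"
 proof -
 have "dim_scale (if t = s then n else 0) (fst t) = (if t = s then dim_scale n (fst s) else 0)" for t by simp
 thus ?thesis using s S(1) by (simp add: mult_dim_def sum.delta)
 qed
 with n have "dim_le (mult_dim S (%t. if t = s then n else 0)) ga" by simp
 from mult_dim_le_bound[OF S(1) s S(2)[OF s] this] s show "x:S \<times> {..dim_size ga}" by (simp add: x)
 qed
 qed (use S(1) in simp)
 have "of_nat (dim_size ga) * qmass S w ga = (SUM m:?M ga. SUM s:S. of_nat (dim_size (fst s)) * (of_nat (m s) * ?e m))"
 unfolding qmass_def sum_distrib_left
 proof (rule sum.cong[OF refl])
 fix m assume "m:?M ga"
 hence "dim_size ga = (SUM s:S. m s * dim_size (fst s))"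
 using dim_size_mult_dim[OF S(1), of m] by (simp add: mult_fams_def)
 thus "of_nat (dim_size ga) * ?e m = (SUM s:S. of_nat (dim_size (fst s)) * (of_nat (m s) * ?e m))"
 by (simp add: sum_distrib_left mult_ac)
 qed
 also have "... = (SUM m:?M ga. SUM s:S. SUM n=1..m s. ?g s n * ?e (m(s := m s - n)))"
 by (intro sum.cong[OF refl]) (subst e_upd, simp_all add: sum_distrib_left)
 also have "... = (SUM (m, s, n):Sigma (?M ga) (%m. Sigma S (%s. {1..m s})). ?g s n * ?e (m(s := m s - n)))"
 using S(1) fM by (simp add: sum.Sigma)
 also have "... = (SUM ((s, n), m'):Sigma ?P (%(s, n). ?M (ga - dim_scale n (fst s))). ?g s n * ?e m')"
 proof (rule sum.reindex_bij_witness[where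
 i = "%((s, n), m'). (m'(s := m' s + n), s, n)" and j = "%(m, s, n). ((s, n), m(s := m s - n))"], goal_cases)
 case (2 a)
 then obtain m s n where a: "a = (m, s, n)" "m:?M ga" "s:S" "n >= 1" "n <= m s" by auto
 have "dim_le (dim_scale n (fst s)) ga" "mult_dim S (m(s := m s - n)) = ga - dim_scale n (fst s)"
 proof -
 have g: "ga = mult_dim S (m(s := m s - n)) + dim_scale n (fst s)"
 using upd[where m = m and s = s and n = n, OF a(3,5)] a(2) by (simp add: mult_fams_def)
 show "dim_le (dim_scale n (fst s)) ga" unfolding g by (simp add: dim_le_def lookup_add)
 show "mult_dim S (m(s := m s - n)) = ga - dim_scale n (fst s)" unfolding g by simp
 qed
 thus ?case using a by (auto simp: mult_fams_def)
 next
 case (4 b)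
 then obtain m' s n where b: "b = ((s, n), m')" "m':?M (ga - dim_scale n (fst s))" "s:S" "n > 0"
 "dim_le (dim_scale n (fst s)) ga" by auto
 have "ga - dim_scale n (fst s) + dim_scale n (fst s) = ga"
 using b(5) by (intro poly_mapping_eqI) (simp add: lookup_add lookup_minus dim_le_def)
 hence "mult_dim S (m'(s := m' s + n)) = ga"
 using mult_dim_upd[OF S(1) b(3), of m' n] b(2) by (simp add: mult_fams_def)
 thus ?case using b by (auto simp: mult_fams_def)
 qed auto
 also have "... = (SUM (s, n):?P. SUM m':?M (ga - dim_scale n (fst s)). ?g s n * ?e m')"
 by (subst sum.Sigma[symmetric]) (use finP fM in "auto simp: case_prod_unfold")
 finally show ?thesis by (simp add: qmass_def sum_distrib_left case_prod_unfold)
qed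

lemma qmass_0:
 assumes S: "finite S" "!!s. s:S ==> fst s ~= 0"
 shows "qmass S w 0 = 1"
proof -
 have "mult_fams S 0 = {%_. 0}"
 proof (intro equalityI subsetI)
 fix m assume m: "m:mult_fams S (0::'a dimvec)"
 have "m s = 0" for s
 proof (cases "s:S")
 case True
 have "dim_le (mult_dim S m) 0" using m by (simp add: mult_fams_def dim_le_def)
 from mult_dim_le_bound[OF S(1) True S(2)[OF True] this] show ?thesis by simp
 next
 case False
 with m show ?thesis unfolding mult_fams_def by blast
 qed
 thus "m:{%_. 0}" by auto
 qed (auto simp: mult_fams_def mult_dim_def)
 thus ?thesis by (simp add: qmass_def)
qed

text \<open>A term \<open>(S, n)\<close> with End(S) of degree d is collected under \<open>k = dn\<close> and \<open>ta = dim S/d\<close>. Its weight \<open>|dim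
S| = d |ta|\<close> supplies the factor d of \<open>count_abs_simple\<close>.\<close>

theorem simple_mass_log:
 fixes Q::"('i, 'h) pre_digraph" and R::"('i dimvec \<times> ('h, 'f::alg_closed_field) mats_fam) set"
 assumes q: "char_power TYPE('f) q" and R: "simple_reps_upto Q (FF q) ga' R" and le: "dim_le ga ga'"
 shows "of_nat (dim_size ga) * simple_mass Q (FF q) R ga =
 (SUM (k, ta) | k > 0 & ta ~= 0 & dim_le (dim_scale k ta) ga.
 of_nat (dim_size ta * card (abs_simple_reps Q (FF (q ^ k)::'f set) ta // iso_rel Q (FF (q ^ k)) ta)) / (1 - of_nat q ^ k) *
 simple_mass Q (FF q) R (ga - dim_scale k ta))"
proof -
 let ?k = "FF q::'f set" and ?d = "%s. end_deg Q q s"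
 have k: "fsubfield ?k" by (rule FF_fsubfield[OF q])
 have fin: "finite R" using R by (simp add: simple_reps_upto_def)
 have RS: "snd s:reps Q ?k (fst s)" "simple_rep Q ?k (fst s) (snd s)" if "s:R" for s
 using R that by (auto simp: simple_reps_upto_def)
 have nz: "fst s ~= 0" if "s:R" for s
 by (rule simple_rep_dim_nonzero[OF fsubfieldD(2)[OF k] RS(2)[OF that]])
 have d: "end_card Q ?k s = q ^ ?d s" "?d s > 0" "EX ta. fst s = dim_scale (?d s) ta" if "s:R" for s
 using simple_rep_end_deg[OF q RS(1)[OF that] RS(2)[OF that]] by simp_all
 define t where "t = (%s::'i dimvec \<times> ('h, 'f) mats_fam. SOME ta. fst s = dim_scale (?d s) ta)"
 have t: "fst s = dim_scale (?d s) (t s)" if "s:R" for s unfolding t_def by (rule someI_ex) (rule d(3)[OF that])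
 let ?w = "%s. of_nat (end_card Q ?k s)::rat"
 let ?m = "simple_mass Q ?k R"
 have q2: "q >= 2" by (rule char_power_ge_2[OF q])
 have w: "?w s ^ n ~= 1" if "s:R" "n >= 1" for s n
 proof -
 have "(1::nat) < q ^ (?d s * n)" using q2 d(2)[OF that(1)] that(2) by (intro one_less_power) auto
 hence "(of_nat (q ^ (?d s * n))::rat) ~= of_nat 1" unfolding of_nat_eq_iff by (rule less_imp_neq[THEN not_sym])
 thus ?thesis by (simp add: d(1)[OF that(1)] power_mult)
 qed
 have mass: "?m = qmass R ?w" by (simp add: fun_eq_iff simple_mass_def qmass_def)
 let ?I = "{(k, ta). k > 0 & ta ~= 0 & dim_le (dim_scale k ta) ga}"
 let ?P = "%(k, ta). {s:R. ?d s dvd k & fst s = dim_scale (?d s) ta}"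
 have finI: "finite ?I"
 proof (rule finite_subset)
 show "?I <= {..dim_size ga} \<times> {be. dim_le be ga}"
 proof
 fix x assume "x:?I"
 then obtain k ta where x: "x = (k, ta)" "k > 0" "ta ~= 0" "dim_le (dim_scale k ta) ga" by blast
 have "dim_le (mult_dim {(ta, ())} (%_. k)) ga" using x(4) by (simp add: mult_dim_def)
 from mult_dim_le_bound[OF _ _ _ this, of "(ta, ())"] x(3) have "k <= dim_size ga" by simp
 moreover have "lk ta i <= lk ga i" for i
 proof -
 have "lk ta i <= k * lk ta i" using x(2) by simp
 also have "... <= lk ga i" using x(4) by (simp add: dim_le_def)
 finally show ?thesis .
 qed
 ultimately show "x:{..dim_size ga} \<times> {be. dim_le be ga}" by (simp add: x(1) dim_le_def)
 qed
 qed (intro finite_cartesian_product finite_dim_le, simp)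
 have "of_nat (dim_size ga) * ?m ga = (SUM (s, n) | s:R & n > 0 & dim_le (dim_scale n (fst s)) ga.
 of_nat (dim_size (fst s)) / (1 - ?w s ^ n) * ?m (ga - dim_scale n (fst s)))"
 unfolding mass by (rule qmass_log[OF fin nz w])
 also have "... = (SUM ((k, ta), s):Sigma ?I ?P. of_nat (dim_size ta) / (1 - of_nat q ^ k) * ?m (ga - dim_scale k ta) * of_nat (?d s))"
 proof (rule sum.reindex_bij_witness[where j = "%(s, n). ((n * ?d s, t s), s)" and i = "%((k, ta), s). (s, k div ?d s)"], goal_cases)
 case (1 a)
 thus ?case using d(2) by auto
 next
 case (2 a)
 then obtain s n where a: "a = (s, n)" "s:R" "n > 0" "dim_le (dim_scale n (fst s)) ga" by blast
 have "dim_scale (n * ?d s) (t s) = dim_scale n (fst s)"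
 by (subst t[OF a(2)], rule poly_mapping_eqI) simp
 moreover have "t s ~= 0"
 proof
 assume "t s = 0"
 hence "fst s = 0" using t[OF a(2)] by (metis dim_size_eq_0_iff dim_size_scale dim_size_zero mult_0_right)
 with nz[OF a(2)] show False by simp
 qed
 ultimately show ?case using a d(2)[OF a(2)] t[OF a(2)] by simp
 next
 case (3 b)
 then obtain k ta s where b: "b = ((k, ta), s)" "k > 0" "s:R" "?d s dvd k" "fst s = dim_scale (?d s) ta" by blast
 have "t s = ta"
 proof (rule poly_mapping_eqI)
 fix i
 have "dim_scale (?d s) (t s) = dim_scale (?d s) ta" by (rule trans[OF t[OF b(3), symmetric] b(5)])
 from arg_cong[OF this, of "%p. lk p i"]
 have "?d s * lk (t s) i = ?d s * lk ta i" by simp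
 thus "lk (t s) i = lk ta i" using d(2)[OF b(3)] by simp
 qed
 thus ?case using b by simp
 next
 case (4 b)
 then obtain k ta s where b: "b = ((k, ta), s)" "k > 0" "s:R" "?d s dvd k" "fst s = dim_scale (?d s) ta"
 "dim_le (dim_scale k ta) ga" by blast
 have "dim_scale (k div ?d s) (fst s) = dim_scale k ta"
 using b(4) by (subst b(5), intro poly_mapping_eqI) (simp add: mult.assoc[symmetric])
 thus ?case using b d(2)[OF b(3)] by (auto simp: dvd_imp_le div_greater_zero_iff)
 next
 case (5 a)
 then obtain s n where a: "a = (s, n)" "s:R" "n > 0" by blast
 have 1: "dim_scale (n * ?d s) (t s) = dim_scale n (fst s)"
 by (subst t[OF a(2)], rule poly_mapping_eqI) simp
 have 2: "dim_size (fst s) = ?d s * dim_size (t s)" by (subst t[OF a(2)]) simp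
 show ?case unfolding a(1) prod.case 1 2 d(1)[OF a(2)] by (simp add: power_mult[symmetric] mult_ac)
 qed
 also have "... = (SUM (k, ta):?I. of_nat (dim_size ta) / (1 - of_nat q ^ k) * ?m (ga - dim_scale k ta) * of_nat (SUM s:?P (k, ta). ?d s))"
 by (subst sum.Sigma[symmetric]) (use finI fin in "auto simp: sum_distrib_left case_prod_unfold")
 also have "... = (SUM (k, ta):?I. of_nat (dim_size ta * card (abs_simple_reps Q (FF (q ^ k)::'f set) ta // iso_rel Q (FF (q ^ k)) ta)) / (1 - of_nat q ^ k) *
 ?m (ga - dim_scale k ta))"
 proof (rule sum.cong[OF refl])
 fix x assume "x:?I"
 then obtain k ta where x: "x = (k, ta)" "k > 0" "dim_le (dim_scale k ta) ga" by blast
 have "dim_le (dim_scale k ta) ga'" using x(3) le unfolding dim_le_def by (meson order_trans)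
 from count_abs_simple[OF q x(2) R this]
 show "(case x of (k, ta) => of_nat (dim_size ta) / (1 - of_nat q ^ k) * ?m (ga - dim_scale k ta) * of_nat (SUM s:?P (k, ta). ?d s)) =
 (case x of (k, ta) => of_nat (dim_size ta * card (abs_simple_reps Q (FF (q ^ k)::'f set) ta // iso_rel Q (FF (q ^ k)) ta)) / (1 - of_nat q ^ k) *
 ?m (ga - dim_scale k ta))" by (simp add: x(1))
 qed
 finally show ?thesis .
qed

section \<open>The order of the general linear group\<close>

context Ring.field
begin

lemma finsum_swap:
 assumes "finite A" "finite B" "!!a b. a:A ==> b:B ==> f a b:carrier R"
 shows "(\<Oplus>a\<in>A. \<Oplus>b\<in>B. f a b) = (\<Oplus>b\<in>B. \<Oplus>a\<in>A. f a b)"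
 using assms(1,3)
proof (induction A rule: finite_induct)
 case (insert x A)
 have "(\<Oplus>b\<in>B. \<Oplus>a\<in>insert x A. f a b) = (\<Oplus>b\<in>B. f x b \<oplus> (\<Oplus>a\<in>A. f a b))"
 by (intro finsum_cong') (use insert in "auto simp: Pi_def")
 also have "... = (\<Oplus>b\<in>B. f x b) \<oplus> (\<Oplus>b\<in>B. \<Oplus>a\<in>A. f a b)"
 by (rule finsum_addf) (use insert in "auto simp: Pi_def")
 also have "... = (\<Oplus>a\<in>insert x A. \<Oplus>b\<in>B. f a b)"
 using insert by (simp add: finsum_insert Pi_def)
 finally show ?case by simp
qed simp

lemma finsum_unit:
 assumes "finite A" "a:A" "!!b. b:A ==> f b:carrier R"
 shows "(\<Oplus>b\<in>A. f b \<otimes> (if b = a then \<one> else \<zero>)) = f a"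
proof -
 have "(\<Oplus>b\<in>A. f b \<otimes> (if b = a then \<one> else \<zero>)) = (\<Oplus>b\<in>A. if a = b then f b else \<zero>)"
 by (intro finsum_cong') (use assms in auto)
 also have "... = f a" by (rule finsum_singleton) (use assms in auto)
 finally show ?thesis .
qed

abbreviation "coords n \<equiv> {..<n::nat} \<rightarrow>\<^sub>E carrier R"

definition comb::"(nat => nat => 'a) => nat => nat => (nat => 'a) => nat => 'a" where
 "comb C m n t = (\<lambda>i\<in>{..<m}. \<Oplus>j\<in>{..<n}. t j \<otimes> C j i)"

definition indep_cols::"(nat => nat => 'a) => nat => nat => bool" where
 "indep_cols C m n \<longleftrightarrow> (ALL t:coords n. (ALL i<m. (\<Oplus>j\<in>{..<n}. t j \<otimes> C j i) = \<zero>) --> (ALL j<n. t j = \<zero>))"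

lemma comb_in: "C:{..<n} \<rightarrow>\<^sub>E coords m ==> t:coords n ==> comb C m n t:coords m"
 by (auto simp: comb_def PiE_def Pi_def intro!: finsum_closed)

lemma comb_inj:
 assumes C: "C:{..<n} \<rightarrow>\<^sub>E coords m" and ind: "indep_cols C m n"
 shows "inj_on (comb C m n) (coords n)"
proof (rule inj_onI)
 fix s t assume s: "s:coords n" and t: "t:coords n" and eq: "comb C m n s = comb C m n t"
 let ?u = "\<lambda>j\<in>{..<n}. s j \<ominus> t j"
 have car: "s j:carrier R" "t j:carrier R" if "j < n" for j using s t that by auto
 have Cc: "C j i:carrier R" if "j < n" "i < m" for i j using C that by (auto simp: PiE_def Pi_def)
 have "(\<Oplus>j\<in>{..<n}. ?u j \<otimes> C j i) = \<zero>" if i: "i < m" for i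
 proof -
 have "(\<Oplus>j\<in>{..<n}. s j \<otimes> C j i) = (\<Oplus>j\<in>{..<n}. t j \<otimes> C j i)"
 using fun_cong[OF eq, of i] i by (simp add: comb_def)
 moreover have "(\<Oplus>j\<in>{..<n}. s j \<otimes> C j i) = (\<Oplus>j\<in>{..<n}. ?u j \<otimes> C j i \<oplus> t j \<otimes> C j i)"
 by (intro finsum_cong') (use car Cc i in "auto simp: Pi_def l_distr[symmetric] minus_eq a_assoc l_neg")
 moreover have "... = (\<Oplus>j\<in>{..<n}. ?u j \<otimes> C j i) \<oplus> (\<Oplus>j\<in>{..<n}. t j \<otimes> C j i)"
 by (rule finsum_addf) (use car Cc i in auto)
 ultimately have eq: "(\<Oplus>j\<in>{..<n}. ?u j \<otimes> C j i) \<oplus> (\<Oplus>j\<in>{..<n}. t j \<otimes> C j i) = (\<Oplus>j\<in>{..<n}. t j \<otimes> C j i)"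
 by simp
 have "(\<Oplus>j\<in>{..<n}. ?u j \<otimes> C j i):carrier R" by (intro finsum_closed) (use car Cc i in auto)
 moreover have "(\<Oplus>j\<in>{..<n}. t j \<otimes> C j i):carrier R" by (intro finsum_closed) (use car Cc i in auto)
 ultimately show ?thesis using eq by (simp only: add.r_cancel_one)
 qed
 moreover have "?u:coords n" using car by auto
 ultimately have "ALL j<n. ?u j = \<zero>" using ind unfolding indep_cols_def by blast
 hence "s j \<ominus> t j = \<zero>" if "j < n" for j using that by simp
 hence "s j = t j" if "j < n" for j
 using that sum_zero_eq_neg[of "s j" "\<ominus> t j"] car[OF that] by (simp add: minus_eq)
 thus "s = t" using s t by (intro PiE_ext) auto
qed

lemma indep_cols_Suc:
 assumes C: "C:{..<n} \<rightarrow>\<^sub>E coords m" and c: "c:coords m"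
 shows "indep_cols (C(n := c)) m (Suc n) \<longleftrightarrow> indep_cols C m n & c ~: comb C m n ` coords n"
proof -
 have Cc: "C j i:carrier R" if "j < n" "i < m" for i j using C that by (auto simp: PiE_def Pi_def)
 have cc: "c i:carrier R" if "i < m" for i using c that by auto
 have sum: "(\<Oplus>j\<in>{..<Suc n}. t j \<otimes> (C(n := c)) j i) = t n \<otimes> c i \<oplus> (\<Oplus>j\<in>{..<n}. t j \<otimes> C j i)"
 if t: "!!j. j < Suc n ==> t j:carrier R" and i: "i < m" for t i
 proof -
 have "(\<Oplus>j\<in>{..<n}. t j \<otimes> (C(n := c)) j i) = (\<Oplus>j\<in>{..<n}. t j \<otimes> C j i)"
 by (intro finsum_cong') (use t Cc i in auto)
 thus ?thesis unfolding lessThan_Suc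
 by (subst finsum_insert) (use t Cc cc i in "auto simp: Pi_def")
 qed
 show ?thesis
 proof (intro iffI conjI)
 assume ind: "indep_cols (C(n := c)) m (Suc n)"
 show "indep_cols C m n" unfolding indep_cols_def
 proof (intro ballI impI)
 fix t assume t: "t:coords n" "ALL i<m. (\<Oplus>j\<in>{..<n}. t j \<otimes> C j i) = \<zero>"
 have tc: "(t(n := \<zero>)) j:carrier R" if "j < Suc n" for j using t(1) that by (auto simp: less_Suc_eq)
 have "(\<Oplus>j\<in>{..<n}. (t(n := \<zero>)) j \<otimes> C j i) = (\<Oplus>j\<in>{..<n}. t j \<otimes> C j i)" if "i < m" for i
 by (intro finsum_cong') (use t Cc that in auto)
 hence "ALL i<m. (\<Oplus>j\<in>{..<Suc n}. (t(n := \<zero>)) j \<otimes> (C(n := c)) j i) = \<zero>"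
 using sum[OF tc] t(2) cc by simp
 moreover have "t(n := \<zero>):coords (Suc n)" using t(1) tc by (auto simp: PiE_def extensional_def)
 ultimately have "ALL j<Suc n. (t(n := \<zero>)) j = \<zero>" using ind unfolding indep_cols_def by blast
 thus "ALL j<n. t j = \<zero>" by (metis fun_upd_other less_Suc_eq less_irrefl)
 qed
 show "c ~: comb C m n ` coords n"
 proof
 assume "c:comb C m n ` coords n"
 then obtain t where t: "t:coords n" "c = comb C m n t" by blast
 have tc: "(t(n := \<ominus> \<one>)) j:carrier R" if "j < Suc n" for j using t(1) that by (auto simp: less_Suc_eq)
 have "(\<Oplus>j\<in>{..<n}. (t(n := \<ominus> \<one>)) j \<otimes> C j i) = c i" if i: "i < m" for i
 proof -
 have "(\<Oplus>j\<in>{..<n}. (t(n := \<ominus> \<one>)) j \<otimes> C j i) = (\<Oplus>j\<in>{..<n}. t j \<otimes> C j i)"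
 by (intro finsum_cong') (use t(1) Cc i in auto)
 thus ?thesis using t(2) i by (simp add: comb_def)
 qed
 hence "ALL i<m. (\<Oplus>j\<in>{..<Suc n}. (t(n := \<ominus> \<one>)) j \<otimes> (C(n := c)) j i) = \<zero>"
 using sum[OF tc] cc by (simp add: l_minus l_neg)
 moreover have "t(n := \<ominus> \<one>):coords (Suc n)" using t(1) tc by (auto simp: PiE_def extensional_def)
 ultimately have "ALL j<Suc n. (t(n := \<ominus> \<one>)) j = \<zero>" using ind unfolding indep_cols_def by blast
 hence "\<ominus> \<one> = \<zero>" by (metis fun_upd_same lessI)
 thus False by (metis minus_minus minus_zero one_closed one_not_zero)
 qed
 next
 assume ind: "indep_cols C m n & c ~: comb C m n ` coords n"
 show "indep_cols (C(n := c)) m (Suc n)" unfolding indep_cols_def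
 proof (intro ballI impI)
 fix t assume t: "t:coords (Suc n)" "ALL i<m. (\<Oplus>j\<in>{..<Suc n}. t j \<otimes> (C(n := c)) j i) = \<zero>"
 have tc: "t j:carrier R" if "j < Suc n" for j using t(1) that by auto
 let ?s = "%i. \<Oplus>j\<in>{..<n}. t j \<otimes> C j i"
 have sc: "?s i:carrier R" if "i < m" for i by (intro finsum_closed) (use tc Cc that in auto)
 have z: "t n \<otimes> c i \<oplus> ?s i = \<zero>" if "i < m" for i using t(2) sum[of t i] tc that by simp
 have tn: "t n = \<zero>"
 proof (rule ccontr)
 assume nz: "t n ~= \<zero>"
 hence u: "t n:Units R" using tc[of n] by (simp add: field_Units)
 define a where "a = \<ominus> (inv (t n))"
 have a: "a:carrier R" and at: "a \<otimes> t n = \<ominus> \<one>" using u tc[of n] by (auto simp: a_def l_minus)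
 let ?v = "\<lambda>j\<in>{..<n}. a \<otimes> t j"
 have v: "?v:coords n" using a tc by auto
 have "c = comb C m n ?v"
 proof (rule PiE_ext[OF c comb_in[OF C v]])
 fix i assume "i:{..<m}"
 hence i: "i < m" by simp
 have "(\<Oplus>j\<in>{..<n}. ?v j \<otimes> C j i) = (\<Oplus>j\<in>{..<n}. a \<otimes> (t j \<otimes> C j i))"
 by (intro finsum_cong') (use a tc Cc i in "auto simp: m_assoc")
 also have "... = a \<otimes> ?s i" by (rule finsum_rdistr[symmetric]) (use a tc Cc i in auto)
 finally have 1: "comb C m n ?v i = a \<otimes> ?s i" using i by (simp add: comb_def)
 have "\<zero> = a \<otimes> (t n \<otimes> c i \<oplus> ?s i)" using z[OF i] a by simp
 also have "... = \<ominus> (c i) \<oplus> a \<otimes> ?s i"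
 using a tc[of n] cc[OF i] sc[OF i] by (simp add: r_distr m_assoc[symmetric] at l_minus)
 finally have "\<ominus> c i \<oplus> a \<otimes> ?s i = \<zero>" by simp
 from sum_zero_eq_neg[OF _ _ this] a sc[OF i] cc[OF i] have "\<ominus> c i = \<ominus> (a \<otimes> ?s i)" by simp
 from arg_cong[OF this, of "a_inv R"] a sc[OF i] cc[OF i]
 show "c i = comb C m n ?v i" unfolding 1 by simp
 qed
 with v ind show False by blast
 qed
 have "?s i = \<zero>" if "i < m" for i using z[OF that] cc[OF that] sc[OF that] by (simp add: tn)
 moreover have "(\<Oplus>j\<in>{..<n}. restrict t {..<n} j \<otimes> C j i) = ?s i" if "i < m" for i
 by (intro finsum_cong') (use tc Cc that in auto)
 ultimately have z: "ALL i<m. (\<Oplus>j\<in>{..<n}. restrict t {..<n} j \<otimes> C j i) = \<zero>" by simp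
 have "restrict t {..<n}:coords n" using tc by auto
 with z have "ALL j<n. restrict t {..<n} j = \<zero>" using ind unfolding indep_cols_def by blast
 thus "ALL j<Suc n. t j = \<zero>" using tn by (simp add: less_Suc_eq)
 qed
 qed
qed

lemma card_indep_cols:
 assumes fin: "finite (carrier R)"
 shows "int (card {C:{..<n} \<rightarrow>\<^sub>E coords m. indep_cols C m n}) = (PROD i<n. int (order R) ^ m - int (order R) ^ i)"
proof (induction n)
 case 0
 have "{C:{..<0::nat} \<rightarrow>\<^sub>E coords m. indep_cols C m 0} = {%_. undefined}" by (auto simp: indep_cols_def)
 thus ?case by simp
next
 case (Suc n)
 let ?I = "%n. {C:{..<n} \<rightarrow>\<^sub>E coords m. indep_cols C m n}"
 let ?S = "Sigma (?I n) (%C. coords m - comb C m n ` coords n)"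
 have finc: "finite (coords l)" for l by (intro finite_PiE) (use fin in auto)
 have cardc: "card (coords l) = order R ^ l" for l by (simp add: card_PiE order_def)
 have finI: "finite (?I n)" by (rule finite_subset[of _ "{..<n} \<rightarrow>\<^sub>E coords m"]) (auto intro: finite_PiE finc)
 have "bij_betw (%(C, c). C(n := c)) ?S (?I (Suc n))"
 proof (rule bij_betwI[where g = "%C. (restrict C {..<n}, C n)"], goal_cases)
 case 1
 show ?case
 proof (intro funcsetI)
 fix x assume "x:?S"
 then obtain C c where x: "x = (C, c)" "C:{..<n} \<rightarrow>\<^sub>E coords m" "c:coords m" "indep_cols C m n" "c ~: comb C m n ` coords n" by auto
 have "C(n := c):{..<Suc n} \<rightarrow>\<^sub>E coords m"
 unfolding lessThan_Suc using PiE_fun_upd[OF x(3,2)] by blast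
 thus "(case x of (C, c) => C(n := c)):?I (Suc n)" using x indep_cols_Suc[OF x(2,3)] by simp
 qed
 next
 case 2
 show ?case
 proof (intro funcsetI)
 fix C assume "C:?I (Suc n)"
 hence C: "C:{..<Suc n} \<rightarrow>\<^sub>E coords m" "indep_cols C m (Suc n)" by auto
 have r: "restrict C {..<n}:{..<n} \<rightarrow>\<^sub>E coords m" "C n:coords m"
 using PiE_mem[OF C(1)] by (simp_all add: restrict_PiE_iff)
 have "(restrict C {..<n})(n := C n) = C" using C(1) by (auto simp: fun_eq_iff PiE_def extensional_def less_Suc_eq)
 thus "(restrict C {..<n}, C n):?S" using r C(2) indep_cols_Suc[OF r] by simp
 qed
 next
 case (3 x)
 thus ?case by (auto simp: fun_eq_iff PiE_def extensional_def)
 next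
 case (4 C)
 thus ?case by (auto simp: fun_eq_iff PiE_def extensional_def less_Suc_eq)
 qed
 from bij_betw_same_card[OF this] have "int (card (?I (Suc n))) = int (card ?S)" by simp
 also have "... = (SUM C:?I n. int (card (coords m - comb C m n ` coords n)))"
 using finI finc by simp
 also have "... = (SUM C:?I n. int (order R) ^ m - int (order R) ^ n)"
 proof (rule sum.cong[OF refl])
 fix C assume C: "C:?I n"
 have "card (comb C m n ` coords n) = order R ^ n" using comb_inj[of C n m] C by (simp add: card_image cardc)
 moreover have sub: "comb C m n ` coords n <= coords m" using comb_in[of C n m] C by auto
 moreover have "card (comb C m n ` coords n) <= card (coords m)" by (rule card_mono[OF finc sub])
 ultimately show "int (card (coords m - comb C m n ` coords n)) = int (order R) ^ m - int (order R) ^ n"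
 using card_Diff_subset[OF finite_subset[OF sub finc] sub] by (simp add: cardc of_nat_diff)
 qed
 finally show ?case using Suc.IH by simp
qed

definition cols::"nat => nat => 'a mat => nat => nat => 'a" where
 "cols m n A = (\<lambda>j\<in>{..<n}. \<lambda>i\<in>{..<m}. A $$ (i, j))"

lemma mats_entry: "A:mats R m n ==> i < m ==> j < n ==> A $$ (i, j):carrier R"
 by (auto simp: mats_def intro: subsetD elements_matI)

lemma mats_I: "A:carrier_mat m n ==> (!!i j. i < m ==> j < n ==> A $$ (i, j):carrier R) ==> A:mats R m n"
 by (auto simp: mats_def elements_mat_def)

lemma bij_cols: "bij_betw (cols m n) (mats R m n) ({..<n} \<rightarrow>\<^sub>E coords m)"
proof (rule bij_betwI[where g = "%C. mat m n (%(i, j). C j i)"], goal_cases)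
 case 1 show ?case using mats_entry by (auto simp: cols_def)
next
 case 2 show ?case by (auto intro!: mats_I simp: PiE_def Pi_def)
next
 case (3 A)
 thus ?case by (intro eq_matI) (auto simp: mats_def cols_def)
next
 case (4 C)
 show ?case
 proof (rule PiE_ext[OF _ 4])
 fix j assume j: "j:{..<n}"
 show "cols m n (mat m n (%(i, j). C j i)) j = C j"
 by (rule PiE_ext[of _ "{..<m}" "%_. carrier R"]) (use j 4 in "auto simp: cols_def PiE_def Pi_def")
 qed (use 4 in "auto simp: cols_def PiE_def Pi_def")
qed

lemma card_mats: "card (mats R m n) = order R ^ (m * n)"
 using bij_betw_same_card[OF bij_cols, of m n] by (simp add: card_PiE order_def power_mult)

lemma mat_prod_entry:
 "A:carrier_mat l m ==> B:carrier_mat m n ==> i < l ==> j < n ==>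
 mat_prod R A B $$ (i, j) = (\<Oplus>k\<in>{..<m}. A $$ (i, k) \<otimes> B $$ (k, j))"
 by (simp add: mat_prod_def)

lemma mat_prod_mats: "A:mats R l m ==> B:mats R m n ==> mat_prod R A B:mats R l n"
 by (rule mats_I) (use mats_entry[of A l m] mats_entry[of B m n] in
 \<open>auto simp: mat_prod_def mats_def intro!: finsum_closed\<close>)

lemma mat_prod_assoc_entry:
 assumes A: "!!k. k < m ==> a k:carrier R" and B: "B:mats R m n" and c: "!!k. k < n ==> c k:carrier R"
 shows "(\<Oplus>k\<in>{..<n}. (\<Oplus>j\<in>{..<m}. a j \<otimes> B $$ (j, k)) \<otimes> c k) = (\<Oplus>j\<in>{..<m}. a j \<otimes> (\<Oplus>k\<in>{..<n}. B $$ (j, k) \<otimes> c k))"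
proof -
 note e = mats_entry[OF B]
 have "(\<Oplus>k\<in>{..<n}. (\<Oplus>j\<in>{..<m}. a j \<otimes> B $$ (j, k)) \<otimes> c k) = (\<Oplus>k\<in>{..<n}. \<Oplus>j\<in>{..<m}. a j \<otimes> B $$ (j, k) \<otimes> c k)"
 by (intro finsum_cong' finsum_ldistr) (use A c e in "auto intro!: finsum_closed")
 also have "... = (\<Oplus>j\<in>{..<m}. \<Oplus>k\<in>{..<n}. a j \<otimes> B $$ (j, k) \<otimes> c k)"
 by (rule finsum_swap) (use A c e in auto)
 also have "... = (\<Oplus>j\<in>{..<m}. \<Oplus>k\<in>{..<n}. a j \<otimes> (B $$ (j, k) \<otimes> c k))"
 by (intro finsum_cong') (use A c e in "auto simp: m_assoc intro!: finsum_closed")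
 also have "... = (\<Oplus>j\<in>{..<m}. a j \<otimes> (\<Oplus>k\<in>{..<n}. B $$ (j, k) \<otimes> c k))"
 by (intro finsum_cong' finsum_rdistr[symmetric]) (use A c e in "auto intro!: finsum_closed")
 finally show ?thesis .
qed

text \<open>Independent columns make multiplication an injective map of a finite space to itself, and a preimage of each unit vector is a column of the inverse.\<close>

lemma GL_iff_indep_cols:
 assumes fin: "finite (carrier R)" and A: "A:mats R n n"
 shows "A:GL R n \<longleftrightarrow> indep_cols (cols n n A) n n"
proof -
 let ?one = "mat n n (%(i, j). if i = j then \<one> else \<zero>)"
 have GL: "A:GL R n \<longleftrightarrow> (EX B:mats R n n. mat_prod R B A = ?one & mat_prod R A B = ?one)"
 using A by (simp add: GL_def Units_def mat_monoid_def)
 note Ae = mats_entry[OF A]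
 have Ac: "A:carrier_mat n n" using A by (simp add: mats_def)
 have C: "cols n n A:{..<n} \<rightarrow>\<^sub>E coords n" using bij_betwE[OF bij_cols] A by blast
 have comb_cols: "(\<Oplus>j\<in>{..<n}. t j \<otimes> cols n n A j i) = (\<Oplus>j\<in>{..<n}. A $$ (i, j) \<otimes> t j)" if "t:coords n" "i < n" for t i
 by (intro finsum_cong') (use that Ae in "auto simp: cols_def PiE_def Pi_def intro: m_comm")
 show ?thesis
 proof
 assume "A:GL R n"
 then obtain B where B: "B:mats R n n" "mat_prod R B A = ?one" using GL by blast
 note Be = mats_entry[OF B(1)]
 show "indep_cols (cols n n A) n n" unfolding indep_cols_def
 proof (intro ballI impI allI)
 fix t k assume t: "t:coords n" and z: "ALL i<n. (\<Oplus>j\<in>{..<n}. t j \<otimes> cols n n A j i) = \<zero>" and k: "k < n"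
 have tc: "t j:carrier R" if "j < n" for j using t that by auto
 have "t k = (\<Oplus>j\<in>{..<n}. t j \<otimes> (if j = k then \<one> else \<zero>))" by (rule finsum_unit[symmetric]) (use tc k in auto)
 also have "... = (\<Oplus>j\<in>{..<n}. (\<Oplus>l\<in>{..<n}. B $$ (k, l) \<otimes> A $$ (l, j)) \<otimes> t j)"
 proof (rule finsum_cong'[OF refl])
 show "(%j. (\<Oplus>l\<in>{..<n}. B $$ (k, l) \<otimes> A $$ (l, j)) \<otimes> t j):{..<n} \<rightarrow> carrier R"
 using tc Ae Be k by (auto intro!: finsum_closed)
 fix j assume "j:{..<n}"
 hence j: "j < n" by simp
 have "(\<Oplus>l\<in>{..<n}. B $$ (k, l) \<otimes> A $$ (l, j)) = ?one $$ (k, j)"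
 using mat_prod_entry[of B n n A n k j] B A j k by (simp add: mats_def)
 thus "t j \<otimes> (if j = k then \<one> else \<zero>) = (\<Oplus>l\<in>{..<n}. B $$ (k, l) \<otimes> A $$ (l, j)) \<otimes> t j"
 using j k tc by auto
 qed
 also have "... = (\<Oplus>l\<in>{..<n}. B $$ (k, l) \<otimes> (\<Oplus>j\<in>{..<n}. A $$ (l, j) \<otimes> t j))"
 by (rule mat_prod_assoc_entry[OF _ A]) (use tc Be k in auto)
 also have "... = (\<Oplus>l\<in>{..<n}. \<zero>)"
 by (intro finsum_cong') (use z comb_cols[OF t] Be k in auto)
 finally show "t k = \<zero>" by simp
 qed
 next
 assume ind: "indep_cols (cols n n A) n n"
 have finc: "finite (coords n)" by (intro finite_PiE) (use fin in auto)
 have inj: "inj_on (comb (cols n n A) n n) (coords n)" by (rule comb_inj[OF C ind])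
 have surj: "comb (cols n n A) n n ` coords n = coords n"
 by (rule endo_inj_surj[OF finc _ inj]) (use comb_in[OF C] in auto)
 define e where "e k = (\<lambda>i\<in>{..<n}. if i = k then \<one> else \<zero>)" for k
 have ec: "e k:coords n" for k unfolding e_def by (intro restrict_PiE_iff[THEN iffD2] ballI) simp
 have "EX b:coords n. comb (cols n n A) n n b = e k" for k
 proof -
 have "e k:comb (cols n n A) n n ` coords n" unfolding surj by (rule ec)
 thus ?thesis by (rule imageE) (rule bexI, rule sym)
 qed
 then obtain b where b: "!!k. b k:coords n" "!!k. comb (cols n n A) n n (b k) = e k" by metis
 define B where "B = mat n n (%(j, k). b k j)"
 have B: "B:mats R n n" using b(1) by (intro mats_I) (auto simp: B_def PiE_def Pi_def)
 note Be = mats_entry[OF B]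
 have AB': "(\<Oplus>j\<in>{..<n}. A $$ (i, j) \<otimes> B $$ (j, k)) = (if i = k then \<one> else \<zero>)" if ik: "i < n" "k < n" for i k
 proof -
 have "(\<Oplus>j\<in>{..<n}. A $$ (i, j) \<otimes> B $$ (j, k)) = (\<Oplus>j\<in>{..<n}. A $$ (i, j) \<otimes> b k j)"
 by (intro finsum_cong') (use ik Ae b(1)[of k] in "auto simp: B_def PiE_def Pi_def")
 also have "... = comb (cols n n A) n n (b k) i" using comb_cols[OF b(1) ik(1)] ik by (simp add: comb_def)
 finally show ?thesis using ik by (simp add: b(2) e_def)
 qed
 have AB: "mat_prod R A B = ?one"
 proof (rule eq_matI)
 fix i k assume "i < dim_row ?one" "k < dim_col ?one"
 thus "mat_prod R A B $$ (i, k) = ?one $$ (i, k)"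
 using AB' mat_prod_entry[OF Ac, of B n i k] B by (simp add: mats_def)
 qed (use A B in "auto simp: mat_prod_def mats_def")
 have BA: "mat_prod R B A = ?one"
 proof (rule eq_matI)
 fix j' k assume "j' < dim_row ?one" "k < dim_col ?one"
 hence jk: "j' < n" "k < n" by auto
 let ?c = "\<lambda>j\<in>{..<n}. \<Oplus>l\<in>{..<n}. B $$ (j, l) \<otimes> A $$ (l, k)"
 have cc: "?c:coords n" using Ae Be jk by (auto intro!: finsum_closed)
 have "comb (cols n n A) n n ?c = comb (cols n n A) n n (e k)"
 proof (rule PiE_ext[OF comb_in[OF C cc] comb_in[OF C ec]])
 fix i assume "i:{..<n}"
 hence i: "i < n" by simp
 have "comb (cols n n A) n n ?c i = (\<Oplus>j\<in>{..<n}. A $$ (i, j) \<otimes> ?c j)"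
 using comb_cols[OF cc i] i by (simp add: comb_def)
 also have "... = (\<Oplus>j\<in>{..<n}. A $$ (i, j) \<otimes> (\<Oplus>l\<in>{..<n}. B $$ (j, l) \<otimes> A $$ (l, k)))"
 by (intro finsum_cong') (use Ae Be jk i in "auto intro!: finsum_closed")
 also have "... = (\<Oplus>l\<in>{..<n}. (\<Oplus>j\<in>{..<n}. A $$ (i, j) \<otimes> B $$ (j, l)) \<otimes> A $$ (l, k))"
 by (rule mat_prod_assoc_entry[OF _ B, symmetric]) (use Ae i jk in auto)
 also have "... = (\<Oplus>l\<in>{..<n}. A $$ (l, k) \<otimes> (if l = i then \<one> else \<zero>))"
 by (intro finsum_cong') (use AB' i Ae jk in auto)
 also have "... = A $$ (i, k)" by (rule finsum_unit) (use i Ae jk in auto)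
 also have "... = (\<Oplus>j\<in>{..<n}. A $$ (i, j) \<otimes> (if j = k then \<one> else \<zero>))" by (rule finsum_unit[symmetric]) (use i Ae jk in auto)
 also have "... = (\<Oplus>j\<in>{..<n}. A $$ (i, j) \<otimes> e k j)"
 by (intro finsum_cong') (use Ae i in "auto simp: e_def")
 also have "... = comb (cols n n A) n n (e k) i" using comb_cols[OF ec i] i by (simp add: comb_def)
 finally show "comb (cols n n A) n n ?c i = comb (cols n n A) n n (e k) i" .
 qed
 from inj_onD[OF inj this cc ec] have "?c j' = e k j'" by (rule fun_cong)
 thus "mat_prod R B A $$ (j', k) = ?one $$ (j', k)"
 using mat_prod_entry[of B n n A n j' k] A B jk by (simp add: mats_def e_def)
 qed (use A B in "auto simp: mat_prod_def mats_def")
 show "A:GL R n" using GL B AB BA by blast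
 qed
qed

theorem card_GL:
 assumes fin: "finite (carrier R)"
 shows "int (card (GL R n)) = (PROD i<n. int (order R) ^ n - int (order R) ^ i)"
proof -
 have sub: "GL R n <= mats R n n" by (auto simp: GL_def Units_def mat_monoid_def)
 have "bij_betw (cols n n) (GL R n) {C:{..<n} \<rightarrow>\<^sub>E coords n. indep_cols C n n}"
 proof (rule bij_betw_imageI)
 show "inj_on (cols n n) (GL R n)" using bij_cols[of n n] sub by (auto simp: bij_betw_def intro: inj_on_subset)
 show "cols n n ` GL R n = {C:{..<n} \<rightarrow>\<^sub>E coords n. indep_cols C n n}"
 proof (intro equalityI subsetI)
 fix C assume "C:cols n n ` GL R n"
 then obtain A where A: "A:GL R n" "C = cols n n A" by blast
 hence "A:mats R n n" using sub by blast
 thus "C:{C:{..<n} \<rightarrow>\<^sub>E coords n. indep_cols C n n}"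
 using A GL_iff_indep_cols[OF fin] bij_betwE[OF bij_cols] by blast
 next
 fix C assume C: "C:{C:{..<n} \<rightarrow>\<^sub>E coords n. indep_cols C n n}"
 hence "C:cols n n ` mats R n n" using bij_cols[of n n] by (simp add: bij_betw_def)
 then obtain A where A: "A:mats R n n" "C = cols n n A" by blast
 with C GL_iff_indep_cols[OF fin A(1)] show "C:cols n n ` GL R n" by blast
 qed
 qed
 from bij_betw_same_card[OF this] show ?thesis using card_indep_cols[OF fin, of n n] by simp
qed

end

section \<open>Representations over a field given by a record\<close>


text \<open>Transports representations over a field given as a record to its image in an algebraically closed field, where the fields of different sizes are
nested.\<close>

locale field_emb = Ring.field K for K::"'a ring" (structure) +
 fixes ps::"'a => 'f::field"
 assumes fin: "finite (carrier K)" and ps_one: "ps \<one> = 1"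
 and ps_add: "!!x y. x:carrier K ==> y:carrier K ==> ps (x \<oplus> y) = ps x + ps y"
 and ps_mult: "!!x y. x:carrier K ==> y:carrier K ==> ps (x \<otimes> y) = ps x * ps y"
begin

abbreviation "k \<equiv> ps ` carrier K"

lemma ps_zero [simp]: "ps \<zero> = 0"
proof -
 have "ps \<zero> + 0 = ps \<zero> + ps \<zero>" using ps_add[of \<zero> \<zero>] by simp
 thus ?thesis by (simp only: add_left_cancel)
qed

lemma ps_minus: "x:carrier K ==> ps (\<ominus> x) = - ps x"
 using ps_add[of x "\<ominus> x"] by (simp add: r_neg eq_neg_iff_add_eq_0 add.commute)

lemma ps_inverse: assumes "x:carrier K" "x ~= \<zero>" shows "ps (inv x) = inverse (ps x)" and "ps x ~= 0"
proof -
 have x: "x:Units K" using assms by (simp add: field_Units)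
 have "ps x * ps (inv x) = 1" using ps_mult[of x "inv x"] x assms ps_one by simp
 thus "ps (inv x) = inverse (ps x)" "ps x ~= 0" by (auto simp: inverse_unique)
qed

lemma ps_inj: "inj_on ps (carrier K)"
proof (rule inj_onI)
 fix x y assume xy: "x:carrier K" "y:carrier K" "ps x = ps y"
 hence "ps (x \<ominus> y) = 0" by (simp add: minus_eq ps_add ps_minus)
 hence "x \<ominus> y = \<zero>" using ps_inverse(2)[of "x \<ominus> y"] xy by auto
 thus "x = y" using sum_zero_eq_neg[of x "\<ominus> y"] xy by (simp add: minus_eq)
qed

lemma ps_eq_iff: "x:carrier K ==> y:carrier K ==> ps x = ps y \<longleftrightarrow> x = y"
 using inj_on_eq_iff[OF ps_inj] .

lemma fsub: "fsubfield k"
 unfolding fsubfield_def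
proof (intro conjI ballI)
 show "finite k" using fin by simp
 show "0:k" by (rule image_eqI[of _ _ \<zero>]) simp_all
 show "1:k" by (rule image_eqI[of _ _ \<one>]) (simp_all add: ps_one)
next
 fix x y assume "x:k" "y:k"
 then obtain a b where ab: "x = ps a" "y = ps b" "a:carrier K" "b:carrier K" by blast
 show "x - y:k" by (rule image_eqI[of _ _ "a \<ominus> b"]) (use ab in "simp_all add: minus_eq ps_add ps_minus")
 show "x * y:k" by (rule image_eqI[of _ _ "a \<otimes> b"]) (use ab in "simp_all add: ps_mult")
next
 fix x assume "x:k"
 then obtain a where a: "x = ps a" "a:carrier K" by blast
 show "inverse x:k"
 proof (cases "a = \<zero>")
 case True
 thus ?thesis using a by (intro image_eqI[of _ _ \<zero>]) simp_all
 next
 case False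
 show ?thesis by (rule image_eqI[of _ _ "inv a"]) (use a False ps_inverse(1)[of a] field_Units in auto)
 qed
qed

lemma card_k: "card k = order K" by (simp add: card_image[OF ps_inj] order_def)

lemma ps_sum: "(!!j. j:A ==> f j:carrier K) ==> ps (\<Oplus>j\<in>A. f j) = (SUM j:A. ps (f j))"
proof (induction A rule: infinite_finite_induct)
 case (insert x A)
 thus ?case by (simp add: finsum_insert Pi_def ps_add finsum_closed)
qed (simp_all add: finsum_infinite)

definition unemb::"'f => 'a" where "unemb = inv_into (carrier K) ps"

lemma unemb: "x:k ==> unemb x:carrier K" "x:k ==> ps (unemb x) = x" "a:carrier K ==> unemb (ps a) = a"
 using inv_into_into[of x ps "carrier K"] f_inv_into_f[of x ps "carrier K"] inv_into_f_f[OF ps_inj, of a]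
 by (auto simp: unemb_def)

lemma unemb_0 [simp]: "unemb 0 = \<zero>" using unemb(3)[of \<zero>] by simp

definition emb_rep::"('i, 'h) pre_digraph => 'i dimvec => ('h => 'a mat) => ('h, 'f) mats_fam" where
 "emb_rep Q al M = (%h a b. if h:arcs Q & a < lk al (head Q h) & b < lk al (tail Q h) then ps (M h $$ (a, b)) else 0)"

lemma rep_spaceD:
 assumes "M:rep_space Q K al" "h:arcs Q"
 shows "M h:mats K (lk al (head Q h)) (lk al (tail Q h))" "M h:carrier_mat (lk al (head Q h)) (lk al (tail Q h))"
 "a < lk al (head Q h) ==> b < lk al (tail Q h) ==> M h $$ (a, b):carrier K"
proof -
 show 1: "M h:mats K (lk al (head Q h)) (lk al (tail Q h))" using assms by (auto simp: rep_space_def)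
 thus "M h:carrier_mat (lk al (head Q h)) (lk al (tail Q h))" by (simp add: mats_def)
 show "a < lk al (head Q h) ==> b < lk al (tail Q h) ==> M h $$ (a, b):carrier K" by (rule mats_entry[OF 1])
qed

lemma bij_emb_rep: "bij_betw (emb_rep Q al) (rep_space Q K al) (reps Q k al)"
proof (rule bij_betwI[where g = "%M. \<lambda>h\<in>arcs Q. mat (lk al (head Q h)) (lk al (tail Q h)) (%(a, b). unemb (M h a b))"], goal_cases)
 case 1
 have "emb_rep Q al M h a b:k" if "M:rep_space Q K al" for M h a b
 using rep_spaceD(3)[OF that] fsubfieldD(2)[OF fsub] by (simp add: emb_rep_def)
 thus ?case by (auto simp: mat_fams_def emb_rep_def split: if_splits)
next
 case 2
 have "mat m n (%(a, b). unemb (M h a b)):mats K m n" if "M:reps Q k al" for M h m n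
 by (rule mats_I) (use mat_famsD(1)[OF that] in "auto intro!: unemb(1)")
 thus ?case by (auto simp: rep_space_def)
next
 case (3 M)
 show ?case
 proof (rule ext)
 fix h
 show "(\<lambda>h\<in>arcs Q. mat (lk al (head Q h)) (lk al (tail Q h)) (%(a, b). unemb (emb_rep Q al M h a b))) h = M h"
 proof (cases "h:arcs Q")
 case True
 show ?thesis unfolding restrict_apply'[OF True]
 by (rule eq_matI) (use rep_spaceD(2,3)[OF 3 True] True in "simp_all add: emb_rep_def unemb")
 next
 case False
 thus ?thesis using 3 by (auto simp: rep_space_def PiE_def extensional_def)
 qed
 qed
next
 case (4 M)
 show ?case
 proof (intro ext)
 fix h a b
 show "emb_rep Q al (\<lambda>h\<in>arcs Q. mat (lk al (head Q h)) (lk al (tail Q h)) (%(a, b). unemb (M h a b))) h a b = M h a b"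
 proof (cases "h:arcs Q & a < lk al (head Q h) & b < lk al (tail Q h)")
 case True
 thus ?thesis using mat_famsD(1)[OF 4, of h a b] by (simp add: emb_rep_def unemb)
 next
 case False
 thus ?thesis using mat_famsD(2)[OF 4, of h a b] by (auto simp: emb_rep_def)
 qed
 qed
qed

lemma vec_space_module: "module K (vec_space K n)"
proof (rule moduleI)
 show "cring K" ..
 show "abelian_group (vec_space K n)"
 proof (rule abelian_groupI)
 fix v w assume v: "v:carrier (vec_space K n)" and w: "w:carrier (vec_space K n)"
 show "v \<oplus>\<^bsub>vec_space K n\<^esub> w:carrier (vec_space K n)"
 and "v \<oplus>\<^bsub>vec_space K n\<^esub> w = w \<oplus>\<^bsub>vec_space K n\<^esub> v"
 using v w by (auto simp: vec_space_def a_comm intro!: eq_vecI)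
 show "v \<oplus>\<^bsub>vec_space K n\<^esub> w \<oplus>\<^bsub>vec_space K n\<^esub> u = v \<oplus>\<^bsub>vec_space K n\<^esub> (w \<oplus>\<^bsub>vec_space K n\<^esub> u)"
 if "u:carrier (vec_space K n)" for u
 using v w that by (auto simp: vec_space_def a_assoc intro!: eq_vecI)
 next
 show "\<zero>\<^bsub>vec_space K n\<^esub>:carrier (vec_space K n)" by (auto simp: vec_space_def)
 next
 fix v assume v: "v:carrier (vec_space K n)"
 show "\<zero>\<^bsub>vec_space K n\<^esub> \<oplus>\<^bsub>vec_space K n\<^esub> v = v"
 using v by (auto simp: vec_space_def intro!: eq_vecI)
 show "EX w:carrier (vec_space K n). w \<oplus>\<^bsub>vec_space K n\<^esub> v = \<zero>\<^bsub>vec_space K n\<^esub>"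
 by (rule bexI[of _ "vec n (%i. \<ominus> (v $ i))"]) (use v in "auto simp: vec_space_def l_neg intro!: eq_vecI")
 qed
qed (auto simp: vec_space_def m_assoc l_distr r_distr intro!: eq_vecI)

lemma submodule_iff:
 "submodule H K (vec_space K n) \<longleftrightarrow> H <= carrier (vec_space K n) & vec n (%_. \<zero>):H &
 (ALL v:H. ALL w:H. vec n (%i. v $ i \<oplus> w $ i):H) & (ALL c:carrier K. ALL v:H. vec n (%i. c \<otimes> v $ i):H)"
 (is "?L \<longleftrightarrow> ?R")
proof -
 interpret M: module K "vec_space K n" by (rule vec_space_module)
 have z: "\<zero>\<^bsub>vec_space K n\<^esub> = vec n (%_. \<zero>)" and p: "v \<oplus>\<^bsub>vec_space K n\<^esub> w = vec n (%i. v $ i \<oplus> w $ i)"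
 and s: "c \<odot>\<^bsub>vec_space K n\<^esub> v = vec n (%i. c \<otimes> v $ i)" for v w c by (simp_all add: vec_space_def)
 show ?thesis
 proof
 assume L: ?L
 then interpret S: submodule H K "vec_space K n" .
 show ?R using M.submoduleE(1,4,5)[OF L] S.one_closed by (simp add: z[symmetric] p[symmetric] s[symmetric])
 next
 assume R: ?R
 show ?L
 proof (rule M.submoduleI)
 fix v assume v: "v:H"
 hence "v:carrier (vec_space K n)" using R by blast
 hence "\<ominus>\<^bsub>vec_space K n\<^esub> v = (\<ominus> \<one>) \<odot>\<^bsub>vec_space K n\<^esub> v" by (simp add: M.smult_l_minus)
 thus "\<ominus>\<^bsub>vec_space K n\<^esub> v:H" using R v by (simp add: s)
 qed (use R in "auto simp: z p s")
 qed
qed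

definition to_vec::"'i dimvec => 'i => ('i, 'f) gvec => 'a vec" where
 "to_vec al i v = vec (lk al i) (%a. unemb (v i a))"

definition of_vec::"'i => 'a vec => ('i, 'f) gvec" where
 "of_vec i u = (%j a. if j = i & a < dim_vec u then ps (u $ a) else 0)"

lemma to_vec_simps:
 assumes v: "v:vspace k al"
 shows "to_vec al i v:carrier (vec_space K (lk al i))"
 "of_vec i (to_vec al i v) = rep_act Q al M (Proj i) v"
 "w:vspace k al ==> to_vec al i (v + w) = vec (lk al i) (%a. to_vec al i v $ a \<oplus> to_vec al i w $ a)"
 "c:carrier K ==> to_vec al i (rep_act Q al M (Scal (ps c)) v) = vec (lk al i) (%a. c \<otimes> to_vec al i v $ a)"
 "to_vec al i (rep_act Q al M (Proj j) v) = (if i = j then to_vec al i v else vec (lk al i) (%_. \<zero>))"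
 "N:rep_space Q K al ==> to_vec al i (rep_act Q al (emb_rep Q al N) (Arr h) v) =
 (if h:arcs Q & i = head Q h then mat_app K (N h) (to_vec al (tail Q h) v) else vec (lk al i) (%_. \<zero>))"
proof -
 note vk = vspaceD(1)[OF v]
 show "to_vec al i v:carrier (vec_space K (lk al i))" using vk by (auto simp: to_vec_def vec_space_def unemb)
 show "of_vec i (to_vec al i v) = rep_act Q al M (Proj i) v"
 using vk vspaceD(3)[OF v] by (auto simp: of_vec_def to_vec_def rep_act_simps fun_eq_iff unemb)
 show "to_vec al i (v + w) = vec (lk al i) (%a. to_vec al i v $ a \<oplus> to_vec al i w $ a)" if w: "w:vspace k al"
 proof (rule eq_vecI)
 fix a assume "a < dim_vec (vec (lk al i) (%a. to_vec al i v $ a \<oplus> to_vec al i w $ a))"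
 hence a: "a < lk al i" by simp
 have "ps (unemb (v i a) \<oplus> unemb (w i a)) = v i a + w i a" using vk vspaceD(1)[OF w] by (simp add: ps_add unemb)
 hence "unemb (v i a + w i a) = unemb (v i a) \<oplus> unemb (w i a)"
 using unemb(3)[of "unemb (v i a) \<oplus> unemb (w i a)"] vk vspaceD(1)[OF w] unemb(1) by simp
 thus "to_vec al i (v + w) $ a = vec (lk al i) (%a. to_vec al i v $ a \<oplus> to_vec al i w $ a) $ a"
 using a by (simp add: to_vec_def)
 qed (simp add: to_vec_def)
 show "to_vec al i (rep_act Q al M (Scal (ps c)) v) = vec (lk al i) (%a. c \<otimes> to_vec al i v $ a)" if c: "c:carrier K"
 proof (rule eq_vecI)
 fix a assume "a < dim_vec (vec (lk al i) (%a. c \<otimes> to_vec al i v $ a))"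
 hence a: "a < lk al i" by simp
 have "ps (c \<otimes> unemb (v i a)) = ps c * v i a" using vk c by (simp add: ps_mult unemb)
 hence "unemb (ps c * v i a) = c \<otimes> unemb (v i a)"
 using unemb(3)[of "c \<otimes> unemb (v i a)"] vk unemb(1) c by simp
 thus "to_vec al i (rep_act Q al M (Scal (ps c)) v) $ a = vec (lk al i) (%a. c \<otimes> to_vec al i v $ a) $ a"
 using a by (simp add: to_vec_def rep_act_simps)
 qed (simp add: to_vec_def)
 show "to_vec al i (rep_act Q al M (Proj j) v) = (if i = j then to_vec al i v else vec (lk al i) (%_. \<zero>))"
 by (auto simp: to_vec_def rep_act_simps intro!: eq_vecI)
 show "to_vec al i (rep_act Q al (emb_rep Q al N) (Arr h) v) =
 (if h:arcs Q & i = head Q h then mat_app K (N h) (to_vec al (tail Q h) v) else vec (lk al i) (%_. \<zero>))"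
 if N: "N:rep_space Q K al"
 proof (cases "h:arcs Q & i = head Q h")
 case True
 note Nh = rep_spaceD[OF N conjunct1[OF True]]
 have d: "dim_row (N h) = lk al (head Q h)" "dim_col (N h) = lk al (tail Q h)" using Nh(2) by auto
 have "unemb (SUM b<lk al (tail Q h). emb_rep Q al N h a b * v (tail Q h) b) =
 (\<Oplus>j\<in>{..<lk al (tail Q h)}. N h $$ (a, j) \<otimes> to_vec al (tail Q h) v $ j)" if a: "a < lk al (head Q h)" for a
 proof -
 have c: "N h $$ (a, j) \<otimes> to_vec al (tail Q h) v $ j:carrier K" if "j < lk al (tail Q h)" for j
 using Nh(3)[OF a that] vk unemb(1) that by (simp add: to_vec_def)
 have "ps (\<Oplus>j\<in>{..<lk al (tail Q h)}. N h $$ (a, j) \<otimes> to_vec al (tail Q h) v $ j) =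
 (SUM b<lk al (tail Q h). emb_rep Q al N h a b * v (tail Q h) b)"
 by (subst ps_sum) (use c Nh(3)[OF a] True a vk in "auto simp: ps_mult to_vec_def unemb emb_rep_def")
 thus ?thesis
 using unemb(3)[of "\<Oplus>j\<in>{..<lk al (tail Q h)}. N h $$ (a, j) \<otimes> to_vec al (tail Q h) v $ j"] c
 by (simp add: finsum_closed)
 qed
 thus ?thesis using True 
 by (intro eq_vecI) (simp_all add: mat_app_def rep_act_simps d, simp_all add: to_vec_def)
 qed (auto simp: to_vec_def rep_act_simps emb_rep_def intro!: eq_vecI)
qed

lemma of_vec_in:
 assumes "u:carrier (vec_space K (lk al i))"
 shows "of_vec i u:vspace k al" "to_vec al i (of_vec i u) = u" "j ~= i ==> to_vec al j (of_vec i u) = vec (lk al j) (%_. \<zero>)"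
 using assms fsubfieldD(2)[OF fsub]
 by (auto simp: of_vec_def to_vec_def vspace_def vec_space_def unemb intro!: eq_vecI)

text \<open>A family of subspaces at the vertices corresponds to their direct sum. Conversely, a submodule is the sum of its vertex parts because the projections
are among the operators.\<close>

theorem irreducible_iff_simple:
 fixes Q::"('i, 'h) pre_digraph"
 assumes Q: "fin_digraph Q" and al: "al:dimvecs Q" and M: "M:rep_space Q K al"
 shows "irreducible_rep Q K al M \<longleftrightarrow> simple_rep Q k al (emb_rep Q al M)"
proof -
 interpret Q: fin_digraph Q by (rule Q)
 let ?V = "vspace k al::('i, 'f) gvec set" and ?A = "rep_act Q al (emb_rep Q al M)"
 let ?z = "%i. vec (lk al i) (%_. \<zero>)"
 have E: "emb_rep Q al M:reps Q k al" using bij_betwE[OF bij_emb_rep] M by blast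
 have sV: "submod (ops k) ?A ?V" by (rule vspace_submod[OF fsub order_refl E])
 have out: "lk al i = 0" if "i ~: verts Q" for i using al that by (auto simp: dimvecs_def in_keys_iff)
 have zero: "\<zero>\<^bsub>vec_space K (lk al i)\<^esub> = ?z i" for i by (simp add: vec_space_def)
 have P: "?A (Proj i) v = of_vec i (to_vec al i v)" if "v:?V" for i v by (rule to_vec_simps(2)[OF that, symmetric])
 have expand: "v = (SUM i:Poly_Mapping.keys al. ?A (Proj i) v)" if v: "v:?V" for v
 proof (intro ext)
 fix j a
 have "(SUM i:Poly_Mapping.keys al. ?A (Proj i) v) j a = (SUM i:Poly_Mapping.keys al. if j = i then v j a else 0)"
 by (simp add: sum_gvec_apply rep_act_simps)
 also have "... = v j a" using vspaceD(3)[OF v, of a j] vspaceD(3)[OF v] by (auto simp: in_keys_iff)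
 finally show "v j a = (SUM i:Poly_Mapping.keys al. ?A (Proj i) v) j a" by simp
 qed
 have zvec: "v = 0" if v: "v:?V" and z: "!!i. i:verts Q ==> to_vec al i v = ?z i" for v
 proof -
 have "?A (Proj i) v = 0" for i
 proof (cases "i:verts Q")
 case True
 thus ?thesis using P[OF v, of i] z[OF True] by (auto simp: of_vec_def fun_eq_iff)
 next
 case False
 thus ?thesis using vspaceD(3)[OF v] out by (auto simp: rep_act_simps fun_eq_iff)
 qed
 thus ?thesis using expand[OF v] by simp
 qed
 have nonzero: "(EX i:verts Q. lk al i ~= 0) \<longleftrightarrow> ?V ~= {0}"
 proof
 assume "EX i:verts Q. lk al i ~= 0"
 then obtain i where "0 < lk al i" by auto
 from basis_vec_in[OF fsub this] have "basis_vec i 0:?V" .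
 moreover have "basis_vec i 0 ~= (0::('i, 'f) gvec)" by (auto simp: basis_vec_def fun_eq_iff)
 ultimately show "?V ~= {0}" by auto
 next
 assume "?V ~= {0}"
 hence "al ~= 0" using vspace_zero[OF fsubfieldD(2)[OF fsub]] by auto
 thus "EX i:verts Q. lk al i ~= 0" using out by (metis lookup_zero poly_mapping_eqI)
 qed
 show ?thesis
 proof
 assume irr: "irreducible_rep Q K al M"
 have "W = {0} | W = ?V" if W: "W <= ?V & submod (ops k) ?A W" for W
 proof -
 note sW = submodD[OF conjunct2[OF W]]
 let ?U = "%i. to_vec al i ` W"
 have "subrep Q K al M ?U" unfolding subrep_def submodule_iff
 proof (intro conjI ballI)
 fix i
 show "?U i <= carrier (vec_space K (lk al i))" by (intro image_subsetI to_vec_simps(1)) (use W in blast)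
 show "?z i:?U i" by (rule image_eqI[OF _ sW(1)]) (auto simp: to_vec_def)
 fix v assume "v:?U i"
 then obtain v' where v': "v':W" "v = to_vec al i v'" by blast
 show "vec (lk al i) (%a. c \<otimes> v $ a):?U i" if c: "c:carrier K" for c
 by (rule image_eqI[of _ _ "?A (Scal (ps c)) v'"])
 (use v' W c to_vec_simps(4)[of v' al c i Q] sW(5)[of "Scal (ps c)" v'] in "auto simp: ops_def")
 fix w assume "w:?U i"
 then obtain w' where w': "w':W" "w = to_vec al i w'" by blast
 show "vec (lk al i) (%a. v $ a \<oplus> w $ a):?U i"
 by (rule image_eqI[of _ _ "v' + w'"]) (use v' w' W to_vec_simps(3)[of v' al w' i] sW(3) in "auto simp: subset_iff")
 next
 fix h v assume h: "h:arcs Q" and "v:?U (tail Q h)"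
 then obtain v' where v': "v':W" "v = to_vec al (tail Q h) v'" by blast
 hence "v':?V" using W by blast
 from to_vec_simps(6)[OF this M, of "head Q h" h] h v'
 have "mat_app K (M h) v = to_vec al (head Q h) (?A (Arr h) v')" by simp
 thus "mat_app K (M h) v:?U (head Q h)"
 using sW(5)[of "Arr h" v'] v'(1) by (simp add: ops_def)
 qed
 with irr consider "ALL i:verts Q. ?U i = {?z i}" | "ALL i:verts Q. ?U i = carrier (vec_space K (lk al i))"
 unfolding irreducible_rep_def zero by blast
 thus ?thesis
 proof cases
 case 1
 have "w = 0" if "w:W" for w
 by (rule zvec) (use 1 that W in blast)+
 thus ?thesis using sW(1) by blast
 next
 case 2
 have "v:W" if v: "v:?V" for v
 proof -
 have "?A (Proj i) v:W" for i
 proof (cases "i:verts Q")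
 case True
 hence "to_vec al i v:?U i" using 2 to_vec_simps(1)[OF v] by simp
 then obtain w where w: "w:W" "to_vec al i v = to_vec al i w" by blast
 hence "?A (Proj i) v = ?A (Proj i) w" using P[OF v, of i] P[of w i] W by auto
 thus ?thesis using sW(5)[of "Proj i" w] w(1) by (simp add: ops_def)
 next
 case False
 hence "?A (Proj i) v = 0" using vspaceD(3)[OF v] out by (auto simp: rep_act_simps fun_eq_iff)
 thus ?thesis using sW(1) by simp
 qed
 hence "(SUM i:I. ?A (Proj i) v):W" for I
 by (induction I rule: infinite_finite_induct) (use sW(1,3) in auto)
 with expand[OF v] show ?thesis by metis
 qed
 thus ?thesis using W by blast
 qed
 qed
 moreover have "?V ~= {0}" using irr nonzero by (simp add: irreducible_rep_def)
 ultimately show "simple_rep Q k al (emb_rep Q al M)" unfolding simple_mod_def using sV by blast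
 next
 assume sim: "simple_rep Q k al (emb_rep Q al M)"
 show "irreducible_rep Q K al M" unfolding irreducible_rep_def
 proof (intro conjI allI impI)
 show "EX i:verts Q. lk al i ~= 0" using nonzero sim by (simp add: simple_mod_def)
 fix U assume U: "subrep Q K al M U"
 have Ui: "U i <= carrier (vec_space K (lk al i))" "?z i:U i"
 "v:U i ==> w:U i ==> vec (lk al i) (%a. v $ a \<oplus> w $ a):U i"
 "c:carrier K ==> v:U i ==> vec (lk al i) (%a. c \<otimes> v $ a):U i" if "i:verts Q" for i v w c
 using U that unfolding subrep_def submodule_iff by blast+
 have Uh: "mat_app K (M h) v:U (head Q h)" if "h:arcs Q" "v:U (tail Q h)" for h v
 using U that unfolding subrep_def by blast
 let ?W = "{v:?V. ALL i:verts Q. to_vec al i v:U i}"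
 have "submod (ops k) ?A ?W"
 unfolding submod_def
 proof (intro conjI ballI)
 show "0:?W" using submodD(1)[OF sV] Ui(2) by (auto simp: to_vec_def)
 next
 have scal: "?A (Scal t) v:?W" if t: "t:k" and v: "v:?W" for t v
 proof -
 obtain c where c: "t = ps c" "c:carrier K" using t by blast
 have v': "v:?V" using v by simp
 have "to_vec al i (?A (Scal t) v):U i" if "i:verts Q" for i
 using to_vec_simps(4)[OF v' c(2), of i Q] Ui(4)[OF that c(2), of "to_vec al i v"] v that c(1) by simp
 moreover have "?A (Scal t) v:?V" using submodD(5)[OF sV, of "Scal t" v] t v' by (simp add: ops_def)
 ultimately show ?thesis by simp
 qed
 have add: "v + w:?W" if "v:?W" "w:?W" for v w
 using that submodD(3)[OF sV] to_vec_simps(3)[of v al w] Ui(3) by simp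
 fix v assume v: "v:?W"
 hence v': "v:?V" by simp
 show "v - w:?W" if w: "w:?W" for w
 proof -
 have m: "?A (Scal (- 1)) w = - w" by (auto simp: rep_act_simps fun_eq_iff)
 have "- 1:k" using fsubfieldD(8)[OF fsub fsubfieldD(3)[OF fsub]] .
 from add[OF v scal[OF this w]] show ?thesis unfolding m by simp
 qed
 fix c::"('i, 'h, 'f) rep_op" assume c: "c:ops k"
 show "?A c v:?W"
 proof (cases c)
 case (Scal t)
 thus ?thesis using scal v c by (auto simp: ops_def)
 next
 case (Proj j)
 thus ?thesis using submodD(5)[OF sV c v'] to_vec_simps(5)[OF v', of _ Q "emb_rep Q al M" j] v Ui(2) by simp
 next
 case (Arr h)
 thus ?thesis using submodD(5)[OF sV c v'] to_vec_simps(6)[OF v' M, of _ h] v Ui(2) Uh[of h "to_vec al (tail Q h) v"]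
 by auto
 qed
 qed
 hence "?W = {0} | ?W = ?V" using sim unfolding simple_mod_def by blast
 moreover have inW: "of_vec i u:?W" if i: "i:verts Q" and u: "u:U i" for i u
 proof -
 have u': "u:carrier (vec_space K (lk al i))" using Ui(1)[OF i] u by blast
 have "to_vec al j (of_vec i u):U j" if "j:verts Q" for j
 using of_vec_in(2)[OF u'] of_vec_in(3)[OF u', of j] Ui(2)[OF that] u by (cases "j = i") auto
 thus ?thesis using of_vec_in(1)[OF u'] by simp
 qed
 ultimately consider "?W = {0}" | "?W = ?V" by blast
 thus "(ALL i:verts Q. U i = {\<zero>\<^bsub>vec_space K (lk al i)\<^esub>}) |
 (ALL i:verts Q. U i = carrier (vec_space K (lk al i)))"
 proof cases
 case 1
 have "u = ?z i" if i: "i:verts Q" and u: "u:U i" for i u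
 proof -
 have "u:carrier (vec_space K (lk al i))" using Ui(1)[OF i] u by blast
 moreover have "of_vec i u:{0}" using inW[OF i u] unfolding 1 .
 ultimately have "u = to_vec al i 0" using of_vec_in(2)[of u al i] by simp
 thus ?thesis by (simp add: to_vec_def zero_fun_def)
 qed
 thus ?thesis unfolding zero using Ui(2) by blast
 next
 case 2
 have "u:U i" if i: "i:verts Q" and u: "u:carrier (vec_space K (lk al i))" for i u
 proof -
 have "of_vec i u:?W" unfolding 2 by (rule of_vec_in(1)[OF u])
 thus ?thesis using of_vec_in(2)[OF u] i by auto
 qed
 thus ?thesis using Ui(1) by blast
 qed
 qed
 qed
qed

end

context field_emb
begin

lemma GL_dimD:
 assumes "g:GL_dim Q K al" "i:verts Q"
 shows "g i:GL K (lk al i)" "g i:mats K (lk al i) (lk al i)"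
 using assms by (auto simp: GL_dim_def GL_def Units_def mat_monoid_def dest: PiE_mem)

theorem rep_iso_iff:
 fixes Q::"('i, 'h) pre_digraph"
 assumes Q: "fin_digraph Q" and al: "al:dimvecs Q" and M: "M:rep_space Q K al" and N: "N:rep_space Q K al"
 shows "(M, N):rep_iso Q K al \<longleftrightarrow> (emb_rep Q al M, emb_rep Q al N):iso_rel Q k al"
proof -
 interpret Q: fin_digraph Q by (rule Q)
 let ?V = "vspace k al::('i, 'f) gvec set"
 let ?M = "emb_rep Q al M" and ?N = "emb_rep Q al N"
 have E: "?M:reps Q k al" "?N:reps Q k al" using bij_betwE[OF bij_emb_rep] M N by blast+
 have sV: "submod (ops k) (rep_act Q al ?M) ?V" by (rule vspace_submod[OF fsub order_refl E(1)])
 have finV: "finite ?V" by (rule finite_vspace[OF fsubfieldD(1)[OF fsub]])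
 have out: "lk al i = 0" if "i ~: verts Q" for i using al that by (auto simp: dimvecs_def in_keys_iff)
 note sub_l = vspace_lsubmod[OF fsub order_refl, of Q al]
 have entry: "(mat_prod K (g (head Q h)) (M h) = mat_prod K (N h) (g (tail Q h))) \<longleftrightarrow>
 (ALL a<lk al (head Q h). ALL b<lk al (tail Q h). mat_mult (lk al (tail Q h)) (?N h) (%a b. ps (g (tail Q h) $$ (a, b))) a b =
 mat_mult (lk al (head Q h)) (%a b. ps (g (head Q h) $$ (a, b))) (?M h) a b)"
 if g: "!!i. i:verts Q ==> g i:mats K (lk al i) (lk al i)" and h: "h:arcs Q" for g h
 proof -
 let ?s = "tail Q h" and ?t = "head Q h"
 have gs: "g ?s:mats K (lk al ?s) (lk al ?s)" "g ?t:mats K (lk al ?t) (lk al ?t)"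
 using g Q.tail_in_verts[OF h] Q.head_in_verts[OF h] by auto
 note Mh = rep_spaceD[OF M h] and Nh = rep_spaceD[OF N h]
 have 1: "mat_prod K (g ?t) (M h):mats K (lk al ?t) (lk al ?s)" "mat_prod K (N h) (g ?s):mats K (lk al ?t) (lk al ?s)"
 by (rule mat_prod_mats[OF gs(2) Mh(1)], rule mat_prod_mats[OF Nh(1) gs(1)])
 hence "mat_prod K (g ?t) (M h) = mat_prod K (N h) (g ?s) \<longleftrightarrow>
 (ALL a<lk al ?t. ALL b<lk al ?s. mat_prod K (g ?t) (M h) $$ (a, b) = mat_prod K (N h) (g ?s) $$ (a, b))"
 by (auto simp: mats_def)
 also have "... \<longleftrightarrow> (ALL a<lk al ?t. ALL b<lk al ?s. ps (mat_prod K (N h) (g ?s) $$ (a, b)) = ps (mat_prod K (g ?t) (M h) $$ (a, b)))"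
 using ps_eq_iff[OF mats_entry[OF 1(1)] mats_entry[OF 1(2)]] by metis
 also have "... \<longleftrightarrow> (ALL a<lk al ?t. ALL b<lk al ?s. mat_mult (lk al ?s) (?N h) (%a b. ps (g ?s $$ (a, b))) a b =
 mat_mult (lk al ?t) (%a b. ps (g ?t $$ (a, b))) (?M h) a b)"
 proof -
 have "ps (mat_prod K (N h) (g ?s) $$ (a, b)) = mat_mult (lk al ?s) (?N h) (%a b. ps (g ?s $$ (a, b))) a b"
 and "ps (mat_prod K (g ?t) (M h) $$ (a, b)) = mat_mult (lk al ?t) (%a b. ps (g ?t $$ (a, b))) (?M h) a b"
 if ab: "a < lk al ?t" "b < lk al ?s" for a b
 proof -
 have c: "g ?s:carrier_mat (lk al ?s) (lk al ?s)" "g ?t:carrier_mat (lk al ?t) (lk al ?t)"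
 using gs by (auto simp: mats_def)
 show "ps (mat_prod K (N h) (g ?s) $$ (a, b)) = mat_mult (lk al ?s) (?N h) (%a b. ps (g ?s $$ (a, b))) a b"
 unfolding mat_prod_entry[OF Nh(2) c(1) ab] mat_mult_def
 by (subst ps_sum) (use ab Nh(3) mats_entry[OF gs(1)] h in "auto simp: ps_mult emb_rep_def intro!: sum.cong")
 show "ps (mat_prod K (g ?t) (M h) $$ (a, b)) = mat_mult (lk al ?t) (%a b. ps (g ?t $$ (a, b))) (?M h) a b"
 unfolding mat_prod_entry[OF c(2) Mh(2) ab] mat_mult_def
 by (subst ps_sum) (use ab Mh(3) mats_entry[OF gs(2)] h in "auto simp: ps_mult emb_rep_def intro!: sum.cong")
 qed
 thus ?thesis by simp
 qed
 finally show ?thesis .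
 qed
 show ?thesis
 proof
 assume "(M, N):rep_iso Q K al"
 then obtain g where g: "g:GL_dim Q K al" and eq: "!!h. h:arcs Q ==> mat_prod K (g (head Q h)) (M h) = mat_prod K (N h) (g (tail Q h))"
 by (auto simp: rep_iso_def)
 note gm = GL_dimD(2)[OF g]
 define F where "F i a b = (if i:verts Q & a < lk al i & b < lk al i then ps (g i $$ (a, b)) else 0)" for i a b
 have F: "F i a b:k" "lk al i <= a ==> F i a b = 0" for i a b
 using mats_entry[OF gm] fsubfieldD(2)[OF fsub] by (auto simp: F_def)
 let ?f = "mat_map k al F"
 have f: "?f:ophom (lops k) (lact Q) ?V (lact Q) ?V" by (rule mat_map_lhom[OF fsub F])
 have fb: "?f (basis_vec i b) i a = F i a b" if b: "b < lk al i" for i a b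
 proof -
 have "?f (basis_vec i b) i a = (SUM b'<lk al i. if b' = b then F i a b' else 0)"
 unfolding mat_map_def if_P[OF basis_vec_in[OF fsub b]]
 by (rule sum.cong[OF refl]) (simp add: basis_vec_def)
 thus ?thesis using b by simp
 qed
 have "mat_mult (lk al (tail Q h)) (?N h) (%a b. ?f (basis_vec (tail Q h) b) (tail Q h) a) a b =
 mat_mult (lk al (head Q h)) (%a b. ?f (basis_vec (head Q h) b) (head Q h) a) (?M h) a b"
 if b: "b < lk al (tail Q h)" for h a b
 proof (cases "h:arcs Q & a < lk al (head Q h)")
 case True
 hence v: "tail Q h:verts Q" "head Q h:verts Q" by auto
 have "mat_mult (lk al (tail Q h)) (?N h) (%a b. ?f (basis_vec (tail Q h) b) (tail Q h) a) a b =
 mat_mult (lk al (tail Q h)) (?N h) (%a b. ps (g (tail Q h) $$ (a, b))) a b"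
 unfolding mat_mult_def by (intro sum.cong[OF refl]) (use fb[OF b] v b in "simp add: F_def")
 also have "... = mat_mult (lk al (head Q h)) (%a b. ps (g (head Q h) $$ (a, b))) (?M h) a b"
 using entry[of g h, OF gm conjunct1[OF True]] eq True b by blast
 also have "... = mat_mult (lk al (head Q h)) (%a b. ?f (basis_vec (head Q h) b) (head Q h) a) (?M h) a b"
 unfolding mat_mult_def by (intro sum.cong[OF refl]) (use v True in "simp add: F_def fb")
 finally show ?thesis .
 next
 case False
 have "?N h a c = 0" for c using False by (auto simp: emb_rep_def)
 moreover have "?f (basis_vec (head Q h) c) (head Q h) a * ?M h c b = 0" if c: "c < lk al (head Q h)" for c
 using False fb[OF c, of a] by (auto simp: emb_rep_def F_def)
 ultimately show ?thesis unfolding mat_mult_def by (intro trans[OF sum.neutral sum.neutral[symmetric]]) auto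
 qed
 hence hom: "?f:rep_hom Q k al ?M al ?N" using rep_hom_iff[OF fsub E f] by blast
 have "inj_on ?f ?V"
 proof (rule inj_onI)
 fix v w assume v: "v:?V" and w: "w:?V" and eq: "?f v = ?f w"
 have u: "v - w:?V" by (rule submodD(2)[OF sV v w])
 have "?f v = ?f (v - w) + ?f w" using ophomD(3)[OF f u w] by simp
 hence z: "?f (v - w) = 0" using eq by simp
 have "(v - w) i b = 0" if b: "b < lk al i" for i b
 proof -
 have i: "i:verts Q" using out b by force
 let ?t = "\<lambda>j\<in>{..<lk al i}. unemb ((v - w) i j)"
 have t: "?t:coords (lk al i)" using unemb(1) vspaceD(1)[OF u] by auto
 have c: "?t j \<otimes> g i $$ (a, j):carrier K" if "a < lk al i" "j < lk al i" for a j
 using mats_entry[OF gm[OF i] that] unemb(1) vspaceD(1)[OF u] that by simp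
 have "(\<Oplus>j\<in>{..<lk al i}. ?t j \<otimes> cols (lk al i) (lk al i) (g i) j a) = \<zero>" if a: "a < lk al i" for a
 proof -
 have e: "(\<Oplus>j\<in>{..<lk al i}. ?t j \<otimes> cols (lk al i) (lk al i) (g i) j a) = (\<Oplus>j\<in>{..<lk al i}. ?t j \<otimes> g i $$ (a, j))"
 by (intro finsum_cong') (use c a in "auto simp: cols_def Pi_def")
 have "ps (\<Oplus>j\<in>{..<lk al i}. ?t j \<otimes> g i $$ (a, j)) = (SUM j<lk al i. (v - w) i j * F i a j)"
 by (subst ps_sum) (use c a mats_entry[OF gm[OF i]] unemb vspaceD(1)[OF u] i in "auto simp: ps_mult F_def simp del: minus_apply")
 also have "... = ?f (v - w) i a" using u by (simp add: mat_map_def)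
 finally have "ps (\<Oplus>j\<in>{..<lk al i}. ?t j \<otimes> g i $$ (a, j)) = ps \<zero>" using z by simp
 thus ?thesis unfolding e using ps_eq_iff[of "\<Oplus>j\<in>{..<lk al i}. ?t j \<otimes> g i $$ (a, j)" \<zero>] c[OF a]
 by (simp add: finsum_closed)
 qed
 hence "?t b = \<zero>"
 using GL_iff_indep_cols[OF fin gm[OF i]] GL_dimD(1)[OF g i] t b unfolding indep_cols_def by blast
 thus ?thesis using unemb(2)[OF vspaceD(1)[OF u, of i b]] b by simp
 qed
 hence "v - w = 0" using vspaceD(3)[OF u] by (auto simp: fun_eq_iff)
 thus "v = w" by simp
 qed
 hence "bij_betw ?f ?V ?V"
 using endo_inj_surj[OF finV _ ] ophomD(2)[OF f] by (auto simp: bij_betw_def image_subset_iff)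
 thus "(?M, ?N):iso_rel Q k al" using hom E by (auto simp: iso_rel_def)
 next
 assume "(?M, ?N):iso_rel Q k al"
 then obtain f where f: "f:rep_hom Q k al ?M al ?N" "bij_betw f ?V ?V" by (auto simp: iso_rel_def)
 have fl: "f:ophom (lops k) (lact Q) ?V (lact Q) ?V"
 using ophom_mono_ops[OF f(1) lops_subset_ops] ophom_lops[of k Q al ?M] by blast
 have fk: "f (basis_vec i b) i a:k" if "b < lk al i" for i a b
 using vspaceD(1)[OF ophomD(2)[OF fl basis_vec_in[OF fsub that]]] .
 define g where "g = (\<lambda>i\<in>verts Q. mat (lk al i) (lk al i) (%(a, b). unemb (f (basis_vec i b) i a)))"
 have gm: "g i:mats K (lk al i) (lk al i)" if "i:verts Q" for i
 using that by (auto simp: g_def intro!: mats_I unemb(1) fk)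
 have ge: "ps (g i $$ (a, b)) = f (basis_vec i b) i a" if "i:verts Q" "a < lk al i" "b < lk al i" for i a b
 using that by (simp add: g_def unemb(2) fk)
 have "indep_cols (cols (lk al i) (lk al i) (g i)) (lk al i) (lk al i)" if i: "i:verts Q" for i
 unfolding indep_cols_def
 proof (intro ballI impI)
 let ?n = "lk al i"
 fix t assume t: "t:coords ?n" and z: "ALL a<?n. (\<Oplus>j\<in>{..<?n}. t j \<otimes> cols ?n ?n (g i) j a) = \<zero>"
 have tc: "t j:carrier K" if "j < ?n" for j using t that by auto
 define v where "v = (%i' b. if i' = i & b < ?n then ps (t b) else 0)"
 have v: "v:?V" using tc fsubfieldD(2)[OF fsub] by (auto simp: v_def vspace_def)
 have "f v j a = 0" for j a
 proof (cases "j = i & a < ?n")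
 case True
 have "f v i a = (SUM b<?n. ps (t b \<otimes> cols ?n ?n (g i) b a))"
 unfolding lhom_apply(1)[OF fsub fl v]
 by (intro sum.cong[OF refl]) (use True ge[OF i] mats_entry[OF gm[OF i]] tc in "simp add: v_def cols_def ps_mult")
 also have "... = ps (\<Oplus>j\<in>{..<?n}. t j \<otimes> cols ?n ?n (g i) j a)"
 by (rule ps_sum[symmetric]) (use True mats_entry[OF gm[OF i]] tc in "simp add: cols_def")
 also have "... = 0" using z True by simp
 finally show ?thesis using True by simp
 next
 case False
 show ?thesis
 proof (cases "j = i")
 case True
 thus ?thesis using False vspaceD(3)[OF ophomD(2)[OF fl v], of a i] by simp
 next
 case ne: False
 show ?thesis unfolding lhom_apply(1)[OF fsub fl v] using ne by (simp add: v_def)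
 qed
 qed
 hence "f v = f 0" using ophom_zero_at[OF f(1)] by (simp add: fun_eq_iff)
 hence v0: "v = 0" using f(2) v submodD(1)[OF sV] by (auto simp: bij_betw_def dest: inj_onD)
 show "ALL j<?n. t j = \<zero>"
 proof (intro allI impI)
 fix j assume j: "j < ?n"
 have "ps (t j) = ps \<zero>" using fun_cong[OF fun_cong[OF v0, of i], of j] j by (simp add: v_def)
 thus "t j = \<zero>" using ps_eq_iff[OF tc[OF j], of \<zero>] by simp
 qed
 qed
 hence "g:GL_dim Q K al" using GL_iff_indep_cols[OF fin gm] by (auto simp: GL_dim_def g_def)
 moreover have "mat_prod K (g (head Q h)) (M h) = mat_prod K (N h) (g (tail Q h))" if h: "h:arcs Q" for h
 proof (rule entry[of g h, OF gm h, THEN iffD2], assumption, intro allI impI)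
 fix a b assume a: "a < lk al (head Q h)" and b: "b < lk al (tail Q h)"
 have v: "tail Q h:verts Q" "head Q h:verts Q" using h by auto
 have "mat_mult (lk al (tail Q h)) (?N h) (%a b. ps (g (tail Q h) $$ (a, b))) a b =
 mat_mult (lk al (tail Q h)) (?N h) (%a b. f (basis_vec (tail Q h) b) (tail Q h) a) a b"
 unfolding mat_mult_def by (intro sum.cong[OF refl]) (use ge[OF v(1)] b in simp)
 also have "... = mat_mult (lk al (head Q h)) (%a b. f (basis_vec (head Q h) b) (head Q h) a) (?M h) a b"
 using rep_hom_iff[OF fsub E fl] f(1) b by blast
 also have "... = mat_mult (lk al (head Q h)) (%a b. ps (g (head Q h) $$ (a, b))) (?M h) a b"
 unfolding mat_mult_def by (intro sum.cong[OF refl]) (use ge[OF v(2)] a in simp)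
 finally show "mat_mult (lk al (tail Q h)) (?N h) (%a b. ps (g (tail Q h) $$ (a, b))) a b =
 mat_mult (lk al (head Q h)) (%a b. ps (g (head Q h) $$ (a, b))) (?M h) a b" .
 qed
 ultimately show "(M, N):rep_iso Q K al" using M N by (auto simp: rep_iso_def)
 qed
qed

end

section \<open>Absolute irreducibility\<close>

text \<open>Send a generator of the multiplicative group of the large field to a root of its minimal polynomial over the small one.\<close>

lemma finite_field_extension_embedding:
 fixes K::"'a ring" and L::"'b ring" (structure) and ps::"'a => 'f::alg_closed_field"
 assumes K: "field_emb K ps" and L: "Ring.field L" "finite (carrier L)" and ph: "ph:Ring.ring_hom K L"
 obtains ps' where "field_emb L ps'" "!!c. c:carrier K ==> ps' (ph c) = ps c"
proof -
 interpret K: field_emb K ps by (rule K)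
 interpret L: Ring.field L by (rule L(1))
 let ?k = "ps ` carrier K"
 note k = fsubfieldD[OF K.fsub]
 define h where "h = (%x. ph (K.unemb x))"
 have phh: "ph x:carrier L" "ph (x \<oplus>\<^bsub>K\<^esub> y) = ph x \<oplus> ph y" "ph (x \<otimes>\<^bsub>K\<^esub> y) = ph x \<otimes> ph y"
 if "x:carrier K" "y:carrier K" for x y
 using ph that by (auto simp: Ring.ring_hom_def)
 have hps: "h (ps c) = ph c" if "c:carrier K" for c using that by (simp add: h_def K.unemb(3))
 have h: "h x:carrier L" "h (x + y) = h x \<oplus> h y" "h (x * y) = h x \<otimes> h y" if xy: "x:?k" "y:?k" for x y
 proof -
 from xy obtain a b where ab: "x = ps a" "y = ps b" "a:carrier K" "b:carrier K" by blast
 show "h x:carrier L" using ab hps phh(1) by simp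
 show "h (x + y) = h x \<oplus> h y" using ab hps phh(2) hps[of "a \<oplus>\<^bsub>K\<^esub> b"] by (simp add: K.ps_add)
 show "h (x * y) = h x \<otimes> h y" using ab hps phh(3) hps[of "a \<otimes>\<^bsub>K\<^esub> b"] by (simp add: K.ps_mult)
 qed
 have h1: "h 1 = \<one>" using hps[of "\<one>\<^bsub>K\<^esub>"] ph by (simp add: K.ps_one ring_hom_one)
 have h0: "h 0 = \<zero>"
 using h(2)[OF k(2,2)] h(1)[OF k(2,2)] L.add.l_cancel_one'[of "h 0" "h 0"] by simp
 obtain g where g: "g:carrier L" "!!x. x:carrier L ==> x = \<zero> | (EX i::nat. x = g [^] i)"
 proof -
 from L.finite_field_mult_group_has_gen[OF L(2)] obtain g where g: "g:carrier (Multiplicative_Group.mult_of L)"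
 "carrier (Multiplicative_Group.mult_of L) = {g [^] i | i::nat. i:UNIV}"
 by (elim bexE) (rule that)
 have "x = \<zero> | (EX i::nat. x = g [^] i)" if "x:carrier L" for x
 proof (cases "x = \<zero>")
 case False
 hence "x:carrier (Multiplicative_Group.mult_of L)" using that by (simp add: Multiplicative_Group.carrier_mult_of)
 thus ?thesis using g(2) by blast
 qed simp
 thus thesis using that[of g] g(1) by (simp add: Multiplicative_Group.carrier_mult_of)
 qed
 \<comment> \<open>evaluation at \<open>g\<close> of the polynomials with coefficients in the image of \<open>K\<close>\<close>
 define ev where "ev = (%p. fold_coeffs (%a x. h a \<oplus> g \<otimes> x) p \<zero>)"
 define P where "P = {p::'f poly. ALL i. pcoeff p i:?k}"
 have ev0 [simp]: "ev 0 = \<zero>" by (simp add: ev_def)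
 have evC: "ev (pCons a p) = h a \<oplus> g \<otimes> ev p" for a p
 proof (cases "a = 0 & p = 0")
 case True
 thus ?thesis using g(1) h0 by (simp add: ev_def)
 next
 case False
 thus ?thesis by (cases "a = 0") (auto simp: ev_def)
 qed
 have P0 [simp]: "0:P" using k(2) by (simp add: P_def)
 have PC: "pCons a p:P \<longleftrightarrow> a:?k & p:P" for a p
 unfolding P_def mem_Collect_eq by (auto simp: coeff_pCons split: nat.splits)
 have Padd: "p + r:P" if "p:P" "r:P" for p r using that k(7) unfolding P_def mem_Collect_eq coeff_add by blast
 have Psm: "psmult c p:P" if "c:?k" "p:P" for c p
 using that k(5) unfolding P_def mem_Collect_eq coeff_smult by blast
 have evc: "ev p:carrier L" if "p:P" for p
 using that
 proof (induction p)
 case (pCons a p)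
 thus ?case using g(1) h(1)[OF _ k(2)] by (simp add: evC PC)
 qed simp
 have ev_add: "ev (p + r) = ev p \<oplus> ev r" if "p:P" "r:P" for p r
 using that
 proof (induction p arbitrary: r)
 case 0
 thus ?case using evc by simp
 next
 case (pCons a p)
 obtain b r' where r: "r = pCons b r'" by (cases r) auto
 have c: "h a:carrier L" "h b:carrier L" "ev p:carrier L" "ev r':carrier L"
 using pCons.prems h(1)[OF _ k(2)] evc by (auto simp: PC r)
 show ?case using pCons.IH[of r'] pCons.prems c g(1) h(2)
 by (simp add: r evC PC L.r_distr L.a_ac)
 qed
 have ev_smult: "ev (psmult c p) = h c \<otimes> ev p" if "c:?k" "p:P" for c p
 using that(2)
 proof (induction p)
 case 0
 thus ?case using h(1)[OF that(1) k(2)] by simp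
 next
 case (pCons a p)
 have c: "h a:carrier L" "h c:carrier L" "ev p:carrier L"
 using pCons.prems h(1)[OF _ k(2)] that(1) evc by (auto simp: PC)
 show ?case using pCons.IH pCons.prems c g(1) h(3)[OF that(1)]
 by (simp add: evC PC L.r_distr L.m_lcomm)
 qed
 have ev_mult: "ev (p * r) = ev p \<otimes> ev r & p * r:P" if "p:P" "r:P" for p r
 using that(1)
 proof (induction p)
 case 0
 thus ?case using evc[OF that(2)] by simp
 next
 case (pCons a p)
 have c: "h a:carrier L" "ev r:carrier L" "ev p:carrier L" "a:?k" "p:P"
 using pCons.prems h(1)[OF _ k(2)] that(2) evc by (auto simp: PC)
 have IH: "ev (p * r) = ev p \<otimes> ev r" "p * r:P" using pCons.IH c(5) by auto
 have in_P: "psmult a r:P" "pCons 0 (p * r):P" using Psm[OF c(4) that(2)] IH(2) k(2) by (auto simp: PC)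
 show ?case using ev_add[OF in_P] Padd[OF in_P] c g(1)
 by (simp add: evC ev_smult[OF c(4) that(2)] IH(1) h0 L.l_distr L.m_assoc)
 qed
 have ev_surj: "EX p:P. ev p = x" if x: "x:carrier L" for x
 proof -
 have "EX p:P. ev p = g [^] i" for i::nat
 proof (induction i)
 case 0
 show ?case by (rule bexI[of _ "pCons 1 0"]) (use g(1) k(2,3) in "simp_all add: evC PC h1")
 next
 case (Suc i)
 then obtain p where p: "p:P" "ev p = g [^] i" by blast
 show ?case by (rule bexI[of _ "pCons 0 p"]) (use p g(1) k(2) in "simp_all add: evC PC h0 L.m_comm")
 qed
 thus ?thesis using g(2)[OF x] P0 ev0 by metis
 qed
 define Z where "Z = {p:P. ev p = \<zero> & p ~= 0}"
 have "EX p. p:Z"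
 proof (rule ccontr)
 assume no: "\<nexists>p. p:Z"
 have mon: "pmonom 1 i:P" for i using k(2,3) by (simp add: P_def)
 have "inj (%i::nat. ev (pmonom 1 i))"
 proof (rule injI)
 fix i j::nat assume eq: "ev (pmonom 1 i) = ev (pmonom 1 j)"
 let ?d = "pmonom 1 i + psmult (- 1) (pmonom 1 j)::'f poly"
 have "- 1:?k" using k(8)[OF k(3)] .
 have hm: "h (- 1) \<oplus> \<one> = \<zero>" using h(2)[OF \<open>- 1:?k\<close> k(3)] h0 h1 by simp
 have "ev ?d = ev (pmonom 1 i) \<oplus> h (- 1) \<otimes> ev (pmonom 1 j)"
 using ev_add[OF mon Psm[OF \<open>- 1:?k\<close> mon], of i j] ev_smult[OF \<open>- 1:?k\<close> mon, of j] by simp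
 also have "... = (\<one> \<oplus> h (- 1)) \<otimes> ev (pmonom 1 j)"
 using evc[OF mon, of j] h(1)[OF \<open>- 1:?k\<close> k(2)] by (simp add: eq L.l_distr)
 also have "... = \<zero>" using hm evc[OF mon, of j] h(1)[OF \<open>- 1:?k\<close> k(2)] by (simp add: L.a_comm)
 finally have "ev ?d = \<zero>" .
 moreover have "?d:P" by (rule Padd[OF mon Psm[OF \<open>- 1:?k\<close> mon]])
 ultimately have "?d = 0" using no by (auto simp: Z_def)
 hence "pcoeff ?d i = 0" by simp
 thus "i = j" by (auto split: if_splits)
 qed
 moreover have "range (%i. ev (pmonom 1 i)) <= carrier L" using evc[OF mon] by blast
 ultimately show False using finite_subset[OF _ L(2)] finite_imageD infinite_UNIV_nat by blast
 qed
 then obtain p where p: "p:Z" "!!r. r:Z ==> pdeg p <= pdeg r"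
 using ex_has_least_nat[of "%p. p:Z" _ pdeg] by auto
 have pP: "p:P" "ev p = \<zero>" "p ~= 0" using p(1) by (auto simp: Z_def)
 have "pdeg p > 0"
 proof (rule ccontr)
 assume "~  ?thesis"
 then obtain a where a: "p = pCons a 0" by (metis degree_eq_zeroE gr0I)
 then obtain c where c: "a = ps c" "c:carrier K" using pP(1) by (auto simp: PC)
 hence "c ~= \<zero>\<^bsub>K\<^esub>" using pP(3) a by auto
 have "ph c = \<zero>" using pP(2) hps[OF c(2)] phh(1)[OF c(2,2)] g(1) by (simp add: a c(1) evC)
 moreover have "inv\<^bsub>K\<^esub> c:carrier K" "c \<otimes>\<^bsub>K\<^esub> inv\<^bsub>K\<^esub> c = \<one>\<^bsub>K\<^esub>" using c(2) \<open>c ~= \<zero>\<^bsub>K\<^esub>\<close> by (auto simp: K.field_Units)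
 ultimately have "\<zero> = \<one>" using phh(3)[OF c(2), of "inv\<^bsub>K\<^esub> c"] phh(1)[of "inv\<^bsub>K\<^esub> c"] ph by (simp add: ring_hom_one)
 thus False by simp
 qed
 then obtain th where th: "poly p th = 0" using alg_closed_imp_poly_has_root by blast
 have root: "poly f th = 0" if "f:P" "ev f = \<zero>" for f
 using that
 proof (induction "pdeg f" arbitrary: f rule: less_induct)
 case less
 show ?case
 proof (cases "f = 0")
 case False
 let ?n = "pdeg f" and ?m = "pdeg p"
 have mn: "?m <= ?n" using p(2)[of f] less.prems False by (simp add: Z_def)
 define c where "c = - (plead f * inverse (plead p))"
 have ck: "c:?k" unfolding c_def using k(5,6,8) less.prems(1) pP(1) by (simp add: P_def)
 let ?u = "pmonom c (?n - ?m)"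
 have uP: "?u:P" using ck k(2) by (simp add: P_def)
 define f' where "f' = f + ?u * p"
 have f'P: "f':P" unfolding f'_def by (rule Padd[OF less.prems(1)]) (use ev_mult[OF uP pP(1)] in blast)
 have ev': "ev f' = \<zero>"
 unfolding f'_def using ev_add[OF less.prems(1), of "?u * p"] ev_mult[OF uP pP(1)] less.prems(2) pP(2) evc[OF uP] by simp
 have th': "poly f' th = poly f th" by (simp add: f'_def th)
 have "pcoeff (?u * p) ?n = c * plead p" using mn by (simp add: coeff_monom_mult)
 hence "pcoeff f' ?n = 0" using pP(3) by (simp add: f'_def c_def)
 moreover have "pdeg f' <= ?n" unfolding f'_def
 by (intro degree_add_le degree_mult_le[THEN order_trans])
 (use mn degree_monom_le[of c "?n - ?m"] in auto)
 ultimately have "f' = 0 | pdeg f' < ?n" using eq_zero_or_degree_less by blast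
 thus ?thesis using less.hyps[OF _ f'P ev'] th' by auto
 qed simp
 qed
 define ps' where "ps' x = poly (SOME f. f:P & ev f = x) th" for x
 have ps': "ps' (ev f) = poly f th" if f: "f:P" for f
 proof -
 let ?f' = "SOME f'. f':P & ev f' = ev f"
 have f': "?f':P & ev ?f' = ev f" by (rule someI[of _ f]) (use f in simp)
 have m1: "- 1:?k" using k(8)[OF k(3)] .
 have hm: "\<one> \<oplus> h (- 1) = \<zero>" using h(2)[OF k(3) m1] h0 h1 by simp
 have d: "?f' + psmult (- 1) f:P" by (rule Padd[OF _ Psm[OF m1 f]]) (use f' in simp)
 have "ev (?f' + psmult (- 1) f) = ev f \<oplus> h (- 1) \<otimes> ev f"
 using ev_add[of ?f', OF _ Psm[OF m1 f]] ev_smult[OF m1 f] f' by simp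
 also have "... = (\<one> \<oplus> h (- 1)) \<otimes> ev f" using evc[OF f] h(1)[OF m1 k(2)] by (simp add: L.l_distr)
 also have "... = \<zero>" using hm evc[OF f] by simp
 finally have "poly (?f' + psmult (- 1) f) th = 0" by (rule root[OF d])
 thus ?thesis by (simp add: ps'_def)
 qed
 have "field_emb L ps'"
 proof (intro field_emb.intro field_emb_axioms.intro L)
 have one: "pCons 1 0:P" "ev (pCons 1 0) = \<one>" using k(2,3) g(1) by (simp_all add: evC PC h1)
 show "ps' \<one> = 1" using ps'[OF one(1)] by (simp add: one(2))
 fix x y assume "x:carrier L" "y:carrier L"
 then obtain u v where uv: "u:P" "v:P" "x = ev u" "y = ev v" using ev_surj by metis
 show "ps' (x \<oplus> y) = ps' x + ps' y" using uv ev_add[OF uv(1,2)] ps' Padd[OF uv(1,2)] by (metis poly_add)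
 show "ps' (x \<otimes> y) = ps' x * ps' y" using uv ev_mult[OF uv(1,2)] ps' by (metis poly_mult)
 qed
 moreover have "ps' (ph c) = ps c" if c: "c:carrier K" for c
 proof -
 have "pCons (ps c) 0:P" "ev (pCons (ps c) 0) = ph c" using c g(1) phh(1)[OF c c] by (simp_all add: evC PC hps)
 with ps'[of "pCons (ps c) 0"] show ?thesis by simp
 qed
 ultimately show thesis by (rule that)
qed

lemma subfield_card_power:
 fixes k::"'f::field set"
 assumes k: "fsubfield k" and K: "fsubfield K" "k <= K"
 obtains m where "card K = card k ^ m" "m > 0"
proof -
 let ?A = "(*)::'f => 'f => 'f"
 note kD = fsubfieldD[OF k] and KD = fsubfieldD[OF K(1)]
 have add: "additive_action ?A" by (simp add: additive_action_def distrib_left)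
 have sk: "submod k ?A k" "submod k ?A K" using kD KD K(2) by (auto simp: submod_def subset_iff)
 have "U = {0} | U = k" if U: "submod k ?A U" "U <= k" for U
 proof (rule disjCI)
 assume "U ~= k"
 then obtain x where x: "x:k" "x ~: U" using U(2) by blast
 have "y = 0" if y: "y:U" for y
 proof (rule ccontr)
 assume "y ~= 0"
 moreover have "x * inverse y:k" using kD(5,6) x(1) y U(2) by blast
 ultimately have "x:U" using submodD(5)[OF U(1) _ y, of "x * inverse y"] by (simp add: mult.assoc)
 with x(2) show False ..
 qed
 thus "U = {0}" using submodD(1)[OF U(1)] by blast
 qed
 moreover have "k ~= {0}" using kD(3) by auto
 ultimately have sim: "simple_mod k ?A k" using sk(1) by (simp add: simple_mod_def)
 have "EX g:ophom k ?A k ?A K. v:g ` k" if v: "v:K" for v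
 proof (rule bexI[of _ "%s. if s:k then s * v else 0"])
 show "v:(%s. if s:k then s * v else 0) ` k" by (rule image_eqI[of _ _ 1]) (use kD(3) in auto)
 show "(%s. if s:k then s * v else 0):ophom k ?A k ?A K"
 by (rule ophomI) (use kD KD K(2) v in "auto simp: distrib_right mult.assoc subset_iff")
 qed
 then obtain n where n: "isotypic k ?A k ?A K K n" using isotypic_total[OF sim sk(2) add add KD(1)] by blast
 have "card K = card k ^ n" by (rule isotypic_card[OF sim sk(2) add add n])
 moreover have "n > 0" using calculation fsubfield_card_gt_1[OF K(1)] by (cases n) auto
 ultimately show thesis by (rule that)
qed

lemma nat_copy_of_FF:
 assumes q: "char_power TYPE('f::alg_closed_field) q"
 obtains K::"nat ring" and ps::"nat => 'f::alg_closed_field" where "field_emb K ps" "ps ` carrier K = FF q"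
proof -
 note k = fsubfieldD[OF FF_fsubfield[OF q]]
 obtain h::"'f => nat" where h: "bij_betw h (FF q) {0..<card (FF q::'f set)}"
 using ex_bij_betw_finite_nat[OF k(1)] by blast
 define ps where "ps = inv_into (FF q) h"
 have ps: "ps (h x) = x" if "x:FF q" for x using h that by (simp add: ps_def bij_betw_def)
 define K::"nat ring" where "K = \<lparr>carrier = h ` FF q, monoid.mult = (%x y. h (ps x * ps y)), one = h 1,
 ring.zero = h 0, add = (%x y. h (ps x + ps y))\<rparr>"
 have K: "carrier K = h ` FF q" "!!x y. x \<otimes>\<^bsub>K\<^esub> y = h (ps x * ps y)" "\<one>\<^bsub>K\<^esub> = h 1" "\<zero>\<^bsub>K\<^esub> = h 0"
 "!!x y. x \<oplus>\<^bsub>K\<^esub> y = h (ps x + ps y)" by (simp_all add: K_def)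
 have cr: "cring K"
 proof (rule cringI)
 show "abelian_group K"
 proof (rule abelian_groupI)
 fix x assume "x:carrier K"
 then obtain a where a: "x = h a" "a:FF q" by (auto simp: K)
 show "EX y:carrier K. y \<oplus>\<^bsub>K\<^esub> x = \<zero>\<^bsub>K\<^esub>"
 by (rule bexI[of _ "h (- a)"]) (use a k(8) in "auto simp: K ps")
 qed (use k(2,7) in "auto simp: K ps add_ac")
 show "Group.comm_monoid K" by (rule comm_monoidI) (use k(3,5) in "auto simp: K ps mult_ac")
 qed (use k(5,7) in "auto simp: K ps algebra_simps")
 interpret K: Ring.field K
 proof (rule cring.cring_fieldI2[OF cr])
 show "\<zero>\<^bsub>K\<^esub> ~= \<one>\<^bsub>K\<^esub>" using ps[OF k(2)] ps[OF k(3)] by (auto simp: K)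
 fix x assume "x:carrier K" "x ~= \<zero>\<^bsub>K\<^esub>"
 then obtain a where a: "x = h a" "a:FF q" "a ~= 0" by (auto simp: K)
 show "EX y:carrier K. x \<otimes>\<^bsub>K\<^esub> y = \<one>\<^bsub>K\<^esub>" 
 by (rule bexI[of _ "h (inverse a)"]) (use a k(6) in "auto simp: K ps")
 qed
 have "field_emb K ps"
 by unfold_locales (use k(1,3,5,7) in "auto simp: K ps")
 moreover have "ps ` carrier K = FF q" using ps by (auto simp: K image_image)
 ultimately show thesis by (rule that)
qed

lemma finite_imp_finite_dimension:
 assumes L: "Ring.field L" "finite (carrier L)" and k: "subfield k L"
 shows "ring.finite_dimension L k (carrier L)"
proof -
 interpret L: Ring.field L by (rule L(1))
 obtain us where us: "set us = carrier L" using finite_list[OF L(2)] by blast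
 have "L.Span k us = carrier L"
 proof
 show "L.Span k us <= carrier L" by (rule L.Span_in_carrier) (use us subfieldE(3)[OF k] in auto)
 show "carrier L <= L.Span k us" using L.Span_base_incl[OF k, of us] us by auto
 qed
 thus ?thesis using L.Span_finite_dimension[OF k, of us] us by simp
qed

lemma finite_dimension_imp_finite:
 assumes L: "Ring.field L" and k: "finite k" and dim: "ring.finite_dimension L k (carrier L)"
 shows "finite (carrier L)"
proof -
 interpret L: Ring.field L by (rule L)
 have "finite E" if "L.dimension n k E" for n E
 using that k
 proof (induction n k E rule: L.dimension.induct)
 case (Suc_dim v E n k)
 have "L.line_extension k v E = (%(c, e). c \<otimes>\<^bsub>L\<^esub> v \<oplus>\<^bsub>L\<^esub> e) ` (k \<times> E)"
 unfolding L.line_extension_def set_add_def' r_coset_def by auto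
 thus ?case using Suc_dim by simp
 qed simp
 thus ?thesis using dim unfolding L.finite_dimension_def by blast
qed

text \<open>If M stays irreducible over the extension whose degree is that of End(M), then \<open>dims\<close> for this extension says that the degree is 1.
Conversely, over a field L let T be a component of M: by \<open>dims\<close> it has the dimension of M, so that M is simple over L.\<close>

theorem abs_irreducible_iff:
 fixes K::"nat ring" and ps::"nat => 'f::alg_closed_field" and Q::"('i, 'h) pre_digraph"
 assumes q: "char_power TYPE('f) q" and emb: "field_emb K ps" and k: "ps ` carrier K = FF q"
 and Q: "fin_digraph Q" and al: "al:dimvecs Q" and M: "M:rep_space Q K al"
 shows "abs_irreducible_rep Q K al M \<longleftrightarrow> field_emb.emb_rep ps Q al M:abs_simple_reps Q (FF q) al"
proof -
 interpret K: field_emb K ps by (rule emb)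
 define S where "S = K.emb_rep Q al M"
 have fsk: "fsubfield (FF q::'f set)" by (rule FF_fsubfield[OF q])
 have SR: "S:reps Q (FF q) al" using bij_betwE[OF K.bij_emb_rep] M unfolding S_def k by blast
 have cardk: "card (FF q::'f set) = q" by (rule FF_prod(2)[OF q])
 have simple_iff: "irreducible_rep Q K al M \<longleftrightarrow> simple_rep Q (FF q) al S"
 using K.irreducible_iff_simple[OF Q al M] by (simp add: k S_def)
 have ext: "irreducible_rep Q L al (extend_scalars Q ph M) \<longleftrightarrow> simple_rep Q (ps' ` carrier L) al S"
 if L: "field_emb L ps'" and ph: "ph:Ring.ring_hom K L" "!!c. c:carrier K ==> ps' (ph c) = ps c" for L::"nat ring" and ps'::"nat => 'f" and ph
 proof -
 interpret L: field_emb L ps' by (rule L)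
 have entry: "map_mat ph (M h) $$ (a, b) = ph (M h $$ (a, b))"
 if "h:arcs Q" "a < lk al (head Q h)" "b < lk al (tail Q h)" for h a b
 by (rule index_map_mat(1)) (use K.rep_spaceD(2)[OF M that(1)] that in auto)
 have "map_mat ph (M h):mats L (lk al (head Q h)) (lk al (tail Q h))" if h: "h:arcs Q" for h
 by (rule L.mats_I) (use K.rep_spaceD(2)[OF M h] K.rep_spaceD(3)[OF M h] Ring.ring_hom_closed[OF ph(1)] in
 \<open>auto simp: entry[OF h]\<close>)
 hence "extend_scalars Q ph M:rep_space Q L al"
 by (auto simp: rep_space_def extend_scalars_def)
 moreover have "L.emb_rep Q al (extend_scalars Q ph M) = S"
 using K.rep_spaceD(3)[OF M] ph(2) by (auto simp: fun_eq_iff S_def K.emb_rep_def L.emb_rep_def extend_scalars_def entry)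
 ultimately show ?thesis using L.irreducible_iff_simple[OF Q al] by metis
 qed
 show ?thesis
 proof
 assume abs: "abs_irreducible_rep Q K al M"
 hence sim: "simple_rep Q (FF q) al S" using simple_iff by (simp add: abs_irreducible_rep_def)
 let ?d = "end_deg Q q (al, S)"
 note d = simple_rep_end_deg[OF q SR sim]
 have qd: "char_power TYPE('f) (q ^ ?d)" by (rule char_power_pow[OF q d(2)])
 obtain L::"nat ring" and ps'::"nat => 'f" where L: "field_emb L ps'" "ps' ` carrier L = FF (q ^ ?d)"
 using nat_copy_of_FF[OF qd] .
 interpret L: field_emb L ps' by (rule L(1))
 define ph where "ph = (%x. L.unemb (ps x))"
 have in_L: "ps c:ps' ` carrier L" if "c:carrier K" for c using that k FF_mono[of q ?d] unfolding L(2) by blast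
 have phc: "ph c:carrier L" "ps' (ph c) = ps c" if "c:carrier K" for c using L.unemb(1,2)[OF in_L[OF that]] by (auto simp: ph_def)
 have ph: "ph:Ring.ring_hom K L"
 proof (rule ring_hom_memI)
 show "ph \<one>\<^bsub>K\<^esub> = \<one>\<^bsub>L\<^esub>" using L.unemb(3)[of "\<one>\<^bsub>L\<^esub>"] by (simp add: ph_def K.ps_one L.ps_one)
 fix x y assume xy: "x:carrier K" "y:carrier K"
 show "ph (x \<otimes>\<^bsub>K\<^esub> y) = ph x \<otimes>\<^bsub>L\<^esub> ph y"
 using L.ps_eq_iff[of "ph (x \<otimes>\<^bsub>K\<^esub> y)" "ph x \<otimes>\<^bsub>L\<^esub> ph y"] phc xy by (simp add: L.ps_mult K.ps_mult)
 show "ph (x \<oplus>\<^bsub>K\<^esub> y) = ph x \<oplus>\<^bsub>L\<^esub> ph y"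
 using L.ps_eq_iff[of "ph (x \<oplus>\<^bsub>K\<^esub> y)" "ph x \<oplus>\<^bsub>L\<^esub> ph y"] phc xy by (simp add: L.ps_add K.ps_add)
 qed (use phc in simp)
 interpret ph: ring_hom_ring K L ph by (rule ring_hom_ringI2[OF K.is_ring L.is_ring ph])
 have "subfield (ph ` carrier K) L" by (rule ph.img_is_subfield(2)[OF K.carrier_is_subfield]) simp
 hence "ring.finite_dimension L (ph ` carrier K) (carrier L)"
 by (rule finite_imp_finite_dimension[OF L.field_axioms L.fin])
 hence "irreducible_rep Q L al (extend_scalars Q ph M)"
 using abs ph L.field_axioms by (simp add: abs_irreducible_rep_def)
 hence simL: "simple_rep Q (FF (q ^ ?d)) al S" using ext[OF L(1) ph phc(2)] by (simp add: L(2))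
 note sV = vspace_submod[OF fsk order_refl SR]
 (* Inclusion of vector spaces embeds S over FF q into S over the extension. *)
 have "ext_rep Q q ?d al al S S"
 proof
 have sub: "vspace (FF q) al <= (vspace (FF (q ^ ?d)) al::('i, 'f) gvec set)" using FF_mono[of q ?d] by (auto simp: vspace_def)
 have "idon (vspace (FF q) al) ~= (0::('i, 'f) gvec => _)"
 proof
 assume z: "idon (vspace (FF q) al) = (0::('i, 'f) gvec => _)"
 have "v = 0" if "v:vspace (FF q) al" for v::"('i, 'f) gvec" using fun_cong[OF z, of v] that by (simp add: idon_def)
 with sim submodD(1)[OF sV] show False by (auto simp: simple_mod_def)
 qed
 thus "EX f. f:ophom (ops (FF q)) (rep_act Q al S) (vspace (FF q) al) (rep_act Q al S) (vspace (FF (q ^ ?d)) al) & f ~= 0"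
 using idon_ophom[OF sV sub] by blast
 qed (use q d(2) SR sim simL reps_mono[OF FF_mono] in auto)
 then interpret E: ext_rep Q q ?d al al S S .
 have "al = dim_scale ?d al" by (rule E.dims(2)[OF E.eig_if_dvd[OF dvd_refl]])
 hence "dim_size al = ?d * dim_size al" by (metis dim_size_scale)
 moreover have "dim_size al ~= 0" using simple_rep_dim_nonzero[OF fsubfieldD(2)[OF fsk] sim] by (simp add: dim_size_eq_0_iff)
 ultimately have "?d = 1" by simp
 hence "end_card Q (FF q) (al, S) = card (FF q::'f set)" using d(1) cardk by simp
 thus "K.emb_rep Q al M:abs_simple_reps Q (FF q) al"
 using SR sim by (simp add: abs_simple_reps_def S_def)
 next
 assume "K.emb_rep Q al M:abs_simple_reps Q (FF q) al"
 hence sim: "simple_rep Q (FF q) al S" and e: "end_card Q (FF q) (al, S) = q"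
 by (auto simp: abs_simple_reps_def S_def cardk)
 have d: "end_deg Q q (al, S) = 1"
 proof -
 have "q ^ end_deg Q q (al, S) = q ^ 1" using simple_rep_end_deg(1)[OF q SR sim] e by simp
 thus ?thesis using char_power_ge_2[OF q] by (subst (asm) power_inject_exp) auto
 qed
 show "abs_irreducible_rep Q K al M" unfolding abs_irreducible_rep_def
 proof (intro conjI allI impI)
 show "irreducible_rep Q K al M" using simple_iff sim by simp
 fix L::"nat ring" and ph
 assume L: "Ring.field L & ph:Ring.ring_hom K L & ring.finite_dimension L (ph ` carrier K) (carrier L)"
 hence ph: "ph:Ring.ring_hom K L" by blast
 have "finite (carrier L)" by (rule finite_dimension_imp_finite[of L "ph ` carrier K"]) (use L K.fin in auto)
 then obtain ps' where ps': "field_emb L ps'" "!!c. c:carrier K ==> ps' (ph c) = ps c"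
 using finite_field_extension_embedding[OF emb _ _ ph] L by metis
 interpret L: field_emb L ps' by (rule ps'(1))
 have sub: "FF q <= ps' ` carrier L"
 unfolding k[symmetric]
 proof (rule image_subsetI)
 fix c assume c: "c:carrier K"
 show "ps c:ps' ` carrier L" by (rule image_eqI[where x = "ph c"]) (use ps'(2)[OF c] Ring.ring_hom_closed[OF ph c] in auto)
 qed
 obtain m where m: "card (ps' ` carrier L) = q ^ m" "m > 0"
 using subfield_card_power[OF fsk L.fsub sub] cardk by auto
 have LF: "ps' ` carrier L = FF (q ^ m)"
 using fsubfield_eq_FF[OF L.fsub] char_power_pow[OF q m(2)] by (simp add: m(1))
 obtain ta T f where T: "ext_rep Q q m al ta S T" "f:rep_hom Q (FF (q ^ m)) ta T al S" "inj_on f (vspace (FF (q ^ m)) ta)"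
 using lift_exists[OF q m(2) SR sim] .
 interpret T: ext_rep Q q m al ta S T by (rule T(1))
 have "al = dim_scale 1 ta" using T.dims(2)[OF T.eig_if_dvd] by (simp add: d)
 hence ta: "ta = al" by (simp add: dim_scale_Suc)
 have sW: "submod (ops T.K) (rep_act Q al S) T.W" unfolding ta
 by (rule vspace_submod[OF T.K(1) order_refl reps_mono[OF FF_mono SR]])
 have "f ` T.W = T.W" by (rule endo_inj_surj[OF T.finW _ T(3)]) (use ophomD(2)[OF T(2)] in "auto simp: ta")
 hence bij: "bij_betw f T.W T.W" using T(3) by (simp add: bij_betw_def)
 have f: "f:ophom (ops T.K) T.B T.W (rep_act Q al S) T.W" using T(2) by (simp add: ta)
 have "simple_mod (ops T.K) (rep_act Q al S) T.W"
 by (rule simple_mod_image[OF hinv_ophom(1)[OF f bij T.sW] bij_hinv[OF f bij T.sW] sW T.T(2)])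
 thus "irreducible_rep Q L al (extend_scalars Q ph M)"
 using ext[OF ps'(1) ph ps'(2)] by (simp add: LF ta)
 qed
 qed
qed

lemma card_quotient_transfer:
 assumes bij: "bij_betw e Y Z" and sub: "Y0 <= Y" "Z0 = e ` Y0"
 and r: "r <= Y \<times> Y" "s <= Z \<times> Z" "!!x y. x:Y ==> y:Y ==> (x, y):r \<longleftrightarrow> (e x, e y):s"
 shows "card (Y0 // r) = card (Z0 // s)"
proof -
 have im: "e ` (r `` {x}) = s `` {e x}" if "x:Y0" for x
 proof (intro equalityI subsetI)
 fix z assume "z:s `` {e x}"
 hence z: "(e x, z):s" by simp
 from z obtain y where "y:Y" "z = e y" using r(2) bij by (auto simp: bij_betw_def)
 moreover from this have "(x, y):r" using z r(3)[of x y] that sub(1) by auto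
 ultimately show "z:e ` (r `` {x})" by blast
 next
 fix z assume "z:e ` (r `` {x})"
 then obtain y where y: "(x, y):r" "z = e y" by blast
 hence "y:Y" "x:Y" using r(1) by auto
 thus "z:s `` {e x}" using y r(3) by simp
 qed
 have "Y0 // r = (%x. r `` {x}) ` Y0" "Z0 // s = (%x. s `` {e x}) ` Y0" by (auto simp: quotient_def sub(2))
 hence "Z0 // s = (%c. e ` c) ` (Y0 // r)" by (simp add: image_image im cong: image_cong)
 moreover have "inj_on (%c. e ` c) (Y0 // r)"
 proof (rule inj_on_subset[OF inj_on_image_Pow])
 show "inj_on e Y" using bij by (simp add: bij_betw_def)
 show "Y0 // r <= Pow Y" using r(1) by (auto simp: quotient_def)
 qed
 ultimately show ?thesis by (simp add: card_image)
qed

theorem num_abs_irreducible_eq: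
 fixes K::"nat ring" and ps::"nat => 'f::alg_closed_field" and Q::"('i, 'h) pre_digraph"
 assumes q: "char_power TYPE('f) q" and emb: "field_emb K ps" and k: "ps ` carrier K = FF q"
 and Q: "fin_digraph Q" and al: "al:dimvecs Q"
 shows "num_abs_irreducible Q K al = card (abs_simple_reps Q (FF q::'f set) al // iso_rel Q (FF q) al)"
 unfolding num_abs_irreducible_def
proof (rule card_quotient_transfer)
 interpret K: field_emb K ps by (rule emb)
 show "bij_betw (K.emb_rep Q al) (rep_space Q K al) (reps Q (FF q) al)" using K.bij_emb_rep[of Q al] by (simp add: k)
 show "abs_simple_reps Q (FF q) al = K.emb_rep Q al ` {M:rep_space Q K al. abs_irreducible_rep Q K al M}"
 proof (intro equalityI subsetI)
 fix S assume S: "S:abs_simple_reps Q (FF q::'f set) al"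
 hence "S:K.emb_rep Q al ` rep_space Q K al" using K.bij_emb_rep[of Q al] by (simp add: k bij_betw_def abs_simple_reps_def)
 then obtain M where M: "M:rep_space Q K al" "S = K.emb_rep Q al M" by blast
 thus "S:K.emb_rep Q al ` {M:rep_space Q K al. abs_irreducible_rep Q K al M}"
 using abs_irreducible_iff[OF q emb k Q al M(1)] S by blast
 next
 fix S assume "S:K.emb_rep Q al ` {M:rep_space Q K al. abs_irreducible_rep Q K al M}"
 then obtain M where "M:rep_space Q K al" "abs_irreducible_rep Q K al M" "S = K.emb_rep Q al M" by blast
 thus "S:abs_simple_reps Q (FF q) al" using abs_irreducible_iff[OF q emb k Q al] by simp
 qed
 show "rep_iso Q K al <= rep_space Q K al \<times> rep_space Q K al" by (auto simp: rep_iso_def)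
 show "iso_rel Q (FF q) al <= reps Q (FF q) al \<times> (reps Q (FF q) al::('h, 'f) mats_fam set)" by (auto simp: iso_rel_def)
 show "(M, N):rep_iso Q K al \<longleftrightarrow> (K.emb_rep Q al M, K.emb_rep Q al N):iso_rel Q (FF q) al"
 if "M:rep_space Q K al" "N:rep_space Q K al" for M N
 using K.rep_iso_iff[OF Q al that] by (simp add: k)
qed auto

section \<open>Values of rational functions\<close>

text \<open>Any representation of f as a fraction whose denominator does not vanish at x may be used; then the rules for sums, products and substitutions need no
common reduced form.\<close>

definition has_value::"ratfun => rat => rat => bool" where
 "has_value f x v \<longleftrightarrow> (EX a b. f = to_fract a / to_fract b & poly b x ~= 0 & v = poly a x / poly b x)"

lemma has_valueI: "f = to_fract a / to_fract b ==> poly b x ~= 0 ==> v = poly a x / poly b x ==> has_value f x v"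
 by (auto simp: has_value_def)

lemma has_value_poly: "has_value (to_fract a) x (poly a x)"
 by (rule has_valueI[of _ a 1]) simp_all

lemma has_value_add:
 assumes "has_value f x u" "has_value g x v" shows "has_value (f + g) x (u + v)"
proof -
 obtain a b c d where f: "f = to_fract a / to_fract b" "poly b x ~= 0" "u = poly a x / poly b x"
 and g: "g = to_fract c / to_fract d" "poly d x ~= 0" "v = poly c x / poly d x"
 using assms by (auto simp: has_value_def)
 have "b ~= 0" "d ~= 0" using f(2) g(2) by auto
 thus ?thesis by (intro has_valueI[of _ "a * d + c * b" "b * d"]) (use f g in "auto simp: add_frac_eq")
qed

lemma has_value_mult:
 assumes "has_value f x u" "has_value g x v" shows "has_value (f * g) x (u * v)"
proof -
 obtain a b c d where f: "f = to_fract a / to_fract b" "poly b x ~= 0" "u = poly a x / poly b x"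
 and g: "g = to_fract c / to_fract d" "poly d x ~= 0" "v = poly c x / poly d x"
 using assms by (auto simp: has_value_def)
 show ?thesis by (rule has_valueI[of _ "a * c" "b * d"]) (use f g in auto)
qed

lemma has_value_inverse:
 assumes "has_value f x u" "u ~= 0" shows "has_value (inverse f) x (inverse u)"
proof -
 obtain a b where f: "f = to_fract a / to_fract b" "poly b x ~= 0" "u = poly a x / poly b x"
 using assms by (auto simp: has_value_def)
 show ?thesis by (rule has_valueI[of _ b a]) (use f assms(2) in auto)
qed

lemma has_value_0 [simp]: "has_value 0 x 0" using has_value_poly[of 0 x] by simp
lemma has_value_1 [simp]: "has_value 1 x 1" using has_value_poly[of 1 x] by simp
lemma has_value_qvar: "has_value qvar x x" using has_value_poly[of "[:0, 1:]" x] by (simp add: qvar_def)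
lemma has_value_const: "has_value (to_fract [:c:]) x c" using has_value_poly[of "[:c:]" x] by simp

lemma has_value_uminus: "has_value f x u ==> has_value (- f) x (- u)"
 using has_value_mult[OF has_value_poly[of "- 1" x], of f u] by simp

lemma has_value_diff: "has_value f x u ==> has_value g x v ==> has_value (f - g) x (u - v)"
 using has_value_add[OF _ has_value_uminus, of f x u g v] by simp

lemma has_value_divide: "has_value f x u ==> has_value g x v ==> v ~= 0 ==> has_value (f / g) x (u / v)"
 using has_value_mult[OF _ has_value_inverse, of f x u g v] by (simp add: divide_inverse)

lemma has_value_power: "has_value f x u ==> has_value (f ^ n) x (u ^ n)"
 by (induction n) (simp_all add: has_value_mult)

lemma has_value_powi: "has_value f x u ==> u ~= 0 ==> has_value (f powi n) x (u powi n)"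
 by (cases "n >= 0") (simp_all add: power_int_def has_value_power has_value_inverse)

lemma has_value_sum: "(!!i. i:I ==> has_value (f i) x (u i)) ==> has_value (SUM i:I. f i) x (SUM i:I. u i)"
 by (induction I rule: infinite_finite_induct) (simp_all add: has_value_add)

lemma has_value_prod: "(!!i. i:I ==> has_value (f i) x (u i)) ==> has_value (PROD i:I. f i) x (PROD i:I. u i)"
 by (induction I rule: infinite_finite_induct) (simp_all add: has_value_mult)

lemma has_value_of_nat: "has_value (of_nat n) x (of_nat n)"
 by (induction n) (simp_all add: has_value_add)

lemma of_nat_ratfun_eq_0_iff: "(of_nat n::ratfun) = 0 \<longleftrightarrow> n = 0"
proof
 assume z: "(of_nat n::ratfun) = 0"
 obtain a b where "(of_nat n::ratfun) = to_fract a / to_fract b" "poly b 0 ~= 0" "of_nat n = poly a 0 / poly b (0::rat)"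
 using has_value_of_nat[of n 0] by (auto simp: has_value_def)
 with z show "n = 0" by auto
qed simp

lemma reduced_denominator_nonzero:
 assumes "has_value f x v"
 shows "poly (snd (quot_of_fract f)) x ~= 0" "ratfun_eval f x = v"
proof -
 let ?n = "fst (quot_of_fract f)" and ?d = "snd (quot_of_fract f)"
 obtain a b where f: "f = to_fract a / to_fract b" "poly b x ~= 0" "v = poly a x / poly b x"
 using assms by (auto simp: has_value_def)
 have "to_fract ?n / to_fract ?d = f" using Fract_quot_of_fract[of f] by (simp only: Fract_conv_to_fract)
 hence "to_fract ?n / to_fract ?d = to_fract a / to_fract b" using f(1) by (rule trans)
 moreover have "to_fract ?d ~= 0" "to_fract b ~= 0" using f(2) by auto
 ultimately have "to_fract ?n * to_fract b = to_fract a * to_fract ?d" using frac_eq_eq by blast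
 hence "to_fract (?n * b) = to_fract (a * ?d)" by (simp only: to_fract_mult)
 hence "?n * b = a * ?d" by (simp only: to_fract_eq_iff)
 from arg_cong[OF this, of "%p. poly p x"] have e: "poly ?n x * poly b x = poly a x * poly ?d x" by simp
 show nz: "poly ?d x ~= 0"
 proof
 assume d: "poly ?d x = 0"
 hence "poly ?n x = 0" using e f(2) by simp
 with d have "[:- x, 1:] dvd ?n" "[:- x, 1:] dvd ?d" by (simp_all add: poly_eq_0_iff_dvd)
 hence "is_unit [:- x, 1:]" using coprime_quot_of_fract[of f] by (meson coprime_common_divisor)
 thus False by (simp add: is_unit_pCons_iff)
 qed
 show "ratfun_eval f x = v" using e nz f by (simp add: ratfun_eval_def frac_eq_eq)
qed

lemma has_value_unique: "has_value f x u ==> has_value f x v ==> u = v"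
 using reduced_denominator_nonzero(2) by metis

lemma has_value_eval:
 assumes "poly (snd (quot_of_fract f)) x ~= 0" shows "has_value f x (ratfun_eval f x)"
 by (rule has_valueI[of _ "fst (quot_of_fract f)" "snd (quot_of_fract f)"])
 (use assms Fract_quot_of_fract[of f] in "simp_all only: Fract_conv_to_fract ratfun_eval_def not_False_eq_True")

lemma has_value_subst:
 assumes s: "has_value s x y" and f: "has_value f y v"
 shows "has_value (ratfun_subst s f) x v"
proof -
 have p: "has_value (poly (map_poly (%c. to_fract [:c:]) p) s) x (poly p y)" for p
 proof (induction p)
 case (pCons a p)
 have "map_poly (%c. to_fract [:c:]) (pCons a p) = pCons (to_fract [:a:]) (map_poly (%c. to_fract [:c:]) p)"
 by (rule map_poly_pCons) simp
 thus ?case by (simp add: has_value_add has_value_const has_value_mult s pCons.IH)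
 qed simp
 from has_value_divide[OF p[of "fst (quot_of_fract f)"] p reduced_denominator_nonzero(1)[OF f]]
 show ?thesis using reduced_denominator_nonzero(2)[OF f] by (simp add: ratfun_subst_def ratfun_eval_def)
qed

lemma ratfun_subst_0 [simp]: "ratfun_subst s 0 = 0" by (simp add: ratfun_subst_def)

text \<open>The difference has a numerator with infinitely many zeros.\<close>

lemma ratfun_eqI:
 assumes "!!n. n > 0 ==> EX v. has_value f (2 ^ n) v & has_value g (2 ^ n) v"
 shows "f = g"
proof -
 let ?p = "fst (quot_of_fract (f - g))"
 have "poly ?p (2 ^ n) = 0" if n: "n > 0" for n::nat
 proof -
 obtain v where "has_value f (2 ^ n) v" "has_value g (2 ^ n) v" using assms[OF n] by blast
 from has_value_diff[OF this] have "has_value (f - g) (2 ^ n) 0" by simp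
 from reduced_denominator_nonzero[OF this] show ?thesis by (simp add: ratfun_eval_def)
 qed
 hence sub: "(%n. 2 ^ Suc n) ` UNIV <= {x. poly ?p x = 0}" by (auto simp del: power_Suc)
 have "inj (%n. 2 ^ Suc n::rat)" by (auto intro!: injI)
 hence "infinite {x. poly ?p x = 0}" using finite_subset[OF sub] finite_imageD infinite_UNIV_nat by blast
 hence "?p = 0" using poly_roots_finite by blast
 thus ?thesis by simp
qed

lemma has_value_of_int_poly:
 "has_value (ratfun_of_int_poly P) (of_int x) (of_int (poly P x))"
proof -
 have "poly (map_poly rat_of_int P) (of_int x) = of_int (poly P x)"
 by (induction P) (simp_all add: map_poly_pCons)
 thus ?thesis using has_value_poly[of "map_poly rat_of_int P" "of_int x"] by (simp add: ratfun_of_int_poly_def)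
qed

subsection \<open>The number of representations\<close>

definition gl_count::"rat => nat => rat" where
 "gl_count x n = (PROD l<n. x ^ n - x ^ l)"

definition rep_quot::"('i, 'h) pre_digraph => 'i dimvec => rat => rat" where
 "rep_quot Q al x = x ^ (SUM h:arcs Q. lk al (head Q h) * lk al (tail Q h)) / (PROD i:verts Q. gl_count x (lk al i))"

lemma gl_count_nonzero: "x > 1 ==> gl_count x n ~= 0"
 by (auto simp: gl_count_def power_strict_increasing_iff)

lemma card_rep_quot:
 assumes Q: "fin_digraph Q" and K: "finite_field K"
 shows "of_nat (card (rep_space Q K al)) / of_nat (card (GL_dim Q K al)) = rep_quot Q al (of_nat (order K))"
 and "rep_quot Q al (of_nat (order K)) ~= 0"
proof -
 interpret Q: fin_digraph Q by (rule Q)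
 interpret K: Ring.field K using K by (simp add: finite_field_def)
 have fin: "finite (carrier K)" using K by (simp add: finite_field_def)
 have "{\<zero>\<^bsub>K\<^esub>, \<one>\<^bsub>K\<^esub>} <= carrier K" by simp
 from card_mono[OF fin this] have q: "order K >= 2" by (simp add: order_def)
 have GL: "(of_nat (card (GL K n))::rat) = gl_count (of_nat (order K)) n" for n
 using arg_cong[OF K.card_GL[OF fin, of n], of rat_of_int] by (simp add: gl_count_def)
 have R: "card (rep_space Q K al) = order K ^ (SUM h:arcs Q. lk al (head Q h) * lk al (tail Q h))"
 by (simp add: rep_space_def card_PiE K.card_mats power_sum)
 have "(of_nat (card (GL_dim Q K al))::rat) = (PROD i:verts Q. gl_count (of_nat (order K)) (lk al i))"
 by (simp add: GL_dim_def card_PiE GL[symmetric])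
 thus "of_nat (card (rep_space Q K al)) / of_nat (card (GL_dim Q K al)) = rep_quot Q al (of_nat (order K))"
 by (simp add: rep_quot_def R)
 show "rep_quot Q al (of_nat (order K)) ~= 0"
 using q gl_count_nonzero[of "of_nat (order K)"] by (simp add: rep_quot_def prod_zero_iff)
qed

abbreviation F2::"bit alg_closure itself" where "F2 \<equiv> TYPE(bit alg_closure)"

lemma CHAR_bit: "CHAR(bit) = 2"
proof (rule CHAR_eqI)
 fix n::nat assume "(of_nat n::bit) = 0"
 moreover have "(of_nat n::bit) = (if even n then 0 else 1)" by (induction n) auto
 ultimately show "2 dvd n" by (simp split: if_splits)
qed simp

lemma char_power_2: "n > 0 ==> char_power F2 (2 ^ n)"
 by (auto simp: char_power_def CHAR_bit)

lemma finite_field_2_power: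
 assumes "n > 0" obtains K where "finite_field K" "order K = 2 ^ n"
proof -
 obtain K::"nat ring" and ps::"nat => bit alg_closure" where K: "field_emb K ps" "ps ` carrier K = FF (2 ^ n)"
 using nat_copy_of_FF[OF char_power_2[OF assms]] .
 interpret field_emb K ps by (rule K(1))
 have "finite_field K" using fin field_axioms by (simp add: finite_field_def)
 moreover have "order K = 2 ^ n" using card_k FF_prod(2)[OF char_power_2[OF assms]] by (simp add: K(2))
 ultimately show thesis by (rule that)
qed

lemma has_value_rep_ratfun:
 assumes Q: "fin_digraph Q" and x: "x > 1"
 shows "has_value (rep_ratfun Q al) x (rep_quot Q al x)"
proof -
 interpret Q: fin_digraph Q by (rule Q)
 define R::ratfun where "R = qvar ^ (SUM h:arcs Q. lk al (head Q h) * lk al (tail Q h)) /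
 (PROD i:verts Q. PROD l<lk al i. qvar ^ lk al i - qvar ^ l)"
 have R: "has_value R y (rep_quot Q al y)" if "y > 1" for y
 unfolding R_def rep_quot_def gl_count_def
 by (intro has_value_divide has_value_power has_value_prod has_value_diff has_value_qvar)
 (use gl_count_nonzero[OF that] in "auto simp: gl_count_def prod_zero_iff")
 have spec: "ALL K. finite_field K --> ratfun_eval R (of_nat (order K)) = of_nat (card (rep_space Q K al)) / of_nat (card (GL_dim Q K al))"
 proof (intro allI impI)
 fix K assume K: "finite_field K"
 have "{\<zero>\<^bsub>K\<^esub>, \<one>\<^bsub>K\<^esub>} <= carrier K" "\<zero>\<^bsub>K\<^esub> ~= \<one>\<^bsub>K\<^esub>"
 proof -
 interpret K: Ring.field K using K by (simp add: finite_field_def)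
 show "{\<zero>\<^bsub>K\<^esub>, \<one>\<^bsub>K\<^esub>} <= carrier K" "\<zero>\<^bsub>K\<^esub> ~= \<one>\<^bsub>K\<^esub>" by simp_all
 qed
 with card_mono[of "carrier K" "{\<zero>\<^bsub>K\<^esub>, \<one>\<^bsub>K\<^esub>}"] K have "(1::rat) < of_nat (order K)"
 by (simp add: finite_field_def order_def)
 from reduced_denominator_nonzero(2)[OF R[OF this]]
 show "ratfun_eval R (of_nat (order K)) = of_nat (card (rep_space Q K al)) / of_nat (card (GL_dim Q K al))"
 using card_rep_quot(1)[OF Q K] by simp
 qed
 have "rep_ratfun Q al = R" unfolding rep_ratfun_def
 proof (rule the_equality, rule spec)
 fix f assume f: "ALL K. finite_field K --> ratfun_eval f (of_nat (order K)) = of_nat (card (rep_space Q K al)) / of_nat (card (GL_dim Q K al))"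
 show "f = R"
 proof (rule ratfun_eqI)
 fix n::nat assume n: "n > 0"
 obtain K where K: "finite_field K" "order K = 2 ^ n" using finite_field_2_power[OF n] .
 have e: "ratfun_eval f (2 ^ n) = rep_quot Q al (2 ^ n)" and nz: "rep_quot Q al (2 ^ n) ~= 0"
 using f card_rep_quot[OF Q K(1), of al] K by auto
 hence "poly (snd (quot_of_fract f)) (2 ^ n) ~= 0" by (auto simp: ratfun_eval_def)
 from has_value_eval[OF this] have "has_value f (2 ^ n) (rep_quot Q al (2 ^ n))" by (simp add: e)
 moreover have "(1::rat) < 2 ^ n" using n by simp
 ultimately show "EX v. has_value f (2 ^ n) v & has_value R (2 ^ n) v" using R by blast
 qed
 qed
 thus ?thesis using R[OF x] by simp
qed

lemma has_value_q_infty_dim: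
 assumes "!!i. i >= 1 ==> x ^ i ~= 1"
 shows "has_value (q_infty_dim Q al) x (PROD i:verts Q. qe x (lk al i))"
 unfolding q_infty_dim_def q_infty_def qe_def
 by (intro has_value_prod has_value_divide has_value_diff has_value_power has_value_qvar has_value_1)
 (use assms in "auto simp: prod_zero_iff")

lemma gl_count_qe: assumes "x > 1" shows "inverse (gl_count x m) = inverse x ^ (m * m) * qe (inverse x) m"
proof -
 have x0: "x ~= 0" using assms by auto
 have "gl_count x m = (PROD l<m. x ^ m * (1 - inverse x ^ Suc (m - Suc l)))" unfolding gl_count_def
 proof (rule prod.cong[OF refl])
 fix l assume "l:{..<m}"
 hence "m = l + Suc (m - Suc l)" by simp
 hence "x ^ m = x ^ l * x ^ Suc (m - Suc l)" by (metis power_add)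
 hence "x ^ l = x ^ m * inverse x ^ Suc (m - Suc l)" using x0 by (simp add: power_inverse field_simps)
 thus "x ^ m - x ^ l = x ^ m * (1 - inverse x ^ Suc (m - Suc l))" by (simp add: right_diff_distrib del: power_Suc)
 qed
 also have "... = x ^ (m * m) * (PROD l<m. 1 - inverse x ^ Suc (m - Suc l))" by (simp add: prod.distrib power_mult)
 also have "(PROD l<m. 1 - inverse x ^ Suc (m - Suc l)) = (PROD l<m. 1 - inverse x ^ Suc l)"
 by (rule prod.nat_diff_reindex)
 also have "... = (PROD i=1..m. 1 - inverse x ^ i)" by (simp add: prod.atLeast1_atMost_eq)
 finally show ?thesis by (simp add: qe_def power_inverse divide_inverse)
qed

theorem rep_ratfun_eq:
 assumes Q: "fin_digraph Q"
 shows "rep_ratfun Q al = ratfun_subst (inverse qvar) (qvar powi tits_form Q (int_dim al) * q_infty_dim Q al)"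
proof (rule ratfun_eqI)
 interpret Q: fin_digraph Q by (rule Q)
 fix n::nat assume n: "n > 0"
 let ?x = "2 ^ n::rat" and ?y = "inverse (2 ^ n)::rat"
 have x: "?x > 1" using n by simp
 have y: "?y ^ i ~= 1" if "i >= 1" for i
 proof -
 have "(1::rat) < 2 ^ (n * i)" using n that by (intro one_less_power) auto
 hence "(2::rat) ^ (n * i) ~= 1" by simp
 thus ?thesis by (simp only: power_inverse power_mult[symmetric] inverse_eq_1_iff not_False_eq_True)
 qed
 have "has_value (ratfun_subst (inverse qvar) (qvar powi tits_form Q (int_dim al) * q_infty_dim Q al)) ?x
 (?y powi tits_form Q (int_dim al) * (PROD i:verts Q. qe ?y (lk al i)))"
 by (rule has_value_subst[OF has_value_inverse[OF has_value_qvar] has_value_mult[OF has_value_powi[OF has_value_qvar] has_value_q_infty_dim]])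
 (use y in auto)
 moreover have "?y powi tits_form Q (int_dim al) * (PROD i:verts Q. qe ?y (lk al i)) = rep_quot Q al ?x"
 proof -
 let ?A = "SUM i:verts Q. lk al i * lk al i" and ?B = "SUM h:arcs Q. lk al (head Q h) * lk al (tail Q h)"
 have "tits_form Q (int_dim al) = int ?A - int ?B"
 by (simp add: tits_form_def ringel_form_def int_dim_def mult.commute)
 hence "?y powi tits_form Q (int_dim al) = ?y ^ ?A * ?x ^ ?B"
 by (simp add: power_int_diff power_int_of_nat divide_inverse power_inverse del: of_nat_sum of_nat_mult)
 also have "?y ^ ?A = (PROD i:verts Q. ?y ^ (lk al i * lk al i))" by (simp add: power_sum)
 finally have "?y powi tits_form Q (int_dim al) * (PROD i:verts Q. qe ?y (lk al i)) =
 ?x ^ ?B * (PROD i:verts Q. ?y ^ (lk al i * lk al i) * qe ?y (lk al i))" by (simp add: prod.distrib mult_ac)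
 also have "(PROD i:verts Q. ?y ^ (lk al i * lk al i) * qe ?y (lk al i)) = (PROD i:verts Q. inverse (gl_count ?x (lk al i)))"
 by (simp only: gl_count_qe[OF x])
 also have "?x ^ ?B * ... = rep_quot Q al ?x" by (simp add: rep_quot_def divide_inverse prod_inversef[symmetric] comp_def)
 finally show ?thesis .
 qed
 ultimately show "EX v. has_value (rep_ratfun Q al) ?x v &
 has_value (ratfun_subst (inverse qvar) (qvar powi tits_form Q (int_dim al) * q_infty_dim Q al)) ?x v"
 using has_value_rep_ratfun[OF Q x] by auto
qed

section \<open>The plethystic exponential\<close>

lemma dim_size_pos_iff: "0 < dim_size ga \<longleftrightarrow> ga ~= 0"
 using dim_size_eq_0_iff[of ga] by auto

lemma dim_le_refl [simp]: "dim_le al al" by (simp add: dim_le_def)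

lemma dim_le_add [simp]: "dim_le al (al + be)" "dim_le be (al + be)" by (simp_all add: dim_le_def lookup_add)

lemma dim_le_diff_add: "dim_le be ga ==> ga - be + be = ga" "dim_le be ga ==> be + (ga - be) = ga"
 by (intro poly_mapping_eqI; simp add: dim_le_def lookup_add lookup_minus)+

abbreviation splits::"'i dimvec => ('i dimvec \<times> 'i dimvec) set" where
 "splits ga \<equiv> {(al, be). al + be = ga}"

lemma finite_splits [simp]: "finite (splits ga)"
 by (rule finite_subset[of _ "{be. dim_le be ga} \<times> {be. dim_le be ga}"]) (use finite_dim_le in auto)

lemma finite_splits' [simp]: "finite {p. fst p + snd p = (ga::'i dimvec)}"
 using finite_splits[of ga] by (simp add: case_prod_unfold)

lemma sum_splits: "(SUM (al, be):splits ga. f al be) = (SUM be | dim_le be ga. f (ga - be) be)"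
 by (rule sum.reindex_bij_witness[of _ "%be. (ga - be, be)" snd]) (auto simp: dim_le_diff_add)

lemma sum_splits': "(SUM (al, be):splits ga. f al be) = (SUM al | dim_le al ga. f al (ga - al))"
 by (rule sum.reindex_bij_witness[of _ "%al. (al, ga - al)" fst]) (auto simp: dim_le_diff_add)

lemma series_mult_left_commute: "series_mult f (series_mult g h) = series_mult g (series_mult f h)"
proof (rule ext)
 fix ga
 have expand: "series_mult f (series_mult g h) ga =
 (SUM ((a, b), (c, d)):Sigma (splits ga) (%(a, b). splits b). f a * (g c * h d))" for f g h::"'a series"
 unfolding series_mult_def by (subst sum.Sigma[symmetric]) (auto simp: sum_distrib_left case_prod_unfold)
 show "series_mult f (series_mult g h) ga = series_mult g (series_mult f h) ga"
 unfolding expand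
 by (rule sum.reindex_bij_witness[of _ "%((c, b), (a, d)). ((a, c + d), (c, d))" "%((a, b), (c, d)). ((c, a + d), (a, d))"])
 (auto simp: ac_simps)
qed

lemma series_mult_eq_0I: "(!!al be. al + be = ga ==> f al * g be = 0) ==> series_mult f g ga = 0"
 unfolding series_mult_def by (rule sum.neutral) auto

definition series_deriv::"'i series => 'i series" where
 "series_deriv f = (%al. of_nat (dim_size al) * f al)"

lemma series_deriv_mult:
 "series_deriv (series_mult f g) ga = series_mult (series_deriv f) g ga + series_mult f (series_deriv g) ga"
 unfolding series_deriv_def series_mult_def sum_distrib_left sum.distrib[symmetric]
 by (rule sum.cong) (auto simp: dim_size_add algebra_simps)

lemma series_mult_scale_right: "series_mult f (%al. c * g al) ga = c * series_mult f g ga"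
 unfolding series_mult_def sum_distrib_left by (rule sum.cong) (auto simp: algebra_simps)

lemma series_deriv_power:
 fixes f::"'i series"
 shows "series_deriv ((series_mult f ^^ Suc n) series_one) ga =
 of_nat (Suc n) * series_mult (series_deriv f) ((series_mult f ^^ n) series_one) ga"
proof (induction n arbitrary: ga)
 case 0
 have "series_deriv (series_one::'i series) = (%_. 0)" by (auto simp: series_deriv_def series_one_def series_monom_def)
 thus ?case using series_mult_eq_0I[of ga f "%_. 0"] by (simp add: series_deriv_mult)
next
 case (Suc n)
 let ?P = "%n. (series_mult f ^^ n) series_one"
 have "series_deriv (?P (Suc n)) = (%ga. of_nat (Suc n) * series_mult (series_deriv f) (?P n) ga)" using Suc.IH by (rule ext)
 hence "series_mult f (series_deriv (?P (Suc n))) ga = of_nat (Suc n) * series_mult (series_deriv f) (?P (Suc n)) ga"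
 by (simp only: series_mult_scale_right series_mult_left_commute[of f "series_deriv f"] funpow.simps comp_apply)
 moreover have "series_deriv (?P (Suc (Suc n))) ga = series_mult (series_deriv f) (?P (Suc n)) ga + series_mult f (series_deriv (?P (Suc n))) ga"
 by (simp only: funpow.simps(2)[of "Suc n"] comp_apply series_deriv_mult)
 ultimately show ?case by (simp only: of_nat_Suc[of "Suc n"] distrib_right mult_1 add.commute)
qed

lemma series_power_eq_0:
 assumes "f 0 = 0" "dim_size ga < n"
 shows "(series_mult f ^^ n) series_one ga = 0"
 using assms(2)
proof (induction n arbitrary: ga)
 case (Suc n)
 have "f al * (series_mult f ^^ n) series_one be = 0" if "al + be = ga" for al be
 proof (cases "al = 0")
 case False
 hence "dim_size be < n" using Suc.prems that dim_size_add[of al be] dim_size_eq_0_iff[of al] by auto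
 thus ?thesis using Suc.IH by simp
 qed (simp add: assms(1))
 thus ?case by (simp only: funpow.simps comp_apply) (rule series_mult_eq_0I)
qed simp

lemma series_exp_finite:
 assumes "f 0 = 0" "dim_size ga <= N"
 shows "series_exp f ga = (SUM n<=N. (series_mult f ^^ n) series_one ga / fact n)"
 unfolding series_exp_def
proof (rule Sum_any.expand_superset)
 show "{n. (series_mult f ^^ n) series_one ga / fact n ~= 0} <= {..N}"
 proof (rule subsetI)
 fix n assume "n:{n. (series_mult f ^^ n) series_one ga / fact n ~= 0}"
 hence "~  dim_size ga < n" using series_power_eq_0[of f ga n] assms(1) by auto
 thus "n:{..N}" using assms(2) by simp
 qed
qed simp

lemma series_exp_0: "f 0 = 0 ==> series_exp f 0 = 1"
 using series_exp_finite[of f 0 0] by (simp add: series_one_def series_monom_def)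

text \<open>\<open>E(exp f) = (E f) exp f\<close>, termwise from \<open>E(f^n) = n (E f) f^(n-1)\<close>.\<close>

theorem series_exp_recursion:
 assumes f: "f 0 = 0"
 shows "of_nat (dim_size ga) * series_exp f ga = (SUM (al, be):splits ga. of_nat (dim_size al) * f al * series_exp f be)"
proof -
 let ?P = "%n. (series_mult f ^^ n) series_one" and ?N = "dim_size ga"
 have "of_nat (dim_size ga) * series_exp f ga = (SUM n<=Suc ?N. series_deriv (?P n) ga / fact n)"
 by (subst series_exp_finite[of f ga "Suc ?N", OF f]) (simp_all add: series_deriv_def sum_distrib_left algebra_simps)
 also have "... = (SUM n<=?N. series_deriv (?P (Suc n)) ga / fact (Suc n))"
 by (subst sum.atMost_Suc_shift) (simp add: series_deriv_def series_one_def series_monom_def)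
 also have "... = (SUM n<=?N. series_mult (series_deriv f) (?P n) ga / fact n)"
 proof (rule sum.cong[OF refl])
 fix n
 have "(of_nat (Suc n)::ratfun) ~= 0" by (subst of_nat_ratfun_eq_0_iff) simp
 thus "series_deriv (?P (Suc n)) ga / fact (Suc n) = series_mult (series_deriv f) (?P n) ga / fact n"
 unfolding series_deriv_power fact_Suc by (simp del: of_nat_Suc)
 qed
 also have "... = (SUM (al, be):splits ga. of_nat (dim_size al) * f al * (SUM n<=?N. ?P n be / fact n))"
 unfolding series_mult_def sum_divide_distrib
 by (subst sum.swap) (auto simp: series_deriv_def sum_distrib_left case_prod_unfold intro!: sum.cong)
 also have "... = (SUM (al, be):splits ga. of_nat (dim_size al) * f al * series_exp f be)"
 proof (rule sum.cong[OF refl])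
 fix x assume "x:splits ga"
 then obtain al be where x: "x = (al, be)" "al + be = ga" by auto
 have "dim_size be <= ?N" unfolding x(2)[symmetric] dim_size_add by simp
 from series_exp_finite[of f be ?N, OF f this] show "(case x of (al, be) => of_nat (dim_size al) * f al * (SUM n<=?N. ?P n be / fact n)) =
 (case x of (al, be) => of_nat (dim_size al) * f al * series_exp f be)" by (simp add: x(1))
 qed
 finally show ?thesis .
qed

definition log_terms::"'i dimvec => (nat \<times> 'i dimvec) set" where
 "log_terms ga = {(k, ta). k > 0 & ta ~= 0 & dim_le (dim_scale k ta) ga}"

text \<open>The recursion of \<open>Exp\<close> for the values at a fixed q: \<open>v k ta\<close> is the value at \<open>q^k\<close>, which takes the place of
the operator \<open>ps\<^sub>k\<close>.\<close>

definition exp_rec::"(nat => 'i dimvec => rat) => ('i dimvec => rat) => 'i dimvec => bool" where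
 "exp_rec v e ga \<longleftrightarrow> of_nat (dim_size ga) * e ga = (SUM (k, ta):log_terms ga. of_nat (dim_size ta) * v k ta * e (ga - dim_scale k ta))"

lemma dim_scale_le_bound: assumes "ta ~= 0" "dim_le (dim_scale k ta) ga" shows "k <= dim_size ga"
proof -
 have "dim_le (mult_dim {(ta, ())} (%_. k)) ga" using assms(2) by (simp add: mult_dim_def)
 from mult_dim_le_bound[OF _ _ _ this, of "(ta, ())"] assms(1) show ?thesis by simp
qed

lemma dim_size_diff: assumes "dim_le be ga" shows "dim_size ga = dim_size (ga - be) + dim_size be"
 using dim_size_add[of "ga - be" be] dim_le_diff_add(1)[OF assms] by simp

lemma exp_rec_unique:
 assumes rec: "!!de. dim_le de ga ==> exp_rec v e de" "!!de. dim_le de ga ==> exp_rec v e' de" and z: "e 0 = e' 0"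
 shows "e ga = e' ga"
proof -
 have "e de = e' de" if "dim_le de ga" for de
 using that
 proof (induction "dim_size de" arbitrary: de rule: less_induct)
 case less
 show ?case
 proof (cases "de = 0")
 case False
 have "e (de - dim_scale k ta) = e' (de - dim_scale k ta)" if "(k, ta):log_terms de" for k ta
 proof (rule less.hyps)
 have kt: "k > 0" "ta ~= 0" "dim_le (dim_scale k ta) de" using that by (auto simp: log_terms_def)
 show "dim_size (de - dim_scale k ta) < dim_size de"
 using dim_size_diff[OF kt(3)] kt(1,2) by (simp add: dim_size_pos_iff)
 show "dim_le (de - dim_scale k ta) ga" using less.prems unfolding dim_le_def lookup_minus by (meson diff_le_self order_trans)
 qed
 hence "of_nat (dim_size de) * e de = of_nat (dim_size de) * e' de"
 using rec[OF less.prems] unfolding exp_rec_def by (auto intro!: sum.cong)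
 thus ?thesis using False by (simp add: dim_size_eq_0_iff)
 qed (simp add: z)
 qed
 thus ?thesis by simp
qed

definition pleth_log::"'i series => 'i series" where
 "pleth_log f = (%al. SUM k=1..dim_size al. adams k f al / of_nat k)"

lemma adams_scale:
 assumes "k > 0" shows "adams k f (dim_scale k ta) = ratfun_subst (qvar ^ k) (f ta)"
proof -
 have "Poly_Mapping.map (%m. m div k) (dim_scale k ta) = ta"
 by (rule poly_mapping_eqI) (use assms in "simp add: map.rep_eq when_def")
 thus ?thesis by (simp add: adams_def)
qed

lemma adams_nonzeroE:
 assumes "adams k f al ~= 0" obtains ta where "al = dim_scale k ta"
proof (rule that[of "Poly_Mapping.map (%m. m div k) al"])
 have "ALL i. k dvd lk al i" using assms by (auto simp: adams_def split: if_splits)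
 thus "al = dim_scale k (Poly_Mapping.map (%m. m div k) al)"
 by (intro poly_mapping_eqI) (simp add: map.rep_eq when_def)
qed

lemma plethystic_Exp_eq:
 assumes "f 0 = 0" shows "plethystic_Exp f = series_exp (pleth_log f)"
proof -
 have "Sum_any (%k. if k >= 1 then adams k f al / of_nat k else 0) = pleth_log f al" for al
 proof -
 have "{k. (if k >= 1 then adams k f al / of_nat k else 0) ~= 0} <= {1..dim_size al}"
 proof
 fix k assume "k:{k. (if k >= 1 then adams k f al / of_nat k else 0) ~= 0}"
 hence k: "k >= 1" "adams k f al ~= 0" by (auto split: if_splits)
 obtain ta where t: "al = dim_scale k ta" using adams_nonzeroE[OF k(2)] .
 have "ta ~= 0" using k adams_scale[of k f ta] assms t by auto
 thus "k:{1..dim_size al}" using dim_scale_le_bound[of ta k al] k t by simp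
 qed
 from Sum_any.expand_superset[OF _ this] show ?thesis by (simp add: pleth_log_def)
 qed
 thus ?thesis by (simp add: plethystic_Exp_def)
qed

lemma finite_log_terms: "finite (log_terms ga)"
proof (rule finite_subset)
 show "log_terms ga <= {..dim_size ga} \<times> {be. dim_le be ga}"
 proof
 fix x assume "x:log_terms ga"
 then obtain k ta where x: "x = (k, ta)" "k > 0" "ta ~= 0" "dim_le (dim_scale k ta) ga" by (auto simp: log_terms_def)
 have "lk ta i <= lk ga i" for i
 proof -
 have "lk ta i <= k * lk ta i" using x(2) by simp
 also have "... <= lk ga i" using x(4) by (simp add: dim_le_def)
 finally show ?thesis .
 qed
 thus "x:{..dim_size ga} \<times> {be. dim_le be ga}"
 using dim_scale_le_bound[OF x(3,4)] by (simp add: x(1) dim_le_def)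
 qed
qed (intro finite_cartesian_product finite_dim_le, simp)

lemma dim_scale_inject: "k > 0 ==> dim_scale k ta = dim_scale k ta' \<longleftrightarrow> ta = ta'"
 by (auto simp: poly_mapping_eq_iff fun_eq_iff)

text \<open>The factor \<open>1/k\<close> cancels in \<open>E(ps\<^sub>k f)/k\<close>, as \<open>E(x^(k ta)) = k |ta| x^(k ta)\<close>.\<close>

theorem plethystic_Exp_recursion:
 assumes f0: "f 0 = 0"
 shows "of_nat (dim_size ga) * plethystic_Exp f ga = (SUM (k, ta):log_terms ga.
 of_nat (dim_size ta) * ratfun_subst (qvar ^ k) (f ta) * plethystic_Exp f (ga - dim_scale k ta))"
proof -
 let ?L = "pleth_log f" and ?E = "plethystic_Exp f" and ?sc = "%(k, ta). dim_scale k ta"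
 let ?h = "%(k, ta). of_nat (dim_size ta) * ratfun_subst (qvar ^ k) (f ta)"
 have L: "of_nat (dim_size al) * ?L al = (SUM p | p:log_terms ga & ?sc p = al. ?h p)" if le: "dim_le al ga" for al
 proof -
 let ?T = "{p:log_terms ga. ?sc p = al}" and ?g = "%k. of_nat (dim_size al) * (adams k f al / of_nat k)"
 have inj: "inj_on fst ?T" by (rule inj_onI) (auto simp: log_terms_def dim_scale_inject)
 have "(SUM p:?T. ?h p) = (SUM p:?T. ?g (fst p))"
 proof (rule sum.cong[OF refl])
 fix p assume "p:?T"
 then obtain k ta where p: "p = (k, ta)" "k > 0" "al = dim_scale k ta" by (auto simp: log_terms_def)
 hence "(of_nat k::ratfun) ~= 0" by (simp add: of_nat_ratfun_eq_0_iff)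
 thus "?h p = ?g (fst p)" by (simp add: p(1,3) adams_scale[OF p(2)])
 qed
 also have "... = (SUM k:fst ` ?T. ?g k)" by (simp add: sum.reindex[OF inj])
 also have "... = (SUM k=1..dim_size al. ?g k)"
 proof (rule sum.mono_neutral_left)
 show "fst ` ?T <= {1..dim_size al}" by (auto simp: log_terms_def dim_size_pos_iff Suc_le_eq)
 show "ALL k:{1..dim_size al} - fst ` ?T. ?g k = 0"
 proof (intro ballI, rule ccontr)
 fix k assume k: "k:{1..dim_size al} - fst ` ?T" and "?g k ~= 0"
 then obtain ta where t: "al = dim_scale k ta" using adams_nonzeroE[of k f al] by force
 hence "(k, ta):?T" using k le by (auto simp: log_terms_def)
 with k show False by force
 qed
 qed simp
 finally show ?thesis by (simp add: pleth_log_def sum_distrib_left)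
 qed
 have "of_nat (dim_size ga) * ?E ga = (SUM al | dim_le al ga. of_nat (dim_size al) * ?L al * ?E (ga - al))"
 using series_exp_recursion[of ?L ga] by (simp add: plethystic_Exp_eq[of f, OF f0] sum_splits' pleth_log_def)
 also have "... = (SUM al | dim_le al ga. SUM p | p:log_terms ga & ?sc p = al. ?h p * ?E (ga - ?sc p))"
 by (intro sum.cong[OF refl]) (simp add: L sum_distrib_right)
 also have "... = (SUM p:log_terms ga. ?h p * ?E (ga - ?sc p))"
 by (rule sum.group[OF finite_log_terms finite_dim_le]) (auto simp: log_terms_def)
 finally show ?thesis by (simp add: case_prod_unfold)
qed

lemma plethystic_Exp_0: "f 0 = 0 ==> plethystic_Exp f 0 = 1"
 using plethystic_Exp_eq[of f] series_exp_0[of "pleth_log f"] by (simp add: pleth_log_def)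

lemma log_terms_less: "(k, ta):log_terms ga ==> dim_size (ga - dim_scale k ta) < dim_size ga"
 using dim_size_diff[of "dim_scale k ta" ga] by (auto simp: log_terms_def dim_size_pos_iff)

theorem plethystic_Exp_values:
 assumes f0: "f 0 = 0" and v: "!!k ta. k > 0 ==> ta ~= 0 ==> has_value (f ta) (x ^ k) (v k ta)"
 obtains e where "!!ga. has_value (plethystic_Exp f ga) x (e ga)" "e 0 = 1" "!!ga. exp_rec v e ga"
proof -
 let ?E = "plethystic_Exp f"
 define e where "e ga = ratfun_eval (?E ga) x" for ga
 let ?R = "%ga. SUM (k, ta):log_terms ga. of_nat (dim_size ta) * v k ta * e (ga - dim_scale k ta)"
 have rec: "has_value (of_nat (dim_size ga) * ?E ga) x (?R ga)"
 if E: "!!k ta. (k, ta):log_terms ga ==> has_value (?E (ga - dim_scale k ta)) x (e (ga - dim_scale k ta))" for ga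
 unfolding plethystic_Exp_recursion[of f, OF f0] case_prod_unfold
 proof (rule has_value_sum)
 fix p assume "p:log_terms ga"
 moreover hence "fst p > 0" "snd p ~= 0" by (auto simp: log_terms_def)
 ultimately show "has_value (of_nat (dim_size (snd p)) * ratfun_subst (qvar ^ fst p) (f (snd p)) * ?E (ga - dim_scale (fst p) (snd p))) x
 (of_nat (dim_size (snd p)) * v (fst p) (snd p) * e (ga - dim_scale (fst p) (snd p)))"
 using E[of "fst p" "snd p"]
 by (intro has_value_mult has_value_of_nat has_value_subst[OF has_value_power[OF has_value_qvar] v]) simp_all
 qed
 have val: "has_value (?E ga) x (e ga)" for ga
 proof (induction "dim_size ga" arbitrary: ga rule: less_induct)
 case less
 have "EX u. has_value (?E ga) x u"
 proof (cases "ga = 0")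
 case True
 have "has_value (?E ga) x 1" unfolding True plethystic_Exp_0[of f, OF f0] by (rule has_value_1)
 thus ?thesis by blast
 next
 case False
 have "has_value (of_nat (dim_size ga) * ?E ga) x (?R ga)" by (rule rec) (use less log_terms_less in blast)
 from has_value_divide[OF this has_value_of_nat[of "dim_size ga"]] False show ?thesis
 by (auto simp: dim_size_eq_0_iff of_nat_ratfun_eq_0_iff)
 qed
 thus ?case using reduced_denominator_nonzero(2) by (auto simp: e_def)
 qed
 moreover have "e 0 = 1" using has_value_unique[OF val[of 0], of 1] by (simp add: plethystic_Exp_0[of f, OF f0])
 moreover have "exp_rec v e ga" for ga
 unfolding exp_rec_def using has_value_unique[OF has_value_mult[OF has_value_of_nat val] rec[OF val]] .
 ultimately show thesis by (rule that)
qed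

lemma plethystic_Exp_support:
 assumes f0: "f 0 = 0" and sup: "!!ta. ta ~: dimvecs Q ==> f ta = 0" and g: "ga ~: dimvecs Q"
 shows "plethystic_Exp f ga = 0"
 using g
proof (induction "dim_size ga" arbitrary: ga rule: less_induct)
 case less
 have "ratfun_subst (qvar ^ k) (f ta) * plethystic_Exp f (ga - dim_scale k ta) = 0" if kt: "(k, ta):log_terms ga" for k ta
 proof (cases "ta:dimvecs Q")
 case True
 have "ga - dim_scale k ta ~: dimvecs Q"
 proof
 assume "ga - dim_scale k ta:dimvecs Q"
 hence z: "lk (ga - dim_scale k ta) i = 0" if "i ~: verts Q" for i
 using that by (auto simp: dimvecs_def in_keys_iff)
 have z2: "lk ta i = 0" if "i ~: verts Q" for i
 using that True by (auto simp: dimvecs_def in_keys_iff)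
 have "lk ga i = 0" if "i ~: verts Q" for i
 using z[OF that] z2[OF that] by (simp add: lookup_minus)
 with less.prems show False by (auto simp: dimvecs_def in_keys_iff)
 qed
 thus ?thesis using less.hyps log_terms_less[OF kt] by simp
 qed (simp add: sup)
 hence "of_nat (dim_size ga) * plethystic_Exp f ga = 0"
 unfolding plethystic_Exp_recursion[of f, OF f0] by (intro sum.neutral) (auto simp: mult.assoc)
 moreover have "ga ~= 0" using less.prems by (auto simp: dimvecs_def)
 ultimately show ?case by (simp add: of_nat_ratfun_eq_0_iff dim_size_eq_0_iff)
qed

section \<open>The two generating series\<close>

lemma power_2_neq_1: assumes "n > 0" "i >= (1::nat)" shows "((2::rat) ^ n) ^ i ~= 1"
proof -
 have "(1::rat) < 2 ^ (n * i)" using assms by (intro one_less_power) auto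
 thus ?thesis by (simp add: power_mult)
qed

lemma unit_dim_eq_iff: "unit_dim i = unit_dim j \<longleftrightarrow> i = j"
proof
 assume "unit_dim i = unit_dim j"
 from arg_cong[OF this, of "%p. lk p i"] show "i = j" by (auto simp: lookup_single when_def split: if_splits)
qed simp

lemma unit_dim_nonzero: "unit_dim i ~= 0"
proof
 assume "unit_dim i = 0"
 from arg_cong[OF this, of "%p. lk p i"] show False by simp
qed

text \<open>With one class of dimension \<open>unit_dim i\<close> for each vertex i, a multiplicity function is the same as a dimension vector.\<close>

lemma qmass_units:
 fixes Q::"('i, 'h) pre_digraph" and x::rat
 assumes fin: "finite (verts Q)" and ga: "ga:dimvecs Q"
 shows "qmass ((%i. (unit_dim i, ())) ` verts Q) (%_. x) ga = (PROD i:verts Q. qe x (lk ga i))"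
proof -
 let ?u = "%i. (unit_dim i, ())"
 have inj: "inj_on ?u (verts Q)" by (rule inj_onI) (simp add: unit_dim_eq_iff)
 have dim: "lk (mult_dim (?u ` verts Q) m) j = (if j:verts Q then m (?u j) else 0)" for m j
 proof -
 have "lk (mult_dim (?u ` verts Q) m) j = (SUM i:verts Q. m (?u i) * lk (unit_dim i) j)"
 by (simp add: mult_dim_def lookup_sum_pm sum.reindex[OF inj])
 also have "... = (SUM i:verts Q. if i = j then m (?u j) else 0)"
 by (rule sum.cong) (auto simp: lookup_single when_def)
 finally show ?thesis using fin by simp
 qed
 have out: "lk ga j = 0" if "j ~: verts Q" for j using ga that by (auto simp: dimvecs_def in_keys_iff)
 define m0 where "m0 s = (if s:?u ` verts Q then lk ga (inv_into (verts Q) ?u s) else 0)" for s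
 have m0: "m0 (?u i) = lk ga i" if "i:verts Q" for i using that inv_into_f_f[OF inj that] by (simp add: m0_def)
 have "mult_fams (?u ` verts Q) ga = {m0}"
 proof (intro equalityI subsetI)
 fix m assume "m:mult_fams (?u ` verts Q) ga"
 hence z: "!!s. s ~: ?u ` verts Q ==> m s = 0" and d: "mult_dim (?u ` verts Q) m = ga"
 unfolding mult_fams_def by blast+
 have "m s = m0 s" for s
 proof (cases "s:?u ` verts Q")
 case True
 then obtain i where i: "i:verts Q" "s = ?u i" by blast
 show ?thesis using dim[of m i] i m0[OF i(1)] by (simp add: d)
 next
 case False
 thus ?thesis unfolding m0_def if_not_P[OF False] by (rule z)
 qed
 thus "m:{m0}" by auto
 next
 fix m assume "m:{m0}"
 hence m: "m = m0" by simp
 have "mult_dim (?u ` verts Q) m0 = ga" by (rule poly_mapping_eqI) (simp add: dim m0 out)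
 thus "m:mult_fams (?u ` verts Q) ga" unfolding m mult_fams_def by (simp add: m0_def)
 qed
 thus ?thesis by (simp add: qmass_def prod.reindex[OF inj] m0)
qed

lemma sum_vars_eq:
 "finite (verts Q) ==> sum_vars Q ta = (if EX i:verts Q. ta = unit_dim i then 1 else 0)"
proof (cases "EX i:verts Q. ta = unit_dim i")
 case True
 assume fin: "finite (verts Q)"
 from True obtain i where i: "i:verts Q" "ta = unit_dim i" by blast
 have "sum_vars Q ta = (SUM j:verts Q. if j = i then 1 else 0)"
 unfolding sum_vars_def series_monom_def i(2) by (rule sum.cong) (auto simp: unit_dim_eq_iff)
 with fin i True show ?thesis by simp
qed (auto simp: sum_vars_def series_monom_def intro!: sum.neutral)

theorem q_infty_series_eq_Exp:
 fixes Q::"('i, 'h) pre_digraph"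
 assumes Q: "fin_digraph Q"
 shows "gen_series Q (q_infty_dim Q) = plethystic_Exp (series_scale (1 / (1 - qvar)) (sum_vars Q))"
proof (rule ext)
 interpret Q: fin_digraph Q by (rule Q)
 fix ga::"'i dimvec"
 define f where "f = series_scale (1 / (1 - qvar)) (sum_vars Q)"
 have f: "f ta = (if EX i:verts Q. ta = unit_dim i then 1 / (1 - qvar) else 0)" for ta
 by (simp add: f_def series_scale_def sum_vars_eq)
 have f0: "f 0 = 0" by (auto simp: f unit_dim_nonzero unit_dim_nonzero[symmetric])
 show "gen_series Q (q_infty_dim Q) ga = plethystic_Exp f ga"
 proof (cases "ga:dimvecs Q")
 case False
 have "f ta = 0" if "ta ~: dimvecs Q" for ta using that by (auto simp: f dimvecs_def)
 from plethystic_Exp_support[of f, OF f0 this False] False show ?thesis by (simp add: gen_series_def)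
 next
 case True
 show ?thesis
 proof (rule ratfun_eqI)
 fix n::nat assume n: "n > 0"
 let ?x = "2 ^ n::rat" and ?S = "(%i. (unit_dim i::'i dimvec, ())) ` verts Q"
 note x1 = power_2_neq_1[OF n]
 define v where "v k ta = (if EX i:verts Q. ta = unit_dim i then 1 / (1 - ?x ^ k) else 0)" for k::nat and ta::"'i dimvec"
 have v: "has_value (f ta) (?x ^ k) (v k ta)" if "k > 0" for k ta
 proof -
 have "has_value (1 / (1 - qvar)) (?x ^ k) (1 / (1 - ?x ^ k))"
 by (intro has_value_divide has_value_diff has_value_1 has_value_qvar) (use x1[of k] that in simp)
 thus ?thesis by (simp add: f v_def)
 qed
 obtain e where e: "!!ga. has_value (plethystic_Exp f ga) ?x (e ga)" "e 0 = 1" "!!ga. exp_rec v e ga"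
 using plethystic_Exp_values[of f ?x v, OF f0 v] by blast
 have S: "finite ?S" "!!s. s:?S ==> fst s ~= 0" by (auto simp: unit_dim_nonzero)
 let ?e' = "qmass ?S (%_. ?x)"
 have "exp_rec v ?e' de" for de
 proof -
 let ?I = "{(s, n). s:?S & n > 0 & dim_le (dim_scale n (fst s)) de}"
 have "(SUM (k, ta):log_terms de. of_nat (dim_size ta) * v k ta * ?e' (de - dim_scale k ta)) =
 (SUM (k, ta):(%(s, n). (n, fst s)) ` ?I. of_nat (dim_size ta) * v k ta * ?e' (de - dim_scale k ta))"
 proof (rule sum.mono_neutral_right[OF finite_log_terms])
 show "(%(s, n). (n, fst s)) ` ?I <= log_terms de" using S(2) by (auto simp: log_terms_def unit_dim_nonzero)
 show "ALL y:log_terms de - (%(s, n). (n, fst s)) ` ?I.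
 (case y of (k, ta) => of_nat (dim_size ta) * v k ta * ?e' (de - dim_scale k ta)) = 0"
 proof
 fix y assume y: "y:log_terms de - (%(s, n). (n, fst s)) ` ?I"
 then obtain k ta where kt: "y = (k, ta)" "k > 0" "dim_le (dim_scale k ta) de" by (auto simp: log_terms_def)
 have "~  (EX i:verts Q. ta = unit_dim i)"
 proof
 assume "EX i:verts Q. ta = unit_dim i"
 hence "((ta, ()), k):?I" using kt by auto
 hence "(k, ta):(%(s, n). (n, fst s)) ` ?I" by (rule rev_image_eqI) simp
 with y show False by (simp add: kt(1))
 qed
 thus "(case y of (k, ta) => of_nat (dim_size ta) * v k ta * ?e' (de - dim_scale k ta)) = 0"
 by (simp add: kt(1) v_def)
 qed
 qed
 also have "... = (SUM (s, n):?I. of_nat (dim_size (fst s)) / (1 - ?x ^ n) * ?e' (de - dim_scale n (fst s)))"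
 by (subst sum.reindex) (auto simp: v_def inj_on_def intro!: sum.cong)
 also have "... = of_nat (dim_size de) * ?e' de" by (rule qmass_log[OF S, symmetric]) (use x1 in auto)
 finally show ?thesis by (simp add: exp_rec_def)
 qed
 moreover have "?e' 0 = 1" by (rule qmass_0[OF S])
 ultimately have "e ga = ?e' ga" using exp_rec_unique[of ga v e ?e'] e(2,3) by simp
 hence "e ga = (PROD i:verts Q. qe ?x (lk ga i))" using qmass_units[OF _ True] by simp
 moreover have "has_value (q_infty_dim Q ga) ?x (PROD i:verts Q. qe ?x (lk ga i))"
 by (rule has_value_q_infty_dim) (use x1 in auto)
 ultimately show "EX w. has_value (gen_series Q (q_infty_dim Q) ga) ?x w & has_value (plethystic_Exp f ga) ?x w"
 using e(1)[of ga] True by (auto simp: gen_series_def)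
 qed
 qed
qed

text \<open>Both sides satisfy the same recursion, as \<open>a_ta(2^(nk))\<close> is the number of absolutely simple representations over the extension of degree
k.\<close>

theorem abs_irreducible_Exp_value:
 fixes Q::"('i, 'h) pre_digraph" and a::"'i dimvec => int poly"
 and S::"('i dimvec \<times> ('h, bit alg_closure) mats_fam) set"
 assumes Q: "fin_digraph Q" and a0: "a 0 = 0" and a: "!!al. al:dimvecs Q ==> is_abs_irreducible_poly Q al (a al)"
 and n: "n > 0" and ga: "ga:dimvecs Q" and S: "simple_reps_upto Q (FF (2 ^ n)) ga S" and le: "dim_le be ga"
 shows "has_value (plethystic_Exp (series_scale (1 / (1 - qvar)) (gen_series Q (%al. ratfun_of_int_poly (a al)))) be) (2 ^ n)
 (simple_mass Q (FF (2 ^ n)) S be)"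
proof -
 interpret Q: fin_digraph Q by (rule Q)
 let ?x = "2 ^ n::rat" and ?k = "FF (2 ^ n)::bit alg_closure set"
 note q = char_power_2[OF n] and x1 = power_2_neq_1[OF n]
 define f where "f = series_scale (1 / (1 - qvar)) (gen_series Q (%al. ratfun_of_int_poly (a al)))"
 define N where "N k ta = card (abs_simple_reps Q (FF ((2 ^ n) ^ k)::bit alg_closure set) ta // iso_rel Q (FF ((2 ^ n) ^ k)) ta)"
 for k::nat and ta::"'i dimvec"
 define v where "v k ta = (if ta:dimvecs Q then of_nat (N k ta) / (1 - ?x ^ k) else 0)" for k ta
 have f0: "f 0 = 0" by (simp add: f_def series_scale_def gen_series_def a0 ratfun_of_int_poly_def)
 have v: "has_value (f ta) (?x ^ k) (v k ta)" if k: "k > 0" for k ta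
 proof (cases "ta:dimvecs Q")
 case True
 have qk: "char_power F2 ((2 ^ n) ^ k)" by (rule char_power_pow[OF q k])
 obtain K::"nat ring" and ps::"nat => bit alg_closure" where K: "field_emb K ps" "ps ` carrier K = FF ((2 ^ n) ^ k)"
 using nat_copy_of_FF[OF qk] .
 interpret K: field_emb K ps by (rule K(1))
 have "finite_field K" using K.fin K.field_axioms by (simp add: finite_field_def)
 moreover have "order K = (2 ^ n) ^ k" using K.card_k FF_prod(2)[OF qk] by (simp add: K(2))
 ultimately have "poly (a ta) ((2 ^ n) ^ k) = int (N k ta)"
 using a[OF True] num_abs_irreducible_eq[OF qk K Q True] by (auto simp: is_abs_irreducible_poly_def N_def)
 hence "has_value (ratfun_of_int_poly (a ta)) (?x ^ k) (of_nat (N k ta))"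
 using has_value_of_int_poly[of "a ta" "(2 ^ n) ^ k"] by simp
 moreover have "has_value (1 / (1 - qvar)) (?x ^ k) (1 / (1 - ?x ^ k))"
 by (intro has_value_divide has_value_diff has_value_1 has_value_qvar) (use x1[of k] k in simp)
 ultimately show ?thesis using has_value_mult[of "1 / (1 - qvar)" "?x ^ k" _ "ratfun_of_int_poly (a ta)"] True
 by (fastforce simp: f_def series_scale_def gen_series_def v_def)
 qed (simp add: f_def series_scale_def gen_series_def v_def)
 obtain e where e: "!!ga. has_value (plethystic_Exp f ga) ?x (e ga)" "e 0 = 1" "!!ga. exp_rec v e ga"
 using plethystic_Exp_values[of f ?x v, OF f0 v] by blast
 let ?m = "simple_mass Q ?k S"
 have rec: "exp_rec v ?m de" if d: "dim_le de be" for de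
 proof -
 have dga: "dim_le de ga" using d le unfolding dim_le_def by (meson order_trans)
 have "of_nat (dim_size de) * ?m de = (SUM (k, ta):log_terms de. of_nat (dim_size ta * N k ta) / (1 - of_nat (2 ^ n) ^ k) * ?m (de - dim_scale k ta))"
 unfolding log_terms_def N_def by (rule simple_mass_log[OF q S dga])
 also have "... = (SUM (k, ta):log_terms de. of_nat (dim_size ta) * v k ta * ?m (de - dim_scale k ta))"
 proof (rule sum.cong[OF refl])
 fix y assume "y:log_terms de"
 then obtain k ta where y: "y = (k, ta)" "k > 0" "dim_le (dim_scale k ta) de" by (auto simp: log_terms_def)
 have "i:verts Q" if "lk ta i ~= 0" for i
 proof -
 have "k * lk ta i <= lk ga i" using y(3) dga unfolding dim_le_def lookup_dim_scale by (meson order_trans)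
 moreover have "0 < k * lk ta i" using that y(2) by simp
 ultimately have "lk ga i ~= 0" by linarith
 thus ?thesis using ga by (auto simp: dimvecs_def in_keys_iff)
 qed
 hence "ta:dimvecs Q" by (auto simp: dimvecs_def in_keys_iff)
 thus "(case y of (k, ta) => of_nat (dim_size ta * N k ta) / (1 - of_nat (2 ^ n) ^ k) * ?m (de - dim_scale k ta)) =
 (case y of (k, ta) => of_nat (dim_size ta) * v k ta * ?m (de - dim_scale k ta))" by (simp add: y(1) v_def)
 qed
 finally show ?thesis by (simp add: exp_rec_def)
 qed
 have Snz: "fst s ~= 0" if "s:S" for s
 using simple_rep_dim_nonzero[OF fsubfieldD(2)[OF FF_fsubfield[OF q]]] S that by (auto simp: simple_reps_upto_def)
 have "?m 0 = 1"
 using qmass_0[of S, OF _ Snz] S by (simp add: simple_mass_def qmass_def simple_reps_upto_def)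
 with exp_rec_unique[of be v e ?m, OF e(3) rec] e(2) have "e be = ?m be" by simp
 with e(1)[of be] show ?thesis by (simp add: f_def)
qed

lemma prod_lessThan_add_split: "(PROD l<b + a. f l) = (PROD l<b. f l) * (PROD l<a. f (b + l))" for f::"nat => 'a::comm_monoid_mult"
 by (induction a) (simp_all add: mult.assoc)

lemma gl_count_add: "gl_count x (a + b) = (PROD l<b. x ^ (a + b) - x ^ l) * x ^ (a * b) * gl_count x a"
proof -
 have "gl_count x (a + b) = (PROD l<b. x ^ (a + b) - x ^ l) * (PROD l<a. x ^ (a + b) - x ^ (b + l))"
 unfolding gl_count_def using prod_lessThan_add_split[of "%l. x ^ (a + b) - x ^ l" b a] by (simp add: add.commute)
 also have "(PROD l<a. x ^ (a + b) - x ^ (b + l)) = (PROD l<a. x ^ b * (x ^ a - x ^ l))"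
 by (simp add: power_add algebra_simps)
 also have "... = x ^ (a * b) * gl_count x a" by (simp add: prod.distrib gl_count_def power_mult[symmetric] mult.commute)
 finally show ?thesis by (simp add: mult.assoc)
qed

text \<open>The powers of q agree because the number of arrow entries in \<open>|R_ga|\<close>, \<open>|R_al|\<close> and the mixed blocks, and the number of q in
the factors of \<open>q^ga_i - q^l\<close>, differ by the Ringel form.\<close>

lemma twisted_term:
 assumes Q: "fin_digraph Q" and k: "fsubfield k" and x: "x = of_nat (card k)" "x > 1"
 and ga: "ga = al + be" "ga:dimvecs Q"
 shows "(PROD i:verts Q. gl_count x (lk ga i)) * (x powi (- ringel_form Q (int_dim al) (int_dim be)) * rep_quot Q al x) =
 of_nat (card (injhom (lops k) (lact Q) (vspace k be) (lact Q) (vspace k ga))) *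
 (of_nat (card (reps Q k ga)) / of_nat (card (mat_fams Q k be ga)))"
proof -
 interpret Q: fin_digraph Q by (rule Q)
 let ?I = "PROD i:verts Q. PROD l<lk be i. x ^ lk ga i - x ^ l"
 let ?a = "SUM i:verts Q. lk al i * lk be i" and ?b = "SUM h:arcs Q. lk al (tail Q h) * lk be (head Q h)"
 let ?c = "SUM h:arcs Q. lk al (head Q h) * lk al (tail Q h)"
 let ?G = "PROD i:verts Q. gl_count x (lk al i)"
 have x0: "x ~= 0" using x(2) by auto
 have G0: "?G ~= 0" using gl_count_nonzero[OF x(2)] by (simp add: prod_zero_iff)
 have keys: "Poly_Mapping.keys be <= verts Q" using ga by (auto simp: dimvecs_def in_keys_iff subset_iff lookup_add)
 have inj: "of_nat (card (injhom (lops k) (lact Q) (vspace k be) (lact Q) (vspace k ga))) = ?I"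
 using arg_cong[OF card_injlhom[OF k _ keys, of Q ga], of rat_of_int] x(1) by simp
 have 1: "(PROD i:verts Q. gl_count x (lk ga i)) = ?I * x ^ ?a * ?G"
 by (simp add: ga(1) lookup_add gl_count_add prod.distrib power_sum)
 have "- ringel_form Q (int_dim al) (int_dim be) = int ?b - int ?a" by (simp add: ringel_form_def int_dim_def)
 hence 2: "x powi (- ringel_form Q (int_dim al) (int_dim be)) = x ^ ?b / x ^ ?a"
 using x0 by (simp add: power_int_diff power_int_of_nat del: of_nat_sum of_nat_mult)
 have c1: "card (reps Q k ga) = card k ^ (SUM h:arcs Q. lk ga (head Q h) * lk ga (tail Q h))"
 and c2: "card (mat_fams Q k be ga) = card k ^ (SUM h:arcs Q. lk ga (head Q h) * lk be (tail Q h))"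
 by (rule card_mat_fams(2)[OF Q k])+
 have s: "(SUM h:arcs Q. lk ga (head Q h) * lk ga (tail Q h)) = (SUM h:arcs Q. lk ga (head Q h) * lk be (tail Q h)) + (?b + ?c)"
 unfolding sum.distrib[symmetric] by (rule sum.cong) (auto simp: ga(1) lookup_add algebra_simps)
 have 3: "(of_nat (card (reps Q k ga)) / of_nat (card (mat_fams Q k be ga))::rat) = x ^ ?b * x ^ ?c"
 unfolding c1 c2 s power_add of_nat_mult of_nat_power x(1)[symmetric] using x0 by simp
 show ?thesis unfolding inj 1 2 3 rep_quot_def using x0 G0 by (simp add: field_simps)
qed

theorem twisted_product_eq_one:
 fixes Q::"('i, 'h) pre_digraph" and a::"'i dimvec => int poly"
 assumes Q: "fin_digraph Q" and a0: "a 0 = 0" and a: "!!al. al:dimvecs Q ==> is_abs_irreducible_poly Q al (a al)"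
 shows "twisted_mult Q (gen_series Q (rep_ratfun Q))
 (plethystic_Exp (series_scale (1 / (1 - qvar)) (gen_series Q (%al. ratfun_of_int_poly (a al))))) = series_one"
proof (rule ext)
 interpret Q: fin_digraph Q by (rule Q)
 fix ga::"'i dimvec"
 define f where "f = series_scale (1 / (1 - qvar)) (gen_series Q (%al. ratfun_of_int_poly (a al)))"
 let ?r = "gen_series Q (rep_ratfun Q)" and ?E = "plethystic_Exp f"
 have f0: "f 0 = 0" by (simp add: f_def series_scale_def gen_series_def a0 ratfun_of_int_poly_def)
 show "twisted_mult Q ?r ?E ga = series_one ga"
 proof (cases "ga:dimvecs Q")
 case False
 have "f ta = 0" if "ta ~: dimvecs Q" for ta using that by (simp add: f_def series_scale_def gen_series_def)
 from plethystic_Exp_support[of f Q, OF f0 this] have E: "?E be = 0" if "be ~: dimvecs Q" for be using that by blast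
 have "?r al * ?E be = 0" if "al + be = ga" for al be
 proof -
 have "al ~: dimvecs Q | be ~: dimvecs Q" using False that Poly_Mapping.keys_add[of al be] by (auto simp: dimvecs_def)
 thus ?thesis using E by (auto simp: gen_series_def)
 qed
 hence "twisted_mult Q ?r ?E ga = 0" unfolding twisted_mult_def by (intro sum.neutral) (auto simp: mult.assoc)
 moreover have "ga ~= 0" using False by (auto simp: dimvecs_def)
 ultimately show ?thesis by (simp add: series_one_def series_monom_def)
 next
 case True
 show ?thesis
 proof (rule ratfun_eqI)
 fix n::nat assume n: "n > 0"
 let ?x = "2 ^ n::rat" and ?k = "FF (2 ^ n)::bit alg_closure set"
 note q = char_power_2[OF n]
 have k: "fsubfield ?k" by (rule FF_fsubfield[OF q])
 have xk: "?x = of_nat (card ?k)" by (simp add: FF_prod(2)[OF q])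
 have x1: "?x > 1" using n by simp
 (* At q = 2^n the product becomes the sum of simple_mass_inverse, up to the order of GL_ga. *)
 obtain S::"('i dimvec \<times> ('h, bit alg_closure) mats_fam) set" where S: "simple_reps_upto Q ?k ga S"
 using simple_reps_upto_exists[OF Q k] .
 let ?m = "simple_mass Q ?k S"
 let ?t = "%al be. ?x powi (- ringel_form Q (int_dim al) (int_dim be)) * rep_quot Q al ?x * ?m be"
 have sub: "al:dimvecs Q" "dim_le be ga" if "al + be = ga" for al be
 using True that by (auto simp: dimvecs_def in_keys_iff subset_iff lookup_add dim_le_def)
 have val: "has_value (twisted_mult Q ?r ?E ga) ?x (SUM (al, be):splits ga. ?t al be)"
 unfolding twisted_mult_def case_prod_unfold
 proof (rule has_value_sum)
 fix y::"'i dimvec \<times> 'i dimvec" assume "y:{p. fst p + snd p = ga}"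
 hence y: "fst y + snd y = ga" by simp
 have "has_value (?r (fst y)) ?x (rep_quot Q (fst y) ?x)"
 using has_value_rep_ratfun[OF Q x1] sub(1)[OF y] by (simp add: gen_series_def)
 moreover have "has_value (?E (snd y)) ?x (?m (snd y))"
 unfolding f_def by (rule abs_irreducible_Exp_value[OF Q a0 a n True S sub(2)[OF y]])
 ultimately show "has_value (qvar powi (- ringel_form Q (int_dim (fst y)) (int_dim (snd y))) * ?r (fst y) * ?E (snd y)) ?x (?t (fst y) (snd y))"
 by (intro has_value_mult has_value_powi has_value_qvar) simp_all
 qed
 have "(SUM (al, be):splits ga. ?t al be) = (if ga = 0 then 1 else 0)"
 proof (cases "ga = 0")
 case z: True
 have "splits ga = {(0, 0)}"
 proof -
 have zero: "al = 0 & be = 0" if "al + be = 0" for al be::"'i dimvec"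
 using dim_size_add[of al be] that by (simp add: dim_size_eq_0_iff)
 show ?thesis
 proof (intro equalityI subsetI)
 fix y assume "y:splits ga"
 then obtain al be where "y = (al, be)" "al + be = 0" using z by auto
 with zero[of al be] show "y:{(0, 0)}" by simp
 qed (simp add: z)
 qed
 moreover have "?m 0 = 1"
 proof -
 have "fst s ~= 0" if "s:S" for s
 using simple_rep_dim_nonzero[OF fsubfieldD(2)[OF k]] S that by (auto simp: simple_reps_upto_def)
 thus ?thesis using qmass_0[of S] S by (simp add: simple_mass_def qmass_def simple_reps_upto_def)
 qed
 moreover have "rep_quot Q 0 ?x = 1" by (simp add: rep_quot_def gl_count_def)
 moreover have "ringel_form Q (int_dim 0) (int_dim 0) = 0" by (simp add: ringel_form_def int_dim_def)
 ultimately show ?thesis by (simp add: z)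
 next
 case nz: False
 let ?G = "PROD i:verts Q. gl_count ?x (lk ga i)"
 have "?G * (SUM (al, be):splits ga. ?t al be) = (SUM (al, be):splits ga.
 of_nat (card (injhom (lops ?k) (lact Q) (vspace ?k be) (lact Q) (vspace ?k ga))) *
 (of_nat (card (reps Q ?k ga)) / of_nat (card (mat_fams Q ?k be ga))) * ?m be)"
 unfolding sum_distrib_left
 proof (rule sum.cong[OF refl])
 fix y assume "y:splits ga"
 then obtain al be where y: "y = (al, be)" "ga = al + be" by auto
 from twisted_term[OF Q k xk x1 y(2) True]
 show "?G * (case y of (al, be) => ?t al be) = (case y of (al, be) =>
 of_nat (card (injhom (lops ?k) (lact Q) (vspace ?k be) (lact Q) (vspace ?k ga))) *
 (of_nat (card (reps Q ?k ga)) / of_nat (card (mat_fams Q ?k be ga))) * ?m be)"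
 unfolding y(1) prod.case mult.assoc[symmetric] by simp
 qed
 also have "... = 0" unfolding sum_splits by (rule simple_mass_inverse[OF Q k S nz])
 finally show ?thesis using nz gl_count_nonzero[OF x1] by (auto simp: prod_zero_iff)
 qed
 with val have "has_value (twisted_mult Q ?r ?E ga) ?x (series_one_value)" if "series_one_value = (if ga = 0 then 1 else 0)" for series_one_value
 using that by simp
 moreover have "has_value (series_one ga) ?x (if ga = 0 then 1 else 0)" by (simp add: series_one_def series_monom_def)
 ultimately show "EX w. has_value (twisted_mult Q ?r ?E ga) ?x w & has_value (series_one ga) ?x w" by blast
 qed
 qed
qed

theorem theorem5p1:
  fixes Q :: "('i, 'h) pre_digraph"
    and a :: "'i dimvec \<Rightarrow> int poly"
    and a_series r p :: "'i series"
  assumes quiver: "fin_digraph Q"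
    and a_zero: "a 0 = 0"
    and a_counts: "\<And>\<alpha>. \<alpha> \<in> dimvecs Q \<Longrightarrow> is_abs_irreducible_poly Q \<alpha> (a \<alpha>)"
    and a_series: "a_series = gen_series Q (\<lambda>\<alpha>. ratfun_of_int_poly (a \<alpha>))"
    and r: "r = gen_series Q (rep_ratfun Q)"
    and p: "p = gen_series Q (q_infty_dim Q)"
  shows "p = plethystic_Exp (series_scale (1 / (1 - qvar)) (sum_vars Q)) \<and>
    r = series_conj (tits_op Q p) \<and>
    twisted_mult Q (series_conj (tits_op Q p))
      (plethystic_Exp (series_scale (1 / (1 - qvar)) a_series)) = series_one"
proof -
 have "p = plethystic_Exp (series_scale (1 / (1 - qvar)) (sum_vars Q))"
 unfolding p by (rule q_infty_series_eq_Exp[OF quiver])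
 moreover have "r = series_conj (tits_op Q p)"
 by (rule ext) (simp add: r p series_conj_def tits_op_def gen_series_def rep_ratfun_eq[OF quiver])
 ultimately show ?thesis
 using twisted_product_eq_one[OF quiver a_zero a_counts] by (simp add: a_series r)
qed

end
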